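(* Let $X$ be a compact subset of an $m$-dimensional Riemannian manifold $M$ and $\mu$ a Borel probability measure. Let $f\in\mathrm{Diff}^1_{\mathrm{loc},\mathbb P}(X,\mu)$ be such that $\mu$ is coquasi-irreducible for $f$. Then the map $$\lambda_m(\mu,\cdot):\big(\mathrm{Diff}^1_{\mathrm{loc},\mathbb P}(X,\mu),d_{C^1}\big)\to\mathbb R,\qquad g\mapsto\lambda_m(\mu,g):=\lim_{n\to\infty}\frac1n\int\log\mathfrak m(Dg^n_\omega(x))\,d\mathbb P\,d\mu$$ is continuous at $f$, where $\mathfrak m(B)=\|B^{-1}\|^{-1}$. Moreover, if $f\in\mathrm{Diff}^1_{\mathrm{loc},\mathbb P}(X)$ is maximal coquasi-irreducible, then the map $$\lambda_m:\big(\mathrm{Diff}^1_{\mathrm{loc},\mathbb P}(X),d_{C^1}\big)\to\mathbb R,\qquad g\mapsto\lambda_m(g):=\inf\{\lambda_m(\eta,g):\eta\in\mathcal I(g)\}$$ is continuous at $f$.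
   Context: Setting. $M$ is a Riemannian manifold of dimension $m$. $(T,\mathscr A,p)$ is a probability space and $(\Omega,\mathscr F,\mathbb P)=(T^{\mathbb N},\mathscr A^{\mathbb N},p^{\mathbb N})$. A $C^1$ random map is a measurable map $f:\Omega\times M\to M$ such that $f_\omega:=f(\omega,\cdot)=f_{\omega_0}$ depends only on the coordinate $\omega_0$ of $\omega$ and is a $C^1$ local diffeomorphism for $\mathbb P$-a.e. $\omega$. Put $f^0_\omega=\mathrm{id}$, $f^n_\omega=f_{\omega_{n-1}}\circ\dots\circ f_{\omega_0}$. For compact $X\subset M$, $\|Df_\omega\|_\infty=\sup_{x\in X}\|Df_\omega(x)\|$, $\|(Df_\omega)^{-1}\|_\infty=\sup_{x\in X}\|Df_\omega(x)^{-1}\|$. $\mathrm{Diff}^1_{\mathrm{loc},\mathbb P}(X)$ is the set of $C^1$ random maps $f$ with $f_\omega(X)\subset X$ for $\mathbb P$-a.e. $\omega$ and $\int(\log^+\|Df_\omega\|_\infty+\log^+\|(Df_\omega)^{-1}\|_\infty)\,d\mathbb P<\infty$; maps are regarded as restricted to $X$. $\mathcal I(f)$ is the set of Borel probability measures $\mu$ on $X$ with $\mu=\int(f_\omega)_*\mu\,d\mathbb P$. $\mathrm{Diff}^1_{\mathrm{loc},\mathbb P}(X,\mu)=\{f\in\mathrm{Diff}^1_{\mathrm{loc},\mathbb P}(X):\mu\in\mathcal I(f)\}$. The average $C^1$ distance (possibly infinite) is $$d_{C^1}(f,g)=\int\big(d_{C^0}(f_\omega,g_\omega)+\|Df_\omega-Dg_\omega\|_\infty+\|(Df_\omega)^{-1}-(Dg_\omega)^{-1}\|_\infty\big)\,d\mathbb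 P,$$ all suprema over $X$. To compare linear maps between different fibres one fixes a continuous fibrewise isometric embedding $\iota:T_XM\hookrightarrow X\times\mathbb R^N$, with $P_x:\mathbb R^N\to\iota_x(T_xM)$ the orthogonal projection, and sets $\|Df_\omega-Dg_\omega\|_\infty=\sup_{x\in X}\|\iota_{f_\omega(x)}Df_\omega(x)\iota_x^{-1}P_x-\iota_{g_\omega(x)}Dg_\omega(x)\iota_x^{-1}P_x\|$ and $\|(Df_\omega)^{-1}-(Dg_\omega)^{-1}\|_\infty=\sup_{x\in X}\|\iota_xDf_\omega(x)^{-1}\iota_{f_\omega(x)}^{-1}P_{f_\omega(x)}-\iota_xDg_\omega(x)^{-1}\iota_{g_\omega(x)}^{-1}P_{g_\omega(x)}\|$. Cotangent dynamics: $(Df_\omega(x)^{-1})^*\xi=\xi\circ Df_\omega(x)^{-1}$; $\tilde X=P(T_X^*M)$ is the projectivized cotangent bundle over $X$; $\tilde f_\omega(x,[\xi])=(f_\omega(x),[(Df_\omega(x)^{-1})^*\xi])$; $\mathcal I_\mu(\tilde f)$ is the set of $\tilde f$-stationary probability measures on $\tilde X$ projecting to $\mu$; $\tilde\phi_f(x,[\xi])=\int\log\|(Df_\omega(x)^{-1})^*\xi\|\,d\mathbb P$ ($\xi$ unit). $\mu\in\mathcal I(f)$ is coquasi-irreducible for $f$ if $\int\tilde\phi_f\,d\tilde\mu=-\lambda_m(\mu,f)$ for every $\tilde\mu\in\mathcal I_\mu(\tilde f)$. $f$ is maximal coquasi-irreducible if every $\mu\in\mathcal I(f)$ is coquasi-irreducible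 and $\lambda_m(\mu,f)=\lambda_m(f)$ for all $\mu\in\mathcal I(f)$. *)

theory Defs
  imports "HOL-Probability.Probability"
begin

section \<open>Riemannian manifolds\<close>

text \<open>For open \<open>S\<close> and finite-dimensional domain this is the usual notion of \<open>C\<^sup>k\<close>.\<close>

primrec Ck_on :: "nat \<Rightarrow> 'e::euclidean_space set \<Rightarrow> ('e \<Rightarrow> 'b::real_normed_vector) \<Rightarrow> bool" where
  "Ck_on 0 S f \<longleftrightarrow> continuous_on S f"
| "Ck_on (Suc k) S f \<longleftrightarrow>
     (\<forall>x\<in>S. f differentiable (at x)) \<and> (\<forall>v. Ck_on k S (\<lambda>x. frechet_derivative f (at x) v))"

definition smooth_on :: "'e::euclidean_space set \<Rightarrow> ('e \<Rightarrow> 'b::real_normed_vector) \<Rightarrow> bool" where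
  "smooth_on S f \<longleftrightarrow> (\<forall>k. Ck_on k S f)"

type_synonym ('a, 'e) chart = "'a set \<times> ('a \<Rightarrow> 'e)"

abbreviation chart_dom :: "('a, 'e) chart \<Rightarrow> 'a set" where "chart_dom c \<equiv> fst c"
abbreviation coord :: "('a, 'e) chart \<Rightarrow> 'a \<Rightarrow> 'e" where "coord c \<equiv> snd c"
abbreviation coord_inv :: "('a, 'e) chart \<Rightarrow> 'e \<Rightarrow> 'a" where
  "coord_inv c \<equiv> inv_into (chart_dom c) (coord c)"

text \<open>
  The manifold is the whole type \<open>'a\<close>; its dimension is \<open>m = DIM('e)\<close>. The structure includes a
  preferred chart \<open>chart_at M x\<close> around every point, by means of which the tangent space at \<open>x\<close> is
  identified with the model space: a vector \<open>v :: 'e\<close> at \<open>x\<close> is the tangent vector whose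
  coordinates in the chart \<open>chart_at M x\<close> are \<open>v\<close>. No regularity in \<open>x\<close> of this choice
  is assumed, so regularity of tensor fields is always expressed in the charts of the atlas.
\<close>

record ('a, 'e) manifold =
  atlas :: "('a, 'e) chart set"
  chart_at :: "'a \<Rightarrow> ('a, 'e) chart"
  metric :: "'a \<Rightarrow> 'e \<Rightarrow> 'e \<Rightarrow> real"

text \<open>The tangent vector at \<open>x\<close> with given coordinates in the chart \<open>c\<close>.\<close>

definition from_chart ::
  "('a, 'e::euclidean_space) manifold \<Rightarrow> ('a, 'e) chart \<Rightarrow> 'a \<Rightarrow> 'e \<Rightarrow> 'e" where
  "from_chart M c x = frechet_derivative (coord (chart_at M x) \<circ> coord_inv c) (at (coord c x))"

definition riemannian_manifold ::
  "('a::{second_countable_topology, t2_space}, 'e::euclidean_space) manifold \<Rightarrow> bool" where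
  "riemannian_manifold M \<longleftrightarrow>
     (\<forall>c\<in>atlas M. open (chart_dom c) \<and> open (coord c ` chart_dom c) \<and>
        homeomorphism (chart_dom c) (coord c ` chart_dom c) (coord c) (coord_inv c)) \<and>
     (\<forall>c\<in>atlas M. \<forall>d\<in>atlas M.
        smooth_on (coord c ` (chart_dom c \<inter> chart_dom d)) (coord d \<circ> coord_inv c)) \<and>
     (\<forall>x. chart_at M x \<in> atlas M \<and> x \<in> chart_dom (chart_at M x)) \<and>
     (\<forall>x. bilinear (metric M x) \<and> (\<forall>v w. metric M x v w = metric M x w v) \<and>
        (\<forall>v. v \<noteq> 0 \<longrightarrow> metric M x v v > 0)) \<and>
     (\<forall>c\<in>atlas M. \<forall>v w. smooth_on (coord c ` chart_dom c)
        (\<lambda>y. metric M (coord_inv c y) (from_chart M c (coord_inv c y) v)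
               (from_chart M c (coord_inv c y) w)))"

definition tnorm :: "('a, 'e::euclidean_space) manifold \<Rightarrow> 'a \<Rightarrow> 'e \<Rightarrow> real" where
  "tnorm M x v = sqrt (metric M x v v)"

text \<open>Operator norm of a linear map from the tangent space at \<open>x\<close> to that at \<open>y\<close>.\<close>

definition opnorm ::
  "('a, 'e::euclidean_space) manifold \<Rightarrow> 'a \<Rightarrow> 'a \<Rightarrow> ('e \<Rightarrow> 'e) \<Rightarrow> real" where
  "opnorm M x y A = (SUP v. tnorm M y (A v) / tnorm M x v)"

text \<open>The conorm \<open>\<m>(B) = \<parallel>B\<^sup>-\<^sup>1\<parallel>\<^sup>-\<^sup>1\<close> of a linear map from the tangent space at \<open>x\<close> to that at \<open>y\<close>.\<close>

definition conorm ::
  "('a, 'e::euclidean_space) manifold \<Rightarrow> 'a \<Rightarrow> 'a \<Rightarrow> ('e \<Rightarrow> 'e) \<Rightarrow> real" where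
  "conorm M x y B = inverse (opnorm M y x (inv B))"

definition cotnorm ::
  "('a, 'e::euclidean_space) manifold \<Rightarrow> 'a \<Rightarrow> ('e \<Rightarrow>\<^sub>L real) \<Rightarrow> real" where
  "cotnorm M x \<xi> = (SUP v. \<bar>blinfun_apply \<xi> v\<bar> / tnorm M x v)"

subsection \<open>Riemannian distance\<close>

text \<open>
  The distance is infinite between different components. As in the library notion
  \<^const>\<open>piecewise_C1_differentiable_on\<close>, derivatives of curves need not exist at finitely many
  points, at which the integrand of the length is irrelevant.
\<close>

definition piecewise_C1_curve ::
  "('a::topological_space, 'e::euclidean_space) manifold \<Rightarrow> (real \<Rightarrow> 'a) \<Rightarrow> bool" where
  "piecewise_C1_curve M \<gamma> \<longleftrightarrow> continuous_on {0..1} \<gamma> \<and>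
     (\<exists>S. finite S \<and> (\<forall>c\<in>atlas M.
        (coord c \<circ> \<gamma>) C1_differentiable_on (({0<..<1} - S) \<inter> \<gamma> -` chart_dom c)))"

definition velocity ::
  "('a, 'e::euclidean_space) manifold \<Rightarrow> (real \<Rightarrow> 'a) \<Rightarrow> real \<Rightarrow> 'e" where
  "velocity M \<gamma> t = vector_derivative (coord (chart_at M (\<gamma> t)) \<circ> \<gamma>) (at t)"

definition curve_length ::
  "('a, 'e::euclidean_space) manifold \<Rightarrow> (real \<Rightarrow> 'a) \<Rightarrow> ennreal" where
  "curve_length M \<gamma> =
     (\<integral>\<^sup>+t. ennreal (tnorm M (\<gamma> t) (velocity M \<gamma> t)) * indicator {0..1} t \<partial>lborel)"

definition rdist ::
  "('a::topological_space, 'e::euclidean_space) manifold \<Rightarrow> 'a \<Rightarrow> 'a \<Rightarrow> ennreal" where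
  "rdist M x y =
     (INF \<gamma> \<in> {\<gamma>. piecewise_C1_curve M \<gamma> \<and> \<gamma> 0 = x \<and> \<gamma> 1 = y}. curve_length M \<gamma>)"

subsection \<open>Maps between manifolds\<close>

text \<open>The derivative of \<open>F\<close> at \<open>x\<close>, as a map from the tangent space at \<open>x\<close> to that at \<open>F x\<close>.\<close>

definition tderiv ::
  "('a, 'e::euclidean_space) manifold \<Rightarrow> ('a \<Rightarrow> 'a) \<Rightarrow> 'a \<Rightarrow> 'e \<Rightarrow> 'e" where
  "tderiv M F x = frechet_derivative (coord (chart_at M (F x)) \<circ> F \<circ> coord_inv (chart_at M x))
     (at (coord (chart_at M x) x))"

definition C1_map_on ::
  "('a::topological_space, 'e::euclidean_space) manifold \<Rightarrow> 'a set \<Rightarrow> ('a \<Rightarrow> 'a) \<Rightarrow> bool" where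
  "C1_map_on M U F \<longleftrightarrow> continuous_on U F \<and> (\<forall>c\<in>atlas M. \<forall>d\<in>atlas M.
     Ck_on 1 (coord c ` (U \<inter> chart_dom c \<inter> F -` chart_dom d)) (coord d \<circ> F \<circ> coord_inv c))"

definition C1_local_diffeo ::
  "('a::topological_space, 'e::euclidean_space) manifold \<Rightarrow> ('a \<Rightarrow> 'a) \<Rightarrow> bool" where
  "C1_local_diffeo M F \<longleftrightarrow> (\<forall>x. \<exists>U G. open U \<and> x \<in> U \<and> open (F ` U) \<and>
     C1_map_on M U F \<and> C1_map_on M (F ` U) G \<and> (\<forall>y\<in>U. G (F y) = y))"

section \<open>Random maps\<close>

abbreviation noise :: "'t measure \<Rightarrow> (nat \<Rightarrow> 't) measure" where
  "noise T \<equiv> Pi\<^sub>M UNIV (\<lambda>_. T)"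

text \<open>
  Several integrands below are only determined for almost every \<open>\<omega>\<close>. Bochner integrals of such
  functions are therefore taken with respect to the completion of the noise measure (the value
  of \<^const>\<open>nn_integral\<close> is unaffected by null sets anyway).
\<close>

definition C1_random_map ::
  "('a::{second_countable_topology, t2_space}, 'e::euclidean_space) manifold \<Rightarrow> 't measure \<Rightarrow>
   ((nat \<Rightarrow> 't) \<Rightarrow> 'a \<Rightarrow> 'a) \<Rightarrow> bool" where
  "C1_random_map M T f \<longleftrightarrow>
     (\<lambda>(\<omega>, x). f \<omega> x) \<in> borel_measurable (noise T \<Otimes>\<^sub>M borel) \<and>
     (\<forall>\<omega>\<in>space (noise T). \<forall>\<omega>'\<in>space (noise T). \<omega> 0 = \<omega>' 0 \<longrightarrow> f \<omega> = f \<omega>') \<and>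
     (AE \<omega> in noise T. C1_local_diffeo M (f \<omega>))"

text \<open>As \<open>f\<close> depends only on the coordinate \<open>\<omega> 0\<close>, the \<open>n\<close>-th factor is \<open>f\<close> at the shifted noise.\<close>

primrec rand_iter :: "((nat \<Rightarrow> 't) \<Rightarrow> 'a \<Rightarrow> 'a) \<Rightarrow> nat \<Rightarrow> (nat \<Rightarrow> 't) \<Rightarrow> 'a \<Rightarrow> 'a" where
  "rand_iter f 0 \<omega> = id"
| "rand_iter f (Suc n) \<omega> = f (\<lambda>k. \<omega> (n + k)) \<circ> rand_iter f n \<omega>"

definition deriv_sup ::
  "('a, 'e::euclidean_space) manifold \<Rightarrow> 'a set \<Rightarrow> ('a \<Rightarrow> 'a) \<Rightarrow> ennreal" where
  "deriv_sup M X F = (SUP x\<in>X. ennreal (opnorm M x (F x) (tderiv M F x)))"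

definition deriv_inv_sup ::
  "('a, 'e::euclidean_space) manifold \<Rightarrow> 'a set \<Rightarrow> ('a \<Rightarrow> 'a) \<Rightarrow> ennreal" where
  "deriv_inv_sup M X F = (SUP x\<in>X. ennreal (opnorm M (F x) x (inv (tderiv M F x))))"

definition log_plus :: "ennreal \<Rightarrow> ennreal" where
  "log_plus s = (if s = \<infinity> then \<infinity> else ennreal (max 0 (ln (enn2real s))))"

definition Diff1_loc ::
  "('a::{second_countable_topology, t2_space}, 'e::euclidean_space) manifold \<Rightarrow> 't measure \<Rightarrow>
   'a set \<Rightarrow> ((nat \<Rightarrow> 't) \<Rightarrow> 'a \<Rightarrow> 'a) set" where
  "Diff1_loc M T X = {f. C1_random_map M T f \<and> (AE \<omega> in noise T. f \<omega> ` X \<subseteq> X) \<and>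
     (\<integral>\<^sup>+\<omega>. log_plus (deriv_sup M X (f \<omega>)) + log_plus (deriv_inv_sup M X (f \<omega>)) \<partial>noise T) < \<infinity>}"

definition stationary ::
  "'w measure \<Rightarrow> ('w \<Rightarrow> 'x \<Rightarrow> 'x) \<Rightarrow> 'x measure \<Rightarrow> bool" where
  "stationary P F \<mu> \<longleftrightarrow>
     (\<forall>B\<in>sets \<mu>. emeasure \<mu> B = (\<integral>\<^sup>+\<omega>. emeasure (distr \<mu> \<mu> (F \<omega>)) B \<partial>P))"

definition stat_measures ::
  "'t measure \<Rightarrow> 'a::topological_space set \<Rightarrow> ((nat \<Rightarrow> 't) \<Rightarrow> 'a \<Rightarrow> 'a) \<Rightarrow> 'a measure set" where
  "stat_measures T X f = {\<mu>. prob_space \<mu> \<and> sets \<mu> = sets (restrict_space borel X) \<and>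
     stationary (noise T) f \<mu>}"

definition Diff1_loc_preserving ::
  "('a::{second_countable_topology, t2_space}, 'e::euclidean_space) manifold \<Rightarrow> 't measure \<Rightarrow>
   'a set \<Rightarrow> 'a measure \<Rightarrow> ((nat \<Rightarrow> 't) \<Rightarrow> 'a \<Rightarrow> 'a) set" where
  "Diff1_loc_preserving M T X \<mu> = {f \<in> Diff1_loc M T X. \<mu> \<in> stat_measures T X f}"

subsection \<open>Average C1 distance\<close>

text \<open>
  \<open>\<iota> x\<close> is the restriction of the embedding to the fibre over \<open>x\<close>; the last clause
  is continuity on the tangent bundle over \<open>X\<close>, in the trivialisations given by the atlas.
\<close>

definition isometric_embedding ::
  "('a::topological_space, 'e::euclidean_space) manifold \<Rightarrow> 'a set \<Rightarrow>
   ('a \<Rightarrow> 'e \<Rightarrow> 'n::euclidean_space) \<Rightarrow> bool" where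
  "isometric_embedding M X \<iota> \<longleftrightarrow>
     (\<forall>x\<in>X. linear (\<iota> x) \<and> (\<forall>v. norm (\<iota> x v) = tnorm M x v)) \<and>
     (\<forall>c\<in>atlas M. continuous_on ((X \<inter> chart_dom c) \<times> UNIV) (\<lambda>(x, v). \<iota> x (from_chart M c x v)))"

definition orth_proj :: "'n::euclidean_space set \<Rightarrow> 'n \<Rightarrow> 'n" where
  "orth_proj S z = (THE y. y \<in> S \<and> (\<forall>w\<in>S. orthogonal (z - y) w))"

text \<open>The extension \<open>\<iota>\<^sub>y A \<iota>\<^sub>x\<^sup>-\<^sup>1 P\<^sub>x\<close> to the ambient space of a map \<open>A\<close> from the fibre at \<open>x\<close> to that at \<open>y\<close>.\<close>

definition ambient ::
  "('a \<Rightarrow> 'e \<Rightarrow> 'n::euclidean_space) \<Rightarrow> 'a \<Rightarrow> 'a \<Rightarrow> ('e \<Rightarrow> 'e) \<Rightarrow> 'n \<Rightarrow> 'n" where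
  "ambient \<iota> x y A = (\<lambda>z. \<iota> y (A (inv (\<iota> x) (orth_proj (range (\<iota> x)) z))))"

definition dist_C0 ::
  "('a::topological_space, 'e::euclidean_space) manifold \<Rightarrow> 'a set \<Rightarrow>
   ('a \<Rightarrow> 'a) \<Rightarrow> ('a \<Rightarrow> 'a) \<Rightarrow> ennreal" where
  "dist_C0 M X F G = (SUP x\<in>X. rdist M (F x) (G x))"

definition dist_deriv ::
  "('a, 'e::euclidean_space) manifold \<Rightarrow> 'a set \<Rightarrow> ('a \<Rightarrow> 'e \<Rightarrow> 'n::euclidean_space) \<Rightarrow>
   ('a \<Rightarrow> 'a) \<Rightarrow> ('a \<Rightarrow> 'a) \<Rightarrow> ennreal" where
  "dist_deriv M X \<iota> F G = (SUP x\<in>X. ennreal (onorm (\<lambda>z.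
     ambient \<iota> x (F x) (tderiv M F x) z - ambient \<iota> x (G x) (tderiv M G x) z)))"

definition dist_deriv_inv ::
  "('a, 'e::euclidean_space) manifold \<Rightarrow> 'a set \<Rightarrow> ('a \<Rightarrow> 'e \<Rightarrow> 'n::euclidean_space) \<Rightarrow>
   ('a \<Rightarrow> 'a) \<Rightarrow> ('a \<Rightarrow> 'a) \<Rightarrow> ennreal" where
  "dist_deriv_inv M X \<iota> F G = (SUP x\<in>X. ennreal (onorm (\<lambda>z.
     ambient \<iota> (F x) x (inv (tderiv M F x)) z - ambient \<iota> (G x) x (inv (tderiv M G x)) z)))"

definition dist_C1 ::
  "('a::topological_space, 'e::euclidean_space) manifold \<Rightarrow> 't measure \<Rightarrow> 'a set \<Rightarrow>
   ('a \<Rightarrow> 'e \<Rightarrow> 'n::euclidean_space) \<Rightarrow>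
   ((nat \<Rightarrow> 't) \<Rightarrow> 'a \<Rightarrow> 'a) \<Rightarrow> ((nat \<Rightarrow> 't) \<Rightarrow> 'a \<Rightarrow> 'a) \<Rightarrow> ennreal" where
  "dist_C1 M T X \<iota> f g = (\<integral>\<^sup>+\<omega>. dist_C0 M X (f \<omega>) (g \<omega>) + dist_deriv M X \<iota> (f \<omega>) (g \<omega>)
     + dist_deriv_inv M X \<iota> (f \<omega>) (g \<omega>) \<partial>noise T)"

definition continuous_at_wrt ::
  "('f \<Rightarrow> 'f \<Rightarrow> ennreal) \<Rightarrow> 'f set \<Rightarrow> ('f \<Rightarrow> real) \<Rightarrow> 'f \<Rightarrow> bool" where
  "continuous_at_wrt d S \<Phi> f \<longleftrightarrow>
     (\<forall>\<epsilon>>0. \<exists>\<delta>>0. \<forall>g\<in>S. d f g < ennreal \<delta> \<longrightarrow> \<bar>\<Phi> g - \<Phi> f\<bar> < \<epsilon>)"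

subsection \<open>The smallest Lyapunov exponent\<close>

definition lyap_min_at ::
  "('a, 'e::euclidean_space) manifold \<Rightarrow> 't measure \<Rightarrow> 'a measure \<Rightarrow>
   ((nat \<Rightarrow> 't) \<Rightarrow> 'a \<Rightarrow> 'a) \<Rightarrow> real" where
  "lyap_min_at M T \<mu> g = lim (\<lambda>n. 1 / real n * (LINT x|\<mu>. LINT \<omega>|completion (noise T).
     ln (conorm M x (rand_iter g n \<omega> x) (tderiv M (rand_iter g n \<omega>) x))))"

definition lyap_min ::
  "('a::topological_space, 'e::euclidean_space) manifold \<Rightarrow> 't measure \<Rightarrow> 'a set \<Rightarrow>
   ((nat \<Rightarrow> 't) \<Rightarrow> 'a \<Rightarrow> 'a) \<Rightarrow> real" where
  "lyap_min M T X g = (INF \<eta>\<in>stat_measures T X g. lyap_min_at M T \<eta> g)"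

subsection \<open>Projectivised cotangent dynamics\<close>

text \<open>A point of the projectivised cotangent bundle is a point \<open>x\<close> with a line of covectors at \<open>x\<close>.\<close>

definition proj_cotangent :: "'a set \<Rightarrow> ('a \<times> ('e::euclidean_space \<Rightarrow>\<^sub>L real) set) set" where
  "proj_cotangent X = {(x, span {\<xi>}) | x \<xi>. x \<in> X \<and> \<xi> \<noteq> 0}"

text \<open>
  Openness in the quotient topology: the preimage in the bundle of nonzero covectors over \<open>X\<close> is
  open in all trivialisations \<open>(x, \<xi>) \<mapsto> (x, coordinates of \<xi> in c)\<close> given by the atlas.
\<close>

definition proj_cotangent_open ::
  "('a::topological_space, 'e::euclidean_space) manifold \<Rightarrow> 'a set \<Rightarrow>
   ('a \<times> ('e \<Rightarrow>\<^sub>L real) set) set \<Rightarrow> bool" where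
  "proj_cotangent_open M X U \<longleftrightarrow> U \<subseteq> proj_cotangent X \<and>
     (\<forall>c\<in>atlas M. openin (top_of_set ((X \<inter> chart_dom c) \<times> (- {0})))
        {(x, \<xi> o\<^sub>L Blinfun (from_chart M c x)) | x \<xi>.
           x \<in> chart_dom c \<and> \<xi> \<noteq> 0 \<and> (x, span {\<xi>}) \<in> U})"

definition proj_cotangent_borel ::
  "('a::topological_space, 'e::euclidean_space) manifold \<Rightarrow> 'a set \<Rightarrow>
   ('a \<times> ('e \<Rightarrow>\<^sub>L real) set) measure" where
  "proj_cotangent_borel M X = sigma (proj_cotangent X) {U. proj_cotangent_open M X U}"

text \<open>The action \<open>\<xi> \<mapsto> (DF(x)\<^sup>-\<^sup>1)\<^sup>*\<xi>\<close> from covectors at \<open>x\<close> to covectors at \<open>F x\<close>.\<close>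

definition cot_push ::
  "('a, 'e::euclidean_space) manifold \<Rightarrow> ('a \<Rightarrow> 'a) \<Rightarrow> 'a \<Rightarrow> ('e \<Rightarrow>\<^sub>L real) \<Rightarrow> ('e \<Rightarrow>\<^sub>L real)" where
  "cot_push M F x \<xi> = \<xi> o\<^sub>L Blinfun (inv (tderiv M F x))"

definition proj_cot_map ::
  "('a, 'e::euclidean_space) manifold \<Rightarrow> ('a \<Rightarrow> 'a) \<Rightarrow>
   'a \<times> ('e \<Rightarrow>\<^sub>L real) set \<Rightarrow> 'a \<times> ('e \<Rightarrow>\<^sub>L real) set" where
  "proj_cot_map M F = (\<lambda>(x, L). (F x, cot_push M F x ` L))"

definition cot_stat_measures ::
  "('a::topological_space, 'e::euclidean_space) manifold \<Rightarrow> 't measure \<Rightarrow> 'a set \<Rightarrow> 'a measure \<Rightarrow>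
   ((nat \<Rightarrow> 't) \<Rightarrow> 'a \<Rightarrow> 'a) \<Rightarrow> ('a \<times> ('e \<Rightarrow>\<^sub>L real) set) measure set" where
  "cot_stat_measures M T X \<mu> f = {\<nu>. prob_space \<nu> \<and> sets \<nu> = sets (proj_cotangent_borel M X) \<and>
     stationary (noise T) (\<lambda>\<omega>. proj_cot_map M (f \<omega>)) \<nu> \<and> distr \<nu> \<mu> fst = \<mu>}"

text \<open>The two unit covectors on a line differ by a sign, so the choice below is immaterial.\<close>

definition cot_phi ::
  "('a, 'e::euclidean_space) manifold \<Rightarrow> 't measure \<Rightarrow> ((nat \<Rightarrow> 't) \<Rightarrow> 'a \<Rightarrow> 'a) \<Rightarrow>
   'a \<times> ('e \<Rightarrow>\<^sub>L real) set \<Rightarrow> real" where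
  "cot_phi M T f = (\<lambda>(x, L). LINT \<omega>|completion (noise T).
     ln (cotnorm M (f \<omega> x) (cot_push M (f \<omega>) x (SOME \<xi>. \<xi> \<in> L \<and> cotnorm M x \<xi> = 1))))"

definition coquasi_irreducible ::
  "('a::topological_space, 'e::euclidean_space) manifold \<Rightarrow> 't measure \<Rightarrow> 'a set \<Rightarrow> 'a measure \<Rightarrow>
   ((nat \<Rightarrow> 't) \<Rightarrow> 'a \<Rightarrow> 'a) \<Rightarrow> bool" where
  "coquasi_irreducible M T X \<mu> f \<longleftrightarrow>
     (\<forall>\<nu>\<in>cot_stat_measures M T X \<mu> f. (LINT z|\<nu>. cot_phi M T f z) = - lyap_min_at M T \<mu> f)"

definition maximal_coquasi_irreducible ::
  "('a::topological_space, 'e::euclidean_space) manifold \<Rightarrow> 't measure \<Rightarrow> 'a set \<Rightarrow>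
   ((nat \<Rightarrow> 't) \<Rightarrow> 'a \<Rightarrow> 'a) \<Rightarrow> bool" where
  "maximal_coquasi_irreducible M T X f \<longleftrightarrow> (\<forall>\<mu>\<in>stat_measures T X f.
     coquasi_irreducible M T X \<mu> f \<and> lyap_min_at M T \<mu> f = lyap_min M T X f)"

end

theory Submission
  imports Defs
begin

text \<open>Suppose \<open>g\<^sub>k \<rightarrow> f\<close> with stationary measures \<open>\<mu>\<^sub>k\<close>. The exponent \<open>-\<lambda>\<^sub>m(\<mu>\<^sub>k, g\<^sub>k)\<close> is the growth rate of the
  norm of the cotangent cocycle. By subadditivity the upper limit of these rates is at most the rate
  of \<open>f\<close> at any weak limit of the \<open>\<mu>\<^sub>k\<close>. For the lower limit, start the projectivised cotangent
  dynamics of \<open>g\<^sub>k\<close> at a measurable section over \<open>\<mu>\<^sub>k\<close> and average along \<open>n\<^sub>k > k\<close> steps, where \<open>n\<^sub>k\<close> is so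
  large that the norm growth up to time \<open>n\<^sub>k\<close>, which dominates the growth of the section, almost
  realises the rate. A weak limit of the averages is stationary for \<open>f\<close> and integrates the mean
  logarithmic stretch to at most the lower limit; coquasi-irreducibility says that this integral is
  the rate of \<open>f\<close>. When the distances from \<open>f\<close> to the \<open>g\<^sub>k\<close> are summable, the maps and derivatives converge
  uniformly for almost every noise, dominated by an integrable function.\<close>

section \<open>Probability measures on compact spaces\<close>

text \<open>The distance \<open>dist_C1\<close> controls integrals only, so closeness by itself says
  nothing about a fixed noise. A failure of continuity at \<open>f\<close>, however, supplies
  counterexamples at every prescribed distance, so they may be drawn within \<open>d k\<close>, at
  most \<open>(1/2)^k\<close>, of \<open>f\<close>; this rate does not involve \<open>f\<close> and
  is fixed beforehand. Letting the stationary measures vary with \<open>k\<close> makes both claims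
  instances of one statement: constant measures for the first, almost minimising ones for the
  second.

  Two obstacles shape the rest. The identifications of the tangent spaces may jump from point to
  point, so \<open>tderiv\<close> need not be continuous even for a smooth map. Transporting
  everything into \<real>^N by the embedding cures this: a covector becomes a vector of the fibre
  and the cotangent action becomes an adjoint. The cocycle then acts on unit spheres, a double cover
  of the lines, and it vanishes on the orthogonal complements of the fibres. Secondly,
  \<open>rdist\<close> may be infinite and is tied to the topology only through the lengths of
  curves, so continuous functions on \<open>X\<close> do the work of a metric.\<close>

lemma compact_zero_set_function:
  fixes S :: "'a::{second_countable_topology,t2_space} set"
  assumes "compact S" "closed C"
  obtains h :: "'a \<Rightarrow> real" where "continuous_on S h" "\<And>x. x \<in> S \<Longrightarrow> 0 \<le> h x \<and> h x \<le> 1"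
    "\<And>x. x \<in> S \<Longrightarrow> h x = 0 \<longleftrightarrow> x \<in> C"
proof -
  let ?X = "top_of_set S"
  have "compact_space ?X" using assms(1) by (simp add: compact_space_subtopology)
  moreover have "Hausdorff_space (euclidean :: 'a topology)"
    unfolding Hausdorff_space_def disjnt_def using hausdorff by (auto simp: open_openin[symmetric])
  then have "Hausdorff_space ?X" by (rule Hausdorff_space_subtopology)
  ultimately have nX: "normal_space ?X" using compact_Hausdorff_or_regular_imp_normal_space by blast
  \<comment> \<open>One Urysohn function per point outside \<open>C\<close>. Lindelof keeps
    countably many whose positivity sets still cover \<open>S - C\<close>, and a weighted sum of
    these vanishes exactly on \<open>C\<close>.\<close>
  have "\<exists>g::'a\<Rightarrow>real. continuous_on S g \<and> g ` S \<subseteq> {0..1} \<and> g ` (S \<inter> C) \<subseteq> {0} \<and> g x = 1"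
    if "x \<in> S - C" for x
  proof -
    have c1: "closedin ?X (S \<inter> C)" using assms(2) by (simp add: closedin_closed_Int)
    have c2: "closedin ?X {x}"
      using closedin_closed_Int[of "{x}" S] that by (simp add: insert_absorb)
    from Urysohn_lemma[OF nX c1 c2, of 0 1] obtain g :: "'a \<Rightarrow> real"
      where "continuous_map ?X (top_of_set {0..1}) g" "g ` (S \<inter> C) \<subseteq> {0}" "g ` {x} \<subseteq> {1}"
      using \<open>x \<in> S - C\<close> by (auto simp: disjnt_def)
    thus ?thesis by (intro exI[of _ g]) (auto simp: continuous_map_in_subtopology)
  qed
  then obtain g :: "'a \<Rightarrow> 'a \<Rightarrow> real" where g: "\<And>x. x \<in> S - C \<Longrightarrow> continuous_on S (g x)"
    "\<And>x. x \<in> S - C \<Longrightarrow> g x ` S \<subseteq> {0..1}" "\<And>x. x \<in> S - C \<Longrightarrow> g x ` (S \<inter> C) \<subseteq> {0}"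
    "\<And>x. x \<in> S - C \<Longrightarrow> g x x = 1"
    by metis
  have "\<exists>U. open U \<and> U \<inter> S = g x -` {0<..} \<inter> S" if "x \<in> S - C" for x
    using continuous_on_open_invariant[of S "g x"] g(1)[OF that] by (metis open_greaterThan)
  then obtain U where U: "\<And>x. x \<in> S - C \<Longrightarrow> open (U x)"
    "\<And>x. x \<in> S - C \<Longrightarrow> U x \<inter> S = g x -` {0<..} \<inter> S" by metis
  obtain F' where F': "F' \<subseteq> U ` (S - C)" "countable F'" "\<Union>F' = \<Union>(U ` (S - C))"
    using Lindelof[of "U ` (S - C)"] U(1) by blast
  obtain D where D: "countable D" "D \<subseteq> S - C" "F' = U ` D"
    using countable_subset_image[of F' U "S - C"] F' by auto
  \<comment> \<open>If \<open>D\<close> is empty, \<open>S\<close> lies inside \<open>C\<close> and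
    zero functions will do. Otherwise the enumeration may repeat members of \<open>D\<close>, which
    is harmless since only the zero set of the sum matters.\<close>
  define c where "c n = (if D = {} then (\<lambda>_. 0) else g (from_nat_into D n))" for n
  have cD: "from_nat_into D n \<in> S - C" if "D \<noteq> {}" for n
    using D that from_nat_into[of D n] by auto
  have c_cont: "continuous_on S (c n)" for n using g(1) cD by (simp add: c_def)
  have c_b: "0 \<le> c n x \<and> c n x \<le> 1" if "x \<in> S" for n x
    using g(2)[OF cD] that by (fastforce simp: c_def)
  have c_0: "c n x = 0" if "x \<in> S" "x \<in> C" for n x
    using g(3)[OF cD] that by (fastforce simp: c_def)
  have c_pos: "\<exists>n. c n x > 0" if "x \<in> S" "x \<notin> C" for x
  proof -
    have "x \<in> U x" using U(2)[of x] g(4)[of x] that by auto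
    then have "x \<in> \<Union>F'" using that unfolding F'(3) by blast
    then obtain d where d: "d \<in> D" "x \<in> U d" unfolding D(3) by blast
    then have "g d x > 0" using U(2)[of d] D(2) that by auto
    moreover obtain n where "d = from_nat_into D n" using d(1) D(1)
      by (metis from_nat_into_to_nat_on)
    ultimately show ?thesis using d by (auto simp: c_def)
  qed
  define h where "h x = (\<Sum>n. (1/2) ^ Suc n * c n x)" for x
  have sm: "summable (\<lambda>n. (1/2::real) ^ Suc n)"
    using power_half_series sums_summable by blast
  have bnd: "norm ((1/2) ^ Suc n * c n x) \<le> (1/2::real) ^ Suc n" if "x \<in> S" for n x
    using c_b[OF that, of n] by (simp add: abs_mult mult_le_cancel_left1)
  have sm2: "summable (\<lambda>n. (1/2) ^ Suc n * c n x)" if "x \<in> S" for x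
    by (rule summable_comparison_test'[OF sm]) (rule bnd[OF that])
  show thesis
  proof (rule that[of h])
    show "continuous_on S h"
      unfolding h_def
    proof (rule uniform_limit_theorem)
      show "uniform_limit S (\<lambda>n x. \<Sum>i<n. (1/2) ^ Suc i * c i x) (\<lambda>x. \<Sum>n. (1/2) ^ Suc n * c n x) sequentially"
        by (rule Weierstrass_m_test[where M="\<lambda>n. (1/2) ^ Suc n"]) (use bnd sm in auto)
      show "\<forall>\<^sub>F n in sequentially. continuous_on S (\<lambda>x. \<Sum>i<n. (1/2) ^ Suc i * c i x)"
        by (intro always_eventually allI continuous_intros c_cont)
    qed simp
    fix x assume x: "x \<in> S"
    have "h x \<le> (\<Sum>n. (1/2) ^ Suc n)" unfolding h_def
      by (rule suminf_le[OF _ sm2[OF x] sm]) (use bnd[OF x] in \<open>auto simp: abs_le_iff\<close>)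
    moreover have "(\<Sum>n. (1/2::real) ^ Suc n) = 1" using power_half_series sums_unique by metis
    moreover have "0 \<le> h x" unfolding h_def
      by (rule suminf_nonneg[OF sm2[OF x]]) (use c_b[OF x] in auto)
    ultimately show "0 \<le> h x \<and> h x \<le> 1" by simp
    show "h x = 0 \<longleftrightarrow> x \<in> C"
    proof
      assume "x \<in> C" thus "h x = 0" using c_0[OF x] by (simp add: h_def)
    next
      assume h0: "h x = 0"
      show "x \<in> C"
      proof (rule ccontr)
        assume "x \<notin> C"
        then obtain n where "c n x > 0" using c_pos[OF x] by auto
        then have "0 < h x" unfolding h_def
          using suminf_pos2[OF sm2[OF x], of n] c_b[OF x] by simp
        thus False using h0 by simp
      qed
    qed
  qed
qed

section \<open>Testing Borel measures with continuous functions\<close>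

lemma borel_on_integrable_continuous:
  fixes h :: "'a::t2_space \<Rightarrow> real"
  assumes "compact S" "continuous_on S h" "prob_space M" "sets M = sets (restrict_space borel S)"
  shows "integrable M h" and "h \<in> borel_measurable M"
proof -
  interpret prob_space M by fact
  have sp: "space M = S" using sets_eq_imp_space_eq[OF assms(4)] by (simp add: space_restrict_space)
  show m: "h \<in> borel_measurable M"
    using borel_measurable_continuous_on_restrict[OF assms(2)] assms(4)
    by (simp cong: measurable_cong_sets)
  obtain B where "\<And>x. x \<in> S \<Longrightarrow> norm (h x) \<le> B"
    using compact_continuous_image[OF assms(2,1)] compact_imp_bounded bounded_iff
    by (metis imageI)
  thus "integrable M h"
    by (intro integrable_const_bound[of _ B] m AE_I2) (auto simp: sp)
qed

text \<open>With \<open>h\<close> vanishing exactly on \<open>C\<close> and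
  \<open>0 \<le> h \<le> 1\<close>, the powers of \<open>1 - h\<close> stay 1 on \<open>C\<close>
  and die off elsewhere.\<close>

lemma compact_closed_approx:
  fixes S :: "'a::{second_countable_topology,t2_space} set"
  assumes "compact S" "closed C"
  obtains h :: "nat \<Rightarrow> 'a \<Rightarrow> real" where "\<And>n. continuous_on S (h n)"
    "\<And>n x. x \<in> S \<Longrightarrow> \<bar>h n x\<bar> \<le> 1" "\<And>x. x \<in> S \<Longrightarrow> (\<lambda>n. h n x) \<longlonglongrightarrow> indicator C x"
proof -
  obtain h :: "'a \<Rightarrow> real" where h: "continuous_on S h" "\<And>x. x \<in> S \<Longrightarrow> 0 \<le> h x \<and> h x \<le> 1"
    "\<And>x. x \<in> S \<Longrightarrow> h x = 0 \<longleftrightarrow> x \<in> C" using compact_zero_set_function[OF assms] by blast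
  show thesis
  proof (rule that[of "\<lambda>n x. (1 - h x) ^ n"])
    show "continuous_on S (\<lambda>x. (1 - h x) ^ n)" for n by (intro continuous_intros h)
    show "\<bar>(1 - h x) ^ n\<bar> \<le> 1" if "x \<in> S" for n x
      using h(2)[OF that] by (simp add: power_abs power_le_one)
    show "(\<lambda>n. (1 - h x) ^ n) \<longlonglongrightarrow> indicator C x" if "x \<in> S" for x
    proof (cases "x \<in> C")
      case True thus ?thesis using h(3)[OF that] by simp
    next
      case False
      then have "(\<lambda>n. (1 - h x) ^ n) \<longlonglongrightarrow> 0"
        using h(2,3)[OF that] by (intro LIMSEQ_realpow_zero) auto
      thus ?thesis using False by simp
    qed
  qed
qed

text \<open>Closed sets generate the Borel sets and are stable under intersection; dominated
  convergence along \<open>compact_closed_approx\<close> carries equality of integrals over to them.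
  This is how limits of integrals are turned into identities between measures later on.\<close>

lemma compact_borel_measure_eqI:
  fixes S :: "'a::{second_countable_topology,t2_space} set"
  assumes S: "compact S" and M: "prob_space M" "sets M = sets (restrict_space borel S)"
    and N: "prob_space N" "sets N = sets (restrict_space borel S)"
    and eq: "\<And>h::'a\<Rightarrow>real. continuous_on S h \<Longrightarrow> integral\<^sup>L M h = integral\<^sup>L N h"
  shows "M = N"
proof -
  interpret M: prob_space M by fact
  interpret N: prob_space N by fact
  have sp: "space M = S" "space N = S"
    using sets_eq_imp_space_eq[OF M(2)] sets_eq_imp_space_eq[OF N(2)] by (simp_all add: space_restrict_space)
  have Sb: "S \<in> sets borel" using S by (simp add: borel_compact)
  have mea[measurable]: "(\<lambda>x. x) \<in> measurable M borel" "(\<lambda>x. x) \<in> measurable N borel"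
    using M(2) N(2) measurable_restrict_space1[OF measurable_ident, of borel S] by (simp_all add: id_def cong: measurable_cong_sets)
  have closed_eq: "emeasure M (C \<inter> S) = emeasure N (C \<inter> S)" if C: "closed C" for C
  proof -
    obtain h :: "nat \<Rightarrow> 'a \<Rightarrow> real" where h: "\<And>n. continuous_on S (h n)"
      "\<And>n x. x \<in> S \<Longrightarrow> \<bar>h n x\<bar> \<le> 1" "\<And>x. x \<in> S \<Longrightarrow> (\<lambda>n. h n x) \<longlonglongrightarrow> indicator C x"
      using compact_closed_approx[OF S C] by blast
    have [measurable]: "C \<in> sets borel" using C by simp
    have lim: "(\<lambda>n. integral\<^sup>L Q (h n)) \<longlonglongrightarrow> integral\<^sup>L Q (indicator C)"
      if Q: "prob_space Q" "sets Q = sets (restrict_space borel S)" "space Q = S" for Q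
    proof (rule integral_dominated_convergence[where w="\<lambda>_. 1"])
      interpret Q: prob_space Q by fact
      show "(indicator C :: 'a \<Rightarrow> real) \<in> borel_measurable Q"
        using measurable_restrict_space1[of "indicator C::'a\<Rightarrow>real" borel borel S] Q(2)
        by (simp cong: measurable_cong_sets)
      show "h n \<in> borel_measurable Q" for n
        using borel_on_integrable_continuous(2)[OF S h(1) Q(1,2)] .
      show "integrable Q (\<lambda>_. 1 :: real)" by simp
    qed (use h Q in auto)
    have "integral\<^sup>L M (indicator C :: 'a \<Rightarrow> real) = integral\<^sup>L N (indicator C)"
      using LIMSEQ_unique[OF lim[OF M sp(1)]] lim[OF N sp(2)] eq[OF h(1)] by simp
    then have "measure M (C \<inter> S) = measure N (C \<inter> S)"
      by (simp add: sp)
    thus ?thesis by (simp add: M.emeasure_eq_measure N.emeasure_eq_measure)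
  qed
  \<comment> \<open>The generator argument is run on the whole type, where the closed sets generate
    \<open>borel\<close>; hence the detour through the images under the inclusion of
    \<open>S\<close>.\<close>
  have "distr M borel (\<lambda>x. x) = distr N borel (\<lambda>x. x)"
  proof (rule measure_eqI_generator_eq[where E="Collect closed" and \<Omega>=UNIV and A="\<lambda>_. UNIV"])
    show "Int_stable (Collect (closed :: 'a set \<Rightarrow> bool))" by (auto simp: Int_stable_def)
    show "sets (distr M borel (\<lambda>x. x)) = sigma_sets UNIV (Collect closed)"
      "sets (distr N borel (\<lambda>x. x)) = sigma_sets UNIV (Collect closed)"
      by (simp_all add: borel_eq_closed)
    show "emeasure (distr M borel (\<lambda>x. x)) Y = emeasure (distr N borel (\<lambda>x. x)) Y" if "Y \<in> Collect closed" for Y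
      using closed_eq[of Y] that by (simp add: emeasure_distr sp)
    show "emeasure (distr M borel (\<lambda>x. x)) UNIV \<noteq> \<infinity>"
      using M.emeasure_space_1 by (simp add: emeasure_distr sp)
  qed auto
  note d = this
  show "M = N"
  proof (rule measure_eqI)
    show "sets M = sets N" using M N by simp
    fix A assume A: "A \<in> sets M"
    then have AS: "A \<subseteq> S" "A \<in> sets borel"
      using sets.sets_into_space[OF A] sp M(2) Sb by (auto simp: sets_restrict_space_iff)
    have "emeasure (distr M borel (\<lambda>x. x)) A = emeasure M A"
         "emeasure (distr N borel (\<lambda>x. x)) A = emeasure N A"
      using AS by (simp_all add: emeasure_distr sp Int_absorb2)
    thus "emeasure M A = emeasure N A" using d by simp
  qed
qed

text \<open>At the first disagreement \<open>j\<close> the sums differ by \<open>(1/4)^j\<close>,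
  while all later digits together contribute at most \<open>(1/4)^j / 3\<close>. Base 4 leaves this
  gap; in base 2 the tail could cancel the digit, as in 0.0111... = 0.1.\<close>

lemma agree_of_weighted_sum_close:
  fixes a b :: "nat \<Rightarrow> bool"
  assumes close: "\<bar>(\<Sum>n. (1/4)^n * of_bool (a n)) - (\<Sum>n. (1/4)^n * of_bool (b n))\<bar> < (1/4::real)^Suc m"
    and "i \<le> m"
  shows "a i \<longleftrightarrow> b i"
proof (rule ccontr)
  assume "\<not> (a i \<longleftrightarrow> b i)"
  define j where "j = (LEAST j. a j \<noteq> b j)"
  have j: "a j \<noteq> b j" "\<And>k. k < j \<Longrightarrow> a k = b k"
    using LeastI[of "\<lambda>j. a j \<noteq> b j" i] not_less_Least[of _ "\<lambda>j. a j \<noteq> b j"] \<open>\<not> (a i \<longleftrightarrow> b i)\<close>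
    unfolding j_def by blast+
  have ji: "j \<le> m" using Least_le[of "\<lambda>j. a j \<noteq> b j" i] \<open>\<not> (a i \<longleftrightarrow> b i)\<close> \<open>i \<le> m\<close> unfolding j_def by auto
  define e where "e n = (of_bool (a n) - of_bool (b n) :: real)" for n
  have g: "summable (\<lambda>n. (1/4::real)^n)" by (rule summable_geometric) simp
  have sa: "summable (\<lambda>n. (1/4::real)^n * of_bool (a n))" for a :: "nat \<Rightarrow> bool"
    by (rule summable_comparison_test'[OF g]) auto
  have se: "summable (\<lambda>n. (1/4)^n * e n)"
    using summable_diff[OF sa[of a] sa[of b]] by (simp add: e_def right_diff_distrib)
  have "(\<Sum>n. (1/4)^n * of_bool (a n)) - (\<Sum>n. (1/4)^n * of_bool (b n)) = (\<Sum>n. (1/4)^n * e n)"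
    by (subst suminf_diff[OF sa sa]) (simp add: e_def right_diff_distrib)
  also have "\<dots> = (\<Sum>n. (1/4)^(n + Suc j) * e (n + Suc j)) + (\<Sum>n<Suc j. (1/4)^n * e n)"
    by (rule suminf_split_initial_segment[OF se])
  also have "(\<Sum>n<Suc j. (1/4)^n * e n) = (1/4)^j * e j"
    using j(2) by (simp add: e_def)
  finally have eq: "(\<Sum>n. (1/4)^n * of_bool (a n)) - (\<Sum>n. (1/4)^n * of_bool (b n))
     = (\<Sum>n. (1/4)^(n + Suc j) * e (n + Suc j)) + (1/4)^j * e j" .
  have "\<bar>\<Sum>n. (1/4)^(n + Suc j) * e (n + Suc j)\<bar> \<le> (\<Sum>n. (1/4)^Suc j * (1/4)^n)"
  proof -
    have s: "summable (\<lambda>n. (1/4::real)^Suc j * (1/4)^n)" using g by (rule summable_mult)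
    have b: "norm ((1/4)^(n + Suc j) * e (n + Suc j)) \<le> (1/4)^Suc j * (1/4)^n" for n
    proof -
      have "\<bar>e (n + Suc j)\<bar> \<le> 1" by (auto simp: e_def)
      thus ?thesis by (simp add: abs_mult power_add mult_left_le)
    qed
    have "norm (\<Sum>n. (1/4)^(n + Suc j) * e (n + Suc j)) \<le> (\<Sum>n. (1/4)^Suc j * (1/4)^n)"
      by (rule norm_suminf_le[OF b s])
    thus ?thesis by simp
  qed
  also have "(\<Sum>n. (1/4::real)^Suc j * (1/4)^n) = (1/4)^Suc j * (4/3)"
    using suminf_mult[OF g, of "(1/4)^Suc j"] suminf_geometric[of "1/4::real"] by simp
  finally have 1: "\<bar>\<Sum>n. (1/4)^(n + Suc j) * e (n + Suc j)\<bar> \<le> (1/4)^j / 3" by simp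
  have "\<bar>e j\<bar> = 1" using j(1) by (auto simp: e_def)
  then have "\<bar>(1/4)^j * e j\<bar> = (1/4)^j" by (simp add: abs_mult)
  then have "\<bar>(\<Sum>n. (1/4)^n * of_bool (a n)) - (\<Sum>n. (1/4)^n * of_bool (b n))\<bar> \<ge> (1/4)^j - (1/4::real)^j/3"
    using 1 unfolding eq by linarith
  also have "(1/4)^j - (1/4)^j/3 \<ge> (1/4::real)^Suc m"
  proof -
    have "(1/4::real)^Suc m \<le> (1/4)^Suc j" using ji by (intro power_decreasing) auto
    moreover have "(1/4::real)^Suc j \<le> (1/4)^j - (1/4)^j/3" by simp
    ultimately show ?thesis by linarith
  qed
  finally show False using close by linarith
qed

text \<open>Recording membership in the sets of a countable basis as digits encodes the points of a compact
  space as reals. The encoding has a continuous left inverse on the closure of its range, which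
  reduces weak compactness to Helly's theorem on the line.\<close>

lemma compact_real_encoding:
  fixes S :: "'a::{second_countable_topology,t2_space} set"
  assumes S: "compact S" and "S \<noteq> {}"
  obtains s :: "'a \<Rightarrow> real" and K :: "real set" and p :: "real \<Rightarrow> 'a"
  where "s \<in> borel_measurable borel" "K \<subseteq> {0..2}" "compact K" "continuous_on K p" "p ` K \<subseteq> S"
    "\<And>z. z \<in> S \<Longrightarrow> s z \<in> K" "\<And>z. z \<in> S \<Longrightarrow> p (s z) = z"
proof -
  obtain \<B> :: "'a set set" where B: "countable \<B>" "topological_basis \<B>" using ex_countable_basis by auto
  have Bne: "\<B> \<noteq> {}" using B(2) assms(2) by (metis empty_iff ex_in_conv open_UNIV topological_basisE UNIV_I)
  define E where "E n = from_nat_into \<B> n" for n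
  have E_open: "open (E n)" for n
    using B Bne from_nat_into[OF Bne] topological_basis_open unfolding E_def by blast
  have E_nbhd: "\<exists>n. x \<in> E n \<and> E n \<subseteq> U" if "open U" "x \<in> U" for x U
    using topological_basisE[OF B(2) that] from_nat_into_surj[OF B(1)] unfolding E_def by metis
  have sep: "\<exists>m n. x \<in> E m \<and> y \<in> E n \<and> E m \<inter> E n = {}" if "x \<noteq> y" for x y
  proof -
    obtain U V where "open U" "open V" "x \<in> U" "y \<in> V" "U \<inter> V = {}" using hausdorff[of x y] \<open>x \<noteq> y\<close> by auto
    then obtain m n where "x \<in> E m" "E m \<subseteq> U" "y \<in> E n" "E n \<subseteq> V" using E_nbhd by metis
    thus ?thesis using \<open>U \<inter> V = {}\<close> by blast
  qed
  define s where "s z = (\<Sum>n. (1/4::real)^n * of_bool (z \<in> E n))" for z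
  have g: "summable (\<lambda>n. (1/4::real)^n)" by (rule summable_geometric) simp
  have sa: "summable (\<lambda>n. (1/4::real)^n * of_bool (z \<in> E n))" for z
    by (rule summable_comparison_test'[OF g]) auto
  have s_meas: "s \<in> borel_measurable borel"
  proof -
    have [measurable]: "E n \<in> sets borel" for n using E_open by simp
    show ?thesis unfolding s_def by measurable
  qed
  have s01: "s z \<in> {0..2}" for z
  proof -
    have "s z \<le> (\<Sum>n. (1/4)^n)" unfolding s_def by (rule suminf_le[OF _ sa g]) simp
    also have "\<dots> \<le> 2" using suminf_geometric[of "1/4::real"] by simp
    finally show ?thesis using suminf_nonneg[OF sa, of z] by (simp add: s_def)
  qed
  have agree: "z \<in> E i \<longleftrightarrow> z' \<in> E i" if "\<bar>s z - s z'\<bar> < (1/4)^Suc m" "i \<le> m" for z z' i m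
    using agree_of_weighted_sum_close[of "\<lambda>n. z \<in> E n" "\<lambda>n. z' \<in> E n" m i] that by (simp add: s_def)
  define K where "K = closure (s ` S)"
  have K02: "K \<subseteq> {0..2}" unfolding K_def using s01 by (intro closure_minimal) auto
  have Kc: "compact K"
    using K02 bounded_subset[OF bounded_closed_interval] by (auto simp: K_def compact_eq_bounded_closed)
  \<comment> \<open>\<open>Q r z\<close> says that \<open>z\<close> is the point coded by
    \<open>r\<close>, also when \<open>r\<close> is only a limit of codes: every basic set around
    \<open>z\<close> captures all points whose code is close enough to \<open>r\<close>.\<close>
  define Q where "Q r z \<longleftrightarrow> z \<in> S \<and> (\<forall>n. z \<in> E n \<longrightarrow> (\<exists>\<delta>>0. \<forall>y\<in>S. \<bar>s y - r\<bar> < \<delta> \<longrightarrow> y \<in> E n))" for r z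
  have near: "\<exists>y\<in>S. \<bar>s y - r\<bar> < \<delta>" if "r \<in> K" "\<delta> > 0" for r \<delta>
    using that closure_approachable[of r "s ` S"] unfolding K_def dist_real_def by auto
  have Q_uniq: "z = z'" if rK: "r \<in> K" and Qz: "Q r z" and Qz': "Q r z'" for r z z'
  proof (rule ccontr)
    assume "z \<noteq> z'"
    then obtain m n where mn: "z \<in> E m" "z' \<in> E n" "E m \<inter> E n = {}" using sep by metis
    obtain d where d: "d > 0" "\<forall>y\<in>S. \<bar>s y - r\<bar> < d \<longrightarrow> y \<in> E m" using Qz mn(1) unfolding Q_def by blast
    obtain d' where d': "d' > 0" "\<forall>y\<in>S. \<bar>s y - r\<bar> < d' \<longrightarrow> y \<in> E n" using Qz' mn(2) unfolding Q_def by blast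
    obtain y where "y \<in> S" "\<bar>s y - r\<bar> < min d d'" using near[OF rK, of "min d d'"] d d' by auto
    thus False using d d' mn by auto
  qed
  have Q_ex: "\<exists>z. Q r z" if r: "r \<in> K" for r
  proof (rule ccontr)
    \<comment> \<open>Each \<open>z\<close> then has a basic neighbourhood that points with codes
      arbitrarily near \<open>r\<close> avoid. Finitely many of these cover \<open>S\<close>, and
      codes close enough to \<open>r\<close> agree on all their digits, so one of the covering sets
      must contain every such point.\<close>
    assume no: "\<nexists>z. Q r z"
    have "\<exists>n. z \<in> E n \<and> (\<forall>\<delta>>0. \<exists>y\<in>S. \<bar>s y - r\<bar> < \<delta> \<and> y \<notin> E n)" if "z \<in> S" for z
      using no that unfolding Q_def by metis
    then obtain n where n: "\<And>z. z \<in> S \<Longrightarrow> z \<in> E (n z)"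
      "\<And>z \<delta>. z \<in> S \<Longrightarrow> \<delta> > 0 \<Longrightarrow> \<exists>y\<in>S. \<bar>s y - r\<bar> < \<delta> \<and> y \<notin> E (n z)" by metis
    have "S \<subseteq> (\<Union>z\<in>S. E (n z))" using n(1) by blast
    then obtain D where D: "D \<subseteq> S" "finite D" "S \<subseteq> (\<Union>z\<in>D. E (n z))"
      using compactE_image[OF S, of S "\<lambda>z. E (n z)"] E_open by metis
    define m where "m = Max (n ` D)"
    have nm: "n z \<le> m" if "z \<in> D" for z using that D by (simp add: m_def)
    \<comment> \<open>Half the tolerance, because two codes near \<open>r\<close> are going to be
      compared with each other.\<close>
    obtain y0 where y0: "y0 \<in> S" "\<bar>s y0 - r\<bar> < (1/4)^Suc m / 2" using near[OF r, of "(1/4)^Suc m / 2"] by auto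
    then obtain z where z: "z \<in> D" "y0 \<in> E (n z)" using D by blast
    obtain y where y: "y \<in> S" "\<bar>s y - r\<bar> < (1/4)^Suc m / 2" "y \<notin> E (n z)"
      using n(2)[of z "(1/4)^Suc m / 2"] z D by auto
    have "\<bar>s y - s y0\<bar> < (1/4)^Suc m" using y y0 by linarith
    thus False using agree[of y y0 m "n z"] nm[OF z(1)] z y by blast
  qed
  define p where "p r = (SOME z. Q r z)" for r
  have pQ: "Q r (p r)" if "r \<in> K" for r using someI_ex[OF Q_ex[OF that]] by (simp add: p_def)
  have sK: "s z \<in> K" if "z \<in> S" for z using that closure_subset[of "s ` S"] by (auto simp: K_def)
  have ps: "p (s z) = z" if "z \<in> S" for z
  proof (rule Q_uniq[OF sK[OF that] pQ[OF sK[OF that]]])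
    have "\<exists>\<delta>>0. \<forall>y\<in>S. \<bar>s y - s z\<bar> < \<delta> \<longrightarrow> y \<in> E n" if "z \<in> E n" for n
      using agree[of _ z n n] that by (intro exI[of _ "(1/4)^Suc n"]) auto
    thus "Q (s z) z" using that by (simp add: Q_def)
  qed
  have "continuous_on K p"
    unfolding continuous_on_topological
  proof (intro ballI allI impI)
    fix r U assume r: "r \<in> K" and U: "open U" "p r \<in> U"
    \<comment> \<open>Every point outside \<open>U\<close> is separated from \<open>p r\<close> by
      disjoint basic sets, and finitely many pairs suffice by compactness. For \<open>r'\<close>
      near \<open>r\<close>, codes near \<open>r'\<close> are also near \<open>r\<close>, so
      \<open>p r'\<close> cannot lie on the far side of any pair.\<close>
    have "\<exists>m n. w \<in> E m \<and> p r \<in> E n \<and> E m \<inter> E n = {}" if "w \<in> S - U" for w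
      using sep[of w "p r"] that U by blast
    then obtain m n where mn: "\<And>w. w \<in> S - U \<Longrightarrow> w \<in> E (m w)" "\<And>w. w \<in> S - U \<Longrightarrow> p r \<in> E (n w)"
      "\<And>w. w \<in> S - U \<Longrightarrow> E (m w) \<inter> E (n w) = {}" by metis
    have "compact (S - U)" using S U by (simp add: compact_diff)
    moreover have "S - U \<subseteq> (\<Union>w\<in>S - U. E (m w))" using mn(1) by blast
    ultimately obtain D where D: "D \<subseteq> S - U" "finite D" "S - U \<subseteq> (\<Union>w\<in>D. E (m w))"
      using compactE_image[of "S - U" "S - U" "\<lambda>w. E (m w)"] E_open by metis
    have "\<exists>\<delta>>0. \<forall>y\<in>S. \<bar>s y - r\<bar> < \<delta> \<longrightarrow> y \<in> E (n w)" if "w \<in> D" for w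
      using pQ[OF r] mn(2) that D(1) unfolding Q_def by blast
    then obtain d where d: "\<And>w. w \<in> D \<Longrightarrow> d w > 0" "\<And>w y. w \<in> D \<Longrightarrow> y \<in> S \<Longrightarrow> \<bar>s y - r\<bar> < d w \<Longrightarrow> y \<in> E (n w)"
      by metis
    define \<delta> where "\<delta> = Min (insert 1 (d ` D))"
    have \<delta>: "\<delta> > 0" "\<And>w. w \<in> D \<Longrightarrow> \<delta> \<le> d w" using D(2) d(1) by (auto simp: \<delta>_def)
    show "\<exists>A. open A \<and> r \<in> A \<and> (\<forall>y\<in>K. y \<in> A \<longrightarrow> p y \<in> U)"
    proof (intro exI[of _ "ball r \<delta>"] conjI ballI impI)
      fix r' assume r': "r' \<in> K" "r' \<in> ball r \<delta>"
      show "p r' \<in> U"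
      proof (rule ccontr)
        assume "p r' \<notin> U"
        then have "p r' \<in> S - U" using pQ[OF r'(1)] unfolding Q_def by simp
        then obtain w where w: "w \<in> D" "p r' \<in> E (m w)" using D(3) by blast
        then obtain e where e: "e > 0" "\<And>y. y \<in> S \<Longrightarrow> \<bar>s y - r'\<bar> < e \<Longrightarrow> y \<in> E (m w)"
          using pQ[OF r'(1)] unfolding Q_def by blast
        have pos: "min e (\<delta> - \<bar>r - r'\<bar>) > 0" using e r' by (auto simp: dist_real_def)
        obtain y where y: "y \<in> S" "\<bar>s y - r'\<bar> < min e (\<delta> - \<bar>r - r'\<bar>)" using near[OF r'(1) pos] by auto
        have "y \<in> E (m w)" using e y by auto
        moreover have "\<bar>s y - r\<bar> < d w" using y \<delta>(2)[OF w(1)] by auto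
        then have "y \<in> E (n w)" using d(2)[OF w(1) y(1)] by simp
        ultimately show False using mn(3)[of w] w D(1) by blast
      qed
    qed (use \<delta> in auto)
  qed
  moreover have "p ` K \<subseteq> S" using pQ by (auto simp: Q_def)
  ultimately show thesis using that s_meas K02 Kc sK ps by metis
qed

text \<open>The image measures under the encoding live on a bounded interval, so Helly's theorem
  applies. The limit is carried by the compact set \<open>K\<close> and is brought back by the left
  inverse \<open>p\<close>.\<close>

theorem compact_prob_measures_subseq:
  fixes S :: "'a::{second_countable_topology,t2_space} set"
  assumes S: "compact S" and \<nu>: "\<And>k. prob_space (\<nu> k)" "\<And>k. sets (\<nu> k) = sets (restrict_space borel S)"
  obtains r :: "nat \<Rightarrow> nat" and N where "strict_mono r" "prob_space N" "sets N = sets (restrict_space borel S)"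
    "\<And>h::'a\<Rightarrow>real. continuous_on S h \<Longrightarrow> (\<lambda>k. integral\<^sup>L (\<nu> (r k)) h) \<longlonglongrightarrow> integral\<^sup>L N h"
proof -
  have sp: "space (\<nu> k) = S" for k
    using sets_eq_imp_space_eq[OF \<nu>(2)[of k]] by (simp add: space_restrict_space)
  have "S \<noteq> {}" using prob_space.not_empty[OF \<nu>(1)] sp by auto
  from compact_real_encoding[OF S this] obtain s :: "'a \<Rightarrow> real" and K p
    where s[measurable]: "s \<in> borel_measurable borel" and K: "K \<subseteq> {0..2}" "compact K"
     and p: "continuous_on K p" "p ` K \<subseteq> S" and sK: "\<And>z. z \<in> S \<Longrightarrow> s z \<in> K" and ps: "\<And>z. z \<in> S \<Longrightarrow> p (s z) = z"
    by metis
  obtain z0 where z0: "z0 \<in> S" using \<open>S \<noteq> {}\<close> by auto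
  have Kne: "K \<noteq> {}" using z0 sK by auto
  have Kcl: "closed K" using K compact_imp_closed by auto
  have [measurable]: "s \<in> borel_measurable (\<nu> k)" for k
    using measurable_restrict_space1[OF s, of S] \<nu>(2)[of k] by (simp cong: measurable_cong_sets)
  define \<rho> where "\<rho> k = distr (\<nu> k) borel s" for k
  interpret \<nu>: prob_space "\<nu> k" for k by fact
  have \<rho>rd: "real_distribution (\<rho> k)" for k
    unfolding \<rho>_def by (simp add: \<nu>.real_distribution_distr)
  have "tight \<rho>"
    unfolding tight_def
  proof (intro conjI allI impI)
    fix e :: real assume "e > 0"
    \<comment> \<open>Codes lie in [0, 2]; the left end is moved to -1 because tightness is
      formulated with intervals open on the left.\<close>
    have "measure (\<rho> n) {-1<..2} = 1" for n
    proof -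
      have "s -` {-1<..2} \<inter> space (\<nu> n) = space (\<nu> n)" using sK K by (force simp: sp)
      thus ?thesis by (simp add: \<rho>_def measure_distr \<nu>.prob_space)
    qed
    thus "\<exists>a b. a < b \<and> (\<forall>n. 1 - e < measure (\<rho> n) {a<..b})" using \<open>e > 0\<close>
      by (intro exI[of _ "-1"] exI[of _ 2]) auto
  qed (rule \<rho>rd)
  then obtain r M where r: "strict_mono r" and M: "real_distribution M" "weak_conv_m (\<rho> \<circ> id \<circ> r) M"
    using tight_imp_convergent_subsubsequence[of \<rho> id] strict_mono_id by (auto simp: id_def)
  interpret M: real_distribution M by fact
  have wc: "(\<lambda>k. integral\<^sup>L (\<rho> (r k)) f) \<longlonglongrightarrow> integral\<^sup>L M f"
    if "continuous_on UNIV f" "\<And>x. norm (f x) \<le> B" for f :: "real \<Rightarrow> real" and B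
  proof -
    have "\<And>n. real_distribution ((\<rho> \<circ> id \<circ> r) n)" using \<rho>rd by simp
    from weak_conv_imp_integral_bdd_continuous_conv[OF this M(1) M(2), of f B] that show ?thesis
      by (simp add: continuous_on_eq_continuous_at)
  qed
  have int\<rho>: "integral\<^sup>L (\<rho> k) f = (LINT z|\<nu> k. f (s z))" if "f \<in> borel_measurable borel" for k and f :: "real \<Rightarrow> real"
    using that by (simp add: \<rho>_def integral_distr)
  have AEK: "AE x in M. x \<in> K"
  proof -
    \<comment> \<open>A bounded continuous function vanishing exactly on \<open>K\<close>: its
      integrals along the sequence are 0, hence so is the limit, and the limit measure is carried by
      \<open>K\<close>.\<close>
    define f where "f x = min 1 (infdist x K)" for x
    have fc: "continuous_on UNIV f" unfolding f_def by (intro continuous_intros)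
    have fb: "norm (f x) \<le> 1" for x by (simp add: f_def infdist_nonneg)
    have fm[measurable]: "f \<in> borel_measurable borel" using fc by (rule borel_measurable_continuous_onI)
    have "integral\<^sup>L (\<rho> k) f = 0" for k
      unfolding int\<rho>[OF fm] using sK
      by (intro integral_eq_zero_AE AE_I2) (simp add: sp f_def)
    then have "(\<lambda>k. 0) \<longlonglongrightarrow> integral\<^sup>L M f" using wc[OF fc fb] by simp
    then have "integral\<^sup>L M f = 0" using LIMSEQ_unique[OF tendsto_const] by metis
    moreover have "integrable M f" by (intro M.integrable_const_bound[of _ 1] AE_I2 fb) simp
    ultimately have "AE x in M. f x = 0"
      by (subst (asm) integral_nonneg_eq_0_iff_AE) (auto simp: f_def infdist_nonneg)
    then show ?thesis
    proof eventually_elim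
      case (elim x)
      then have "infdist x K = 0" by (auto simp: f_def min_def split: if_splits)
      thus ?case using in_closed_iff_infdist_zero[OF Kcl Kne] by simp
    qed
  qed
  \<comment> \<open>The value \<open>z0\<close> off \<open>K\<close> only makes the map total; the
    limit measure gives no mass there.\<close>
  define p' where "p' x = (if x \<in> K then p x else z0)" for x
  have p'b: "p' \<in> borel_measurable borel" unfolding p'_def
    using Kcl p(1) by (intro borel_measurable_continuous_on_if) auto
  have p'S: "p' x \<in> S" for x using p(2) z0 by (auto simp: p'_def)
  have p'm[measurable]: "p' \<in> measurable M (restrict_space borel S)"
    using p'b p'S by (intro measurable_restrict_space2) auto
  define N where "N = distr M (restrict_space borel S) p'"
  show thesis
  proof (rule that[OF r])
    show "prob_space N" unfolding N_def by (rule M.prob_space_distr) simp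
    show sN: "sets N = sets (restrict_space borel S)" by (simp add: N_def)
    fix h :: "'a \<Rightarrow> real" assume h: "continuous_on S h"
    obtain B where B: "\<And>x. x \<in> S \<Longrightarrow> norm (h x) \<le> B"
      using compact_continuous_image[OF h S] compact_imp_bounded bounded_iff by (metis imageI)
    have B0: "0 \<le> B" using B[OF z0] norm_ge_zero order_trans by blast
    have hp: "continuous_on K (\<lambda>x. h (p x))"
      using continuous_on_compose2[OF h p(1) p(2)] .
    \<comment> \<open>The encoding \<open>s\<close> is merely Borel, so \<open>h\<close> cannot be
      pulled back directly. Tietze extends \<open>h \<circ> p\<close> from \<open>K\<close> to a
      bounded continuous \<open>g\<close> on the line, and \<open>g (s z) = h z\<close> on
      \<open>S\<close>.\<close>
    obtain g where g: "continuous_on UNIV g" "\<And>x. x \<in> K \<Longrightarrow> g x = h (p x)" "\<And>x. norm (g x) \<le> B"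
    proof -
      have "closedin (top_of_set UNIV) K" using Kcl by simp
      moreover have "norm (h (p x)) \<le> B" if "x \<in> K" for x using B p(2) that by auto
      ultimately show thesis using Tietze[OF hp _ B0, of UNIV] that by (metis UNIV_I)
    qed
    have gm[measurable]: "g \<in> borel_measurable borel" using g(1) by (rule borel_measurable_continuous_onI)
    have hm: "h \<in> borel_measurable (restrict_space borel S)" by (rule borel_measurable_continuous_on_restrict[OF h])
    have "integral\<^sup>L N h = (LINT x|M. h (p' x))" unfolding N_def by (rule integral_distr[OF p'm hm])
    also have "\<dots> = integral\<^sup>L M g"
      using AEK by (intro integral_cong_AE measurable_compose[OF p'm hm]) (auto simp: p'_def g elim!: eventually_mono)
    finally have 1: "integral\<^sup>L N h = integral\<^sup>L M g" .
    have 2: "integral\<^sup>L (\<rho> k) g = integral\<^sup>L (\<nu> k) h" for k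
      unfolding int\<rho>[OF gm] by (intro Bochner_Integration.integral_cong) (auto simp: sp g sK ps)
    show "(\<lambda>k. integral\<^sup>L (\<nu> (r k)) h) \<longlonglongrightarrow> integral\<^sup>L N h"
      using wc[OF g(1,3)] unfolding 1 2 .
  qed
qed

section \<open>Continuous convergence\<close>

text \<open>Convergence along moving points: stable under composition, equal to continuity for a
  constant sequence, and uniform convergence when \<open>S\<close> is compact and the limit
  continuous. The subsequence \<open>r\<close> is built in because compactness arguments choose the
  points along subsequences only.\<close>

definition continuously_convergent ::
  "'z::topological_space set \<Rightarrow> (nat \<Rightarrow> 'z \<Rightarrow> 'y::topological_space) \<Rightarrow> ('z \<Rightarrow> 'y) \<Rightarrow> bool" where
  "continuously_convergent S q p \<longleftrightarrow> (\<forall>r z z0. strict_mono r \<longrightarrow> (\<forall>j. z j \<in> S) \<longrightarrow> z0 \<in> S \<longrightarrow>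
     z \<longlonglongrightarrow> z0 \<longrightarrow> (\<lambda>j. q (r j) (z j)) \<longlonglongrightarrow> p z0)"

lemma continuously_convergentD:
  assumes "continuously_convergent S q p" "strict_mono r" "\<And>j. z j \<in> S" "z0 \<in> S" "z \<longlonglongrightarrow> z0"
  shows "(\<lambda>j. q (r j) (z j)) \<longlonglongrightarrow> p z0"
  using assms unfolding continuously_convergent_def by blast

lemma continuously_convergent_subseq:
  assumes "continuously_convergent S q p" "strict_mono (s :: nat \<Rightarrow> nat)"
  shows "continuously_convergent S (\<lambda>k. q (s k)) p"
  unfolding continuously_convergent_def
proof (intro allI impI)
  fix r :: "nat \<Rightarrow> nat" and z z0
  assume "strict_mono r" "\<forall>j. z j \<in> S" "z0 \<in> S" "z \<longlonglongrightarrow> z0"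
  then show "(\<lambda>j. q (s (r j)) (z j)) \<longlonglongrightarrow> p z0"
    using continuously_convergentD[OF assms(1), of "s \<circ> r" z z0] strict_mono_o[OF assms(2), of r] by (simp add: comp_def)
qed

lemma continuously_convergent_const_iff:
  fixes p :: "'z::{first_countable_topology,t2_space} \<Rightarrow> 'y::topological_space"
  shows "continuously_convergent S (\<lambda>_. p) p \<longleftrightarrow> continuous_on S p"
  unfolding continuously_convergent_def continuous_on_sequentially comp_def
  using strict_mono_id by blast

lemmas continuously_convergent_const = continuously_convergent_const_iff[THEN iffD2]

lemma continuously_convergent_compose:
  assumes "continuously_convergent S q p" "continuously_convergent S' q' p'"
    and "\<And>k z. z \<in> S \<Longrightarrow> q k z \<in> S'" "\<And>z. z \<in> S \<Longrightarrow> p z \<in> S'"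
  shows "continuously_convergent S (\<lambda>k z. q' k (q k z)) (\<lambda>z. p' (p z))"
  unfolding continuously_convergent_def
proof (intro allI impI)
  fix r :: "nat \<Rightarrow> nat" and z z0
  assume *: "strict_mono r" "\<forall>j. z j \<in> S" "z0 \<in> S" "z \<longlonglongrightarrow> z0"
  have "(\<lambda>j. q (r j) (z j)) \<longlonglongrightarrow> p z0" by (rule continuously_convergentD[OF assms(1)]) (use * in auto)
  then show "(\<lambda>j. q' (r j) (q (r j) (z j))) \<longlonglongrightarrow> p' (p z0)"
    by (intro continuously_convergentD[OF assms(2)]) (use * assms(3,4) in auto)
qed

text \<open>Points violating the bound for infinitely many \<open>k\<close> accumulate at some
  \<open>z0\<close>, where both \<open>q\<close> and \<open>p\<close> along them tend to
  \<open>p z0\<close>.\<close>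

lemma continuously_convergent_uniform:
  fixes q :: "nat \<Rightarrow> 'z::{first_countable_topology,t2_space} \<Rightarrow> real"
  assumes S: "compact S" and q: "continuously_convergent S q p" and p: "continuous_on S p" and e: "e > 0"
  shows "\<forall>\<^sub>F k in sequentially. \<forall>z\<in>S. \<bar>q k z - p z\<bar> < e"
proof (rule ccontr)
  assume "\<not> ?thesis"
  then have "\<forall>n. \<exists>k>n. \<exists>z\<in>S. \<bar>q k z - p z\<bar> \<ge> e"
    unfolding eventually_sequentially by (metis Suc_le_lessD not_less)
  then have "\<exists>r::nat\<Rightarrow>nat. strict_mono r \<and> (\<forall>j. \<exists>z\<in>S. \<bar>q (r j) z - p z\<bar> \<ge> e)"
  proof -
    assume *: "\<forall>n. \<exists>k>n. \<exists>z\<in>S. \<bar>q k z - p z\<bar> \<ge> e"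
    have "infinite {k. \<exists>z\<in>S. \<bar>q k z - p z\<bar> \<ge> e}"
      unfolding infinite_nat_iff_unbounded using * by auto
    then obtain r :: "nat \<Rightarrow> nat" where "strict_mono r" "\<forall>n. r n \<in> {k. \<exists>z\<in>S. \<bar>q k z - p z\<bar> \<ge> e}"
      using infinite_enumerate by blast
    thus ?thesis by blast
  qed
  then obtain r :: "nat \<Rightarrow> nat" and z where r: "strict_mono r" and z: "\<And>j. z j \<in> S" "\<And>j. \<bar>q (r j) (z j) - p (z j)\<bar> \<ge> e"
    by metis
  obtain z0 s where s: "z0 \<in> S" "strict_mono (s::nat\<Rightarrow>nat)" "(z \<circ> s) \<longlonglongrightarrow> z0"
    using compact_imp_seq_compact[OF S] z(1) unfolding seq_compact_def by metis
  have "(\<lambda>j. q ((r \<circ> s) j) ((z \<circ> s) j)) \<longlonglongrightarrow> p z0"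
    by (rule continuously_convergentD[OF q strict_mono_o[OF r s(2)] _ s(1,3)]) (use z in simp)
  moreover have "(\<lambda>j. p ((z \<circ> s) j)) \<longlonglongrightarrow> p z0"
    using p s z(1) unfolding continuous_on_sequentially comp_def by auto
  ultimately have "(\<lambda>j. q ((r \<circ> s) j) ((z \<circ> s) j) - p ((z \<circ> s) j)) \<longlonglongrightarrow> 0"
    using tendsto_diff by fastforce
  then have "\<forall>\<^sub>F j in sequentially. \<bar>q ((r \<circ> s) j) ((z \<circ> s) j) - p ((z \<circ> s) j)\<bar> < e"
    using e by (auto dest!: tendstoD simp: dist_real_def)
  then show False using z(2) by (auto simp: eventually_sequentially) (meson not_less order_refl)
qed

text \<open>Dominated convergence along each moving sequence. The exceptional set in
  \<open>cc\<close> is chosen before the points \<open>z\<close>, which is why one null set serves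
  all sequences.\<close>

lemma continuously_convergent_integral:
  fixes P :: "nat \<Rightarrow> 't \<Rightarrow> 'z::topological_space \<Rightarrow> real"
  assumes cc: "AE t in T. continuously_convergent S (\<lambda>k. P k t) (P' t)"
    and m: "\<And>k z. z \<in> S \<Longrightarrow> (\<lambda>t. P k t z) \<in> borel_measurable T"
    and m': "\<And>z. z \<in> S \<Longrightarrow> (\<lambda>t. P' t z) \<in> borel_measurable T"
    and b: "\<And>k z. z \<in> S \<Longrightarrow> AE t in T. \<bar>P k t z\<bar> \<le> G t" and G: "integrable T G"
  shows "continuously_convergent S (\<lambda>k z. LINT t|T. P k t z) (\<lambda>z. LINT t|T. P' t z)"
  unfolding continuously_convergent_def
proof (intro allI impI)
  fix r :: "nat \<Rightarrow> nat" and z z0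
  assume *: "strict_mono r" "\<forall>j. z j \<in> S" "z0 \<in> S" "z \<longlonglongrightarrow> z0"
  show "(\<lambda>j. LINT t|T. P (r j) t (z j)) \<longlonglongrightarrow> (LINT t|T. P' t z0)"
  proof (rule integral_dominated_convergence[OF m'[OF *(3)] _ G])
    show "(\<lambda>t. P (r j) t (z j)) \<in> borel_measurable T" for j using m * by auto
    show "AE t in T. (\<lambda>j. P (r j) t (z j)) \<longlonglongrightarrow> P' t z0"
      using cc by eventually_elim (rule continuously_convergentD, use * in auto)
    show "AE t in T. norm (P (r j) t (z j)) \<le> G t" for j using b[of "z j" "r j"] * by simp
  qed
qed

text \<open>Integrand and measure vary together: the integrand error is uniformly small and the
  measures have mass one, so what remains is weak convergence tested on the fixed function
  \<open>p\<close>.\<close>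

lemma integral_continuously_convergent:
  fixes q :: "nat \<Rightarrow> 'z::{second_countable_topology,t2_space} \<Rightarrow> real"
  assumes S: "compact S" and q: "continuously_convergent S q p" and p: "continuous_on S p"
    and \<nu>: "\<And>k. prob_space (\<nu> k)" "\<And>k. sets (\<nu> k) = sets (restrict_space borel S)"
    and N: "\<And>h::'z\<Rightarrow>real. continuous_on S h \<Longrightarrow> (\<lambda>k. integral\<^sup>L (\<nu> k) h) \<longlonglongrightarrow> integral\<^sup>L N h"
    and m: "\<And>k. q k \<in> borel_measurable (restrict_space borel S)"
  shows "(\<lambda>k. integral\<^sup>L (\<nu> k) (q k)) \<longlonglongrightarrow> integral\<^sup>L N p"
proof -
  have "(\<lambda>k. integral\<^sup>L (\<nu> k) (q k) - integral\<^sup>L (\<nu> k) p) \<longlonglongrightarrow> 0"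
  proof (rule tendstoI)
    fix e :: real assume e: "e > 0"
    have "\<forall>\<^sub>F k in sequentially. \<forall>z\<in>S. \<bar>q k z - p z\<bar> < e/2"
      using continuously_convergent_uniform[OF S q p, of "e/2"] e by simp
    then show "\<forall>\<^sub>F k in sequentially. dist (integral\<^sup>L (\<nu> k) (q k) - integral\<^sup>L (\<nu> k) p) 0 < e"
    proof eventually_elim
      case (elim k)
      interpret prob_space "\<nu> k" by fact
      have sp: "space (\<nu> k) = S" using sets_eq_imp_space_eq[OF \<nu>(2)[of k]] by (simp add: space_restrict_space)
      have ip: "integrable (\<nu> k) p" by (rule borel_on_integrable_continuous(1)[OF S p \<nu>])
      have [measurable]: "p \<in> borel_measurable (\<nu> k)" using ip by simp
      have [measurable]: "q k \<in> borel_measurable (\<nu> k)" using m[of k] \<nu>(2) by (simp cong: measurable_cong_sets)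
      have id: "integrable (\<nu> k) (\<lambda>z. q k z - p z)"
        by (rule integrable_const_bound[of _ "e/2"]) (use elim in \<open>auto simp: sp intro!: AE_I2 less_imp_le\<close>)
      have iq: "integrable (\<nu> k) (q k)" using Bochner_Integration.integrable_add[OF id ip] by simp
      have "\<bar>integral\<^sup>L (\<nu> k) (\<lambda>z. q k z - p z)\<bar> \<le> integral\<^sup>L (\<nu> k) (\<lambda>z. \<bar>q k z - p z\<bar>)"
        by (rule integral_abs_bound)
      also have "\<dots> \<le> integral\<^sup>L (\<nu> k) (\<lambda>_. e/2)"
        by (rule integral_mono) (use elim id in \<open>auto simp: sp intro: less_imp_le\<close>)
      also have "\<dots> < e" using e by (simp add: prob_space)
      finally show ?case using Bochner_Integration.integral_diff[OF iq ip] by (simp add: dist_real_def)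
    qed
  qed
  from tendsto_add[OF this N[OF p]] show ?thesis by simp
qed

section \<open>Random dynamics\<close>

text \<open>The map is indexed by a single letter of the noise instead of a shifted sequence as in
  \<open>rand_iter\<close>; the two agree almost surely once a random map is given by a
  representative.\<close>

primrec iter :: "('t \<Rightarrow> 'z \<Rightarrow> 'z) \<Rightarrow> nat \<Rightarrow> (nat \<Rightarrow> 't) \<Rightarrow> 'z \<Rightarrow> 'z" where
  "iter \<Phi> 0 \<omega> z = z"
| "iter \<Phi> (Suc n) \<omega> z = \<Phi> (\<omega> n) (iter \<Phi> n \<omega> z)"

lemma iter_cong: "(\<And>i. i < n \<Longrightarrow> \<omega> i = \<omega>' i) \<Longrightarrow> iter \<Phi> n \<omega> z = iter \<Phi> n \<omega>' z"
  by (induction n) auto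

lemma iter_add: "iter \<Phi> (n + m) \<omega> z = iter \<Phi> m (\<lambda>k. \<omega> (n + k)) (iter \<Phi> n \<omega> z)"
  by (induction m) auto

definition random_map :: "'t measure \<Rightarrow> 'z::topological_space set \<Rightarrow> ('t \<Rightarrow> 'z \<Rightarrow> 'z) \<Rightarrow> bool" where
  "random_map T S \<Phi> \<longleftrightarrow> (\<lambda>(t, z). \<Phi> t z) \<in> measurable (T \<Otimes>\<^sub>M restrict_space borel S) (restrict_space borel S)"

lemma random_map_measurable:
  assumes "random_map T S \<Phi>" "f \<in> measurable M T" "g \<in> measurable M (restrict_space borel S)"
  shows "(\<lambda>x. \<Phi> (f x) (g x)) \<in> measurable M (restrict_space borel S)"
  using measurable_compose[OF measurable_Pair[OF assms(2,3)] assms(1)[unfolded random_map_def]] by simp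

lemma random_map_in: "random_map T S \<Phi> \<Longrightarrow> t \<in> space T \<Longrightarrow> z \<in> S \<Longrightarrow> \<Phi> t z \<in> S"
  unfolding random_map_def
  by (drule measurable_space[of _ _ _ "(t, z)"]) (auto simp: space_pair_measure space_restrict_space)

lemma noise_component: "\<omega> \<in> space (noise T) \<Longrightarrow> \<omega> n \<in> space T"
  by (auto simp: space_PiM)

lemma iter_in: "random_map T S \<Phi> \<Longrightarrow> \<omega> \<in> space (noise T) \<Longrightarrow> z \<in> S \<Longrightarrow> iter \<Phi> n \<omega> z \<in> S"
  by (induction n) (auto intro: random_map_in noise_component)

lemma measurable_noise_shift: "(\<lambda>\<omega> k. \<omega> (n + k)) \<in> measurable (noise T) (noise T)"
  by (rule measurable_PiM_single') (auto simp: space_PiM)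

lemma shift_in_space: "\<omega> \<in> space (noise T) \<Longrightarrow> (\<lambda>k. \<omega> (n + k)) \<in> space (noise T)"
  by (auto simp: space_PiM)

lemma iter_measurable:
  assumes "random_map T S \<Phi>"
  shows "(\<lambda>(\<omega>, z). iter \<Phi> n \<omega> z) \<in> measurable (noise T \<Otimes>\<^sub>M restrict_space borel S) (restrict_space borel S)"
proof (induction n)
  case 0
  show ?case by simp
next
  case (Suc n)
  have "(\<lambda>x. \<Phi> (fst x n) (iter \<Phi> n (fst x) (snd x))) \<in> measurable (noise T \<Otimes>\<^sub>M restrict_space borel S) (restrict_space borel S)"
  proof (rule random_map_measurable[OF assms])
    show "(\<lambda>x. fst x n) \<in> measurable (noise T \<Otimes>\<^sub>M restrict_space borel S) T"
      by (rule measurable_compose[OF measurable_fst measurable_component_singleton]) simp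
  qed (use Suc in \<open>simp add: case_prod_beta'\<close>)
  thus ?case by (simp add: case_prod_beta')
qed

lemma iter_measurable':
  assumes "random_map T S \<Phi>" "f \<in> measurable M (noise T)" "g \<in> measurable M (restrict_space borel S)"
  shows "(\<lambda>x. iter \<Phi> n (f x) (g x)) \<in> measurable M (restrict_space borel S)"
  using measurable_compose[OF measurable_Pair[OF assms(2,3)] iter_measurable[OF assms(1), of n]] by simp

section \<open>Independence of past and future noise\<close>

lemma prob_space_noise: "prob_space T \<Longrightarrow> prob_space (noise T)"
  by (rule prob_space_PiM)

lemma distr_noise_component: "prob_space T \<Longrightarrow> distr (noise T) T (\<lambda>\<omega>. \<omega> n) = T"
  using distr_PiM_component[of UNIV "\<lambda>_. T" n] by simp

lemma integral_noise_component:
  assumes "prob_space T" "f \<in> borel_measurable T"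
  shows "(LINT \<omega>|noise T. f (\<omega> n)) = (LINT t|T. (f t :: real))"
  using integral_distr[of "\<lambda>\<omega>. \<omega> n" "noise T" T f] assms distr_noise_component[OF assms(1), of n] by simp

lemma integrable_noise_component:
  assumes "prob_space T" "integrable T (f :: _ \<Rightarrow> real)"
  shows "integrable (noise T) (\<lambda>\<omega>. f (\<omega> n))"
  using integrable_distr_eq[of "\<lambda>\<omega>. \<omega> n" "noise T" T f] assms distr_noise_component[OF assms(1), of n] by simp

lemma AE_noise_component:
  assumes "prob_space T" "AE t in T. P t"
  shows "AE \<omega> in noise T. \<forall>n. P (\<omega> n)"
  unfolding AE_all_countable
proof
  fix n
  show "AE \<omega> in noise T. P (\<omega> n)"
  proof (rule AE_distrD[where f="\<lambda>\<omega>. \<omega> n" and M'=T])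
    show "(\<lambda>\<omega>. \<omega> n) \<in> measurable (noise T) T" by simp
    show "AE t in distr (noise T) T (\<lambda>\<omega>. \<omega> n). P t" using assms(2) by (simp only: distr_noise_component[OF assms(1)])
  qed
qed

text \<open>The first \<open>n\<close> letters and the sequence from time \<open>n\<close> on are
  independent and the latter is again distributed as the noise: splicing two independent copies at
  \<open>n\<close> reproduces the law.\<close>

lemma noise_split:
  assumes "prob_space T"
  shows "distr (noise T \<Otimes>\<^sub>M noise T) (noise T) (\<lambda>(\<omega>, \<omega>'). comb_seq n \<omega> \<omega>') = noise T"
proof -
  interpret prob_space T by fact
  interpret product_prob_space "\<lambda>_. T" "UNIV :: nat set" by unfold_locales
  interpret sequence_space T ..
  show ?thesis by (rule PiM_comb_seq)
qed

lemma integrable_snd_prob: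
  assumes "prob_space A" "sigma_finite_measure B" "integrable B (K :: _ \<Rightarrow> real)"
  shows "integrable (A \<Otimes>\<^sub>M B) (\<lambda>p. K (snd p))"
proof -
  interpret A: prob_space A by fact
  interpret B: sigma_finite_measure B by fact
  interpret pair_sigma_finite A B ..
  show ?thesis
    using assms(3) by (intro Fubini_integrable) (auto intro: measurable_compose[OF measurable_snd])
qed

text \<open>\<open>iter \<Phi> n\<close> reads the letters before \<open>n\<close> and
  \<open>H\<close> those from \<open>n\<close> on. After the splitting they read different factors
  of a product, and Fubini, dominated by \<open>K\<close>, finishes.\<close>

lemma integral_noise_independent:
  fixes H :: "(nat \<Rightarrow> 't) \<Rightarrow> 'z::topological_space \<Rightarrow> real"
  assumes T: "prob_space T" and \<Phi>: "random_map T S \<Phi>" and z: "z \<in> S"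
    and H: "(\<lambda>(\<omega>, y). H \<omega> y) \<in> borel_measurable (noise T \<Otimes>\<^sub>M restrict_space borel S)"
    and b: "\<And>\<omega> y. \<omega> \<in> space (noise T) \<Longrightarrow> y \<in> S \<Longrightarrow> \<bar>H \<omega> y\<bar> \<le> K \<omega>" and K: "integrable (noise T) K"
  shows "(LINT \<omega>|noise T. H (\<lambda>k. \<omega> (n + k)) (iter \<Phi> n \<omega> z)) =
    (LINT \<omega>|noise T. LINT \<omega>'|noise T. H \<omega>' (iter \<Phi> n \<omega> z))"
proof -
  interpret N: prob_space "noise T" by (rule prob_space_noise[OF T])
  interpret NN: pair_prob_space "noise T" "noise T" ..
  let ?g = "\<lambda>\<omega>. H (\<lambda>k. \<omega> (n + k)) (iter \<Phi> n \<omega> z)"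
  have zc: "(\<lambda>_. z) \<in> measurable M (restrict_space borel S)" for M :: "'b measure"
    using z by (simp add: space_restrict_space)
  have H': "(\<lambda>x. H (f x) (g x)) \<in> borel_measurable M" if "f \<in> measurable M (noise T)" "g \<in> measurable M (restrict_space borel S)"
    for f g and M :: "'b measure"
    using measurable_compose[OF measurable_Pair[OF that] H] by simp
  have gm: "?g \<in> borel_measurable (noise T)"
    using z by (intro H' measurable_noise_shift iter_measurable'[OF \<Phi>]) (auto simp: space_restrict_space)
  have cm: "(\<lambda>(\<omega>, \<omega>'). comb_seq n \<omega> \<omega>') \<in> measurable (noise T \<Otimes>\<^sub>M noise T) (noise T)"
    by (rule measurable_comb_seq)
  have "integral\<^sup>L (noise T) ?g = integral\<^sup>L (distr (noise T \<Otimes>\<^sub>M noise T) (noise T) (\<lambda>(\<omega>, \<omega>'). comb_seq n \<omega> \<omega>')) ?g"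
    by (simp add: noise_split[OF T])
  also have "\<dots> = (LINT p|(noise T \<Otimes>\<^sub>M noise T). ?g (case p of (\<omega>, \<omega>') \<Rightarrow> comb_seq n \<omega> \<omega>'))"
    by (rule integral_distr[OF cm gm])
  also have "\<dots> = (LINT p|(noise T \<Otimes>\<^sub>M noise T). (case p of (\<omega>, \<omega>') \<Rightarrow> H \<omega>' (iter \<Phi> n \<omega> z)))"
  proof (rule Bochner_Integration.integral_cong[OF refl])
    fix p :: "(nat \<Rightarrow> 't) \<times> (nat \<Rightarrow> 't)"
    obtain \<omega> \<omega>' where p: "p = (\<omega>, \<omega>')" by fastforce
    have "(\<lambda>k. comb_seq n \<omega> \<omega>' (n + k)) = \<omega>'" by (auto simp: comb_seq_def)
    moreover have "iter \<Phi> n (comb_seq n \<omega> \<omega>') z = iter \<Phi> n \<omega> z"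
      by (rule iter_cong) (simp add: comb_seq_def)
    ultimately show "?g (case p of (\<omega>, \<omega>') \<Rightarrow> comb_seq n \<omega> \<omega>') = (case p of (\<omega>, \<omega>') \<Rightarrow> H \<omega>' (iter \<Phi> n \<omega> z))"
      by (simp add: p)
  qed
  also have "\<dots> = (LINT \<omega>|noise T. LINT \<omega>'|noise T. H \<omega>' (iter \<Phi> n \<omega> z))"
  proof (rule NN.integral_fst[symmetric])
    show "integrable (noise T \<Otimes>\<^sub>M noise T) (\<lambda>(\<omega>, \<omega>'). H \<omega>' (iter \<Phi> n \<omega> z))"
    proof (rule Bochner_Integration.integrable_bound[OF integrable_snd_prob[OF N.prob_space_axioms N.sigma_finite_measure_axioms K]])
      show "(\<lambda>(\<omega>, \<omega>'). H \<omega>' (iter \<Phi> n \<omega> z)) \<in> borel_measurable (noise T \<Otimes>\<^sub>M noise T)"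
        unfolding case_prod_beta'
        using z by (intro H' iter_measurable'[OF \<Phi>]) (auto simp: space_restrict_space)
      show "AE p in noise T \<Otimes>\<^sub>M noise T. norm (case p of (\<omega>, \<omega>') \<Rightarrow> H \<omega>' (iter \<Phi> n \<omega> z)) \<le> norm (K (snd p))"
      proof (intro AE_I2)
        fix p assume "p \<in> space (noise T \<Otimes>\<^sub>M noise T)"
        then have "fst p \<in> space (noise T)" "snd p \<in> space (noise T)" by (auto simp: space_pair_measure)
        from b[OF this(2) iter_in[OF \<Phi> this(1) z, of n]]
        show "norm (case p of (\<omega>, \<omega>') \<Rightarrow> H \<omega>' (iter \<Phi> n \<omega> z)) \<le> norm (K (snd p))"
          by (simp add: case_prod_beta')
      qed
    qed
  qed
  finally show ?thesis .
qed

text \<open>The Markov property for one step: the letter at time \<open>n\<close> is independent of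
  the position reached at time \<open>n\<close>.\<close>

lemma integral_noise_step:
  fixes H :: "'t \<Rightarrow> 'z::topological_space \<Rightarrow> real"
  assumes T: "prob_space T" and \<Phi>: "random_map T S \<Phi>" and z: "z \<in> S"
    and H: "(\<lambda>(t, y). H t y) \<in> borel_measurable (T \<Otimes>\<^sub>M restrict_space borel S)"
    and b: "\<And>t y. t \<in> space T \<Longrightarrow> y \<in> S \<Longrightarrow> \<bar>H t y\<bar> \<le> K t" and K: "integrable T K"
  shows "(LINT \<omega>|noise T. H (\<omega> n) (iter \<Phi> n \<omega> z)) = (LINT \<omega>|noise T. LINT t|T. H t (iter \<Phi> n \<omega> z))"
proof -
  have "(LINT \<omega>|noise T. H (\<omega> (n + 0)) (iter \<Phi> n \<omega> z)) = (LINT \<omega>|noise T. LINT \<omega>'|noise T. H (\<omega>' 0) (iter \<Phi> n \<omega> z))"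
  proof (rule integral_noise_independent[OF T \<Phi> z, where H="\<lambda>\<omega> y. H (\<omega> 0) y"])
    have "(\<lambda>p. case (fst p 0, snd p) of (t, y) \<Rightarrow> H t y) \<in> borel_measurable (noise T \<Otimes>\<^sub>M restrict_space borel S)"
      by (rule measurable_compose[OF measurable_Pair H]) (auto intro: measurable_compose[OF measurable_fst])
    thus "(\<lambda>(\<omega>, y). H (\<omega> 0) y) \<in> borel_measurable (noise T \<Otimes>\<^sub>M restrict_space borel S)"
      by (simp add: case_prod_beta')
    show "integrable (noise T) (\<lambda>\<omega>. K (\<omega> 0))" by (rule integrable_noise_component[OF T K])
  qed (use b noise_component in blast)
  also have "\<dots> = (LINT \<omega>|noise T. LINT t|T. H t (iter \<Phi> n \<omega> z))"
  proof (rule Bochner_Integration.integral_cong[OF refl])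
    fix \<omega> assume "\<omega> \<in> space (noise T)"
    then have y: "iter \<Phi> n \<omega> z \<in> S" using iter_in[OF \<Phi> _ z] by simp
    have "(\<lambda>t. H t (iter \<Phi> n \<omega> z)) \<in> borel_measurable T"
      using measurable_compose[OF measurable_Pair[OF measurable_ident measurable_const] H] y
      by (simp add: space_restrict_space)
    from integral_noise_component[OF T this]
    show "(LINT \<omega>'|noise T. H (\<omega>' 0) (iter \<Phi> n \<omega> z)) = (LINT t|T. H t (iter \<Phi> n \<omega> z))" .
  qed
  finally show ?thesis by simp
qed

lemma integral_over_noise_measurable:
  fixes H :: "'t \<Rightarrow> 'z \<Rightarrow> real"
  assumes "prob_space T" "(\<lambda>(t, y). H t y) \<in> borel_measurable (T \<Otimes>\<^sub>M M)"
  shows "(\<lambda>y. LINT t|T. H t y) \<in> borel_measurable M"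
proof -
  interpret prob_space T by fact
  have "(\<lambda>p. (case (snd p, fst p) of (t, y) \<Rightarrow> H t y)) \<in> borel_measurable (M \<Otimes>\<^sub>M T)"
    by (rule measurable_compose[OF measurable_Pair assms(2)]) auto
  then show ?thesis by (intro borel_measurable_lebesgue_integral) (simp add: case_prod_beta')
qed

text \<open>A non-integrable \<open>f\<close> has integral 0 by convention, and
  \<open>0 \<le> B\<close> covers that case.\<close>

lemma prob_integral_abs_bound:
  fixes f :: "'t \<Rightarrow> real"
  assumes "prob_space T" "\<And>t. t \<in> space T \<Longrightarrow> \<bar>f t\<bar> \<le> B" "0 \<le> B"
  shows "\<bar>LINT t|T. f t\<bar> \<le> B"
proof -
  interpret prob_space T by fact
  show ?thesis
  proof (cases "integrable T f")
    case True
    have "\<bar>LINT t|T. f t\<bar> \<le> (LINT t|T. \<bar>f t\<bar>)" by (rule integral_abs_bound)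
    also have "\<dots> \<le> (LINT t|T. B)" using True assms(2) by (intro integral_mono) auto
    finally show ?thesis by (simp add: prob_space)
  qed (use assms(3) in \<open>simp add: not_integrable_integral_eq\<close>)
qed

text \<open>Stationarity over a single letter, as an identity of image measures, which makes change
  of variables and Fubini directly applicable; \<open>stationary_iff_invariant\<close> connects it
  with \<open>stationary\<close>.\<close>

definition invariant_measure ::
  "'t measure \<Rightarrow> 'z::topological_space set \<Rightarrow> ('t \<Rightarrow> 'z \<Rightarrow> 'z) \<Rightarrow> 'z measure \<Rightarrow> bool" where
  "invariant_measure T S \<Phi> \<nu> \<longleftrightarrow> prob_space \<nu> \<and> sets \<nu> = sets (restrict_space borel S) \<and>
     distr (T \<Otimes>\<^sub>M \<nu>) (restrict_space borel S) (\<lambda>(t, z). \<Phi> t z) = \<nu>"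

lemma integral_random_map:
  fixes h :: "'z::topological_space \<Rightarrow> real"
  assumes T: "prob_space T" and \<Phi>: "random_map T S \<Phi>"
    and \<nu>: "prob_space \<nu>" "sets \<nu> = sets (restrict_space borel S)"
    and h: "h \<in> borel_measurable (restrict_space borel S)" and b: "\<And>z. z \<in> S \<Longrightarrow> \<bar>h z\<bar> \<le> B"
  shows "integral\<^sup>L (distr (T \<Otimes>\<^sub>M \<nu>) (restrict_space borel S) (\<lambda>(t, z). \<Phi> t z)) h = (LINT z|\<nu>. LINT t|T. h (\<Phi> t z))"
proof -
  interpret T: prob_space T by fact
  interpret \<nu>: prob_space \<nu> by fact
  interpret P: pair_prob_space T \<nu> ..
  have sp: "space \<nu> = S" using sets_eq_imp_space_eq[OF \<nu>(2)] by (simp add: space_restrict_space)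
  have m: "(\<lambda>(t, z). \<Phi> t z) \<in> measurable (T \<Otimes>\<^sub>M \<nu>) (restrict_space borel S)"
    using \<Phi> \<nu>(2) unfolding random_map_def by (simp cong: measurable_cong_sets sets_pair_measure_cong)
  have "integral\<^sup>L (distr (T \<Otimes>\<^sub>M \<nu>) (restrict_space borel S) (\<lambda>(t, z). \<Phi> t z)) h =
      (LINT p|(T \<Otimes>\<^sub>M \<nu>). h (case p of (t, z) \<Rightarrow> \<Phi> t z))"
    by (rule integral_distr[OF m h])
  also have "\<dots> = (LINT z|\<nu>. LINT t|T. h (\<Phi> t z))"
  proof (subst P.integral_snd)
    have "(\<lambda>p. h (case p of (t, z) \<Rightarrow> \<Phi> t z)) \<in> borel_measurable (T \<Otimes>\<^sub>M \<nu>)"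
      by (rule measurable_compose[OF m h])
    moreover have "AE p in T \<Otimes>\<^sub>M \<nu>. norm (h (case p of (t, z) \<Rightarrow> \<Phi> t z)) \<le> B"
      using b random_map_in[OF \<Phi>] by (intro AE_I2) (auto simp: space_pair_measure sp)
    ultimately show "integrable (T \<Otimes>\<^sub>M \<nu>) (\<lambda>(t, z). h (\<Phi> t z))"
      by (simp add: case_prod_beta' P.integrable_const_bound)
  qed (simp add: case_prod_beta')
  finally show ?thesis .
qed

lemma random_map_comp_measurable:
  assumes "random_map T S \<Phi>" "h \<in> borel_measurable (restrict_space borel S)"
  shows "(\<lambda>(t, z). h (\<Phi> t z)) \<in> borel_measurable (T \<Otimes>\<^sub>M restrict_space borel S)"
  using measurable_compose[OF assms(1)[unfolded random_map_def] assms(2)] by (simp add: case_prod_beta')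

text \<open>Integrating out the last letter replaces \<open>h\<close> by its image under the
  transition operator, again bounded and measurable; the induction therefore runs over all such
  \<open>h\<close>.\<close>

lemma invariant_measure_iter:
  fixes h :: "'z::topological_space \<Rightarrow> real"
  assumes T: "prob_space T" and \<Phi>: "random_map T S \<Phi>" and \<nu>: "invariant_measure T S \<Phi> \<nu>"
    and h: "h \<in> borel_measurable (restrict_space borel S)" and b: "\<And>z. z \<in> S \<Longrightarrow> \<bar>h z\<bar> \<le> B" and B: "0 \<le> B"
  shows "(LINT z|\<nu>. LINT \<omega>|noise T. h (iter \<Phi> n \<omega> z)) = integral\<^sup>L \<nu> h"
  using h b
proof (induction n arbitrary: h)
  case 0
  interpret N: prob_space "noise T" by (rule prob_space_noise[OF T])
  show ?case by (simp add: N.prob_space)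
next
  case (Suc n)
  have sp: "space \<nu> = S" using \<nu> sets_eq_imp_space_eq[of \<nu> "restrict_space borel S"]
    by (simp add: space_restrict_space invariant_measure_def)
  let ?Q = "\<lambda>z. LINT t|T. h (\<Phi> t z)"
  have Qm: "?Q \<in> borel_measurable (restrict_space borel S)"
    by (rule integral_over_noise_measurable[OF T random_map_comp_measurable[OF \<Phi> Suc.prems(1)]])
  have Qb: "\<bar>?Q z\<bar> \<le> B" if "z \<in> S" for z
    using that Suc.prems(2) random_map_in[OF \<Phi>] by (intro prob_integral_abs_bound[OF T _ B]) auto
  have "(LINT z|\<nu>. LINT \<omega>|noise T. h (iter \<Phi> (Suc n) \<omega> z)) = (LINT z|\<nu>. LINT \<omega>|noise T. ?Q (iter \<Phi> n \<omega> z))"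
  proof (rule Bochner_Integration.integral_cong[OF refl])
    fix z assume z: "z \<in> space \<nu>"
    show "(LINT \<omega>|noise T. h (iter \<Phi> (Suc n) \<omega> z)) = (LINT \<omega>|noise T. ?Q (iter \<Phi> n \<omega> z))"
      unfolding iter.simps
    proof (rule integral_noise_step[OF T \<Phi> _ random_map_comp_measurable[OF \<Phi> Suc.prems(1)], where K="\<lambda>_. B"])
      interpret prob_space T by fact
      show "integrable T (\<lambda>_. B)" by simp
    qed (use z sp Suc.prems(2) random_map_in[OF \<Phi>] in auto)
  qed
  also have "\<dots> = integral\<^sup>L \<nu> ?Q" by (rule Suc.IH[OF Qm Qb])
  also have "\<dots> = integral\<^sup>L (distr (T \<Otimes>\<^sub>M \<nu>) (restrict_space borel S) (\<lambda>(t, z). \<Phi> t z)) h"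
    by (rule integral_random_map[symmetric, OF T \<Phi> _ _ Suc.prems]) (use \<nu> in \<open>auto simp: invariant_measure_def\<close>)
  also have "\<dots> = integral\<^sup>L \<nu> h" using \<nu> by (simp add: invariant_measure_def)
  finally show ?case .
qed

text \<open>Tested on a continuous \<open>h\<close>, the transition operators of
  \<open>\<Phi> k\<close> converge continuously to that of \<open>\<Psi>\<close>, so their integrals
  against \<open>\<nu> k\<close> tend to the one against \<open>N\<close>. By \<open>ai\<close> that
  limit is the integral of \<open>h\<close> itself.\<close>

theorem limit_of_almost_invariant:
  fixes S :: "'z::{second_countable_topology,t2_space} set"
  assumes T: "prob_space T" and S: "compact S"
    and \<Phi>: "\<And>k. random_map T S (\<Phi> k)" and \<Psi>: "random_map T S \<Psi>"
    and cc: "AE t in T. continuously_convergent S (\<lambda>k. \<Phi> k t) (\<Psi> t)"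
    and cont: "AE t in T. continuous_on S (\<Psi> t)"
    and \<nu>: "\<And>k. prob_space (\<nu> k)" "\<And>k. sets (\<nu> k) = sets (restrict_space borel S)"
    and N: "prob_space N" "sets N = sets (restrict_space borel S)"
      "\<And>h::'z\<Rightarrow>real. continuous_on S h \<Longrightarrow> (\<lambda>k. integral\<^sup>L (\<nu> k) h) \<longlonglongrightarrow> integral\<^sup>L N h"
    and ai: "\<And>h::'z\<Rightarrow>real. continuous_on S h \<Longrightarrow>
      (\<lambda>k. (LINT z|\<nu> k. LINT t|T. h (\<Phi> k t z)) - integral\<^sup>L (\<nu> k) h) \<longlonglongrightarrow> 0"
  shows "invariant_measure T S \<Psi> N"
proof -
  interpret T: prob_space T by fact
  interpret N: prob_space N by fact
  interpret TN: pair_prob_space T N ..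
  let ?D = "distr (T \<Otimes>\<^sub>M N) (restrict_space borel S) (\<lambda>(t, z). \<Psi> t z)"
  have m: "(\<lambda>(t, z). \<Psi> t z) \<in> measurable (T \<Otimes>\<^sub>M N) (restrict_space borel S)"
    using \<Psi> N(2) unfolding random_map_def by (simp cong: measurable_cong_sets sets_pair_measure_cong)
  have "?D = N"
  proof (rule compact_borel_measure_eqI[OF S])
    show "prob_space ?D" by (rule TN.prob_space_distr[OF m])
    fix h :: "'z \<Rightarrow> real" assume h: "continuous_on S h"
    have hm: "h \<in> borel_measurable (restrict_space borel S)" by (rule borel_measurable_continuous_on_restrict[OF h])
    obtain B where B: "\<And>x. x \<in> S \<Longrightarrow> \<bar>h x\<bar> \<le> B"
      using compact_continuous_image[OF h S] compact_imp_bounded bounded_iff by (metis imageI real_norm_def)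
    have mk: "(\<lambda>t. h (\<Xi> t z)) \<in> borel_measurable T" if "z \<in> S" "random_map T S \<Xi>" for \<Xi> z
      using measurable_compose[OF random_map_measurable[OF that(2) measurable_ident measurable_const] hm, of z] that(1)
      by (simp add: space_restrict_space)
    have bk: "AE t in T. \<bar>h (\<Xi> t z)\<bar> \<le> B" if "z \<in> S" "random_map T S \<Xi>" for \<Xi> z
      by (intro AE_I2 B random_map_in[OF that(2) _ that(1)])
    have q: "continuously_convergent S (\<lambda>k z. LINT t|T. h (\<Phi> k t z)) (\<lambda>z. LINT t|T. h (\<Psi> t z))"
    proof (rule continuously_convergent_integral[where G="\<lambda>_. B"])
      have "AE t in T. \<forall>k z. z \<in> S \<longrightarrow> \<Phi> k t z \<in> S" "AE t in T. \<forall>z\<in>S. \<Psi> t z \<in> S"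
        using random_map_in[OF \<Phi>] random_map_in[OF \<Psi>] by (auto intro!: AE_I2)
      with cc show "AE t in T. continuously_convergent S (\<lambda>k z. h (\<Phi> k t z)) (\<lambda>z. h (\<Psi> t z))"
        by eventually_elim (rule continuously_convergent_compose[OF _ continuously_convergent_const[OF h]], auto)
    qed (auto intro: mk bk \<Phi> \<Psi>)
    \<comment> \<open>Continuity of the limit operator is the same convergence lemma applied to a
      constant sequence.\<close>
    have qc: "continuous_on S (\<lambda>z. LINT t|T. h (\<Psi> t z))"
    proof -
      have "continuously_convergent S (\<lambda>k z. LINT t|T. h (\<Psi> t z)) (\<lambda>z. LINT t|T. h (\<Psi> t z))"
      proof (rule continuously_convergent_integral[where G="\<lambda>_. B"])
        have "AE t in T. \<forall>z\<in>S. \<Psi> t z \<in> S" using random_map_in[OF \<Psi>] by (auto intro!: AE_I2)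
        with cont show "AE t in T. continuously_convergent S (\<lambda>k z. h (\<Psi> t z)) (\<lambda>z. h (\<Psi> t z))"
          by eventually_elim (intro continuously_convergent_const continuous_on_compose2[OF h], auto)
      qed (auto intro: mk bk \<Phi> \<Psi>)
      thus ?thesis by (simp add: continuously_convergent_const_iff)
    qed
    have "(\<lambda>k. LINT z|\<nu> k. LINT t|T. h (\<Phi> k t z)) \<longlonglongrightarrow> (LINT z|N. LINT t|T. h (\<Psi> t z))"
      by (rule integral_continuously_convergent[OF S q qc \<nu> N(3)])
        (auto intro: integral_over_noise_measurable[OF T random_map_comp_measurable[OF \<Phi> hm]])
    from tendsto_diff[OF this N(3)[OF h]] ai[OF h]
    have "(LINT z|N. LINT t|T. h (\<Psi> t z)) - integral\<^sup>L N h = 0" by (rule LIMSEQ_unique)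
    thus "integral\<^sup>L ?D h = integral\<^sup>L N h"
      using integral_random_map[OF T \<Psi> N(1,2) hm B] by simp
  qed (use N in auto)
  thus ?thesis using N by (simp add: invariant_measure_def)
qed

text \<open>The Krylov-Bogoliubov average, written as the law of a single random point: a uniform
  time below \<open>n\<close>, a start \<open>c y\<close> with \<open>y\<close> distributed by
  \<open>\<mu>\<close>, and independent noise.\<close>

definition orbit_average ::
  "'t measure \<Rightarrow> 'z::topological_space set \<Rightarrow> ('t \<Rightarrow> 'z \<Rightarrow> 'z) \<Rightarrow> 'y measure \<Rightarrow> ('y \<Rightarrow> 'z) \<Rightarrow> nat \<Rightarrow> 'z measure" where
  "orbit_average T S \<Phi> \<mu> c n = distr (measure_pmf (pmf_of_set {..<n}) \<Otimes>\<^sub>M (\<mu> \<Otimes>\<^sub>M noise T)) (restrict_space borel S)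
     (\<lambda>(j, y, \<omega>). iter \<Phi> j \<omega> (c y))"

lemma orbit_average_measurable:
  assumes "random_map T S \<Phi>" "c \<in> measurable \<mu> (restrict_space borel S)"
  shows "(\<lambda>(j, y, \<omega>). iter \<Phi> j \<omega> (c y)) \<in> measurable (measure_pmf p \<Otimes>\<^sub>M (\<mu> \<Otimes>\<^sub>M noise T)) (restrict_space borel S)"
proof -
  have "(\<lambda>(j, y, \<omega>). iter \<Phi> j \<omega> (c y)) \<in> measurable (count_space UNIV \<Otimes>\<^sub>M (\<mu> \<Otimes>\<^sub>M noise T)) (restrict_space borel S)"
  proof (rule measurable_pair_measure_countable1)
    fix j
    have "(\<lambda>x. iter \<Phi> j (snd x) (c (fst x))) \<in> measurable (\<mu> \<Otimes>\<^sub>M noise T) (restrict_space borel S)"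
      by (intro iter_measurable'[OF assms(1)] measurable_compose[OF measurable_fst assms(2)] measurable_snd)
    thus "(\<lambda>y. case (j, y) of (j, y, \<omega>) \<Rightarrow> iter \<Phi> j \<omega> (c y)) \<in> measurable (\<mu> \<Otimes>\<^sub>M noise T) (restrict_space borel S)"
      by (simp add: case_prod_beta')
  qed simp
  thus ?thesis by (simp cong: measurable_cong_sets sets_pair_measure_cong)
qed

lemma orbit_average_prob:
  assumes "prob_space T" "prob_space \<mu>" "random_map T S \<Phi>" "c \<in> measurable \<mu> (restrict_space borel S)"
  shows "prob_space (orbit_average T S \<Phi> \<mu> c n)" "sets (orbit_average T S \<Phi> \<mu> c n) = sets (restrict_space borel S)"
proof -
  interpret N: prob_space "noise T" by (rule prob_space_noise[OF assms(1)])
  interpret \<mu>: prob_space \<mu> by fact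
  interpret Q: pair_prob_space \<mu> "noise T" ..
  interpret P: prob_space "measure_pmf (pmf_of_set {..<n})" by (rule prob_space_measure_pmf)
  interpret R: pair_prob_space "measure_pmf (pmf_of_set {..<n})" "\<mu> \<Otimes>\<^sub>M noise T" ..
  show "prob_space (orbit_average T S \<Phi> \<mu> c n)" unfolding orbit_average_def
    by (rule R.prob_space_distr[OF orbit_average_measurable[OF assms(3,4)]])
qed (simp add: orbit_average_def)

lemma integral_orbit_average:
  fixes h :: "'z::topological_space \<Rightarrow> real"
  assumes T: "prob_space T" and \<mu>: "prob_space \<mu>" and \<Phi>: "random_map T S \<Phi>" and c: "c \<in> measurable \<mu> (restrict_space borel S)"
    and n: "n > 0" and h: "h \<in> borel_measurable (restrict_space borel S)" and b: "\<And>z. z \<in> S \<Longrightarrow> \<bar>h z\<bar> \<le> B"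
  shows "integral\<^sup>L (orbit_average T S \<Phi> \<mu> c n) h = (\<Sum>j<n. LINT y|\<mu>. LINT \<omega>|noise T. h (iter \<Phi> j \<omega> (c y))) / n"
proof -
  interpret N: prob_space "noise T" by (rule prob_space_noise[OF T])
  interpret \<mu>: prob_space \<mu> by fact
  interpret Q: pair_prob_space \<mu> "noise T" ..
  let ?U = "measure_pmf (pmf_of_set {..<n})"
  interpret P: prob_space ?U by (rule prob_space_measure_pmf)
  interpret R: pair_prob_space ?U "\<mu> \<Otimes>\<^sub>M noise T" ..
  note m = orbit_average_measurable[OF \<Phi> c, of "pmf_of_set {..<n}"]
  have cS: "c y \<in> S" if "y \<in> space \<mu>" for y
    using measurable_space[OF c that] by (simp add: space_restrict_space)
  have itS: "iter \<Phi> j \<omega> (c y) \<in> S" if "y \<in> space \<mu>" "\<omega> \<in> space (noise T)" for j y \<omega>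
    using iter_in[OF \<Phi> that(2) cS[OF that(1)]] .
  have mh: "(\<lambda>(y, \<omega>). h (iter \<Phi> j \<omega> (c y))) \<in> borel_measurable (\<mu> \<Otimes>\<^sub>M noise T)" for j
    unfolding case_prod_beta'
    by (intro measurable_compose[OF _ h] iter_measurable'[OF \<Phi>] measurable_compose[OF measurable_fst c] measurable_snd)
  have ih: "integrable (\<mu> \<Otimes>\<^sub>M noise T) (\<lambda>(y, \<omega>). h (iter \<Phi> j \<omega> (c y)))" for j
    using b itS by (intro Q.integrable_const_bound[of _ B] mh AE_I2) (auto simp: space_pair_measure)
  have "integral\<^sup>L (orbit_average T S \<Phi> \<mu> c n) h =
      (LINT p|(?U \<Otimes>\<^sub>M (\<mu> \<Otimes>\<^sub>M noise T)). h (case p of (j, y, \<omega>) \<Rightarrow> iter \<Phi> j \<omega> (c y)))"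
    unfolding orbit_average_def by (rule integral_distr[OF m h])
  also have "\<dots> = (LINT p|(?U \<Otimes>\<^sub>M (\<mu> \<Otimes>\<^sub>M noise T)). (case p of (j, q) \<Rightarrow> h (case q of (y, \<omega>) \<Rightarrow> iter \<Phi> j \<omega> (c y))))"
    by (simp add: case_prod_beta')
  also have "\<dots> = (LINT j|?U. LINT q|(\<mu> \<Otimes>\<^sub>M noise T). h (case q of (y, \<omega>) \<Rightarrow> iter \<Phi> j \<omega> (c y)))"
  proof (rule R.integral_fst[symmetric])
    have "(\<lambda>p. h (case p of (j, y, \<omega>) \<Rightarrow> iter \<Phi> j \<omega> (c y))) \<in> borel_measurable (?U \<Otimes>\<^sub>M (\<mu> \<Otimes>\<^sub>M noise T))"
      by (rule measurable_compose[OF m h])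
    moreover have "AE p in ?U \<Otimes>\<^sub>M (\<mu> \<Otimes>\<^sub>M noise T). norm (h (case p of (j, y, \<omega>) \<Rightarrow> iter \<Phi> j \<omega> (c y))) \<le> B"
      using b itS by (intro AE_I2) (auto simp: space_pair_measure)
    ultimately show "integrable (?U \<Otimes>\<^sub>M (\<mu> \<Otimes>\<^sub>M noise T)) (\<lambda>(j, q). h (case q of (y, \<omega>) \<Rightarrow> iter \<Phi> j \<omega> (c y)))"
      by (simp add: case_prod_beta' R.integrable_const_bound)
  qed
  also have "\<dots> = (\<Sum>j<n. LINT q|(\<mu> \<Otimes>\<^sub>M noise T). h (case q of (y, \<omega>) \<Rightarrow> iter \<Phi> j \<omega> (c y))) / n"
    using n by (subst integral_pmf_of_set) auto
  also have "(\<Sum>j<n. LINT q|(\<mu> \<Otimes>\<^sub>M noise T). h (case q of (y, \<omega>) \<Rightarrow> iter \<Phi> j \<omega> (c y))) =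
      (\<Sum>j<n. LINT y|\<mu>. LINT \<omega>|noise T. h (iter \<Phi> j \<omega> (c y)))"
    using Q.integral_fst'[OF ih] by (simp add: case_prod_beta')
  finally show ?thesis .
qed

text \<open>One further step shifts the time sum by one, so all terms cancel except the first and
  the last, each at most \<open>B\<close>.\<close>

lemma orbit_average_almost_invariant:
  fixes h :: "'z::topological_space \<Rightarrow> real"
  assumes T: "prob_space T" and \<mu>: "prob_space \<mu>" and \<Phi>: "random_map T S \<Phi>" and c: "c \<in> measurable \<mu> (restrict_space borel S)"
    and n: "n > 0" and h: "h \<in> borel_measurable (restrict_space borel S)" and b: "\<And>z. z \<in> S \<Longrightarrow> \<bar>h z\<bar> \<le> B" and B: "0 \<le> B"
  shows "\<bar>(LINT z|orbit_average T S \<Phi> \<mu> c n. LINT t|T. h (\<Phi> t z)) - integral\<^sup>L (orbit_average T S \<Phi> \<mu> c n) h\<bar> \<le> 2 * B / n"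
proof -
  let ?Q = "\<lambda>z. LINT t|T. h (\<Phi> t z)"
  let ?a = "\<lambda>j. LINT y|\<mu>. LINT \<omega>|noise T. h (iter \<Phi> j \<omega> (c y))"
  interpret T: prob_space T by fact
  have cS: "c y \<in> S" if "y \<in> space \<mu>" for y
    using measurable_space[OF c that] by (simp add: space_restrict_space)
  have Qm: "?Q \<in> borel_measurable (restrict_space borel S)"
    by (rule integral_over_noise_measurable[OF T random_map_comp_measurable[OF \<Phi> h]])
  have Qb: "\<bar>?Q z\<bar> \<le> B" if "z \<in> S" for z
    using that b random_map_in[OF \<Phi>] by (intro prob_integral_abs_bound[OF T _ B]) auto
  have st: "(LINT y|\<mu>. LINT \<omega>|noise T. ?Q (iter \<Phi> j \<omega> (c y))) = ?a (Suc j)" for j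
  proof (rule Bochner_Integration.integral_cong[OF refl])
    fix y assume y: "y \<in> space \<mu>"
    show "(LINT \<omega>|noise T. ?Q (iter \<Phi> j \<omega> (c y))) = (LINT \<omega>|noise T. h (iter \<Phi> (Suc j) \<omega> (c y)))"
      unfolding iter.simps
      by (rule integral_noise_step[symmetric, OF T \<Phi> cS[OF y] random_map_comp_measurable[OF \<Phi> h], where K="\<lambda>_. B"])
        (use b random_map_in[OF \<Phi>] in auto)
  qed
  have ab: "\<bar>?a j\<bar> \<le> B" for j
    using b iter_in[OF \<Phi>] cS by (intro prob_integral_abs_bound[OF \<mu> _ B] prob_integral_abs_bound[OF prob_space_noise[OF T] _ B]) auto
  have "(LINT z|orbit_average T S \<Phi> \<mu> c n. ?Q z) - integral\<^sup>L (orbit_average T S \<Phi> \<mu> c n) h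
      = (\<Sum>j<n. ?a (Suc j)) / n - (\<Sum>j<n. ?a j) / n"
    using integral_orbit_average[OF T \<mu> \<Phi> c n Qm Qb] integral_orbit_average[OF T \<mu> \<Phi> c n h b] by (simp only: st)
  also have "\<dots> = (?a n - ?a 0) / n"
    using sum_lessThan_telescope[of ?a n] by (simp add: diff_divide_distrib[symmetric] sum_subtractf[symmetric])
  also have "\<bar>\<dots>\<bar> \<le> 2 * B / n"
    using ab[of n] ab[of 0] n by (simp add: abs_le_iff divide_right_mono field_simps)
  finally show ?thesis .
qed

section \<open>Linear cocycles\<close>

text \<open>Fekete's lemma; the linear lower bound keeps the infimum of \<open>a n / n\<close>
  finite. That the limit is this infimum matters as much as its existence: it is the source of upper
  semicontinuity.\<close>

lemma subadditive_limit:
  fixes a :: "nat \<Rightarrow> real"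
  assumes sub: "\<And>m n. a (m + n) \<le> a m + a n" and lb: "\<And>n. - (real n * K) \<le> a n"
  obtains L where "(\<lambda>n. a n / n) \<longlonglongrightarrow> L" "\<And>n. n > 0 \<Longrightarrow> L \<le> a n / n"
proof -
  define L where "L = (INF n\<in>{1..}. a n / real n)"
  have bb: "bdd_below ((\<lambda>n. a n / real n) ` {1..})"
  proof (rule bdd_belowI2[where m="- K"])
    fix n :: nat assume "n \<in> {1..}"
    then show "- K \<le> a n / real n" using lb[of n] by (simp add: field_simps)
  qed
  have L_le: "L \<le> a n / n" if "n > 0" for n unfolding L_def using that by (intro cINF_lower[OF bb]) auto
  have mult: "a (q * m + s) \<le> q * a m + a s" for q m s
  proof (induction q)
    case (Suc q)
    have "a (Suc q * m + s) \<le> a m + a (q * m + s)" using sub[of m "q * m + s"] by (simp add: add.assoc)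
    with Suc show ?case by (simp add: algebra_simps)
  qed simp
  have "(\<lambda>n. a n / n) \<longlonglongrightarrow> L"
  proof (rule tendstoI)
    fix e :: real assume e: "e > 0"
    have "\<exists>n\<in>{1..}. a n / real n < L + e / 2"
      using cINF_less_iff[OF _ bb, of "L + e/2"] e unfolding L_def by simp
    then obtain m where m: "m > 0" "a m / m < L + e / 2" by (metis atLeast_iff less_eq_Suc_le One_nat_def)
    \<comment> \<open>\<open>B\<close> absorbs the remainder \<open>a (n mod m)\<close> and the
      error made on replacing \<open>(n div m) * m\<close> by \<open>n\<close>.\<close>
    define B where "B = Max (insert 0 (a ` {..<m})) + m * \<bar>a m / m\<bar>"
    have up: "a n / n \<le> a m / m + B / n" if n: "n > 0" for n
    proof -
      let ?q = "n div m" and ?s = "n mod m"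
      have "a n \<le> ?q * a m + a ?s" using mult[of ?q m ?s] by simp
      also have "a ?s \<le> Max (insert 0 (a ` {..<m}))" using m by (intro Max_ge) auto
      also have "?q * a m = (a m / m) * (?q * m)" using m by simp
      also have "\<dots> = (a m / m) * (real n - real ?s)"
        by (metis add_diff_cancel_right' div_mult_mod_eq of_nat_add of_nat_mult)
      \<comment> \<open>The sign of \<open>a m\<close> is unknown, hence the absolute value.\<close>
      also have "\<dots> \<le> (a m / m) * n + m * \<bar>a m / m\<bar>"
      proof -
        have "- (a m / m * real ?s) \<le> \<bar>a m / m\<bar> * real ?s" by (metis abs_ge_minus_self abs_mult abs_of_nat)
        also have "\<dots> \<le> \<bar>a m / m\<bar> * m" using m by (intro mult_left_mono) (auto intro: less_imp_le)
        finally show ?thesis by (simp add: algebra_simps)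
      qed
      finally have "a n \<le> (a m / m) * n + B" by (simp add: B_def)
      then have "a n / n \<le> ((a m / m) * n + B) / n" using n by (intro divide_right_mono) auto
      also have "\<dots> = a m / m + B / n" using n by (simp add: add_divide_distrib)
      finally show ?thesis .
    qed
    have "(\<lambda>n. B / real n) \<longlonglongrightarrow> 0" by (rule lim_const_over_n)
    then have "\<forall>\<^sub>F n in sequentially. \<bar>B / real n\<bar> < e / 2" using e by (auto dest!: tendstoD[of _ _ _ "e/2"] simp: dist_real_def)
    with eventually_gt_at_top[of 0] show "\<forall>\<^sub>F n in sequentially. dist (a n / n) L < e"
    proof eventually_elim
      case (elim n)
      then have "B / real n < e / 2" using abs_ge_self[of "B / real n"] by linarith
      then have "a n / real n < L + e" using up[OF elim(1)] m(2) by linarith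
      with elim(1) show ?case using L_le[of n] by (simp add: dist_real_def)
    qed
  qed
  with L_le show thesis using that by blast
qed

text \<open>The inequalities defining the operator norm need checking on a countable dense set of
  vectors only, so measurability of each \<open>B w u\<close> is enough.\<close>

lemma borel_measurable_norm_blinfun:
  fixes B :: "'w \<Rightarrow> 'n::euclidean_space \<Rightarrow>\<^sub>L 'm::euclidean_space"
  assumes "\<And>u. (\<lambda>w. B w u) \<in> borel_measurable M"
  shows "(\<lambda>w. norm (B w)) \<in> borel_measurable M"
proof -
  obtain D :: "'n set" where D: "countable D" "closure D = UNIV"
    using separable[of "UNIV :: 'n set"] by (metis closure_UNIV subset_antisym top_greatest)
  have eq: "norm (B w) \<le> a \<longleftrightarrow> 0 \<le> a \<and> (\<forall>u\<in>D. norm (B w u) \<le> a * norm u)" for w a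
  proof
    assume "norm (B w) \<le> a"
    then show "0 \<le> a \<and> (\<forall>u\<in>D. norm (B w u) \<le> a * norm u)"
      using norm_blinfun[of "B w"] norm_ge_zero[of "B w"] by (meson mult_right_mono norm_ge_zero order_trans)
  next
    assume *: "0 \<le> a \<and> (\<forall>u\<in>D. norm (B w u) \<le> a * norm u)"
    have "closed {u. norm (B w u) \<le> a * norm u}"
      by (intro closed_Collect_le continuous_intros)
    then have "closure D \<subseteq> {u. norm (B w u) \<le> a * norm u}" using * by (intro closure_minimal) auto
    then show "norm (B w) \<le> a" using * D by (intro norm_blinfun_bound) auto
  qed
  have "{w \<in> space M. norm (B w) \<le> a} \<in> sets M" for a
  proof (cases "0 \<le> a")
    case True
    have "{w \<in> space M. \<forall>u\<in>D. norm (B w u) \<le> a * norm u} \<in> sets M"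
      using assms D(1) by measurable
    thus ?thesis using True by (simp add: eq)
  next
    case False
    then have "{w \<in> space M. norm (B w) \<le> a} = {}" using norm_ge_zero order_trans by blast
    thus ?thesis by (simp only: sets.empty_sets)
  qed
  thus ?thesis by (simp add: borel_measurable_iff_le)
qed

lemma borel_measurable_blinfun_apply:
  fixes B :: "'w \<Rightarrow> 'n::euclidean_space \<Rightarrow>\<^sub>L 'm::euclidean_space"
  assumes "\<And>u. (\<lambda>w. B w u) \<in> borel_measurable M" "h \<in> borel_measurable M"
  shows "(\<lambda>w. B w (h w)) \<in> borel_measurable M"
proof -
  have "B w (h w) = (\<Sum>b\<in>Basis. (h w \<bullet> b) *\<^sub>R B w b)" for w
    by (subst euclidean_representation[of "h w", symmetric]) (simp only: blinfun.sum_right blinfun.scaleR_right)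
  thus ?thesis using assms by simp
qed

text \<open>Stands in for the projectivised bundle, of which it is a double cover: unit vectors form
  a subset of an ordinary product, where topology and Borel sets are the ready-made ones.\<close>

definition unit_sphere_bundle :: "'a set \<Rightarrow> ('a \<Rightarrow> 'n::real_normed_vector set) \<Rightarrow> ('a \<times> 'n) set" where
  "unit_sphere_bundle X V = {(x, u). x \<in> X \<and> u \<in> V x \<and> norm u = 1}"

text \<open>One integrable \<open>G\<close> bounds the logarithm of the norm above and the
  logarithmic stretch below. The lower bound is confined to the fibres because the ambient maps
  treated here vanish on their orthogonal complements. A converging family will share the same
  \<open>G\<close>.\<close>

definition cocycle ::
  "'t measure \<Rightarrow> 'a::topological_space set \<Rightarrow> ('a \<Rightarrow> 'n::euclidean_space set) \<Rightarrow> ('t \<Rightarrow> 'a \<Rightarrow> 'a) \<Rightarrow>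
   ('t \<Rightarrow> 'a \<Rightarrow> 'n \<Rightarrow>\<^sub>L 'n) \<Rightarrow> ('t \<Rightarrow> real) \<Rightarrow> bool" where
  "cocycle T X V F C G \<longleftrightarrow> random_map T X F \<and>
     (\<forall>u. (\<lambda>(t, x). C t x u) \<in> borel_measurable (T \<Otimes>\<^sub>M restrict_space borel X)) \<and> integrable T G \<and>
     (\<forall>t\<in>space T. \<forall>x\<in>X. (\<forall>u\<in>V x. C t x u \<in> V (F t x) \<and> exp (- G t) * norm u \<le> norm (C t x u)) \<and>
        norm (C t x) \<le> exp (G t))"

primrec iter_lin :: "('t \<Rightarrow> 'a \<Rightarrow> 'a) \<Rightarrow> ('t \<Rightarrow> 'a \<Rightarrow> 'n::real_normed_vector \<Rightarrow>\<^sub>L 'n) \<Rightarrow> nat \<Rightarrow> (nat \<Rightarrow> 't) \<Rightarrow> 'a \<Rightarrow> 'n \<Rightarrow>\<^sub>L 'n" where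
  "iter_lin F C 0 \<omega> x = id_blinfun"
| "iter_lin F C (Suc n) \<omega> x = C (\<omega> n) (iter F n \<omega> x) o\<^sub>L iter_lin F C n \<omega> x"

definition projective_action ::
  "('t \<Rightarrow> 'a \<Rightarrow> 'a) \<Rightarrow> ('t \<Rightarrow> 'a \<Rightarrow> 'n::real_normed_vector \<Rightarrow>\<^sub>L 'n) \<Rightarrow> 't \<Rightarrow> 'a \<times> 'n \<Rightarrow> 'a \<times> 'n" where
  "projective_action F C t = (\<lambda>(x, u). (F t x, C t x u /\<^sub>R norm (C t x u)))"

definition log_growth ::
  "'t measure \<Rightarrow> ('t \<Rightarrow> 'a \<Rightarrow> 'a) \<Rightarrow> ('t \<Rightarrow> 'a \<Rightarrow> 'n::real_normed_vector \<Rightarrow>\<^sub>L 'n) \<Rightarrow> 'a measure \<Rightarrow> nat \<Rightarrow> real" where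
  "log_growth T F C \<mu> n = (LINT x|\<mu>. LINT \<omega>|noise T. ln (norm (iter_lin F C n \<omega> x)))"

definition growth_rate ::
  "'t measure \<Rightarrow> ('t \<Rightarrow> 'a \<Rightarrow> 'a) \<Rightarrow> ('t \<Rightarrow> 'a \<Rightarrow> 'n::real_normed_vector \<Rightarrow>\<^sub>L 'n) \<Rightarrow> 'a measure \<Rightarrow> real" where
  "growth_rate T F C \<mu> = lim (\<lambda>n. log_growth T F C \<mu> n / n)"

text \<open>The function called \<phi> tilde in the definition of coquasi-irreducibility, read on
  unit vectors instead of lines; \<open>cot_phi_lift\<close> identifies the two.\<close>

definition mean_log_stretch ::
  "'t measure \<Rightarrow> ('t \<Rightarrow> 'a \<Rightarrow> 'n::real_normed_vector \<Rightarrow>\<^sub>L 'n) \<Rightarrow> 'a \<times> 'n \<Rightarrow> real" where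
  "mean_log_stretch T C = (\<lambda>(x, u). LINT t|T. ln (norm (C t x u)))"

lemma iter_lin_add:
  "iter_lin F C (n + m) \<omega> x = iter_lin F C m (\<lambda>k. \<omega> (n + k)) (iter F n \<omega> x) o\<^sub>L iter_lin F C n \<omega> x"
proof (induction m)
  case (Suc m)
  have "iter F m (\<lambda>k. \<omega> (n + k)) (iter F n \<omega> x) = iter F (n + m) \<omega> x" by (simp add: iter_add)
  with Suc show ?case by (auto intro!: blinfun_eqI)
qed (auto intro: blinfun_eqI)

text \<open>A continuous field of unit vectors need not exist, as over the two-sphere; a measurable
  one does, and that suffices as a starting point for orbits. Compactness of the sphere bundle
  supplies the weak limits.\<close>

locale sphere_bundle =
  fixes X :: "'a::{second_countable_topology,t2_space} set" and V :: "'a \<Rightarrow> 'n::euclidean_space set"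
  assumes compact_base: "compact X"
    and compact_sphere: "compact (unit_sphere_bundle X V)"
    and subspace_fibre: "x \<in> X \<Longrightarrow> subspace (V x)"
    and section_exists: "\<exists>c \<in> measurable (restrict_space borel X) (restrict_space borel (unit_sphere_bundle X V)).
        \<forall>x\<in>X. fst (c x) = x"
begin

abbreviation "S \<equiv> unit_sphere_bundle X V"

lemma unit_vector_exists:
  assumes "x \<in> X" obtains u where "u \<in> V x" "norm u = 1"
proof -
  obtain c where c: "c \<in> measurable (restrict_space borel X) (restrict_space borel S)" "\<forall>x\<in>X. fst (c x) = x"
    using section_exists by blast
  then have "c x \<in> S" using measurable_space[OF c(1), of x] assms by (simp add: space_restrict_space)
  thus thesis using that c(2) assms by (auto simp: unit_sphere_bundle_def)
qed

lemma measurable_fst_sphere: "fst \<in> measurable (restrict_space borel S) (restrict_space borel X)"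
proof (rule measurable_restrict_space2)
  show "fst \<in> space (restrict_space borel S) \<rightarrow> X" by (auto simp: space_restrict_space unit_sphere_bundle_def)
  show "fst \<in> borel_measurable (restrict_space borel S)"
    by (intro borel_measurable_continuous_on_restrict continuous_intros)
qed

lemma measurable_snd_sphere: "snd \<in> borel_measurable (restrict_space borel S)"
  by (intro borel_measurable_continuous_on_restrict continuous_intros)

context
  fixes T :: "'t measure" and F :: "'t \<Rightarrow> 'a \<Rightarrow> 'a" and C :: "'t \<Rightarrow> 'a \<Rightarrow> 'n \<Rightarrow>\<^sub>L 'n" and G :: "'t \<Rightarrow> real"
  assumes T: "prob_space T" and coc: "cocycle T X V F C G"
begin

lemma base_random_map: "random_map T X F" using coc by (simp add: cocycle_def)

lemma integrable_bound: "integrable T G" using coc by (simp add: cocycle_def)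

lemma cocycleD:
  assumes "t \<in> space T" "x \<in> X"
  shows "u \<in> V x \<Longrightarrow> C t x u \<in> V (F t x)" "u \<in> V x \<Longrightarrow> exp (- G t) * norm u \<le> norm (C t x u)"
    "norm (C t x) \<le> exp (G t)" "norm (C t x u) \<le> exp (G t) * norm u"
proof -
  show n: "norm (C t x) \<le> exp (G t)" using coc assms by (simp add: cocycle_def)
  show "norm (C t x u) \<le> exp (G t) * norm u"
    using norm_blinfun[of "C t x" u] mult_right_mono[OF n, of "norm u"] by simp
qed (use coc assms in \<open>auto simp: cocycle_def\<close>)

lemma cocycle_apply_measurable:
  assumes "f \<in> measurable M T" "g \<in> measurable M (restrict_space borel X)" "h \<in> borel_measurable M"
  shows "(\<lambda>w. C (f w) (g w) (h w)) \<in> borel_measurable M"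
proof (rule borel_measurable_blinfun_apply[OF _ assms(3)])
  fix u
  have "(\<lambda>(t, x). C t x u) \<in> borel_measurable (T \<Otimes>\<^sub>M restrict_space borel X)" using coc by (simp add: cocycle_def)
  from measurable_compose[OF measurable_Pair[OF assms(1,2)] this]
  show "(\<lambda>w. C (f w) (g w) u) \<in> borel_measurable M" by simp
qed

lemma stretch_pos: "t \<in> space T \<Longrightarrow> x \<in> X \<Longrightarrow> u \<in> V x \<Longrightarrow> u \<noteq> 0 \<Longrightarrow> 0 < norm (C t x u)"
  using cocycleD(2)[of t x u] by (smt (verit) exp_gt_zero mult_pos_pos zero_less_norm_iff)

lemma projective_action_random_map: "random_map T S (projective_action F C)"
  unfolding random_map_def
proof (rule measurable_restrict_space2)
  let ?M = "T \<Otimes>\<^sub>M restrict_space borel S"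
  have f: "fst \<in> measurable ?M T" and x: "(\<lambda>p. fst (snd p)) \<in> measurable ?M (restrict_space borel X)"
    and u: "(\<lambda>p. snd (snd p)) \<in> borel_measurable ?M"
    by (auto intro: measurable_compose[OF measurable_snd] measurable_fst_sphere measurable_snd_sphere)
  have "(\<lambda>p. F (fst p) (fst (snd p))) \<in> measurable ?M (restrict_space borel X)"
    by (rule random_map_measurable[OF base_random_map f x])
  then have 1: "(\<lambda>p. F (fst p) (fst (snd p))) \<in> borel_measurable ?M"
    by (simp add: measurable_restrict_space2_iff)
  have 2: "(\<lambda>p. C (fst p) (fst (snd p)) (snd (snd p))) \<in> borel_measurable ?M"
    by (rule cocycle_apply_measurable[OF f x u])
  have "(\<lambda>p. (F (fst p) (fst (snd p)), C (fst p) (fst (snd p)) (snd (snd p)) /\<^sub>R norm (C (fst p) (fst (snd p)) (snd (snd p))))) \<in> borel_measurable ?M"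
    by (intro borel_measurable_Pair 1 borel_measurable_scaleR borel_measurable_inverse measurable_compose[OF 2 borel_measurable_norm] 2)
  thus "(\<lambda>(t, z). projective_action F C t z) \<in> borel_measurable ?M"
    by (simp add: projective_action_def case_prod_beta')
  show "(\<lambda>(t, z). projective_action F C t z) \<in> space ?M \<rightarrow> S"
  proof
    fix p assume "p \<in> space ?M"
    then obtain t x u where p: "p = (t, (x, u))" "t \<in> space T" "x \<in> X" "u \<in> V x" "norm u = 1"
      by (auto simp: space_pair_measure space_restrict_space unit_sphere_bundle_def)
    have "F t x \<in> X" using random_map_in[OF base_random_map] p by simp
    moreover have "C t x u \<in> V (F t x)" using cocycleD(1) p by simp
    moreover have "0 < norm (C t x u)" using stretch_pos p by force
    ultimately show "(\<lambda>(t, z). projective_action F C t z) p \<in> S"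
      using p subspace_fibre[of "F t x"]
      by (auto simp: projective_action_def unit_sphere_bundle_def subspace_scale)
  qed
qed

lemma log_stretch_bound:
  assumes "t \<in> space T" "(x, u) \<in> S" shows "\<bar>ln (norm (C t x u))\<bar> \<le> G t"
proof -
  have u: "x \<in> X" "u \<in> V x" "norm u = 1" using assms by (auto simp: unit_sphere_bundle_def)
  have l: "exp (- G t) \<le> norm (C t x u)" and r: "norm (C t x u) \<le> exp (G t)"
    using cocycleD(2,4)[of t x u] assms(1) u by auto
  have pos: "0 < norm (C t x u)" using l exp_gt_zero less_le_trans by blast
  have "- G t \<le> ln (norm (C t x u))" using l pos by (simp add: ln_ge_iff)
  moreover have "ln (norm (C t x u)) \<le> G t" using r pos by (metis exp_ln exp_le_cancel_iff)
  ultimately show ?thesis by (simp add: abs_le_iff)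
qed

lemma log_stretch_measurable: "(\<lambda>(t, z). ln (norm (C t (fst z) (snd z)))) \<in> borel_measurable (T \<Otimes>\<^sub>M restrict_space borel S)"
proof -
  have "(\<lambda>p. C (fst p) (fst (snd p)) (snd (snd p))) \<in> borel_measurable (T \<Otimes>\<^sub>M restrict_space borel S)"
    by (rule cocycle_apply_measurable)
      (auto intro: measurable_compose[OF measurable_snd] measurable_fst_sphere measurable_snd_sphere)
  from borel_measurable_ln[OF measurable_compose[OF this borel_measurable_norm]] show ?thesis by (simp add: case_prod_beta')
qed

lemma mean_log_stretch_measurable: "mean_log_stretch T C \<in> borel_measurable (restrict_space borel S)"
  using integral_over_noise_measurable[OF T log_stretch_measurable] by (simp add: mean_log_stretch_def case_prod_beta')

text \<open>The definition leaves the sign of \<open>G\<close> open; it comes from bounding an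
  absolute value at a unit vector over \<open>x\<close>.\<close>

lemma bound_nonneg: "t \<in> space T \<Longrightarrow> x \<in> X \<Longrightarrow> 0 \<le> G t"
proof -
  assume t: "t \<in> space T" and x: "x \<in> X"
  obtain u where "u \<in> V x" "norm u = 1" using unit_vector_exists[OF x] .
  then have "(x, u) \<in> S" using x by (simp add: unit_sphere_bundle_def)
  from log_stretch_bound[OF t this] show "0 \<le> G t" by linarith
qed

lemma mean_log_stretch_bound: "z \<in> S \<Longrightarrow> \<bar>mean_log_stretch T C z\<bar> \<le> (LINT t|T. G t)"
proof -
  assume z: "z \<in> S"
  obtain x u where zx: "z = (x, u)" by fastforce
  have m: "(\<lambda>t. ln (norm (C t x u))) \<in> borel_measurable T"
  proof -
    have "(\<lambda>t. C t x u) \<in> borel_measurable T"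
      using z zx by (intro cocycle_apply_measurable) (auto simp: space_restrict_space unit_sphere_bundle_def)
    thus ?thesis by simp
  qed
  have i: "integrable T (\<lambda>t. ln (norm (C t x u)))"
  proof (rule Bochner_Integration.integrable_bound[OF integrable_bound m AE_I2])
    fix t assume "t \<in> space T"
    from log_stretch_bound[OF this] z zx show "norm (ln (norm (C t x u))) \<le> norm (G t)" by force
  qed
  have "\<bar>mean_log_stretch T C z\<bar> \<le> (LINT t|T. \<bar>ln (norm (C t x u))\<bar>)"
    unfolding zx mean_log_stretch_def by (simp add: integral_abs_bound)
  also have "\<dots> \<le> (LINT t|T. G t)"
    using log_stretch_bound z zx i integrable_bound by (intro integral_mono) auto
  finally show ?thesis .
qed

lemma iter_lin_fibre:
  assumes \<omega>: "\<omega> \<in> space (noise T)" and x: "x \<in> X" and u: "u \<in> V x"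
  shows "iter_lin F C n \<omega> x u \<in> V (iter F n \<omega> x)"
    and "exp (- (\<Sum>j<n. G (\<omega> j))) * norm u \<le> norm (iter_lin F C n \<omega> x u)"
proof (induction n)
  case (Suc n)
  note in' = noise_component[OF \<omega>, of n] iter_in[OF base_random_map \<omega> x, of n]
  { case 1 show ?case using cocycleD(1)[OF in' Suc(1)] by simp }
  { case 2
    have "exp (- (\<Sum>j<Suc n. G (\<omega> j))) * norm u = exp (- G (\<omega> n)) * (exp (- (\<Sum>j<n. G (\<omega> j))) * norm u)"
      by (simp add: exp_add[symmetric])
    also have "\<dots> \<le> exp (- G (\<omega> n)) * norm (iter_lin F C n \<omega> x u)"
      using Suc(2) by (intro mult_left_mono) auto
    also have "\<dots> \<le> norm (iter_lin F C (Suc n) \<omega> x u)" using cocycleD(2)[OF in' Suc(1)] by simp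
    finally show ?case . }
qed (use u in auto)

lemma norm_iter_lin_le:
  assumes \<omega>: "\<omega> \<in> space (noise T)" and x: "x \<in> X"
  shows "norm (iter_lin F C n \<omega> x) \<le> exp (\<Sum>j<n. G (\<omega> j))"
proof (induction n)
  case 0
  show ?case by (simp add: norm_blinfun_id_le)
next
  case (Suc n)
  note in' = noise_component[OF \<omega>, of n] iter_in[OF base_random_map \<omega> x, of n]
  have "norm (iter_lin F C (Suc n) \<omega> x) \<le> norm (C (\<omega> n) (iter F n \<omega> x)) * norm (iter_lin F C n \<omega> x)"
    by (simp add: norm_blinfun_compose)
  also have "\<dots> \<le> exp (G (\<omega> n)) * exp (\<Sum>j<n. G (\<omega> j))"
    using Suc cocycleD(3)[OF in'] by (intro mult_mono) auto
  finally show ?case by (simp add: exp_add mult.commute)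
qed

lemma log_norm_iter_lin:
  assumes \<omega>: "\<omega> \<in> space (noise T)" and z: "(x, u) \<in> S"
  shows "0 < norm (iter_lin F C n \<omega> x u)" "norm (iter_lin F C n \<omega> x u) \<le> norm (iter_lin F C n \<omega> x)"
    "ln (norm (iter_lin F C n \<omega> x u)) \<le> ln (norm (iter_lin F C n \<omega> x))"
    "\<bar>ln (norm (iter_lin F C n \<omega> x))\<bar> \<le> (\<Sum>j<n. G (\<omega> j))"
    "\<bar>ln (norm (iter_lin F C n \<omega> x u))\<bar> \<le> (\<Sum>j<n. G (\<omega> j))"
proof -
  have u: "x \<in> X" "u \<in> V x" "norm u = 1" using z by (auto simp: unit_sphere_bundle_def)
  let ?s = "\<Sum>j<n. G (\<omega> j)"
  have l: "exp (- ?s) \<le> norm (iter_lin F C n \<omega> x u)" using iter_lin_fibre(2)[OF \<omega> u(1,2), of n] u(3) by simp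
  show pos: "0 < norm (iter_lin F C n \<omega> x u)" using l exp_gt_zero less_le_trans by blast
  show le: "norm (iter_lin F C n \<omega> x u) \<le> norm (iter_lin F C n \<omega> x)"
    using norm_blinfun[of "iter_lin F C n \<omega> x" u] u(3) by simp
  show ln_le: "ln (norm (iter_lin F C n \<omega> x u)) \<le> ln (norm (iter_lin F C n \<omega> x))"
    using pos le less_le_trans[OF pos le] by (subst ln_le_cancel_iff)
  have "- ?s \<le> ln (norm (iter_lin F C n \<omega> x u))" using l pos by (simp add: ln_ge_iff)
  moreover have "ln (norm (iter_lin F C n \<omega> x)) \<le> ?s"
    using norm_iter_lin_le[OF \<omega> u(1), of n] pos le by (metis exp_ln exp_le_cancel_iff less_le_trans)
  ultimately show "\<bar>ln (norm (iter_lin F C n \<omega> x))\<bar> \<le> ?s" "\<bar>ln (norm (iter_lin F C n \<omega> x u))\<bar> \<le> ?s"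
    using ln_le by (auto simp: abs_le_iff)
qed

lemma norm_iter_lin_pos: "\<omega> \<in> space (noise T) \<Longrightarrow> x \<in> X \<Longrightarrow> 0 < norm (iter_lin F C n \<omega> x)"
proof -
  assume \<omega>: "\<omega> \<in> space (noise T)" and x: "x \<in> X"
  obtain u where "u \<in> V x" "norm u = 1" using unit_vector_exists[OF x] .
  then have "(x, u) \<in> S" using x by (simp add: unit_sphere_bundle_def)
  from log_norm_iter_lin(1,2)[OF \<omega> this, of n] show ?thesis by linarith
qed

lemma log_norm_iter_lin_bound:
  assumes "\<omega> \<in> space (noise T)" "x \<in> X"
  shows "\<bar>ln (norm (iter_lin F C n \<omega> x))\<bar> \<le> (\<Sum>j<n. G (\<omega> j))"
proof -
  obtain u where "u \<in> V x" "norm u = 1" using unit_vector_exists[OF assms(2)] .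
  then have "(x, u) \<in> S" using assms(2) by (simp add: unit_sphere_bundle_def)
  thus ?thesis by (rule log_norm_iter_lin(4)[OF assms(1)])
qed

lemma iter_projective_action:
  assumes \<omega>: "\<omega> \<in> space (noise T)" and z: "(x, u) \<in> S"
  shows "iter (projective_action F C) n \<omega> (x, u) =
    (iter F n \<omega> x, iter_lin F C n \<omega> x u /\<^sub>R norm (iter_lin F C n \<omega> x u))"
proof (induction n)
  case 0
  show ?case using z by (simp add: unit_sphere_bundle_def)
next
  case (Suc n)
  let ?v = "iter_lin F C n \<omega> x u"
  have pos: "0 < norm ?v" by (rule log_norm_iter_lin(1)[OF \<omega> z])
  have "C t y (?v /\<^sub>R norm ?v) /\<^sub>R norm (C t y (?v /\<^sub>R norm ?v)) = C t y ?v /\<^sub>R norm (C t y ?v)" for t y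
    using pos by (simp add: blinfun.scaleR_right)
  then show ?case using Suc by (simp add: projective_action_def)
qed

text \<open>The projective action renormalises at every step, so the logarithm of each one-step
  stretch is a difference of consecutive logarithms and the sum telescopes.\<close>

lemma sum_log_stretch:
  assumes \<omega>: "\<omega> \<in> space (noise T)" and z: "(x, u) \<in> S"
  shows "(\<Sum>j<n. ln (norm (C (\<omega> j) (fst (iter (projective_action F C) j \<omega> (x, u))) (snd (iter (projective_action F C) j \<omega> (x, u))))))
     = ln (norm (iter_lin F C n \<omega> x u))"
proof (induction n)
  case 0
  show ?case using z by (simp add: unit_sphere_bundle_def)
next
  case (Suc n)
  let ?v = "iter_lin F C n \<omega> x u"
  have pos: "0 < norm ?v" "0 < norm (iter_lin F C (Suc n) \<omega> x u)" by (rule log_norm_iter_lin(1)[OF \<omega> z])+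
  have "ln (norm (C (\<omega> n) (iter F n \<omega> x) (?v /\<^sub>R norm ?v))) = ln (norm (C (\<omega> n) (iter F n \<omega> x) ?v)) - ln (norm ?v)"
    using pos by (simp add: blinfun.scaleR_right ln_mult ln_inverse)
  with Suc show ?case by (simp add: iter_projective_action[OF \<omega> z])
qed

lemma iter_lin_measurable: "(\<lambda>p. iter_lin F C n (fst p) (snd p) u) \<in> borel_measurable (noise T \<Otimes>\<^sub>M restrict_space borel X)"
proof (induction n)
  case (Suc n)
  have "(\<lambda>p. C (fst p n) (iter F n (fst p) (snd p)) (iter_lin F C n (fst p) (snd p) u)) \<in> borel_measurable (noise T \<Otimes>\<^sub>M restrict_space borel X)"
    by (rule cocycle_apply_measurable[OF _ iter_measurable'[OF base_random_map measurable_fst measurable_snd] Suc])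
      (auto intro: measurable_compose[OF measurable_fst])
  thus ?case by simp
qed simp

lemma log_norm_iter_lin_measurable:
  "(\<lambda>(\<omega>, x). ln (norm (iter_lin F C n \<omega> x))) \<in> borel_measurable (noise T \<Otimes>\<^sub>M restrict_space borel X)"
  using borel_measurable_norm_blinfun[OF iter_lin_measurable, of n] by (simp add: case_prod_beta')

lemma measurable_section_left:
  assumes "(\<lambda>(t, x). H t x) \<in> borel_measurable (A \<Otimes>\<^sub>M restrict_space borel Y)" "x \<in> Y"
  shows "(\<lambda>t. (H t x :: real)) \<in> borel_measurable A"
  using measurable_compose[OF measurable_Pair[OF measurable_ident measurable_const] assms(1)] assms(2)
  by (simp add: space_restrict_space)

lemma integrable_sum_bound: "integrable (noise T) (\<lambda>\<omega>. \<Sum>j<n. G (\<omega> j))"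
  by (intro Bochner_Integration.integrable_sum integrable_noise_component[OF T] integrable_bound)

lemma integral_sum_bound: "(LINT \<omega>|noise T. (\<Sum>j<n. G (\<omega> j))) = n * (LINT t|T. G t)"
proof -
  have "(LINT \<omega>|noise T. (\<Sum>j<n. G (\<omega> j))) = (\<Sum>j<n. LINT \<omega>|noise T. G (\<omega> j))"
    by (intro Bochner_Integration.integral_sum integrable_noise_component[OF T] integrable_bound)
  also have "\<dots> = (\<Sum>j<n. LINT t|T. G t)"
    using integrable_bound by (intro sum.cong refl integral_noise_component[OF T]) auto
  finally show ?thesis by simp
qed

lemma log_norm_integrable:
  assumes "x \<in> X" shows "integrable (noise T) (\<lambda>\<omega>. ln (norm (iter_lin F C n \<omega> x)))"
  using log_norm_iter_lin_bound[OF _ assms, of _ n]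
  by (intro Bochner_Integration.integrable_bound[OF integrable_sum_bound[of n]]
      measurable_section_left[OF log_norm_iter_lin_measurable assms] AE_I2) fastforce

lemma mean_log_norm_measurable:
  "(\<lambda>x. LINT \<omega>|noise T. ln (norm (iter_lin F C n \<omega> x))) \<in> borel_measurable (restrict_space borel X)"
  by (rule integral_over_noise_measurable[OF prob_space_noise[OF T] log_norm_iter_lin_measurable])

lemma mean_log_norm_bound:
  assumes "x \<in> X" shows "\<bar>LINT \<omega>|noise T. ln (norm (iter_lin F C n \<omega> x))\<bar> \<le> n * (LINT t|T. G t)"
proof -
  have "\<bar>LINT \<omega>|noise T. ln (norm (iter_lin F C n \<omega> x))\<bar> \<le> (LINT \<omega>|noise T. \<bar>ln (norm (iter_lin F C n \<omega> x))\<bar>)"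
    by (rule integral_abs_bound)
  also have "\<dots> \<le> (LINT \<omega>|noise T. (\<Sum>j<n. G (\<omega> j)))"
    using log_norm_iter_lin_bound[OF _ assms]
    by (intro integral_mono integrable_abs log_norm_integrable[OF assms] integrable_sum_bound)
  finally show ?thesis by (simp only: integral_sum_bound)
qed

lemma bounded_integrable:
  assumes \<mu>: "prob_space \<mu>" "sets \<mu> = sets (restrict_space borel Y)"
    and h: "h \<in> borel_measurable (restrict_space borel Y)" and b: "\<And>x. x \<in> Y \<Longrightarrow> \<bar>h x\<bar> \<le> B"
  shows "integrable \<mu> (h :: _ \<Rightarrow> real)"
proof -
  interpret prob_space \<mu> by fact
  have sp: "space \<mu> = Y" using sets_eq_imp_space_eq[OF \<mu>(2)] by (simp add: space_restrict_space)
  show ?thesis using h b \<mu>(2)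
    by (intro integrable_const_bound[of _ B] AE_I2) (auto simp: sp cong: measurable_cong_sets)
qed

lemma log_growth_lower: 
  assumes "prob_space \<mu>" "space \<mu> = X"
  shows "- (real n * (LINT t|T. G t)) \<le> log_growth T F C \<mu> n"
proof -
  interpret prob_space \<mu> by fact
  obtain x where "x \<in> X" using not_empty assms(2) by auto
  then have "0 \<le> (LINT t|T. G t)" using bound_nonneg by (intro integral_nonneg_AE AE_I2) auto
  then have "\<bar>log_growth T F C \<mu> n\<bar> \<le> real n * (LINT t|T. G t)"
    unfolding log_growth_def using mean_log_norm_bound assms(2)
    by (rule_tac prob_integral_abs_bound[OF assms(1)]) auto
  thus ?thesis by (simp add: abs_le_iff)
qed

text \<open>The norm is submultiplicative over the two blocks of letters. The second block is
  independent of the first, so its conditional mean is the mean log norm at the position reached,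
  and invariance of \<open>\<mu>\<close> removes that position.\<close>

lemma log_growth_subadditive:
  assumes \<mu>: "invariant_measure T X F \<mu>"
  shows "log_growth T F C \<mu> (n + m) \<le> log_growth T F C \<mu> n + log_growth T F C \<mu> m"
proof -
  have \<mu>': "prob_space \<mu>" "sets \<mu> = sets (restrict_space borel X)" using \<mu> by (auto simp: invariant_measure_def)
  have sp: "space \<mu> = X" using sets_eq_imp_space_eq[OF \<mu>'(2)] by (simp add: space_restrict_space)
  interpret prob_space \<mu> by fact
  obtain x0 where x0: "x0 \<in> X" using not_empty sp by auto
  let ?\<psi> = "\<lambda>n x. LINT \<omega>|noise T. ln (norm (iter_lin F C n \<omega> x))"
  let ?K = "LINT t|T. G t"
  have K0: "0 \<le> m * ?K" using mean_log_norm_bound[OF x0, of m] by linarith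
  note itm = iter_measurable'[OF base_random_map]
  have m1: "(\<lambda>x. LINT \<omega>|noise T. ?\<psi> m (iter F n \<omega> x)) \<in> borel_measurable (restrict_space borel X)"
    by (rule integral_over_noise_measurable[OF prob_space_noise[OF T]])
      (auto simp: case_prod_beta' intro!: measurable_compose[OF itm[OF measurable_fst measurable_snd] mean_log_norm_measurable])
  have b1: "\<bar>LINT \<omega>|noise T. ?\<psi> m (iter F n \<omega> x)\<bar> \<le> m * ?K" if "x \<in> X" for x
    using mean_log_norm_bound iter_in[OF base_random_map _ that] K0
    by (rule_tac prob_integral_abs_bound[OF prob_space_noise[OF T]]) auto
  have pt: "?\<psi> (n + m) x \<le> ?\<psi> n x + (LINT \<omega>|noise T. ?\<psi> m (iter F n \<omega> x))" if x: "x \<in> X" for x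
  proof -
    have i2: "integrable (noise T) (\<lambda>\<omega>. ln (norm (iter_lin F C m (\<lambda>k. \<omega> (n + k)) (iter F n \<omega> x))))"
    proof (rule Bochner_Integration.integrable_bound)
      show "integrable (noise T) (\<lambda>\<omega>. \<Sum>j<m. G (\<omega> (n + j)))"
        by (intro Bochner_Integration.integrable_sum integrable_noise_component[OF T] integrable_bound)
      have "(\<lambda>\<omega>. (\<lambda>(\<omega>, x). ln (norm (iter_lin F C m \<omega> x))) (\<lambda>k. \<omega> (n + k), iter F n \<omega> x)) \<in> borel_measurable (noise T)"
        using x by (intro measurable_compose[OF _ log_norm_iter_lin_measurable] measurable_Pair measurable_noise_shift
           iter_measurable'[OF base_random_map]) (auto simp: space_restrict_space)
      thus "(\<lambda>\<omega>. ln (norm (iter_lin F C m (\<lambda>k. \<omega> (n + k)) (iter F n \<omega> x)))) \<in> borel_measurable (noise T)" by simp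
      show "AE \<omega> in noise T. norm (ln (norm (iter_lin F C m (\<lambda>k. \<omega> (n + k)) (iter F n \<omega> x)))) \<le> norm (\<Sum>j<m. G (\<omega> (n + j)))"
      proof (rule AE_I2)
        fix \<omega> assume \<omega>: "\<omega> \<in> space (noise T)"
        from log_norm_iter_lin_bound[OF shift_in_space[OF this] iter_in[OF base_random_map this x], of m n n]
        show "norm (ln (norm (iter_lin F C m (\<lambda>k. \<omega> (n + k)) (iter F n \<omega> x)))) \<le> norm (\<Sum>j<m. G (\<omega> (n + j)))" by simp
      qed
    qed
    have "?\<psi> (n + m) x \<le> (LINT \<omega>|noise T. ln (norm (iter_lin F C n \<omega> x)) + ln (norm (iter_lin F C m (\<lambda>k. \<omega> (n + k)) (iter F n \<omega> x))))"
    proof (rule integral_mono)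
      fix \<omega> assume \<omega>: "\<omega> \<in> space (noise T)"
      let ?A = "iter_lin F C m (\<lambda>k. \<omega> (n + k)) (iter F n \<omega> x)" and ?B = "iter_lin F C n \<omega> x"
      have p: "0 < norm ?A" "0 < norm ?B"
        using norm_iter_lin_pos shift_in_space[OF \<omega>] iter_in[OF base_random_map \<omega> x] \<omega> x by blast+
      have "ln (norm (iter_lin F C (n + m) \<omega> x)) \<le> ln (norm ?A * norm ?B)"
        using norm_iter_lin_pos[OF \<omega> x, of "n + m"] norm_blinfun_compose[of ?A ?B] p by (subst ln_le_cancel_iff) (auto simp: iter_lin_add)
      also have "\<dots> = ln (norm ?B) + ln (norm ?A)" using p by (simp add: ln_mult)
      finally show "ln (norm (iter_lin F C (n + m) \<omega> x)) \<le> ln (norm ?B) + ln (norm ?A)" .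
    qed (intro log_norm_integrable[OF x] Bochner_Integration.integrable_add i2)+
    also have "\<dots> = ?\<psi> n x + (LINT \<omega>|noise T. ln (norm (iter_lin F C m (\<lambda>k. \<omega> (n + k)) (iter F n \<omega> x))))"
      by (rule Bochner_Integration.integral_add[OF log_norm_integrable[OF x] i2])
    also have "(LINT \<omega>|noise T. ln (norm (iter_lin F C m (\<lambda>k. \<omega> (n + k)) (iter F n \<omega> x)))) = (LINT \<omega>|noise T. ?\<psi> m (iter F n \<omega> x))"
      by (rule integral_noise_independent[OF T base_random_map x log_norm_iter_lin_measurable _ integrable_sum_bound[of m]])
        (rule log_norm_iter_lin_bound)
    finally show ?thesis .
  qed
  have "log_growth T F C \<mu> (n + m) \<le> (LINT x|\<mu>. ?\<psi> n x + (LINT \<omega>|noise T. ?\<psi> m (iter F n \<omega> x)))"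
    unfolding log_growth_def using pt
    by (intro integral_mono Bochner_Integration.integrable_add bounded_integrable[OF \<mu>' mean_log_norm_measurable mean_log_norm_bound]
         bounded_integrable[OF \<mu>' m1 b1]) (auto simp: sp)
  also have "\<dots> = log_growth T F C \<mu> n + (LINT x|\<mu>. LINT \<omega>|noise T. ?\<psi> m (iter F n \<omega> x))"
    unfolding log_growth_def
    by (intro Bochner_Integration.integral_add bounded_integrable[OF \<mu>' mean_log_norm_measurable mean_log_norm_bound]
         bounded_integrable[OF \<mu>' m1 b1])
  also have "(LINT x|\<mu>. LINT \<omega>|noise T. ?\<psi> m (iter F n \<omega> x)) = log_growth T F C \<mu> m"
    unfolding log_growth_def
    by (rule invariant_measure_iter[OF T base_random_map \<mu> mean_log_norm_measurable mean_log_norm_bound K0])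
  finally show ?thesis by simp
qed

lemma growth_rate:
  assumes \<mu>: "invariant_measure T X F \<mu>"
  shows "(\<lambda>n. log_growth T F C \<mu> n / n) \<longlonglongrightarrow> growth_rate T F C \<mu>"
    and "n > 0 \<Longrightarrow> growth_rate T F C \<mu> \<le> log_growth T F C \<mu> n / n"
proof -
  have \<mu>': "prob_space \<mu>" "sets \<mu> = sets (restrict_space borel X)" using \<mu> by (auto simp: invariant_measure_def)
  have sp: "space \<mu> = X" using sets_eq_imp_space_eq[OF \<mu>'(2)] by (simp add: space_restrict_space)
  obtain L where L: "(\<lambda>n. log_growth T F C \<mu> n / n) \<longlonglongrightarrow> L" "\<And>n. n > 0 \<Longrightarrow> L \<le> log_growth T F C \<mu> n / n"
    using subadditive_limit[OF log_growth_subadditive[OF \<mu>] log_growth_lower[OF \<mu>'(1) sp]] by blast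
  have "growth_rate T F C \<mu> = L" unfolding growth_rate_def by (rule limI[OF L(1)])
  with L show "(\<lambda>n. log_growth T F C \<mu> n / n) \<longlonglongrightarrow> growth_rate T F C \<mu>"
    "n > 0 \<Longrightarrow> growth_rate T F C \<mu> \<le> log_growth T F C \<mu> n / n" by auto
qed

lemma growth_rate_lower:
  assumes \<mu>: "invariant_measure T X F \<mu>"
  shows "\<bar>growth_rate T F C \<mu>\<bar> \<le> (LINT t|T. G t)"
proof -
  have \<mu>': "prob_space \<mu>" "sets \<mu> = sets (restrict_space borel X)" using \<mu> by (auto simp: invariant_measure_def)
  have sp: "space \<mu> = X" using sets_eq_imp_space_eq[OF \<mu>'(2)] by (simp add: space_restrict_space)
  interpret prob_space \<mu> by fact
  obtain x where "x \<in> X" using not_empty sp by auto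
  then have K0: "0 \<le> (LINT t|T. G t)" using bound_nonneg by (intro integral_nonneg_AE AE_I2) auto
  have "\<bar>log_growth T F C \<mu> n / n\<bar> \<le> (LINT t|T. G t)" for n :: nat
  proof (cases "n = 0")
    case False
    have "\<bar>log_growth T F C \<mu> n\<bar> \<le> real n * (LINT t|T. G t)"
      unfolding log_growth_def using mean_log_norm_bound sp K0
      by (rule_tac prob_integral_abs_bound[OF \<mu>'(1)]) auto
    thus ?thesis using False by (simp add: field_simps)
  qed (use K0 in simp)
  then show ?thesis
    by (intro tendsto_upperbound[OF tendsto_rabs[OF growth_rate(1)[OF \<mu>]]]) (auto intro!: always_eventually)
qed

end

end

text \<open>Krylov-Bogoliubov started from a point mass. It makes the infimum defining
  \<open>lyap_min\<close> range over a nonempty set.\<close>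

theorem invariant_measure_exists:
  fixes X :: "'a::{second_countable_topology,t2_space} set"
  assumes T: "prob_space T" and X: "compact X" "X \<noteq> {}" and F: "random_map T X F"
    and cont: "AE t in T. continuous_on X (F t)"
  obtains N where "invariant_measure T X F N"
proof -
  obtain x0 where x0: "x0 \<in> X" using X by auto
  define \<mu> where "\<mu> = return (restrict_space borel X) x0"
  have \<mu>: "prob_space \<mu>" unfolding \<mu>_def using x0 by (intro prob_space_return) (simp add: space_restrict_space)
  have cm: "(\<lambda>x. x) \<in> measurable \<mu> (restrict_space borel X)" by (simp add: \<mu>_def cong: measurable_cong_sets)
  define \<nu> where "\<nu> k = orbit_average T X F \<mu> (\<lambda>x. x) (Suc k)" for k
  have \<nu>: "prob_space (\<nu> k)" "sets (\<nu> k) = sets (restrict_space borel X)" for k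
    unfolding \<nu>_def by (rule orbit_average_prob[OF T \<mu> F cm])+
  obtain r N where r: "strict_mono r" and N: "prob_space N" "sets N = sets (restrict_space borel X)"
    and w: "\<And>h::'a\<Rightarrow>real. continuous_on X h \<Longrightarrow> (\<lambda>k. integral\<^sup>L (\<nu> (r k)) h) \<longlonglongrightarrow> integral\<^sup>L N h"
    using compact_prob_measures_subseq[of X \<nu>, OF X(1) \<nu>] by metis
  have "invariant_measure T X F N"
  proof (rule limit_of_almost_invariant[OF T X(1) F F _ cont \<nu> N w])
    show "AE t in T. continuously_convergent X (\<lambda>k. F t) (F t)"
      using cont by eventually_elim (rule continuously_convergent_const)
    fix h :: "'a \<Rightarrow> real" assume h: "continuous_on X h"
    have hm: "h \<in> borel_measurable (restrict_space borel X)" by (rule borel_measurable_continuous_on_restrict[OF h])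
    obtain B where B: "\<And>x. x \<in> X \<Longrightarrow> \<bar>h x\<bar> \<le> B"
      using compact_continuous_image[OF h X(1)] compact_imp_bounded bounded_iff by (metis imageI real_norm_def)
    have B0: "0 \<le> B" using B[OF x0] by linarith
    have lim: "(\<lambda>k. 2 * B / real (Suc k)) \<longlonglongrightarrow> 0" using LIMSEQ_Suc[OF lim_const_over_n[of "2 * B"]] by simp
    show "(\<lambda>k. (LINT z|\<nu> (r k). LINT t|T. h (F t z)) - integral\<^sup>L (\<nu> (r k)) h) \<longlonglongrightarrow> 0"
    proof (rule tendsto_rabs_zero_cancel, rule tendsto_sandwich[OF _ _ tendsto_const lim])
      show "\<forall>\<^sub>F k in sequentially. \<bar>(LINT z|\<nu> (r k). LINT t|T. h (F t z)) - integral\<^sup>L (\<nu> (r k)) h\<bar> \<le> 2 * B / real (Suc k)"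
      proof (intro always_eventually allI)
        fix k
        have "Suc k \<le> Suc (r k)" using seq_suble[OF r, of k] by simp
        then have "2 * B / Suc (r k) \<le> 2 * B / Suc k" using B0 by (intro divide_left_mono mult_pos_pos) auto
        with orbit_average_almost_invariant[OF T \<mu> F cm _ hm B B0, of "Suc (r k)"]
        show "\<bar>(LINT z|\<nu> (r k). LINT t|T. h (F t z)) - integral\<^sup>L (\<nu> (r k)) h\<bar> \<le> 2 * B / real (Suc k)"
          unfolding \<nu>_def by simp
      qed
    qed simp
  qed
  thus thesis by (rule that)
qed

section \<open>Limits of orbit averages and of growth rates\<close>

context sphere_bundle begin

lemma continuously_convergent_iter:
  assumes F: "\<And>j. random_map T X F" "\<And>k. random_map T X (F' k)" and \<omega>: "\<omega> \<in> space (noise T)"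
    and cF: "\<And>j. continuously_convergent X (\<lambda>k. F' k (\<omega> j)) (F (\<omega> j))"
    and cC: "\<And>j. continuously_convergent X (\<lambda>k. C' k (\<omega> j)) ((C :: 't \<Rightarrow> 'a \<Rightarrow> 'n \<Rightarrow>\<^sub>L 'n) (\<omega> j))"
  shows "continuously_convergent X (\<lambda>k. iter (F' k) n \<omega>) (iter F n \<omega>)"
    "continuously_convergent X (\<lambda>k. iter_lin (F' k) (C' k) n \<omega>) (iter_lin F C n \<omega>)"
proof (induction n)
  case 0
  { case 1 show ?case by (simp add: continuously_convergent_def) }
  { case 2 show ?case by (simp add: continuously_convergent_def) }
next
  case (Suc n)
  note in' = iter_in[OF F(1) \<omega>] iter_in[OF F(2) \<omega>]
  have F2: "continuously_convergent X (\<lambda>k x. F' k (\<omega> n) (iter (F' k) n \<omega> x)) (\<lambda>x. F (\<omega> n) (iter F n \<omega> x))"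
    using continuously_convergent_compose[OF Suc(1) cF] in' by blast
  have C2: "continuously_convergent X (\<lambda>k x. C' k (\<omega> n) (iter (F' k) n \<omega> x)) (\<lambda>x. C (\<omega> n) (iter F n \<omega> x))"
    using continuously_convergent_compose[OF Suc(1) cC] in' by blast
  { case 1 show ?case using F2 by simp }
  { case 2 show ?case
      using C2 Suc(2) unfolding continuously_convergent_def iter_lin.simps
      by (intro allI impI bounded_bilinear.tendsto[OF bounded_bilinear_blinfun_compose]) blast+ }
qed

text \<open>Normalisation and the logarithm are continuous away from zero, and \<open>nz\<close>
  places the limiting stretch there.\<close>

lemma continuously_convergent_projective_action:
  assumes cF: "continuously_convergent X (\<lambda>k. F' k t) (F t)"
    and cC: "continuously_convergent X (\<lambda>k. C' k t) ((C :: 't \<Rightarrow> 'a \<Rightarrow> 'n \<Rightarrow>\<^sub>L 'n) t)"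
    and nz: "\<And>x u. (x, u) \<in> S \<Longrightarrow> 0 < norm (C t x u)"
  shows "continuously_convergent S (\<lambda>k. projective_action (F' k) (C' k) t) (projective_action F C t)"
    "continuously_convergent S (\<lambda>k z. ln (norm (C' k t (fst z) (snd z)))) (\<lambda>z. ln (norm (C t (fst z) (snd z))))"
proof -
  have *: "(\<lambda>j. F' (r j) t (fst (z j))) \<longlonglongrightarrow> F t (fst z0) \<and> (\<lambda>j. C' (r j) t (fst (z j)) (snd (z j))) \<longlonglongrightarrow> C t (fst z0) (snd z0)"
    if "strict_mono r" "\<forall>j. z j \<in> S" "z0 \<in> S" "z \<longlonglongrightarrow> z0" for r z z0
  proof -
    have x: "fst (z j) \<in> X" "fst z0 \<in> X" for j using that(2,3) by (auto simp: unit_sphere_bundle_def split: prod.splits)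
       (metis (no_types, lifting) case_prodD mem_Collect_eq prod.collapse that(2) unit_sphere_bundle_def)+
    have l: "(\<lambda>j. fst (z j)) \<longlonglongrightarrow> fst z0" "(\<lambda>j. snd (z j)) \<longlonglongrightarrow> snd z0"
      using that(4) by (auto intro: tendsto_fst tendsto_snd)
    show ?thesis
      using continuously_convergentD[OF cF that(1) x l(1)] continuously_convergentD[OF cC that(1) x l(1)] l(2)
      by (auto intro: bounded_bilinear.tendsto[OF bounded_bilinear_blinfun_apply])
  qed
  have nz': "0 < norm (C t (fst z0) (snd z0))" if "z0 \<in> S" for z0 using nz[of "fst z0" "snd z0"] that by simp
  show "continuously_convergent S (\<lambda>k. projective_action (F' k) (C' k) t) (projective_action F C t)"
    unfolding continuously_convergent_def projective_action_def case_prod_beta'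
    using * nz' by (auto intro!: tendsto_Pair tendsto_scaleR tendsto_inverse tendsto_norm)
  show "continuously_convergent S (\<lambda>k z. ln (norm (C' k t (fst z) (snd z)))) (\<lambda>z. ln (norm (C t (fst z) (snd z))))"
    unfolding continuously_convergent_def
    using * nz' by (auto intro!: tendsto_ln tendsto_norm)
qed

text \<open>Along an orbit of the projective action the stretches add up to the log norm of one
  image vector, which is at most the log of the operator norm. The inequality is what a section
  costs compared with the best direction.\<close>

lemma orbit_average_log_stretch:
  assumes T: "prob_space T" and coc: "cocycle T X V F C G" and \<mu>: "prob_space \<mu>" "sets \<mu> = sets (restrict_space borel X)"
    and c: "c \<in> measurable (restrict_space borel X) (restrict_space borel S)" "\<forall>x\<in>X. fst (c x) = x" and n: "n > 0"
  shows "integral\<^sup>L (orbit_average T S (projective_action F C) \<mu> c n) (mean_log_stretch T C) \<le> log_growth T F C \<mu> n / n"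
proof -
  note L = base_random_map[OF T coc] projective_action_random_map[OF T coc]
  have sp: "space \<mu> = X" using sets_eq_imp_space_eq[OF \<mu>(2)] by (simp add: space_restrict_space)
  have cm: "c \<in> measurable \<mu> (restrict_space borel S)" using c(1) \<mu>(2) by (simp cong: measurable_cong_sets)
  have cS: "c x \<in> S" if "x \<in> X" for x using measurable_space[OF c(1), of x] that by (simp add: space_restrict_space)
  have cx: "c x = (x, snd (c x))" if "x \<in> X" for x using c(2) that by (metis prod.collapse)
  let ?\<Phi> = "projective_action F C"
  let ?g = "\<lambda>t z. ln (norm (C t (fst z) (snd z)))"
  have pt: "(LINT \<omega>|noise T. mean_log_stretch T C (iter ?\<Phi> j \<omega> (c x))) = (LINT \<omega>|noise T. ?g (\<omega> j) (iter ?\<Phi> j \<omega> (c x)))" if "x \<in> X" for j x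
    unfolding mean_log_stretch_def case_prod_beta'
    by (rule integral_noise_step[symmetric, OF T L(2) cS[OF that] log_stretch_measurable[OF T coc] _ integrable_bound[OF T coc]])
      (use log_stretch_bound[OF T coc] in force)
  have i1: "integrable (noise T) (\<lambda>\<omega>. ?g (\<omega> j) (iter ?\<Phi> j \<omega> (c x)))" if x: "x \<in> X" for j x
  proof (rule Bochner_Integration.integrable_bound[OF integrable_noise_component[OF T integrable_bound[OF T coc], of j]])
    have "(\<lambda>\<omega>. (\<lambda>(t, z). ?g t z) (\<omega> j, iter ?\<Phi> j \<omega> (c x))) \<in> borel_measurable (noise T)"
      using cS[OF x] by (intro measurable_compose[OF measurable_Pair log_stretch_measurable[OF T coc]] iter_measurable'[OF L(2)])
        (auto simp: space_restrict_space)
    thus "(\<lambda>\<omega>. ?g (\<omega> j) (iter ?\<Phi> j \<omega> (c x))) \<in> borel_measurable (noise T)" by simp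
    show "AE \<omega> in noise T. norm (?g (\<omega> j) (iter ?\<Phi> j \<omega> (c x))) \<le> norm (G (\<omega> j))"
    proof (rule AE_I2)
      fix \<omega> assume \<omega>: "\<omega> \<in> space (noise T)"
      have "(fst (iter ?\<Phi> j \<omega> (c x)), snd (iter ?\<Phi> j \<omega> (c x))) \<in> S" using iter_in[OF L(2) \<omega> cS[OF x]] by simp
      from log_stretch_bound[OF T coc noise_component[OF \<omega>] this, of j]
      show "norm (?g (\<omega> j) (iter ?\<Phi> j \<omega> (c x))) \<le> norm (G (\<omega> j))" by simp
    qed
  qed
  have le: "(\<Sum>j<n. LINT \<omega>|noise T. mean_log_stretch T C (iter ?\<Phi> j \<omega> (c x))) \<le> (LINT \<omega>|noise T. ln (norm (iter_lin F C n \<omega> x)))"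
    if x: "x \<in> X" for x
  proof -
    have "(\<Sum>j<n. LINT \<omega>|noise T. mean_log_stretch T C (iter ?\<Phi> j \<omega> (c x))) = (LINT \<omega>|noise T. (\<Sum>j<n. ?g (\<omega> j) (iter ?\<Phi> j \<omega> (c x))))"
      using pt[OF x] i1[OF x] by (simp add: Bochner_Integration.integral_sum)
    also have "\<dots> \<le> (LINT \<omega>|noise T. ln (norm (iter_lin F C n \<omega> x)))"
    proof (rule integral_mono)
      fix \<omega> assume \<omega>: "\<omega> \<in> space (noise T)"
      have z: "(x, snd (c x)) \<in> S" using cS[OF x] cx[OF x] by simp
      show "(\<Sum>j<n. ?g (\<omega> j) (iter ?\<Phi> j \<omega> (c x))) \<le> ln (norm (iter_lin F C n \<omega> x))"
        using sum_log_stretch[OF T coc \<omega> z, of n] log_norm_iter_lin(3)[OF T coc \<omega> z, of n] cx[OF x] by simp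
    qed (intro Bochner_Integration.integrable_sum i1[OF x] log_norm_integrable[OF T coc x])+
    finally show ?thesis .
  qed
  have B: "\<bar>mean_log_stretch T C z\<bar> \<le> (LINT t|T. G t)" if "z \<in> S" for z by (rule mean_log_stretch_bound[OF T coc that])
  have jm: "(\<lambda>x. LINT \<omega>|noise T. mean_log_stretch T C (iter ?\<Phi> j \<omega> (c x))) \<in> borel_measurable (restrict_space borel X)" for j
    by (rule integral_over_noise_measurable[OF prob_space_noise[OF T]])
      (auto simp: case_prod_beta' intro!: measurable_compose[OF iter_measurable'[OF L(2) measurable_fst measurable_compose[OF measurable_snd c(1)]]
          mean_log_stretch_measurable[OF T coc]])
  have jb: "\<bar>LINT \<omega>|noise T. mean_log_stretch T C (iter ?\<Phi> j \<omega> (c x))\<bar> \<le> (LINT t|T. G t)" if x: "x \<in> X" for j x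
  proof (rule prob_integral_abs_bound[OF prob_space_noise[OF T]])
    show "0 \<le> (LINT t|T. G t)" using B[OF cS[OF x]] by linarith
  qed (use B iter_in[OF L(2) _ cS[OF x]] in auto)
  have "integral\<^sup>L (orbit_average T S ?\<Phi> \<mu> c n) (mean_log_stretch T C) =
    (\<Sum>j<n. LINT x|\<mu>. LINT \<omega>|noise T. mean_log_stretch T C (iter ?\<Phi> j \<omega> (c x))) / n"
    by (rule integral_orbit_average[OF T \<mu>(1) L(2) cm n mean_log_stretch_measurable[OF T coc] B])
  also have "(\<Sum>j<n. LINT x|\<mu>. LINT \<omega>|noise T. mean_log_stretch T C (iter ?\<Phi> j \<omega> (c x))) =
     (LINT x|\<mu>. (\<Sum>j<n. LINT \<omega>|noise T. mean_log_stretch T C (iter ?\<Phi> j \<omega> (c x))))"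
    by (rule Bochner_Integration.integral_sum[symmetric]) (rule bounded_integrable[OF T coc \<mu> jm jb])
  also have "\<dots> \<le> log_growth T F C \<mu> n"
    unfolding log_growth_def
    by (intro integral_mono Bochner_Integration.integrable_sum bounded_integrable[OF T coc \<mu> jm jb] le
       bounded_integrable[OF T coc \<mu> mean_log_norm_measurable[OF T coc] mean_log_norm_bound[OF T coc]]) (auto simp: sp)
  finally show ?thesis by (simp add: divide_right_mono)
qed

text \<open>The base point starts with law \<open>\<mu>\<close>, which every step preserves, so each
  time slice already projects to \<open>\<mu>\<close>. Weak limits of the averages therefore lie
  over weak limits of the base measures.\<close>

lemma orbit_average_projects:
  fixes h :: "'a \<Rightarrow> real"
  assumes T: "prob_space T" and coc: "cocycle T X V F C G" and \<mu>: "invariant_measure T X F \<mu>"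
    and c: "c \<in> measurable (restrict_space borel X) (restrict_space borel S)" "\<forall>x\<in>X. fst (c x) = x" and n: "n > 0"
    and h: "h \<in> borel_measurable (restrict_space borel X)" and b: "\<And>x. x \<in> X \<Longrightarrow> \<bar>h x\<bar> \<le> B" and B: "0 \<le> B"
  shows "(LINT z|orbit_average T S (projective_action F C) \<mu> c n. h (fst z)) = integral\<^sup>L \<mu> h"
proof -
  have \<mu>': "prob_space \<mu>" "sets \<mu> = sets (restrict_space borel X)" using \<mu> by (auto simp: invariant_measure_def)
  note L = base_random_map[OF T coc] projective_action_random_map[OF T coc]
  have sp: "space \<mu> = X" using sets_eq_imp_space_eq[OF \<mu>'(2)] by (simp add: space_restrict_space)
  have cm: "c \<in> measurable \<mu> (restrict_space borel S)" using c(1) \<mu>'(2) by (simp cong: measurable_cong_sets)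
  have cS: "c x \<in> S" if "x \<in> X" for x using measurable_space[OF c(1), of x] that by (simp add: space_restrict_space)
  have cx: "c x = (x, snd (c x))" if "x \<in> X" for x using c(2) that by (metis prod.collapse)
  have it: "fst (iter (projective_action F C) j \<omega> (c x)) = iter F j \<omega> x" if "x \<in> X" "\<omega> \<in> space (noise T)" for x \<omega> j
    using iter_projective_action[OF T coc that(2), of x "snd (c x)" j] cS[OF that(1)] cx[OF that(1)] by simp
  have "(LINT z|orbit_average T S (projective_action F C) \<mu> c n. h (fst z)) =
     (\<Sum>j<n. LINT x|\<mu>. LINT \<omega>|noise T. h (fst (iter (projective_action F C) j \<omega> (c x)))) / n"
    using b by (intro integral_orbit_average[OF T \<mu>'(1) L(2) cm n measurable_compose[OF measurable_fst_sphere h]])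
      (auto simp: unit_sphere_bundle_def)
  also have "(\<Sum>j<n. LINT x|\<mu>. LINT \<omega>|noise T. h (fst (iter (projective_action F C) j \<omega> (c x)))) = 
     (\<Sum>j<n. LINT x|\<mu>. LINT \<omega>|noise T. h (iter F j \<omega> x))"
    using it by (intro sum.cong refl Bochner_Integration.integral_cong) (auto simp: sp)
  also have "\<dots> = (\<Sum>j<n. integral\<^sup>L \<mu> h)"
    by (intro sum.cong refl invariant_measure_iter[OF T L(1) \<mu> h b B])
  finally show ?thesis using n by simp
qed

lemma projected_invariant_measure:
  assumes T: "prob_space T" and coc: "cocycle T X V F C G" and N: "invariant_measure T S (projective_action F C) N"
  shows "invariant_measure T X F (distr N (restrict_space borel X) fst)"
proof -
  let ?\<mu> = "distr N (restrict_space borel X) fst"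
  note L = base_random_map[OF T coc] projective_action_random_map[OF T coc]
  have N': "prob_space N" "sets N = sets (restrict_space borel S)" using N by (auto simp: invariant_measure_def)
  interpret N: prob_space N by fact
  interpret T: prob_space T by fact
  have fm: "fst \<in> measurable N (restrict_space borel X)"
    using measurable_fst_sphere N'(2) by (simp cong: measurable_cong_sets)
  have \<mu>: "prob_space ?\<mu>" by (rule N.prob_space_distr[OF fm])
  interpret \<mu>: prob_space ?\<mu> by fact
  interpret TM: pair_prob_space T ?\<mu> ..
  have mF: "(\<lambda>(t, z). F t z) \<in> measurable (T \<Otimes>\<^sub>M ?\<mu>) (restrict_space borel X)"
    using L(1) unfolding random_map_def by (simp cong: measurable_cong_sets sets_pair_measure_cong)
  have "distr (T \<Otimes>\<^sub>M ?\<mu>) (restrict_space borel X) (\<lambda>(t, z). F t z) = ?\<mu>"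
  proof (rule compact_borel_measure_eqI[OF compact_base])
    show "prob_space (distr (T \<Otimes>\<^sub>M ?\<mu>) (restrict_space borel X) (\<lambda>(t, z). F t z))" by (rule TM.prob_space_distr[OF mF])
    fix h :: "'a \<Rightarrow> real" assume h: "continuous_on X h"
    have hm: "h \<in> borel_measurable (restrict_space borel X)" by (rule borel_measurable_continuous_on_restrict[OF h])
    have hm': "(\<lambda>z. h (fst z)) \<in> borel_measurable (restrict_space borel S)" by (rule measurable_compose[OF measurable_fst_sphere hm])
    obtain B where B: "\<And>x. x \<in> X \<Longrightarrow> \<bar>h x\<bar> \<le> B"
      using compact_continuous_image[OF h compact_base] compact_imp_bounded bounded_iff by (metis imageI real_norm_def)
    have "integral\<^sup>L (distr (T \<Otimes>\<^sub>M ?\<mu>) (restrict_space borel X) (\<lambda>(t, z). F t z)) h = (LINT x|?\<mu>. LINT t|T. h (F t x))"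
      by (rule integral_random_map[OF T L(1) \<mu> _ hm B]) auto
    also have "\<dots> = (LINT z|N. LINT t|T. h (F t (fst z)))"
      by (rule integral_distr[OF fm integral_over_noise_measurable[OF T random_map_comp_measurable[OF L(1) hm]]])
    also have "\<dots> = (LINT z|N. LINT t|T. h (fst (projective_action F C t z)))"
      by (simp add: projective_action_def case_prod_beta')
    also have "\<dots> = integral\<^sup>L (distr (T \<Otimes>\<^sub>M N) (restrict_space borel S) (\<lambda>(t, z). projective_action F C t z)) (\<lambda>z. h (fst z))"
      using B by (intro integral_random_map[symmetric, OF T L(2) N' hm']) (auto simp: unit_sphere_bundle_def)
    also have "\<dots> = (LINT z|N. h (fst z))" using N by (simp add: invariant_measure_def)
    also have "\<dots> = integral\<^sup>L ?\<mu> h" by (rule integral_distr[symmetric, OF fm hm])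
    finally show "integral\<^sup>L (distr (T \<Otimes>\<^sub>M ?\<mu>) (restrict_space borel X) (\<lambda>(t, z). F t z)) h = integral\<^sup>L ?\<mu> h" .
  qed (use \<mu> in auto)
  with \<mu> show ?thesis by (simp add: invariant_measure_def)
qed

text \<open>The convergence of rates is stated conditionally because \<open>N\<close> and its
  projection are known only after compactness has selected them; the premise is where
  coquasi-irreducibility will enter.\<close>

theorem growth_rate_subseq:
  fixes F :: "'t \<Rightarrow> 'a \<Rightarrow> 'a" and C :: "'t \<Rightarrow> 'a \<Rightarrow> 'n \<Rightarrow>\<^sub>L 'n"
  assumes T: "prob_space T" and coc: "cocycle T X V F C G" and coc': "\<And>k. cocycle T X V (F' k) (C' k) G"
    and cF: "AE t in T. continuously_convergent X (\<lambda>k. F' k t) (F t)"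
    and cC: "AE t in T. continuously_convergent X (\<lambda>k. C' k t) (C t)"
    and contF: "AE t in T. continuous_on X (F t)" and contC: "AE t in T. continuous_on X (C t)"
    and \<mu>: "\<And>k. invariant_measure T X (F' k) (\<mu> k)"
  obtains r N where "strict_mono r" "invariant_measure T S (projective_action F C) N"
    "invariant_measure T X F (distr N (restrict_space borel X) fst)"
    "\<And>h::'a\<Rightarrow>real. continuous_on X h \<Longrightarrow> (\<lambda>k. integral\<^sup>L (\<mu> (r k)) h) \<longlonglongrightarrow> integral\<^sup>L (distr N (restrict_space borel X) fst) h"
    "integral\<^sup>L N (mean_log_stretch T C) = growth_rate T F C (distr N (restrict_space borel X) fst) \<Longrightarrow>
      (\<lambda>k. growth_rate T (F' (r k)) (C' (r k)) (\<mu> (r k))) \<longlonglongrightarrow> growth_rate T F C (distr N (restrict_space borel X) fst)"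
proof -
  note L = base_random_map[OF T coc] projective_action_random_map[OF T coc]
  note L' = base_random_map[OF T coc'] projective_action_random_map[OF T coc']
  have \<mu>': "prob_space (\<mu> k)" "sets (\<mu> k) = sets (restrict_space borel X)" for k using \<mu> by (auto simp: invariant_measure_def)
  obtain c where c: "c \<in> measurable (restrict_space borel X) (restrict_space borel S)" "\<forall>x\<in>X. fst (c x) = x"
    using section_exists by blast
  have cm: "c \<in> measurable (\<mu> k) (restrict_space borel S)" for k using c(1) \<mu>'(2) by (simp cong: measurable_cong_sets)
  let ?\<Lambda> = "\<lambda>k. growth_rate T (F' k) (C' k) (\<mu> k)"
  \<comment> \<open>The bound \<open>n > k\<close> forces the invariance defect, of order 1/n, to
    vanish; the slack \<open>1 / Suc k\<close> lets the finite-time growth stand for the rate in the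
    limit.\<close>
  have "\<exists>n. n > k \<and> log_growth T (F' k) (C' k) (\<mu> k) n / n < ?\<Lambda> k + 1 / Suc k" for k
  proof -
    have "\<forall>\<^sub>F n in sequentially. log_growth T (F' k) (C' k) (\<mu> k) n / n < ?\<Lambda> k + 1 / Suc k"
      by (rule order_tendstoD(2)[OF growth_rate(1)[OF T coc' \<mu>]]) simp
    with eventually_gt_at_top[of k] have "\<forall>\<^sub>F n in sequentially. n > k \<and> log_growth T (F' k) (C' k) (\<mu> k) n / n < ?\<Lambda> k + 1 / Suc k"
      by (rule eventually_conj)
    thus ?thesis using eventually_happens'[OF sequentially_bot] by blast
  qed
  then obtain n where n: "\<And>k. n k > k" "\<And>k. log_growth T (F' k) (C' k) (\<mu> k) (n k) / n k < ?\<Lambda> k + 1 / Suc k" by metis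
  have n0: "n k > 0" for k using n(1)[of k] by simp
  define \<nu> where "\<nu> k = orbit_average T S (projective_action (F' k) (C' k)) (\<mu> k) c (n k)" for k
  have \<nu>: "prob_space (\<nu> k)" "sets (\<nu> k) = sets (restrict_space borel S)" for k
    unfolding \<nu>_def by (rule orbit_average_prob[OF T \<mu>'(1) L'(2) cm])+
  obtain r N where r: "strict_mono r" and N: "prob_space N" "sets N = sets (restrict_space borel S)"
    and w: "\<And>h::'a \<times> 'n\<Rightarrow>real. continuous_on S h \<Longrightarrow> (\<lambda>k. integral\<^sup>L (\<nu> (r k)) h) \<longlonglongrightarrow> integral\<^sup>L N h"
    using compact_prob_measures_subseq[of S \<nu>, OF compact_sphere \<nu>] by metis
  have nz: "AE t in T. \<forall>x u. (x, u) \<in> S \<longrightarrow> 0 < norm (C t x u)"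
    by (rule AE_I2) (auto simp: unit_sphere_bundle_def simp del: zero_less_norm_iff intro!: stretch_pos[OF T coc])
  have ccP: "AE t in T. continuously_convergent S (\<lambda>k. projective_action (F' (r k)) (C' (r k)) t) (projective_action F C t) \<and>
     continuously_convergent S (\<lambda>k z. ln (norm (C' (r k) t (fst z) (snd z)))) (\<lambda>z. ln (norm (C t (fst z) (snd z))))"
    using cF cC nz
  proof eventually_elim
    case (elim t)
    show ?case
      using continuously_convergent_projective_action[of "\<lambda>k. F' (r k)" t F "\<lambda>k. C' (r k)" C,
          OF continuously_convergent_subseq[OF elim(1) r] continuously_convergent_subseq[OF elim(2) r]] elim(3) by blast
  qed
  have coP: "AE t in T. continuous_on S (projective_action F C t) \<and> continuous_on S (\<lambda>z. ln (norm (C t (fst z) (snd z))))"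
    using contF contC nz
  proof eventually_elim
    case (elim t)
    show ?case
      using continuously_convergent_projective_action[of "\<lambda>_. F" t F "\<lambda>_. C" C,
          OF continuously_convergent_const[OF elim(1)] continuously_convergent_const[OF elim(2)]] elim(3)
      by (simp add: continuously_convergent_const_iff)
  qed
  have invN: "invariant_measure T S (projective_action F C) N"
  proof (rule limit_of_almost_invariant[OF T compact_sphere L'(2) L(2) _ _ \<nu> N w])
    show "AE t in T. continuously_convergent S (\<lambda>k. projective_action (F' (r k)) (C' (r k)) t) (projective_action F C t)"
      using ccP by eventually_elim simp
    show "AE t in T. continuous_on S (projective_action F C t)" using coP by eventually_elim simp
    fix h :: "'a \<times> 'n \<Rightarrow> real" assume h: "continuous_on S h"
    have hm: "h \<in> borel_measurable (restrict_space borel S)" by (rule borel_measurable_continuous_on_restrict[OF h])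
    obtain B where B: "\<And>x. x \<in> S \<Longrightarrow> \<bar>h x\<bar> \<le> B"
      using compact_continuous_image[OF h compact_sphere] compact_imp_bounded bounded_iff by (metis imageI real_norm_def)
    have B': "\<bar>h x\<bar> \<le> \<bar>B\<bar>" if "x \<in> S" for x using B[OF that] by simp
    have lim: "(\<lambda>k. 2 * \<bar>B\<bar> / real (Suc k)) \<longlonglongrightarrow> 0" using LIMSEQ_Suc[OF lim_const_over_n[of "2 * \<bar>B\<bar>"]] by simp
    show "(\<lambda>k. (LINT z|\<nu> (r k). LINT t|T. h (projective_action (F' (r k)) (C' (r k)) t z)) - integral\<^sup>L (\<nu> (r k)) h) \<longlonglongrightarrow> 0"
    proof (rule tendsto_rabs_zero_cancel, rule tendsto_sandwich[OF _ _ tendsto_const lim])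
      show "\<forall>\<^sub>F k in sequentially. \<bar>(LINT z|\<nu> (r k). LINT t|T. h (projective_action (F' (r k)) (C' (r k)) t z)) - integral\<^sup>L (\<nu> (r k)) h\<bar> \<le> 2 * \<bar>B\<bar> / real (Suc k)"
      proof (intro always_eventually allI)
        fix k
        have "Suc k \<le> n (r k)" using seq_suble[OF r, of k] n(1)[of "r k"] by simp
        then have "2 * \<bar>B\<bar> / n (r k) \<le> 2 * \<bar>B\<bar> / Suc k" by (intro divide_left_mono mult_pos_pos) auto
        with orbit_average_almost_invariant[OF T \<mu>'(1) L'(2) cm n0 hm B', of "r k" "r k" "r k"]
        show "\<bar>(LINT z|\<nu> (r k). LINT t|T. h (projective_action (F' (r k)) (C' (r k)) t z)) - integral\<^sup>L (\<nu> (r k)) h\<bar> \<le> 2 * \<bar>B\<bar> / real (Suc k)"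
          unfolding \<nu>_def by simp
      qed
    qed simp
  qed
  let ?\<mu> = "distr N (restrict_space borel X) fst"
  have inv\<mu>: "invariant_measure T X F ?\<mu>" by (rule projected_invariant_measure[OF T coc invN])
  have \<mu>'': "prob_space ?\<mu>" "sets ?\<mu> = sets (restrict_space borel X)" using inv\<mu> by (auto simp: invariant_measure_def)
  have fm: "fst \<in> measurable N (restrict_space borel X)"
    using measurable_fst_sphere N(2) by (simp cong: measurable_cong_sets)
  have weak: "(\<lambda>k. integral\<^sup>L (\<mu> (r k)) h) \<longlonglongrightarrow> integral\<^sup>L ?\<mu> h" if h: "continuous_on X h" for h :: "'a \<Rightarrow> real"
  proof -
    have hm: "h \<in> borel_measurable (restrict_space borel X)" by (rule borel_measurable_continuous_on_restrict[OF h])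
    obtain B where B: "\<And>x. x \<in> X \<Longrightarrow> \<bar>h x\<bar> \<le> B"
      using compact_continuous_image[OF h compact_base] compact_imp_bounded bounded_iff by (metis imageI real_norm_def)
    have B': "\<bar>h x\<bar> \<le> \<bar>B\<bar>" if "x \<in> X" for x using B[OF that] by simp
    have "continuous_on S (\<lambda>z. h (fst z))"
      by (rule continuous_on_compose2[OF h continuous_on_fst[OF continuous_on_id]]) (auto simp: unit_sphere_bundle_def)
    from w[OF this] show ?thesis
      using orbit_average_projects[OF T coc' \<mu> c n0 hm B'] integral_distr[OF fm hm] by (simp add: \<nu>_def)
  qed
  have conv: "(\<lambda>k. ?\<Lambda> (r k)) \<longlonglongrightarrow> growth_rate T F C ?\<mu>" if eq: "integral\<^sup>L N (mean_log_stretch T C) = growth_rate T F C ?\<mu>"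
  proof (rule tendstoI)
    fix e :: real assume e: "e > 0"
    have gm: "(\<lambda>t. ln (norm (D t (fst z) (snd z)))) \<in> borel_measurable T" "AE t in T. \<bar>ln (norm (D t (fst z) (snd z)))\<bar> \<le> G t"
      if "cocycle T X V H D G" "z \<in> S" for H D z
    proof -
      show "(\<lambda>t. ln (norm (D t (fst z) (snd z)))) \<in> borel_measurable T"
        using measurable_compose[OF measurable_Pair[OF measurable_ident measurable_const] log_stretch_measurable[OF T that(1)]] that(2)
        by (simp add: space_restrict_space)
      show "AE t in T. \<bar>ln (norm (D t (fst z) (snd z)))\<bar> \<le> G t"
        using log_stretch_bound[OF T that(1), of _ "fst z" "snd z"] that(2) by (intro AE_I2) auto
    qed
    have q: "continuously_convergent S (\<lambda>k. mean_log_stretch T (C' (r k))) (mean_log_stretch T C)"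
      unfolding mean_log_stretch_def case_prod_beta'
    proof (rule continuously_convergent_integral[where G=G])
      show "AE t in T. continuously_convergent S (\<lambda>k z. ln (norm (C' (r k) t (fst z) (snd z)))) (\<lambda>z. ln (norm (C t (fst z) (snd z))))"
        using ccP by eventually_elim simp
    qed (erule gm[OF coc'] gm[OF coc] | rule integrable_bound[OF T coc])+
    have qc: "continuous_on S (mean_log_stretch T C)"
      unfolding continuously_convergent_const_iff[symmetric] mean_log_stretch_def case_prod_beta'
    proof (rule continuously_convergent_integral[where G=G])
      show "AE t in T. continuously_convergent S (\<lambda>k z. ln (norm (C t (fst z) (snd z)))) (\<lambda>z. ln (norm (C t (fst z) (snd z))))"
        using coP by eventually_elim (simp add: continuously_convergent_const_iff)
    qed (erule gm[OF coc] | rule integrable_bound[OF T coc])+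
    have "(\<lambda>k. integral\<^sup>L (\<nu> (r k)) (mean_log_stretch T (C' (r k)))) \<longlonglongrightarrow> growth_rate T F C ?\<mu>"
      unfolding eq[symmetric]
      by (rule integral_continuously_convergent[OF compact_sphere q qc \<nu> w mean_log_stretch_measurable[OF T coc']])
    then have "\<forall>\<^sub>F k in sequentially. growth_rate T F C ?\<mu> - e / 2 < integral\<^sup>L (\<nu> (r k)) (mean_log_stretch T (C' (r k)))"
      using e by (intro order_tendstoD(1)) auto
    moreover have "\<forall>\<^sub>F k in sequentially. 1 / Suc k < e / 2"
    proof -
      have "(\<lambda>k. 1 / real (Suc k)) \<longlonglongrightarrow> 0" using LIMSEQ_Suc[OF lim_const_over_n[of 1]] by simp
      thus ?thesis using e by (intro order_tendstoD(2)) auto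
    qed
    \<comment> \<open>The stretch integrals converge to the rate at the limit by \<open>eq\<close>,
      and \<open>orbit_average_log_stretch\<close> together with the choice of \<open>n\<close>
      keeps them below \<open>?\<Lambda> (r k) + 1 / Suc (r k)\<close>.\<close>
    ultimately have lower: "\<forall>\<^sub>F k in sequentially. growth_rate T F C ?\<mu> - e < ?\<Lambda> (r k)"
    proof eventually_elim
      case (elim k)
      have "integral\<^sup>L (\<nu> (r k)) (mean_log_stretch T (C' (r k))) < ?\<Lambda> (r k) + 1 / Suc (r k)"
        using orbit_average_log_stretch[OF T coc' \<mu>' c n0, of "r k" "r k" "r k"] n(2)[of "r k"] unfolding \<nu>_def by linarith
      moreover have "1 / real (Suc (r k)) \<le> 1 / Suc k" using seq_suble[OF r, of k] by (intro divide_left_mono) auto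
      ultimately show ?case using elim by linarith
    qed
    \<comment> \<open>For the upper bound the time \<open>m\<close> is frozen while \<open>k\<close>
      grows: growth up to a fixed time converges, and it dominates every
      \<open>?\<Lambda> (r k)\<close> because the rate is an infimum over times.\<close>
    obtain m where m: "m > 0" "log_growth T F C ?\<mu> m / m < growth_rate T F C ?\<mu> + e / 2"
    proof -
      have "\<forall>\<^sub>F n in sequentially. log_growth T F C ?\<mu> n / n < growth_rate T F C ?\<mu> + e / 2"
        by (rule order_tendstoD(2)[OF growth_rate(1)[OF T coc inv\<mu>]]) (use e in simp)
      with eventually_gt_at_top[of 0] have "\<forall>\<^sub>F n in sequentially. n > 0 \<and> log_growth T F C ?\<mu> n / n < growth_rate T F C ?\<mu> + e / 2"
        by (rule eventually_conj)
      then show thesis using that eventually_happens'[OF sequentially_bot] by blast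
    qed
    have lnm: "(\<lambda>\<omega>. ln (norm (iter_lin H D m \<omega> x))) \<in> borel_measurable (noise T)" 
       "AE \<omega> in noise T. \<bar>ln (norm (iter_lin H D m \<omega> x))\<bar> \<le> (\<Sum>j<m. G (\<omega> j))" if "cocycle T X V H D G" "x \<in> X" for H D x
      using borel_measurable_integrable[OF log_norm_integrable[OF T that]] log_norm_iter_lin_bound[OF T that(1) _ that(2)]
      by (auto intro: AE_I2)
    have cc\<omega>: "AE \<omega> in noise T. \<forall>j. continuously_convergent X (\<lambda>k. F' (r k) (\<omega> j)) (F (\<omega> j)) \<and>
        continuously_convergent X (\<lambda>k. C' (r k) (\<omega> j)) (C (\<omega> j)) \<and> continuous_on X (F (\<omega> j)) \<and> continuous_on X (C (\<omega> j))"
      by (rule AE_noise_component[OF T]) (use cF cC contF contC in \<open>eventually_elim, auto intro: continuously_convergent_subseq[OF _ r]\<close>)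
    have lnc: "continuously_convergent X (\<lambda>k x. ln (norm (q k x))) (\<lambda>x. ln (norm (p x)))"
      if "continuously_convergent X q p" "\<And>x. x \<in> X \<Longrightarrow> 0 < norm (p x)" for q and p :: "'a \<Rightarrow> 'n \<Rightarrow>\<^sub>L 'n"
      using that unfolding continuously_convergent_def by (auto intro!: tendsto_ln tendsto_norm)
    have p: "continuously_convergent X (\<lambda>k x. LINT \<omega>|noise T. ln (norm (iter_lin (F' (r k)) (C' (r k)) m \<omega> x)))
       (\<lambda>x. LINT \<omega>|noise T. ln (norm (iter_lin F C m \<omega> x)))"
    proof (rule continuously_convergent_integral[where G="\<lambda>\<omega>. \<Sum>j<m. G (\<omega> j)"])
      show "AE \<omega> in noise T. continuously_convergent X (\<lambda>k x. ln (norm (iter_lin (F' (r k)) (C' (r k)) m \<omega> x))) (\<lambda>x. ln (norm (iter_lin F C m \<omega> x)))"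
        using cc\<omega> AE_space
      proof eventually_elim
        case (elim \<omega>)
        show ?case
          by (intro lnc continuously_convergent_iter(2)[OF L(1) L'(1)] norm_iter_lin_pos[OF T coc]) (use elim in auto)
      qed
    qed (erule lnm[OF coc'] lnm[OF coc] | rule integrable_sum_bound[OF T coc])+
    have pc: "continuous_on X (\<lambda>x. LINT \<omega>|noise T. ln (norm (iter_lin F C m \<omega> x)))"
      unfolding continuously_convergent_const_iff[symmetric]
    proof (rule continuously_convergent_integral[where G="\<lambda>\<omega>. \<Sum>j<m. G (\<omega> j)"])
      show "AE \<omega> in noise T. continuously_convergent X (\<lambda>k x. ln (norm (iter_lin F C m \<omega> x))) (\<lambda>x. ln (norm (iter_lin F C m \<omega> x)))"
        using cc\<omega> AE_space
      proof eventually_elim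
        case (elim \<omega>)
        show ?case
          by (intro lnc continuously_convergent_iter(2)[OF L(1) L(1)] norm_iter_lin_pos[OF T coc])
            (use elim in \<open>auto simp: continuously_convergent_const_iff\<close>)
      qed
    qed (erule lnm[OF coc] | rule integrable_sum_bound[OF T coc])+
    have "(\<lambda>k. log_growth T (F' (r k)) (C' (r k)) (\<mu> (r k)) m) \<longlonglongrightarrow> log_growth T F C ?\<mu> m"
      unfolding log_growth_def
      by (rule integral_continuously_convergent[OF compact_base p pc \<mu>' weak mean_log_norm_measurable[OF T coc']])
    then have "(\<lambda>k. log_growth T (F' (r k)) (C' (r k)) (\<mu> (r k)) m / m) \<longlonglongrightarrow> log_growth T F C ?\<mu> m / m"
      by (intro tendsto_divide) (use m in auto)
    then have "\<forall>\<^sub>F k in sequentially. log_growth T (F' (r k)) (C' (r k)) (\<mu> (r k)) m / m < growth_rate T F C ?\<mu> + e"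
      using m e by (intro order_tendstoD(2)) auto
    then have upper: "\<forall>\<^sub>F k in sequentially. ?\<Lambda> (r k) < growth_rate T F C ?\<mu> + e"
    proof eventually_elim
      case (elim k)
      then show ?case using growth_rate(2)[OF T coc' \<mu> m(1), of "r k"] by linarith
    qed
    show "\<forall>\<^sub>F k in sequentially. dist (?\<Lambda> (r k)) (growth_rate T F C ?\<mu>) < e"
      using lower upper by eventually_elim (auto simp: dist_real_def)
  qed
  show thesis by (rule that[OF r invN inv\<mu> weak conv])
qed

end

section \<open>Derivatives in charts\<close>

locale riemannian =
  fixes M :: "('a::{second_countable_topology, t2_space}, 'e::euclidean_space) manifold"
  assumes riemannian: "riemannian_manifold M"
begin

lemma chart:
  assumes "c \<in> atlas M"
  shows chart_dom_open: "open (chart_dom c)" and chart_img_open: "open (coord c ` chart_dom c)"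
    and coord_inv_coord: "\<And>x. x \<in> chart_dom c \<Longrightarrow> coord_inv c (coord c x) = x"
    and coord_continuous: "continuous_on (chart_dom c) (coord c)"
    and coord_inv_continuous: "continuous_on (coord c ` chart_dom c) (coord_inv c)"
  using riemannian assms unfolding riemannian_manifold_def homeomorphism_def by auto

lemma chart_at: "chart_at M x \<in> atlas M" "x \<in> chart_dom (chart_at M x)"
  using riemannian unfolding riemannian_manifold_def by auto

lemma coord_image_open:
  assumes "c \<in> atlas M" "open W" shows "open (coord c ` (W \<inter> chart_dom c))"
proof -
  have "coord c ` (W \<inter> chart_dom c) = coord c ` chart_dom c \<inter> coord_inv c -` W"
    using coord_inv_coord[OF assms(1)] by auto
  thus ?thesis
    using continuous_open_preimage[OF coord_inv_continuous chart_img_open, OF assms(1,1,2)] by simp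
qed

text \<open>A relation between arbitrary charts, so that differentiability and the value of the
  derivative travel together through changes of chart.\<close>

definition mderiv :: "('a, 'e) chart \<Rightarrow> ('a, 'e) chart \<Rightarrow> ('a \<Rightarrow> 'a) \<Rightarrow> 'a \<Rightarrow> ('e \<Rightarrow> 'e) \<Rightarrow> bool" where
  "mderiv c d F x A \<longleftrightarrow> ((coord d \<circ> F \<circ> coord_inv c) has_derivative A) (at (coord c x))"

lemma mderiv_unique: "mderiv c d F x A \<Longrightarrow> mderiv c d F x B \<Longrightarrow> A = B"
  unfolding mderiv_def by (rule has_derivative_unique)

lemma mderiv_linear: "mderiv c d F x A \<Longrightarrow> linear A"
  unfolding mderiv_def using has_derivative_bounded_linear bounded_linear.linear by blast

text \<open>The chart expression of \<open>F\<close> alone cannot tell whether \<open>F\<close>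
  stays in the domain of \<open>d\<close>, since \<open>coord d\<close> also has values outside it.
  Continuity of \<open>F\<close> provides a neighbourhood where the inner coordinates
  cancel.\<close>

lemma mderiv_compose:
  assumes cd: "c \<in> atlas M" "d \<in> atlas M" "x \<in> chart_dom c" "F x \<in> chart_dom d" and F: "isCont F x"
    and A: "mderiv c d F x A" and B: "mderiv d e H (F x) B"
  shows "mderiv c e (H \<circ> F) x (B \<circ> A)"
proof -
  have x: "(coord d \<circ> F \<circ> coord_inv c) (coord c x) = coord d (F x)" using coord_inv_coord cd by simp
  obtain W where W: "open W" "x \<in> W" "\<And>y. y \<in> W \<Longrightarrow> F y \<in> chart_dom d"
    using F chart_dom_open[OF cd(2)] cd(4) unfolding continuous_at_open by metis
  have "((coord e \<circ> H \<circ> coord_inv d) \<circ> (coord d \<circ> F \<circ> coord_inv c) has_derivative B \<circ> A) (at (coord c x))"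
    using A B x unfolding mderiv_def by (intro diff_chain_at) simp_all
  then show ?thesis unfolding mderiv_def
    by (rule has_derivative_transform_within_open[OF _ coord_image_open[OF cd(1) W(1)]])
      (use W cd coord_inv_coord in auto)
qed

lemma mderiv_change_target:
  assumes "c \<in> atlas M" "d \<in> atlas M" "x \<in> chart_dom c" "F x \<in> chart_dom d" "isCont F x"
    "mderiv c d F x A" "mderiv d e id (F x) B"
  shows "mderiv c e F x (B \<circ> A)"
  using mderiv_compose[OF assms(1-5,6,7)] unfolding id_comp .

lemma mderiv_change_source:
  assumes "c \<in> atlas M" "d \<in> atlas M" "x \<in> chart_dom c" "x \<in> chart_dom d"
    "mderiv c d id x A" "mderiv d e H x B"
  shows "mderiv c e H x (B \<circ> A)"
  using mderiv_compose[OF assms(1-3), of id A e H B] assms(4-6) unfolding comp_id by simp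

lemma mderiv_transform:
  assumes c: "c \<in> atlas M" "x \<in> chart_dom c" and A: "mderiv c d F x A"
    and W: "open W" "x \<in> W" "\<And>y. y \<in> W \<Longrightarrow> F y = H y"
  shows "mderiv c d H x A"
  using A unfolding mderiv_def
  by (rule has_derivative_transform_within_open[OF _ coord_image_open[OF c(1) W(1)]])
    (use W c coord_inv_coord in auto)

lemma mderiv_ident: assumes "c \<in> atlas M" "x \<in> chart_dom c" shows "mderiv c c id x id"
proof -
  have "((\<lambda>y. y) has_derivative id) (at (coord c x))" by (simp add: id_def)
  then show ?thesis unfolding mderiv_def
    by (rule has_derivative_transform_within_open[OF _ chart_img_open[OF assms(1)]]) (use assms coord_inv_coord in auto)
qed

lemma smooth_onD: assumes "smooth_on S f" "x \<in> S" shows "f differentiable (at x)" 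
  using assms(1)[unfolded smooth_on_def, rule_format, of "Suc 0"] assms(2) by simp

lemma transition_smooth: "c \<in> atlas M \<Longrightarrow> d \<in> atlas M \<Longrightarrow> smooth_on (coord c ` (chart_dom c \<inter> chart_dom d)) (coord d \<circ> coord_inv c)"
  using riemannian unfolding riemannian_manifold_def by blast

text \<open>Change of tangent coordinates is the derivative of the identity read in two charts; its
  linearity and invertibility become instances of the general rules.\<close>

lemma from_chart_mderiv:
  assumes c: "c \<in> atlas M" "x \<in> chart_dom c"
  shows "mderiv c (chart_at M x) id x (from_chart M c x)"
proof -
  have "coord (chart_at M x) \<circ> coord_inv c differentiable at (coord c x)"
    by (rule smooth_onD[OF transition_smooth[OF c(1) chart_at(1)]]) (use c chart_at in auto)
  thus ?thesis unfolding mderiv_def from_chart_def by (simp add: frechet_derivative_works comp_def)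
qed

lemma transition_mderiv:
  assumes "c \<in> atlas M" "x \<in> chart_dom c" "d \<in> atlas M" "x \<in> chart_dom d"
  obtains A where "mderiv c d id x A"
proof -
  have "coord d \<circ> coord_inv c differentiable at (coord c x)"
    by (rule smooth_onD[OF transition_smooth[OF assms(1,3)]]) (use assms in auto)
  thus thesis using that unfolding mderiv_def by (auto simp: differentiable_def comp_def)
qed

lemma from_chart_linear: "c \<in> atlas M \<Longrightarrow> x \<in> chart_dom c \<Longrightarrow> linear (from_chart M c x)"
  by (rule mderiv_linear[OF from_chart_mderiv])

lemma from_chart_bij:
  assumes c: "c \<in> atlas M" "x \<in> chart_dom c"
  shows "bij (from_chart M c x)"
proof -
  obtain A where A: "mderiv (chart_at M x) c id x A" using transition_mderiv[OF chart_at c] .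
  note m = from_chart_mderiv[OF c]
  have "A \<circ> from_chart M c x = id"
    using mderiv_unique[OF mderiv_change_source[OF c(1) chart_at(1) c(2) chart_at(2) m A] mderiv_ident[OF c]] .
  moreover have "from_chart M c x \<circ> A = id"
    using mderiv_unique[OF mderiv_change_source[OF chart_at(1) c(1) chart_at(2) c(2) A m] mderiv_ident[OF chart_at]] .
  ultimately show ?thesis by (rule o_bij)
qed

text \<open>Continuity is part of the notion for the reason seen in \<open>mderiv_compose\<close>:
  coordinates outside the chart domain carry no information.\<close>

definition mdiff :: "('a \<Rightarrow> 'a) \<Rightarrow> 'a \<Rightarrow> bool" where
  "mdiff F x \<longleftrightarrow> isCont F x \<and> mderiv (chart_at M x) (chart_at M (F x)) F x (tderiv M F x)"

lemma tderiv_eq: "mderiv (chart_at M x) (chart_at M (F x)) F x A \<Longrightarrow> tderiv M F x = A"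
  unfolding mderiv_def tderiv_def by (rule frechet_derivative_at[symmetric])

lemma mdiffI:
  assumes c: "c \<in> atlas M" "x \<in> chart_dom c" and d: "d \<in> atlas M" "F x \<in> chart_dom d"
    and F: "isCont F x" and A: "mderiv c d F x A"
  shows "mdiff F x" "tderiv M F x \<circ> from_chart M c x = from_chart M d (F x) \<circ> A"
proof -
  obtain B where B: "mderiv (chart_at M x) c id x B" using transition_mderiv[OF chart_at c] .
  have AB: "mderiv (chart_at M x) d F x (A \<circ> B)"
    by (rule mderiv_change_source[OF chart_at(1) c(1) chart_at(2) c(2) B A])
  have FA: "mderiv (chart_at M x) (chart_at M (F x)) F x (from_chart M d (F x) \<circ> (A \<circ> B))"
    by (rule mderiv_change_target[OF chart_at(1) d(1) chart_at(2) d(2) F AB from_chart_mderiv[OF d]])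
  show "mdiff F x" unfolding mdiff_def tderiv_eq[OF FA] using F FA by blast
  have "mderiv c (chart_at M (F x)) F x (tderiv M F x \<circ> from_chart M c x)"
    using mderiv_change_source[OF c(1) chart_at(1) c(2) chart_at(2) from_chart_mderiv[OF c] FA] unfolding tderiv_eq[OF FA] .
  moreover have "mderiv c (chart_at M (F x)) F x (from_chart M d (F x) \<circ> A)"
    by (rule mderiv_change_target[OF c(1) d(1) c(2) d(2) F A from_chart_mderiv[OF d]])
  ultimately show "tderiv M F x \<circ> from_chart M c x = from_chart M d (F x) \<circ> A" by (rule mderiv_unique)
qed

lemma mdiff_mderiv:
  assumes F: "mdiff F x" and c: "c \<in> atlas M" "x \<in> chart_dom c" and d: "d \<in> atlas M" "F x \<in> chart_dom d"
  obtains A where "mderiv c d F x A" "tderiv M F x \<circ> from_chart M c x = from_chart M d (F x) \<circ> A"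
proof -
  have cont: "isCont F x" and m: "mderiv (chart_at M x) (chart_at M (F x)) F x (tderiv M F x)" using F by (auto simp: mdiff_def)
  obtain B where B: "mderiv (chart_at M (F x)) d id (F x) B" using transition_mderiv[OF chart_at d] .
  have "mderiv c (chart_at M (F x)) F x (tderiv M F x \<circ> from_chart M c x)"
    by (rule mderiv_change_source[OF c(1) chart_at(1) c(2) chart_at(2) from_chart_mderiv[OF c] m])
  from mderiv_change_target[OF c(1) chart_at(1) c(2) chart_at(2) cont this B]
  have "mderiv c d F x (B \<circ> (tderiv M F x \<circ> from_chart M c x))" .
  with mdiffI(2)[OF c d cont this] that show thesis by blast
qed

lemma tderiv_linear: "mdiff F x \<Longrightarrow> linear (tderiv M F x)"
  unfolding mdiff_def using mderiv_linear by blast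

lemma mdiff_compose:
  assumes "mdiff F x" "mdiff H (F x)"
  shows "mdiff (H \<circ> F) x" "tderiv M (H \<circ> F) x = tderiv M H (F x) \<circ> tderiv M F x"
proof -
  have *: "mderiv (chart_at M x) (chart_at M (H (F x))) (H \<circ> F) x (tderiv M H (F x) \<circ> tderiv M F x)"
    using assms unfolding mdiff_def by (intro mderiv_compose[OF chart_at(1) chart_at(1) chart_at(2) chart_at(2)]) auto
  show "tderiv M (H \<circ> F) x = tderiv M H (F x) \<circ> tderiv M F x" using tderiv_eq[of x "H \<circ> F"] * by simp
  with * show "mdiff (H \<circ> F) x" using assms unfolding mdiff_def by (auto intro: continuous_at_compose[unfolded comp_def] simp: comp_def)
qed

lemma mdiff_id: "mdiff id x" "tderiv M id x = id"
  using mderiv_ident[OF chart_at, of x] tderiv_eq[of x id id] by (auto simp: mdiff_def)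

lemma C1_map_on_mdiff:
  assumes F: "C1_map_on M U F" and U: "open U" and x: "x \<in> U"
  shows "mdiff F x"
proof -
  have cont: "isCont F x" using F U x by (auto simp: C1_map_on_def continuous_on_eq_continuous_at)
  have "Ck_on 1 (coord (chart_at M x) ` (U \<inter> chart_dom (chart_at M x) \<inter> F -` chart_dom (chart_at M (F x))))
     (coord (chart_at M (F x)) \<circ> F \<circ> coord_inv (chart_at M x))"
    using F chart_at by (auto simp: C1_map_on_def)
  then have "(coord (chart_at M (F x)) \<circ> F \<circ> coord_inv (chart_at M x)) differentiable (at (coord (chart_at M x) x))"
    using x chart_at(2) by simp
  then obtain A where "mderiv (chart_at M x) (chart_at M (F x)) F x A"
    by (auto simp: mderiv_def differentiable_def)
  from mdiffI(1)[OF chart_at chart_at cont this] show ?thesis .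
qed

lemma C1_local_diffeo_mdiff:
  assumes "C1_local_diffeo M F"
  shows "mdiff F x" "bij (tderiv M F x)" "linear (tderiv M F x)" "linear (inv (tderiv M F x))"
proof -
  from assms have "\<exists>U G. open U \<and> x \<in> U \<and> open (F ` U) \<and> C1_map_on M U F \<and> C1_map_on M (F ` U) G \<and> (\<forall>y\<in>U. G (F y) = y)"
    unfolding C1_local_diffeo_def by (rule spec)
  then obtain U G where U: "open U" "x \<in> U" "open (F ` U)" "C1_map_on M U F" "C1_map_on M (F ` U) G" "\<And>y. y \<in> U \<Longrightarrow> G (F y) = y"
    by metis
  show F: "mdiff F x" by (rule C1_map_on_mdiff[OF U(4,1,2)])
  have G: "mdiff G (F x)" by (rule C1_map_on_mdiff[OF U(5,3)]) (use U in auto)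
  \<comment> \<open>The composite of \<open>F\<close> with its local inverse is the identity near
    \<open>x\<close>, so the chain rule produces a left inverse of the derivative; in equal finite
    dimensions injective is bijective.\<close>
  have m: "mderiv (chart_at M x) (chart_at M x) id x (tderiv M G (F x) \<circ> tderiv M F x)"
  proof (rule mderiv_transform[OF chart_at])
    show "mderiv (chart_at M x) (chart_at M x) (G \<circ> F) x (tderiv M G (F x) \<circ> tderiv M F x)"
      using mdiff_compose[OF F G] U(6)[OF U(2)] unfolding mdiff_def by simp
  qed (use U in auto)
  then have "tderiv M G (F x) \<circ> tderiv M F x = id" using mderiv_unique mderiv_ident[OF chart_at] by blast
  then have "inj (tderiv M F x)" by (metis inj_on_id inj_on_imageI2)
  show l: "linear (tderiv M F x)" by (rule tderiv_linear[OF F])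
  show "bij (tderiv M F x)" using \<open>inj (tderiv M F x)\<close> l linear_injective_imp_surjective by (auto simp: bij_def)
  thus "linear (inv (tderiv M F x))" using l using inj_linear_imp_inv_linear[OF l] bij_is_inj by blast
qed

end

section \<open>Linear algebra of the ambient maps\<close>

text \<open>The projection is defined by a definite description, so every computation with it goes
  through this uniqueness.\<close>

lemma orth_proj_unique:
  assumes W: "subspace W" and y: "y \<in> W" "\<And>w. w \<in> W \<Longrightarrow> orthogonal (z - y) w"
  shows "orth_proj W z = y"
  unfolding orth_proj_def
proof (rule the_equality)
  show "y \<in> W \<and> (\<forall>w\<in>W. orthogonal (z - y) w)" using y by blast
  fix y' assume y': "y' \<in> W \<and> (\<forall>w\<in>W. orthogonal (z - y') w)"
  have d: "y - y' \<in> W" using W y(1) y' subspace_diff by blast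
  have "(y - y') \<bullet> (y - y') = (z - y') \<bullet> (y - y') - (z - y) \<bullet> (y - y')" by (simp add: inner_diff_left)
  also have "\<dots> = 0" using y(2)[OF d] y' d by (simp add: orthogonal_def)
  finally show "y' = y" by simp
qed

lemma orth_proj:
  fixes W :: "'n::euclidean_space set"
  assumes W: "subspace W"
  shows "orth_proj W z \<in> W" "w \<in> W \<Longrightarrow> (z - orth_proj W z) \<bullet> w = 0"
proof -
  obtain y v where yv: "y \<in> span W" "\<And>w. w \<in> span W \<Longrightarrow> orthogonal v w" "z = y + v"
    using orthogonal_subspace_decomp_exists[of W z] by metis
  have "y \<in> W" "\<And>w. w \<in> W \<Longrightarrow> orthogonal (z - y) w" using yv W by (auto simp: span_eq_iff[THEN iffD2])
  note u = orth_proj_unique[OF W this] this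
  show "orth_proj W z \<in> W" using u by simp
  show "w \<in> W \<Longrightarrow> (z - orth_proj W z) \<bullet> w = 0" using u by (simp add: orthogonal_def)
qed

lemma orth_proj_in: "subspace W \<Longrightarrow> w \<in> W \<Longrightarrow> orth_proj W w = w"
  by (rule orth_proj_unique) (auto simp: orthogonal_def)

lemma orth_proj_linear:
  fixes W :: "'n::euclidean_space set"
  assumes W: "subspace W" shows "linear (orth_proj W)"
proof (rule linearI)
  fix a b :: 'n and r :: real
  note i = orth_proj(1)[OF W]
  show "orth_proj W (a + b) = orth_proj W a + orth_proj W b"
  proof (rule orth_proj_unique[OF W subspace_add[OF W i i]])
    fix w assume "w \<in> W"
    from orth_proj(2)[OF W this, of a] orth_proj(2)[OF W this, of b]
    show "orthogonal (a + b - (orth_proj W a + orth_proj W b)) w"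
      by (simp add: orthogonal_def inner_diff_left inner_add_left)
  qed
  show "orth_proj W (r *\<^sub>R a) = r *\<^sub>R orth_proj W a"
  proof (rule orth_proj_unique[OF W subspace_scale[OF W i]])
    fix w assume "w \<in> W"
    from orth_proj(2)[OF W this, of a]
    have "r * ((a - orth_proj W a) \<bullet> w) = 0" by simp
    then show "orthogonal (r *\<^sub>R a - r *\<^sub>R orth_proj W a) w"
      by (simp add: orthogonal_def inner_diff_left right_diff_distrib)
  qed
qed

lemma orth_proj_norm:
  fixes W :: "'n::euclidean_space set"
  assumes W: "subspace W" shows "norm (orth_proj W z) \<le> norm z"
proof -
  have "(norm z)\<^sup>2 = (norm (z - orth_proj W z + orth_proj W z))\<^sup>2" by simp
  also have "\<dots> = (norm (z - orth_proj W z))\<^sup>2 + (norm (orth_proj W z))\<^sup>2"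
    using orth_proj(2)[OF W] orth_proj(1)[OF W, of z] by (intro norm_add_Pythagorean) (simp add: orthogonal_def)
  finally have "(norm (orth_proj W z))\<^sup>2 \<le> (norm z)\<^sup>2" by simp
  thus ?thesis by (rule power2_le_imp_le) simp
qed

text \<open>A subspace is its own double complement; used to place a vector in a fibre by testing it
  against the vectors orthogonal to the fibre.\<close>

lemma orthogonal_complement_zero:
  fixes W :: "'n::euclidean_space set"
  assumes W: "subspace W" and z: "\<And>w. (\<And>v. v \<in> W \<Longrightarrow> v \<bullet> w = 0) \<Longrightarrow> z \<bullet> w = 0"
  shows "z \<in> W"
proof -
  let ?w = "z - orth_proj W z"
  have "v \<bullet> ?w = 0" if "v \<in> W" for v using orth_proj(2)[OF W that, of z] by (simp add: inner_commute)
  then have "z \<bullet> ?w = 0" "orth_proj W z \<bullet> ?w = 0" using z orth_proj(1)[OF W] by blast+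
  then have "?w \<bullet> ?w = 0" by (simp add: inner_diff_left)
  thus ?thesis using orth_proj(1)[OF W, of z] by simp
qed

text \<open>The square of \<open>norm (adjoint f y)\<close> is the inner product of
  \<open>f (adjoint f y)\<close> with \<open>y\<close>; Cauchy-Schwarz and one cancellation give the
  bound.\<close>

lemma onorm_adjoint_le:
  fixes f :: "'n::euclidean_space \<Rightarrow> 'm::euclidean_space"
  assumes "linear f" shows "onorm (adjoint f) \<le> onorm f"
proof (rule onorm_le)
  fix y
  have bl: "bounded_linear f" using assms by (simp add: linear_conv_bounded_linear)
  have "(norm (adjoint f y))\<^sup>2 = f (adjoint f y) \<bullet> y"
    by (simp add: power2_norm_eq_inner adjoint_works[OF assms, of "adjoint f y" y, symmetric])
  also have "\<dots> \<le> norm (f (adjoint f y)) * norm y" by (rule norm_cauchy_schwarz)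
  also have "\<dots> \<le> (onorm f * norm (adjoint f y)) * norm y" by (intro mult_right_mono onorm[OF bl]) simp
  finally have "norm (adjoint f y) * norm (adjoint f y) \<le> (onorm f * norm y) * norm (adjoint f y)"
    by (simp add: power2_eq_square mult_ac)
  thus "norm (adjoint f y) \<le> onorm f * norm y"
    using onorm_pos_le[OF bl] by (cases "norm (adjoint f y) = 0") (auto dest: mult_right_le_imp_le)
qed

lemma onorm_adjoint:
  fixes f :: "'n::euclidean_space \<Rightarrow> 'm::euclidean_space"
  assumes "linear f" shows "onorm (adjoint f) = onorm f"
  using onorm_adjoint_le[OF assms] onorm_adjoint_le[OF adjoint_linear[OF assms]] by (simp add: adjoint_adjoint[OF assms])

section \<open>Tangent maps as linear maps of the ambient space\<close>

locale embedded = riemannian M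
  for M :: "('a::{second_countable_topology, t2_space}, 'e::euclidean_space) manifold" +
  fixes X :: "'a set" and \<iota> :: "'a \<Rightarrow> 'e \<Rightarrow> 'n::euclidean_space"
  assumes compact_X: "compact X" and embedding: "isometric_embedding M X \<iota>"
begin

definition fibre :: "'a \<Rightarrow> 'n set" where "fibre x = range (\<iota> x)"

text \<open>The left inverse of \<open>\<iota> x\<close> that kills the orthogonal complement of the
  fibre; it is the factor by which \<open>ambient\<close> extends a tangent map.\<close>

definition retr :: "'a \<Rightarrow> 'n \<Rightarrow> 'e" where "retr x z = inv (\<iota> x) (orth_proj (fibre x) z)"

lemma emb_linear: "x \<in> X \<Longrightarrow> linear (\<iota> x)" and emb_norm: "x \<in> X \<Longrightarrow> norm (\<iota> x v) = tnorm M x v"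
  using embedding by (auto simp: isometric_embedding_def)

lemma tnorm_pos: "v \<noteq> 0 \<Longrightarrow> 0 < tnorm M x v"
  using riemannian by (simp add: riemannian_manifold_def tnorm_def)

lemma emb_eq_0: "x \<in> X \<Longrightarrow> \<iota> x v = 0 \<longleftrightarrow> v = 0"
  using emb_norm[of x v] tnorm_pos[of v x] linear_0[OF emb_linear] by (metis less_irrefl norm_zero)

lemma emb_inj: "x \<in> X \<Longrightarrow> inj (\<iota> x)"
  using emb_eq_0 linear_injective_0[OF emb_linear] by blast

lemma fibre_subspace: "x \<in> X \<Longrightarrow> subspace (fibre x)"
  unfolding fibre_def by (rule linear_subspace_image[OF emb_linear subspace_UNIV])

lemma emb_in_fibre [simp]: "\<iota> x v \<in> fibre x" by (simp add: fibre_def)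

lemma emb_retr: "x \<in> X \<Longrightarrow> \<iota> x (retr x z) = orth_proj (fibre x) z"
  unfolding retr_def using orth_proj(1)[OF fibre_subspace, of x z] by (simp add: fibre_def f_inv_into_f)

lemma retr_emb: "x \<in> X \<Longrightarrow> retr x (\<iota> x v) = v"
  unfolding retr_def by (simp add: orth_proj_in[OF fibre_subspace] inv_f_f[OF emb_inj])

lemma retr_orth: assumes x: "x \<in> X" and w: "\<And>v. v \<in> fibre x \<Longrightarrow> v \<bullet> w = 0" shows "retr x w = 0"
proof -
  have "orth_proj (fibre x) w = 0"
    using w by (intro orth_proj_unique[OF fibre_subspace[OF x]] subspace_0[OF fibre_subspace[OF x]])
      (auto simp: orthogonal_def inner_commute)
  thus ?thesis using emb_retr[OF x, of w] emb_eq_0[OF x] by simp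
qed

lemma retr_linear: assumes x: "x \<in> X" shows "linear (retr x)"
proof (rule linearI)
  note l = orth_proj_linear[OF fibre_subspace[OF x]]
  fix a b :: 'n and r :: real
  have "\<iota> x (retr x (a + b)) = \<iota> x (retr x a + retr x b)"
    by (simp add: emb_retr[OF x] linear_add[OF l] linear_add[OF emb_linear[OF x]])
  thus "retr x (a + b) = retr x a + retr x b" using emb_inj[OF x] by (simp add: inj_eq)
  have "\<iota> x (retr x (r *\<^sub>R a)) = \<iota> x (r *\<^sub>R retr x a)"
    by (simp add: emb_retr[OF x] linear_cmul[OF l] linear_cmul[OF emb_linear[OF x]])
  thus "retr x (r *\<^sub>R a) = r *\<^sub>R retr x a" using emb_inj[OF x] by (simp add: inj_eq)
qed

lemma ambient_eq: "ambient \<iota> x y A z = \<iota> y (A (retr x z))"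
  by (simp add: ambient_def retr_def fibre_def)

lemma ambient_linear: "x \<in> X \<Longrightarrow> y \<in> X \<Longrightarrow> linear A \<Longrightarrow> linear (ambient \<iota> x y A)"
proof -
  assume "x \<in> X" "y \<in> X" "linear A"
  then have "linear (\<iota> y \<circ> (A \<circ> retr x))" by (intro linear_compose retr_linear emb_linear)
  moreover have "ambient \<iota> x y A = \<iota> y \<circ> (A \<circ> retr x)" by (auto simp: ambient_eq)
  ultimately show ?thesis by simp
qed

text \<open>The embedding is isometric on the fibre and the projection onto it does not increase
  norms, so extending a tangent map by zero on the complement leaves its norm unchanged.\<close>

lemma opnorm_eq:
  assumes x: "x \<in> X" and y: "y \<in> X" and A: "linear A"
  shows "opnorm M x y A = onorm (ambient \<iota> x y A)"
proof -
  have bl: "bounded_linear (ambient \<iota> x y A)" using ambient_linear[OF assms] by (simp add: linear_conv_bounded_linear)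
  have le: "tnorm M y (A v) / tnorm M x v \<le> onorm (ambient \<iota> x y A)" for v
  proof (cases "v = 0")
    case True thus ?thesis using onorm_pos_le[OF bl] linear_0[OF A] emb_norm[OF x, of 0] linear_0[OF emb_linear[OF x]]
      by simp
  next
    case False
    have "tnorm M y (A v) = norm (ambient \<iota> x y A (\<iota> x v))" by (simp add: ambient_eq retr_emb[OF x] emb_norm[OF y])
    also have "\<dots> \<le> onorm (ambient \<iota> x y A) * tnorm M x v" using onorm[OF bl, of "\<iota> x v"] by (simp add: emb_norm[OF x])
    finally show ?thesis using tnorm_pos[OF False, of x] by (simp add: divide_simps)
  qed
  have bdd: "bdd_above (range (\<lambda>v. tnorm M y (A v) / tnorm M x v))" using le by (rule bdd_aboveI2)
  show ?thesis
  proof (rule antisym)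
    show "opnorm M x y A \<le> onorm (ambient \<iota> x y A)" unfolding opnorm_def by (rule cSUP_least) (use le in auto)
    show "onorm (ambient \<iota> x y A) \<le> opnorm M x y A"
    proof (rule onorm_le)
      fix z
      let ?v = "retr x z"
      have q: "tnorm M y (A ?v) / tnorm M x ?v \<le> opnorm M x y A" unfolding opnorm_def by (rule cSUP_upper[OF _ bdd]) simp
      \<comment> \<open>The supremum includes the zero vector, whose quotient is 0 by the convention
        on division; this yields nonnegativity.\<close>
      have "0 / 1 \<le> opnorm M x y A" unfolding opnorm_def
        by (rule order_trans[OF _ cSUP_upper[OF _ bdd, of 0]]) (use emb_norm[OF x, of 0] linear_0[OF emb_linear[OF x]] in auto)
      then have op0: "0 \<le> opnorm M x y A" by simp
      have "norm (ambient \<iota> x y A z) = tnorm M y (A ?v)" by (simp add: ambient_eq emb_norm[OF y])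
      also have "\<dots> \<le> opnorm M x y A * tnorm M x ?v"
      proof (cases "?v = 0")
        case True thus ?thesis using linear_0[OF A] emb_norm[OF y, of 0] linear_0[OF emb_linear[OF y]] op0
          by (metis emb_norm linear_0 emb_linear mult_zero_right norm_zero order_refl x)
      next
        case False thus ?thesis using q tnorm_pos[OF False, of x] by (simp add: divide_simps)
      qed
      also have "tnorm M x ?v \<le> norm z"
        using orth_proj_norm[OF fibre_subspace[OF x], of z] by (simp add: emb_norm[OF x, symmetric] emb_retr[OF x])
      finally show "norm (ambient \<iota> x y A z) \<le> opnorm M x y A * norm z"
        using op0 by (meson mult_left_mono order_trans)
    qed
  qed
qed

definition regular :: "('a \<Rightarrow> 'a) \<Rightarrow> 'a \<Rightarrow> bool" where
  "regular F x \<longleftrightarrow> mdiff F x \<and> bij (tderiv M F x)"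

lemma regularD:
  assumes "regular F x"
  shows "mdiff F x" "bij (tderiv M F x)" "linear (tderiv M F x)" "linear (inv (tderiv M F x))"
proof -
  show "mdiff F x" and b: "bij (tderiv M F x)" using assms by (auto simp: regular_def)
  then show l: "linear (tderiv M F x)" by (intro tderiv_linear)
  show "linear (inv (tderiv M F x))" using inj_linear_imp_inv_linear[OF l] b bij_is_inj by blast
qed

lemma regular_id: "regular id x" by (simp add: regular_def mdiff_id)

lemma regular_compose:
  assumes "regular F x" "regular H (F x)" shows "regular (H \<circ> F) x"
  using assms mdiff_compose[of F x H] unfolding regular_def by (auto intro: bij_comp)

lemma C1_local_diffeo_regular: "C1_local_diffeo M F \<Longrightarrow> regular F x"
  using C1_local_diffeo_mdiff unfolding regular_def by blast

definition amb_deriv :: "('a \<Rightarrow> 'a) \<Rightarrow> 'a \<Rightarrow> 'n \<Rightarrow>\<^sub>L 'n" where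
  "amb_deriv F x = Blinfun (ambient \<iota> x (F x) (tderiv M F x))"

definition amb_inv :: "('a \<Rightarrow> 'a) \<Rightarrow> 'a \<Rightarrow> 'n \<Rightarrow>\<^sub>L 'n" where
  "amb_inv F x = Blinfun (ambient \<iota> (F x) x (inv (tderiv M F x)))"

text \<open>When covectors are represented by fibre vectors through the inner product, composing a
  covector with the inverse derivative becomes applying the adjoint of the ambient inverse.\<close>

definition cot_deriv :: "('a \<Rightarrow> 'a) \<Rightarrow> 'a \<Rightarrow> 'n \<Rightarrow>\<^sub>L 'n" where
  "cot_deriv F x = Blinfun (adjoint (ambient \<iota> (F x) x (inv (tderiv M F x))))"

context
  fixes F :: "'a \<Rightarrow> 'a" and x :: 'a
  assumes F: "regular F x" and x: "x \<in> X" "F x \<in> X"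
begin

lemma amb_deriv_apply: "amb_deriv F x z = \<iota> (F x) (tderiv M F x (retr x z))"
  unfolding amb_deriv_def using ambient_linear[OF x regularD(3)[OF F]]
  by (subst bounded_linear_Blinfun_apply) (auto simp: linear_conv_bounded_linear ambient_eq)

lemma amb_inv_apply: "amb_inv F x z = \<iota> x (inv (tderiv M F x) (retr (F x) z))"
  unfolding amb_inv_def using ambient_linear[OF x(2,1) regularD(4)[OF F]]
  by (subst bounded_linear_Blinfun_apply) (auto simp: linear_conv_bounded_linear ambient_eq)

lemma cot_deriv_apply: "blinfun_apply (cot_deriv F x) = adjoint (amb_inv F x)"
proof -
  have "bounded_linear (adjoint (ambient \<iota> (F x) x (inv (tderiv M F x))))"
    using adjoint_linear[OF ambient_linear[OF x(2,1) regularD(4)[OF F]]] by (simp add: linear_conv_bounded_linear)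
  moreover have "blinfun_apply (amb_inv F x) = ambient \<iota> (F x) x (inv (tderiv M F x))"
    using amb_inv_apply by (auto simp: ambient_eq)
  ultimately show ?thesis unfolding cot_deriv_def by (simp add: bounded_linear_Blinfun_apply)
qed

lemma cot_deriv_inner: "cot_deriv F x u \<bullet> w = u \<bullet> amb_inv F x w"
proof -
  have "linear (amb_inv F x)" by (simp add: blinfun.bounded_linear_right linear_conv_bounded_linear)
  from adjoint_works[OF this, of w u] show ?thesis by (simp add: cot_deriv_apply inner_commute)
qed

lemma amb_inv_emb_deriv: "amb_inv F x (\<iota> (F x) (tderiv M F x v)) = \<iota> x v"
  using bij_is_inj[OF regularD(2)[OF F]] by (simp add: amb_inv_apply retr_emb[OF x(2)])

lemma cot_deriv_in_fibre: "cot_deriv F x u \<in> fibre (F x)"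
proof (rule orthogonal_complement_zero[OF fibre_subspace[OF x(2)]])
  fix w assume "\<And>v. v \<in> fibre (F x) \<Longrightarrow> v \<bullet> w = 0"
  then have "retr (F x) w = 0" by (rule retr_orth[OF x(2)])
  then have "amb_inv F x w = 0"
    using linear_0[OF regularD(4)[OF F]] linear_0[OF emb_linear[OF x(1)]] by (simp add: amb_inv_apply)
  thus "cot_deriv F x u \<bullet> w = 0" by (simp add: cot_deriv_inner)
qed

text \<open>Write u as the image of itself under derivative and then inverse; moving the inverse to
  the other side of the inner product gives
  \<open>u \<bullet> u = cot_deriv F x u \<bullet> amb_deriv F x u\<close>. Thus the norm of the
  derivative bounds the cotangent stretch from below.\<close>

lemma cot_deriv_lower: assumes "u \<in> fibre x" shows "norm u \<le> norm (amb_deriv F x) * norm (cot_deriv F x u)"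
proof (cases "u = 0")
  case False
  obtain v where v: "u = \<iota> x v" using assms by (auto simp: fibre_def)
  have "norm u * norm u = u \<bullet> amb_inv F x (\<iota> (F x) (tderiv M F x v))"
    using amb_inv_emb_deriv[of v] by (simp add: v power2_norm_eq_inner[symmetric] power2_eq_square)
  also have "\<dots> = cot_deriv F x u \<bullet> amb_deriv F x u"
    by (simp add: cot_deriv_inner amb_deriv_apply v retr_emb[OF x(1)])
  also have "\<dots> \<le> norm (cot_deriv F x u) * norm (amb_deriv F x u)" by (rule norm_cauchy_schwarz)
  also have "\<dots> \<le> norm (cot_deriv F x u) * (norm (amb_deriv F x) * norm u)"
    by (intro mult_left_mono norm_blinfun) simp
  finally have "norm u * norm u \<le> (norm (amb_deriv F x) * norm (cot_deriv F x u)) * norm u" by (simp add: mult_ac)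
  thus ?thesis using False by simp
qed simp

lemma norm_cot_deriv: "norm (cot_deriv F x) = norm (amb_inv F x)"
proof -
  have "linear (amb_inv F x)" by (simp add: blinfun.bounded_linear_right linear_conv_bounded_linear)
  from onorm_adjoint[OF this] show ?thesis by (simp add: norm_blinfun.rep_eq cot_deriv_apply)
qed

lemma opnorm_deriv: "opnorm M x (F x) (tderiv M F x) = norm (amb_deriv F x)"
proof -
  have "blinfun_apply (amb_deriv F x) = ambient \<iota> x (F x) (tderiv M F x)" using amb_deriv_apply by (auto simp: ambient_eq)
  thus ?thesis by (simp add: opnorm_eq[OF x regularD(3)[OF F]] norm_blinfun.rep_eq)
qed

lemma opnorm_inv: "opnorm M (F x) x (inv (tderiv M F x)) = norm (cot_deriv F x)"
proof -
  have "blinfun_apply (amb_inv F x) = ambient \<iota> (F x) x (inv (tderiv M F x))" using amb_inv_apply by (auto simp: ambient_eq)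
  then have "norm (amb_inv F x) = onorm (ambient \<iota> (F x) x (inv (tderiv M F x)))" by (simp add: norm_blinfun.rep_eq)
  thus ?thesis unfolding norm_cot_deriv by (simp only: opnorm_eq[OF x(2,1) regularD(4)[OF F]])
qed

text \<open>The reason why the smallest exponent is minus the growth rate of the cotangent
  cocycle.\<close>

lemma conorm_deriv: "conorm M x (F x) (tderiv M F x) = inverse (norm (cot_deriv F x))"
  by (simp add: conorm_def opnorm_inv)

end

lemma dist_amb_deriv:
  assumes "regular F x" "regular H x" "x \<in> X" "F x \<in> X" "H x \<in> X"
  shows "onorm (\<lambda>z. ambient \<iota> x (F x) (tderiv M F x) z - ambient \<iota> x (H x) (tderiv M H x) z) = norm (amb_deriv F x - amb_deriv H x)"
  using assms by (simp add: norm_blinfun.rep_eq minus_blinfun.rep_eq amb_deriv_apply ambient_eq)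

text \<open>Taking adjoints preserves norms, so the inverse-derivative term of
  \<open>dist_C1\<close> measures exactly the change of the cotangent cocycle.\<close>

lemma dist_cot_deriv:
  assumes "regular F x" "regular H x" "x \<in> X" "F x \<in> X" "H x \<in> X"
  shows "onorm (\<lambda>z. ambient \<iota> (F x) x (inv (tderiv M F x)) z - ambient \<iota> (H x) x (inv (tderiv M H x)) z) = norm (cot_deriv F x - cot_deriv H x)"
proof -
  let ?D = "amb_inv F x - amb_inv H x"
  have l: "linear (blinfun_apply ?D)" by (simp add: blinfun.bounded_linear_right linear_conv_bounded_linear)
  have "blinfun_apply (cot_deriv F x - cot_deriv H x) = adjoint ?D"
  proof (rule adjoint_unique[symmetric], intro allI)
    fix z u
    show "blinfun_apply ?D z \<bullet> u = z \<bullet> blinfun_apply (cot_deriv F x - cot_deriv H x) u"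
      using cot_deriv_inner[OF assms(1,3,4), of u z] cot_deriv_inner[OF assms(2,3,5), of u z]
      by (simp add: minus_blinfun.rep_eq inner_diff_left inner_diff_right inner_commute)
  qed
  then have "norm (cot_deriv F x - cot_deriv H x) = onorm (blinfun_apply ?D)"
    using onorm_adjoint[OF l] by (simp add: norm_blinfun.rep_eq)
  also have "blinfun_apply ?D = (\<lambda>z. ambient \<iota> (F x) x (inv (tderiv M F x)) z - ambient \<iota> (H x) x (inv (tderiv M H x)) z)"
    using assms by (auto simp: minus_blinfun.rep_eq amb_inv_apply ambient_eq)
  finally show ?thesis by simp
qed

text \<open>Inversion and adjunction both reverse the order of composition, so together they keep it
  and the result is a cocycle over the maps themselves.\<close>

lemma cot_deriv_compose:
  assumes "regular F x" "regular H (F x)" "x \<in> X" "F x \<in> X" "H (F x) \<in> X"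
  shows "cot_deriv (H \<circ> F) x = cot_deriv H (F x) o\<^sub>L cot_deriv F x"
proof (rule blinfun_eqI)
  fix u
  have r: "regular (H \<circ> F) x" by (rule regular_compose[OF assms(1,2)])
  have inv: "inv (tderiv M (H \<circ> F) x) = inv (tderiv M F x) \<circ> inv (tderiv M H (F x))"
    using mdiff_compose(2)[OF regularD(1)[OF assms(1)] regularD(1)[OF assms(2)]] o_inv_distrib[OF regularD(2)[OF assms(2)] regularD(2)[OF assms(1)]]
    by simp
  have "cot_deriv (H \<circ> F) x u \<bullet> w = (cot_deriv H (F x) o\<^sub>L cot_deriv F x) u \<bullet> w" for w
    using assms by (simp add: cot_deriv_inner[OF r] cot_deriv_inner amb_inv_apply[OF r] amb_inv_apply inv retr_emb)
  thus "cot_deriv (H \<circ> F) x u = (cot_deriv H (F x) o\<^sub>L cot_deriv F x) u"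
    by (metis vector_eq_rdot)
qed

section \<open>Covectors\<close>

text \<open>Riesz representation: a vector of the fibre acts as a covector through the ambient inner
  product.\<close>

definition cov :: "'a \<Rightarrow> 'n \<Rightarrow> 'e \<Rightarrow>\<^sub>L real" where "cov x u = Blinfun (\<lambda>v. u \<bullet> \<iota> x v)"

lemma cov_apply: assumes "x \<in> X" shows "cov x u v = u \<bullet> \<iota> x v"
proof -
  have "bounded_linear (\<lambda>v. u \<bullet> \<iota> x v)"
    using linear_compose[OF emb_linear[OF assms], of "\<lambda>z. u \<bullet> z"] bounded_linear_inner_right[of u]
    by (simp add: linear_conv_bounded_linear comp_def)
  thus ?thesis unfolding cov_def by (simp add: bounded_linear_Blinfun_apply)
qed

lemma cov_scale: "x \<in> X \<Longrightarrow> cov x (r *\<^sub>R u) = r *\<^sub>R cov x u"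
  by (rule blinfun_eqI) (simp add: cov_apply scaleR_blinfun.rep_eq)

text \<open>Cauchy-Schwarz bounds each quotient, with equality at the tangent vector that
  \<open>\<iota> x\<close> sends to \<open>u\<close>.\<close>

lemma cotnorm_cov: assumes x: "x \<in> X" and u: "u \<in> fibre x" shows "cotnorm M x (cov x u) = norm u"
proof -
  have le: "\<bar>cov x u v\<bar> / tnorm M x v \<le> norm u" for v
  proof (cases "v = 0")
    case False
    have "\<bar>cov x u v\<bar> \<le> norm u * tnorm M x v"
      using Cauchy_Schwarz_ineq2[of u "\<iota> x v"] by (simp add: cov_apply[OF x] emb_norm[OF x])
    thus ?thesis using tnorm_pos[OF False, of x] by (simp add: divide_simps)
  qed (simp add: cov_apply[OF x] linear_0[OF emb_linear[OF x]])
  obtain v where v: "u = \<iota> x v" using u by (auto simp: fibre_def)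
  have "\<bar>cov x u v\<bar> / tnorm M x v = norm u"
    by (simp add: cov_apply[OF x] v emb_norm[OF x, symmetric] power2_norm_eq_inner[symmetric] power2_eq_square)
  then show ?thesis unfolding cotnorm_def
    by (intro cSup_eq_maximum image_eqI[of _ _ v]) (use le in auto)
qed

lemma cov_eq_0: "x \<in> X \<Longrightarrow> u \<in> fibre x \<Longrightarrow> cov x u = 0 \<longleftrightarrow> u = 0"
  using cotnorm_cov[of x u] cov_apply[of x u] 
  by (metis (no_types, lifting) fibre_def imageE inner_eq_zero_iff inner_zero_left blinfun_eqI zero_blinfun.rep_eq)

text \<open>The representing vector is the adjoint of \<xi> \<circ> \<open>retr x\<close> evaluated
  at 1. It lies in the fibre because \<open>retr x\<close> kills the orthogonal complement.\<close>

lemma cov_surj: assumes x: "x \<in> X" obtains u where "u \<in> fibre x" "cov x u = \<xi>"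
proof -
  have l: "linear (\<lambda>z. blinfun_apply \<xi> (retr x z))"
    using linear_compose[OF retr_linear[OF x], of "blinfun_apply \<xi>"] blinfun.bounded_linear_right[of \<xi>]
    by (simp add: linear_conv_bounded_linear comp_def)
  define u where "u = adjoint (\<lambda>z. blinfun_apply \<xi> (retr x z)) 1"
  have u: "z \<bullet> u = \<xi> (retr x z)" for z using adjoint_works[OF l, of z 1] by (simp add: u_def)
  have "u \<in> fibre x"
  proof (rule orthogonal_complement_zero[OF fibre_subspace[OF x]])
    fix w assume "\<And>v. v \<in> fibre x \<Longrightarrow> v \<bullet> w = 0"
    from retr_orth[OF x this] u[of w] show "u \<bullet> w = 0" by (simp add: inner_commute)
  qed
  moreover have "cov x u = \<xi>"
  proof (rule blinfun_eqI)
    fix v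
    show "cov x u v = \<xi> v" using u[of "\<iota> x v"] by (simp add: cov_apply[OF x] inner_commute[of u] retr_emb[OF x])
  qed
  ultimately show thesis by (rule that)
qed

lemma cot_push_cov:
  assumes F: "regular F x" and x: "x \<in> X" "F x \<in> X"
  shows "cot_push M F x (cov x u) = cov (F x) (cot_deriv F x u)"
proof (rule blinfun_eqI)
  fix w
  have bl: "bounded_linear (inv (tderiv M F x))" using regularD(4)[OF F] by (simp add: linear_conv_bounded_linear)
  show "cot_push M F x (cov x u) w = cov (F x) (cot_deriv F x u) w"
    by (simp add: cot_push_def bounded_linear_Blinfun_apply[OF bl] cov_apply x cot_deriv_inner[OF F x] amb_inv_apply[OF F x] retr_emb)
qed

lemma cot_push_scale: "cot_push M F x (r *\<^sub>R \<xi>) = r *\<^sub>R cot_push M F x \<xi>"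
  by (rule blinfun_eqI) (simp add: cot_push_def scaleR_blinfun.rep_eq)

definition cot_line :: "'a \<times> 'n \<Rightarrow> 'a \<times> ('e \<Rightarrow>\<^sub>L real) set" where
  "cot_line = (\<lambda>(x, u). (x, span {cov x u}))"

abbreviation "SX \<equiv> unit_sphere_bundle X fibre"

lemma span_scale: "r \<noteq> 0 \<Longrightarrow> span {r *\<^sub>R \<xi>} = span {\<xi>}" for \<xi> :: "'c::real_vector"
  using span_image_scale[of "{\<xi>}" "\<lambda>_. r"] by simp

lemma cot_line_image: "cot_line ` SX = proj_cotangent X"
proof
  show "cot_line ` SX \<subseteq> proj_cotangent X"
  proof
    fix p assume "p \<in> cot_line ` SX"
    then obtain x u where xu: "x \<in> X" "u \<in> fibre x" "norm u = 1" "p = (x, span {cov x u})"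
      by (auto simp: cot_line_def unit_sphere_bundle_def)
    moreover have "cov x u \<noteq> 0" using xu cov_eq_0[of x u] by auto
    ultimately show "p \<in> proj_cotangent X" by (auto simp: proj_cotangent_def)
  qed
  show "proj_cotangent X \<subseteq> cot_line ` SX"
  proof
    fix p :: "'a \<times> ('e \<Rightarrow>\<^sub>L real) set" assume "p \<in> proj_cotangent X"
    then obtain x \<xi> where p: "x \<in> X" "\<xi> \<noteq> 0" "p = (x, span {\<xi>})" by (auto simp: proj_cotangent_def)
    obtain u where u: "u \<in> fibre x" "cov x u = \<xi>" using cov_surj[OF p(1)] .
    have u0: "u \<noteq> 0" using u p cov_eq_0 by auto
    have "(x, u /\<^sub>R norm u) \<in> SX" using p u u0 subspace_scale[OF fibre_subspace] by (simp add: unit_sphere_bundle_def)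
    moreover have "p = cot_line (x, u /\<^sub>R norm u)"
      using u u0 p span_scale[of "inverse (norm u)" \<xi>] by (simp add: cot_line_def cov_scale)
    ultimately show "p \<in> cot_line ` SX" by blast
  qed
qed

text \<open>Passing to lines intertwines the normalised action on unit vectors with the
  projectivised cotangent map, so measures can be moved from spheres to lines.\<close>

lemma proj_cot_map_line:
  assumes F: "regular F x" and xu: "(x, u) \<in> SX" and Fx: "F x \<in> X"
  shows "proj_cot_map M F (cot_line (x, u)) = cot_line (F x, cot_deriv F x u /\<^sub>R norm (cot_deriv F x u))"
proof -
  have x: "x \<in> X" "u \<in> fibre x" "norm u = 1" using xu by (auto simp: unit_sphere_bundle_def)
  have nz: "cot_deriv F x u \<noteq> 0" using cot_deriv_lower[OF F x(1) Fx x(2)] x(3) by auto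
  have "cot_push M F x ` span {cov x u} = span {cov (F x) (cot_deriv F x u)}"
    by (auto simp: span_singleton cot_push_scale cot_push_cov[OF F x(1) Fx] image_image)
  also have "\<dots> = span {cov (F x) (cot_deriv F x u /\<^sub>R norm (cot_deriv F x u))}"
    using nz by (simp add: cov_scale[OF Fx] span_scale)
  finally show ?thesis by (simp add: proj_cot_map_def cot_line_def)
qed

text \<open>A unit covector on the line differs from \<open>cov x u\<close> by a sign, which the
  norm does not see; the value is therefore independent of the choice made in
  \<open>cot_phi\<close>.\<close>

lemma cot_push_unit:
  assumes F: "regular F x" and xu: "(x, u) \<in> SX" and Fx: "F x \<in> X"
    and \<xi>: "\<xi> \<in> span {cov x u}" "cotnorm M x \<xi> = 1"
  shows "cotnorm M (F x) (cot_push M F x \<xi>) = norm (cot_deriv F x u)"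
proof -
  have x: "x \<in> X" "u \<in> fibre x" "norm u = 1" using xu by (auto simp: unit_sphere_bundle_def)
  obtain r where r: "\<xi> = r *\<^sub>R cov x u" using \<xi>(1) by (auto simp: span_singleton)
  have "\<bar>r\<bar> = 1"
    using \<xi>(2) cotnorm_cov[OF x(1) subspace_scale[OF fibre_subspace[OF x(1)] x(2)], of r] x(3) by (simp add: r cov_scale[OF x(1)])
  then have "cotnorm M (F x) (cov (F x) (r *\<^sub>R cot_deriv F x u)) = norm (cot_deriv F x u)"
    using cotnorm_cov[OF Fx subspace_scale[OF fibre_subspace[OF Fx] cot_deriv_in_fibre[OF F x(1) Fx]], of r u] by simp
  thus ?thesis by (simp add: r cot_push_scale cot_push_cov[OF F x(1) Fx] cov_scale[OF Fx])
qed

lemma unit_covector_choice: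
  assumes xu: "(x, u) \<in> SX"
  shows "(SOME \<xi>. \<xi> \<in> span {cov x u} \<and> cotnorm M x \<xi> = 1) \<in> span {cov x u} \<and> cotnorm M x (SOME \<xi>. \<xi> \<in> span {cov x u} \<and> cotnorm M x \<xi> = 1) = 1"
proof (rule someI[of _ "cov x u"])
  show "cov x u \<in> span {cov x u} \<and> cotnorm M x (cov x u) = 1"
    using xu cotnorm_cov by (auto simp: unit_sphere_bundle_def span_base)
qed

end

section \<open>Continuity and measurability of the derivative cocycle\<close>

lemma linear_basis_sum: "linear K \<Longrightarrow> K w = (\<Sum>b\<in>Basis. (w \<bullet> b) *\<^sub>R K b)" for w :: "'e::euclidean_space"
  by (subst euclidean_representation[of w, symmetric]) (simp only: linear_sum linear_cmul)

lemma continuous_on_linear_apply: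
  fixes K :: "'x::topological_space \<Rightarrow> 'e::euclidean_space \<Rightarrow> 'f::real_normed_vector"
  assumes "\<And>x. x \<in> S \<Longrightarrow> linear (K x)" "\<And>v. continuous_on S (\<lambda>x. K x v)" "continuous_on S w"
  shows "continuous_on S (\<lambda>x. K x (w x))"
proof -
  have "continuous_on S (\<lambda>x. \<Sum>b\<in>Basis. (w x \<bullet> b) *\<^sub>R K x b)" by (intro continuous_intros assms)
  thus ?thesis using linear_basis_sum[OF assms(1)] by (simp cong: continuous_on_cong)
qed

lemma borel_measurable_linear_apply:
  fixes K :: "'w \<Rightarrow> 'e::euclidean_space \<Rightarrow> 'f::euclidean_space"
  assumes "\<And>x. x \<in> space M \<Longrightarrow> linear (K x)" "\<And>v. (\<lambda>x. K x v) \<in> borel_measurable M" "w \<in> borel_measurable M"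
  shows "(\<lambda>x. K x (w x)) \<in> borel_measurable M"
proof -
  have "(\<lambda>x. \<Sum>b\<in>Basis. (w x \<bullet> b) *\<^sub>R K x b) \<in> borel_measurable M" using assms by measurable
  thus ?thesis using linear_basis_sum[OF assms(1)] by (simp cong: measurable_cong)
qed

text \<open>\<open>L\<close> stretches every vector by at least \<open>c\<close>. Once
  \<open>K x\<close> is within \<open>c / 2\<close> of it, \<open>K x\<close> still stretches by
  \<open>c / 2\<close>, so the difference of the inverses is controlled by how far
  \<open>K x\<close> misses \<open>w\<close> at \<open>inv L w\<close>.\<close>

lemma tendsto_inv_linear:
  fixes K :: "'x \<Rightarrow> 'e::euclidean_space \<Rightarrow> 'e"
  assumes K: "\<forall>\<^sub>F x in \<F>. linear (K x) \<and> bij (K x)" and L: "linear L" "bij L"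
    and lim: "\<And>v. ((\<lambda>x. K x v) \<longlongrightarrow> L v) \<F>"
  shows "((\<lambda>x. inv (K x) w) \<longlongrightarrow> inv L w) \<F>"
proof -
  obtain c where c: "c > 0" "\<And>v. c * norm v \<le> norm (L v)"
    using linear_inj_bounded_below_pos[OF L(1) bij_is_inj[OF L(2)]] by metis
  \<comment> \<open>A sum over the basis dominates the operator norm of \<open>K x - L\<close> and
    tends to zero by pointwise convergence alone.\<close>
  define e where "e x = (\<Sum>b\<in>Basis. norm (K x b - L b))" for x
  have "(e \<longlongrightarrow> (\<Sum>b\<in>(Basis::'e set). norm (L b - L b))) \<F>" unfolding e_def by (intro tendsto_intros lim)
  then have "\<forall>\<^sub>F x in \<F>. e x < c / 2" using c(1) by (intro order_tendstoD(2)) auto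
  with K have "\<forall>\<^sub>F x in \<F>. norm (inv (K x) w - inv L w) \<le> (2 / c) * norm (w - K x (inv L w))"
  proof eventually_elim
    case (elim x)
    let ?v = "inv (K x) w - inv L w"
    have lK: "linear (K x)" using elim by simp
    have "norm (K x ?v - L ?v) = norm (\<Sum>b\<in>Basis. (?v \<bullet> b) *\<^sub>R (K x b - L b))"
      unfolding linear_basis_sum[OF lK, of ?v] linear_basis_sum[OF L(1), of ?v] by (simp add: sum_subtractf scaleR_diff_right)
    also have "\<dots> \<le> (\<Sum>b\<in>Basis. norm ?v * norm (K x b - L b))"
    proof (rule sum_norm_le)
      fix b :: 'e assume "b \<in> Basis"
      then have "\<bar>?v \<bullet> b\<bar> \<le> norm ?v" by (rule Basis_le_norm)
      thus "norm ((?v \<bullet> b) *\<^sub>R (K x b - L b)) \<le> norm ?v * norm (K x b - L b)" by (simp add: mult_right_mono)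
    qed
    also have "\<dots> = norm ?v * e x" by (simp add: e_def sum_distrib_left)
    also have "\<dots> \<le> norm ?v * (c / 2)" using elim by (intro mult_left_mono) auto
    finally have "c * norm ?v - norm ?v * (c / 2) \<le> norm (K x ?v)"
      using c(2)[of ?v] norm_triangle_ineq2[of "L ?v" "K x ?v"] norm_minus_commute[of "L ?v" "K x ?v"] by linarith
    moreover have "K x ?v = w - K x (inv L w)"
      using elim by (simp add: linear_diff[OF lK] bij_is_surj surj_f_inv_f)
    ultimately show ?case using c(1) by (simp add: field_simps)
  qed
  moreover have "((\<lambda>x. (2 / c) * norm (w - K x (inv L w))) \<longlongrightarrow> (2 / c) * norm (w - L (inv L w))) \<F>"
    by (intro tendsto_intros lim)
  then have "((\<lambda>x. (2 / c) * norm (w - K x (inv L w))) \<longlongrightarrow> 0) \<F>" using L(2) by (simp add: bij_is_surj surj_f_inv_f)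
  ultimately have "((\<lambda>x. inv (K x) w - inv L w) \<longlongrightarrow> 0) \<F>" by (rule Lim_null_comparison)
  thus ?thesis by (simp add: LIM_zero_iff)
qed

lemma continuous_on_inv_linear:
  fixes K :: "'x::topological_space \<Rightarrow> 'e::euclidean_space \<Rightarrow> 'e"
  assumes "\<And>x. x \<in> S \<Longrightarrow> linear (K x)" "\<And>x. x \<in> S \<Longrightarrow> bij (K x)" "\<And>v. continuous_on S (\<lambda>x. K x v)"
  shows "continuous_on S (\<lambda>x. inv (K x) w)"
  unfolding continuous_on_def
proof
  fix x assume x: "x \<in> S"
  have "\<forall>\<^sub>F x in at x within S. linear (K x) \<and> bij (K x)"
    using assms(1,2) by (auto simp: eventually_at_topological)
  then show "((\<lambda>x. inv (K x) w) \<longlongrightarrow> inv (K x) w) (at x within S)"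
    by (rule tendsto_inv_linear[OF _ assms(1)[OF x] assms(2)[OF x]]) (use assms(3) x in \<open>auto simp: continuous_on_def\<close>)
qed

text \<open>The map factors through the tuple of images of the basis vectors: inversion is
  continuous on the invertible tuples, and the tuple depends measurably on the parameter.\<close>

lemma borel_measurable_inv_linear:
  fixes K :: "'w \<Rightarrow> 'e::euclidean_space \<Rightarrow> 'e"
  assumes K: "\<And>\<omega>. \<omega> \<in> space M \<Longrightarrow> linear (K \<omega>)" "\<And>\<omega>. \<omega> \<in> space M \<Longrightarrow> bij (K \<omega>)"
    "\<And>v. (\<lambda>\<omega>. K \<omega> v) \<in> borel_measurable M"
  shows "(\<lambda>\<omega>. inv (K \<omega>) u) \<in> borel_measurable M"
proof -
  obtain b :: "nat \<Rightarrow> 'e" where b: "bij_betw b {..<DIM('e)} Basis"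
    using ex_bij_betw_nat_finite[OF finite_Basis] by (auto simp: atLeast0LessThan)
  define L where "L E v = (\<Sum>i<DIM('e). (v \<bullet> b i) *\<^sub>R E i)" for E :: "nat \<Rightarrow> 'e" and v
  have linL: "linear (L E)" for E unfolding L_def
    by (rule linearI) (simp_all add: inner_add_left scaleR_add_left sum.distrib scaleR_sum_right)
  have LK: "L (\<lambda>i. K \<omega> (b i)) v = K \<omega> v" if "\<omega> \<in> space M" for \<omega> v
    unfolding L_def linear_basis_sum[OF K(1)[OF that], of v]
    by (rule sum.reindex_bij_betw[OF b, of "\<lambda>b. (v \<bullet> b) *\<^sub>R K \<omega> b"])
  have cont: "continuous_on {E. bij (L E)} (\<lambda>E. inv (L E) u)"
  proof (rule continuous_on_inv_linear[OF linL])
    show "continuous_on {E. bij (L E)} (\<lambda>x. L x v)" for v unfolding L_def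
      by (intro continuous_intros continuous_on_subset[OF continuous_on_product_coordinates]) auto
  qed simp
  have "(\<lambda>\<omega> i. K \<omega> (b i)) \<in> measurable M (restrict_space borel {E. bij (L E)})"
  proof (rule measurable_restrict_space2)
    show "(\<lambda>\<omega> i. K \<omega> (b i)) \<in> space M \<rightarrow> {E. bij (L E)}" using LK K(2) by (auto simp: fun_eq_iff cong: ) (metis LK ext)
    show "(\<lambda>\<omega> i. K \<omega> (b i)) \<in> borel_measurable M"
      by (rule measurable_coordinatewise_then_product) (rule K(3))
  qed
  from measurable_compose[OF this borel_measurable_continuous_on_restrict[OF cont]]
  have "(\<lambda>\<omega>. inv (L (\<lambda>i. K \<omega> (b i))) u) \<in> borel_measurable M" .
  moreover have "L (\<lambda>i. K \<omega> (b i)) = K \<omega>" if "\<omega> \<in> space M" for \<omega> using LK[OF that] by auto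
  ultimately show ?thesis by (simp cong: measurable_cong)
qed

text \<open>A derivative as the limit of a sequence of difference quotients with steps
  \<open>1 / Suc k\<close>, the form in which measurability passes to the limit.\<close>

lemma has_derivative_sequentially:
  fixes f :: "'e::euclidean_space \<Rightarrow> 'f::real_normed_vector"
  assumes "(f has_derivative A) (at a)"
  shows "(\<lambda>k. real (Suc k) *\<^sub>R (f (a + v /\<^sub>R real (Suc k)) - f a)) \<longlonglongrightarrow> A v"
proof (cases "v = 0")
  case True
  thus ?thesis using linear_0[OF has_derivative_linear[OF assms]] by simp
next
  case False
  let ?y = "\<lambda>k. a + v /\<^sub>R real (Suc k)"
  have lin: "linear A" using has_derivative_linear[OF assms] .
  have "(\<lambda>k. inverse (real (Suc k)) *\<^sub>R v) \<longlonglongrightarrow> 0 *\<^sub>R v" by (intro tendsto_intros LIMSEQ_inverse_real_of_nat)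
  from tendsto_add[OF tendsto_const[of a] this] have "?y \<longlonglongrightarrow> a" by simp
  then have y: "filterlim ?y (at a) sequentially" using False by (auto simp: filterlim_at)
  have "((\<lambda>y. norm ((f y - f a) - A (y - a)) / norm (y - a)) \<longlongrightarrow> 0) (at a)"
    using assms unfolding has_derivative_iff_norm by simp
  from filterlim_compose[OF this y]
  have "(\<lambda>k. norm v * (norm ((f (?y k) - f a) - A (v /\<^sub>R real (Suc k))) / norm (v /\<^sub>R real (Suc k)))) \<longlonglongrightarrow> norm v * 0"
    by (intro tendsto_mult tendsto_const) simp
  moreover have "norm v * (norm ((f (?y k) - f a) - A (v /\<^sub>R real (Suc k))) / norm (v /\<^sub>R real (Suc k))) =
     norm (real (Suc k) *\<^sub>R (f (?y k) - f a) - A v)" for k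
  proof -
    have "real (Suc k) *\<^sub>R (f (?y k) - f a) - A v = real (Suc k) *\<^sub>R ((f (?y k) - f a) - A (v /\<^sub>R real (Suc k)))"
      by (simp only: linear_cmul[OF lin] scaleR_diff_right scaleR_scaleR) simp
    then have "norm (real (Suc k) *\<^sub>R (f (?y k) - f a) - A v) = real (Suc k) * norm ((f (?y k) - f a) - A (v /\<^sub>R real (Suc k)))"
      by (simp only: norm_scaleR abs_of_nat)
    moreover have "norm (v /\<^sub>R real (Suc k)) = norm v / real (Suc k)" by (simp add: divide_inverse_commute)
    ultimately show ?thesis using False by (simp add: field_simps)
  qed
  ultimately have "(\<lambda>k. norm (real (Suc k) *\<^sub>R (f (?y k) - f a) - A v)) \<longlonglongrightarrow> 0" by simp
  from tendsto_norm_zero_cancel[OF this] show ?thesis by (simp only: LIM_zero_iff)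
qed

section \<open>Local derivatives: measurability and continuity\<close>

context riemannian begin

text \<open>The atlas may be uncountable, whereas gluing measurable pieces requires countably many;
  Lindelof selects them.\<close>

lemma countable_chart_cover:
  obtains C :: "nat \<Rightarrow> ('a, 'e) chart" where "\<And>n. C n \<in> atlas M" "(\<Union>n. chart_dom (C n)) = UNIV"
proof -
  let ?F = "(\<lambda>x. chart_dom (chart_at M x)) ` UNIV"
  obtain F' where F': "F' \<subseteq> ?F" "countable F'" "\<Union>F' = \<Union>?F"
    using Lindelof[of ?F] chart_dom_open[OF chart_at(1)] by blast
  obtain D where D: "countable D" "F' = (\<lambda>x. chart_dom (chart_at M x)) ` D"
    using countable_subset_image[of F' "\<lambda>x. chart_dom (chart_at M x)" UNIV] F' by auto
  have U: "\<Union>F' = UNIV" using F'(3) chart_at(2) by auto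
  then have "D \<noteq> {}" using D(2) by auto
  then have r: "range (from_nat_into D) = D" using D(1) by (rule range_from_nat_into)
  have "(\<Union>n. chart_dom (chart_at M (from_nat_into D n))) = \<Union>((\<lambda>x. chart_dom (chart_at M x)) ` range (from_nat_into D))"
    by (simp add: image_image)
  also have "\<dots> = \<Union>F'" unfolding r D(2) ..
  finally have "(\<Union>n. chart_dom (chart_at M (from_nat_into D n))) = \<Union>F'" .
  thus thesis using that[of "\<lambda>n. chart_at M (from_nat_into D n)"] chart_at(1) U by simp
qed

lemma coord_borel:
  assumes "c \<in> atlas M"
  shows "(\<lambda>x. if x \<in> chart_dom c then coord c x else 0) \<in> borel_measurable borel"
    "(\<lambda>y. if y \<in> coord c ` chart_dom c then coord_inv c y else z) \<in> borel_measurable borel"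
  using chart_dom_open[OF assms] chart_img_open[OF assms] coord_continuous[OF assms] coord_inv_continuous[OF assms]
  by (auto intro!: borel_measurable_continuous_on_if)

definition loc_deriv :: "('a, 'e) chart \<Rightarrow> ('a, 'e) chart \<Rightarrow> ('a \<Rightarrow> 'a) \<Rightarrow> 'a \<Rightarrow> 'e \<Rightarrow> 'e" where
  "loc_deriv c d F x = frechet_derivative (coord d \<circ> F \<circ> coord_inv c) (at (coord c x))"

lemma loc_deriv:
  assumes F: "mdiff F x" and c: "c \<in> atlas M" "x \<in> chart_dom c" and d: "d \<in> atlas M" "F x \<in> chart_dom d"
  shows "mderiv c d F x (loc_deriv c d F x)" "linear (loc_deriv c d F x)"
    "tderiv M F x (from_chart M c x v) = from_chart M d (F x) (loc_deriv c d F x v)"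
proof -
  obtain A where A: "mderiv c d F x A" "tderiv M F x \<circ> from_chart M c x = from_chart M d (F x) \<circ> A"
    using mdiff_mderiv[OF assms] by blast
  have eq: "loc_deriv c d F x = A" using A(1) unfolding mderiv_def loc_deriv_def by (rule frechet_derivative_at[symmetric])
  show "mderiv c d F x (loc_deriv c d F x)" "linear (loc_deriv c d F x)" using A(1) eq mderiv_linear by auto
  show "tderiv M F x (from_chart M c x v) = from_chart M d (F x) (loc_deriv c d F x v)"
    using fun_cong[OF A(2), of v] eq by simp
qed

text \<open>Difference quotients in the charts are measurable jointly in the letter and the point,
  and they converge to the derivative wherever point and image lie in the chosen chart
  domains.\<close>

lemma loc_deriv_measurable:
  assumes F: "(\<lambda>(t, x). F t x) \<in> borel_measurable (T \<Otimes>\<^sub>M borel)"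
    and dF: "\<And>t x. t \<in> space T \<Longrightarrow> mdiff (F t) x" and c: "c \<in> atlas M" and d: "d \<in> atlas M"
  shows "(\<lambda>p. loc_deriv c d (F (fst p)) (snd p) v) \<in> borel_measurable
    (restrict_space (T \<Otimes>\<^sub>M borel) {p. snd p \<in> chart_dom c \<and> F (fst p) (snd p) \<in> chart_dom d})"
proof -
  let ?R = "{p. snd p \<in> chart_dom c \<and> F (fst p) (snd p) \<in> chart_dom d}"
  \<comment> \<open>The coordinate maps are extended by constants to total Borel functions. For
    small \<open>k\<close> the shifted argument may leave the chart; eventually it stays inside, and
    only the limit counts.\<close>
  define co where "co c x = (if x \<in> chart_dom c then coord c x else 0)" for c :: "('a, 'e) chart" and x
  define ci where "ci y = (if y \<in> coord c ` chart_dom c then coord_inv c y else undefined)" for y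
  have [measurable]: "co c \<in> borel_measurable borel" "co d \<in> borel_measurable borel" "ci \<in> borel_measurable borel"
    unfolding co_def ci_def using coord_borel c d by auto
  have Fm: "(\<lambda>p. F (fst p) (g p)) \<in> borel_measurable (T \<Otimes>\<^sub>M borel)" if "g \<in> borel_measurable (T \<Otimes>\<^sub>M borel)" for g
    using measurable_compose[OF measurable_Pair[OF measurable_fst that] F] by simp
  define q where "q k p = real (Suc k) *\<^sub>R (co d (F (fst p) (ci (co c (snd p) + v /\<^sub>R real (Suc k)))) - co d (F (fst p) (snd p)))" for k p
  have q_meas: "q k \<in> borel_measurable (T \<Otimes>\<^sub>M borel)" for k
  proof -
    have "(\<lambda>p. ci (co c (snd p) + v /\<^sub>R real (Suc k))) \<in> borel_measurable (T \<Otimes>\<^sub>M borel)" by measurable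
    note [measurable] = Fm[OF this] Fm[OF measurable_snd]
    show ?thesis unfolding q_def by measurable
  qed
  show ?thesis
  proof (rule borel_measurable_LIMSEQ_metric[where f=q])
    show "q k \<in> borel_measurable (restrict_space (T \<Otimes>\<^sub>M borel) ?R)" for k
      by (rule measurable_restrict_space1[OF q_meas])
    fix p assume "p \<in> space (restrict_space (T \<Otimes>\<^sub>M borel) ?R)"
    then obtain t x where p: "p = (t, x)" "t \<in> space T" "x \<in> chart_dom c" "F t x \<in> chart_dom d"
      by (auto simp: space_restrict_space space_pair_measure)
    let ?f = "coord d \<circ> F t \<circ> coord_inv c" and ?a = "coord c x"
    have m: "mderiv c d (F t) x (loc_deriv c d (F t) x)" by (rule loc_deriv(1)[OF dF[OF p(2)] c p(3) d p(4)])
    have "isCont (F t) x" using dF[OF p(2)] by (simp add: mdiff_def)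
    then obtain W where W: "open W" "x \<in> W" "\<And>y. y \<in> W \<Longrightarrow> F t y \<in> chart_dom d"
      using chart_dom_open[OF d] p(4) unfolding continuous_at_open by metis
    let ?O = "coord c ` (W \<inter> chart_dom c)"
    have O: "open ?O" "?a \<in> ?O" using coord_image_open[OF c W(1)] W p by auto
    have "(\<lambda>k. inverse (real (Suc k)) *\<^sub>R v) \<longlonglongrightarrow> 0 *\<^sub>R v" by (intro tendsto_intros LIMSEQ_inverse_real_of_nat)
    from tendsto_add[OF tendsto_const[of ?a] this] have "(\<lambda>k. ?a + v /\<^sub>R real (Suc k)) \<longlonglongrightarrow> ?a" by simp
    from topological_tendstoD[OF this O]
    have "\<forall>\<^sub>F k in sequentially. q k p = real (Suc k) *\<^sub>R (?f (?a + v /\<^sub>R real (Suc k)) - ?f ?a)"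
    proof eventually_elim
      case (elim k)
      then obtain w where w: "w \<in> W" "w \<in> chart_dom c" "?a + v /\<^sub>R real (Suc k) = coord c w" by auto
      have "ci (coord c w) = w" using w coord_inv_coord[OF c] by (simp add: ci_def)
      thus ?case using w p W(3) coord_inv_coord[OF c] by (simp add: q_def co_def)
    qed
    moreover have "(\<lambda>k. real (Suc k) *\<^sub>R (?f (?a + v /\<^sub>R real (Suc k)) - ?f ?a)) \<longlonglongrightarrow> loc_deriv c d (F t) x v"
      using m unfolding mderiv_def by (rule has_derivative_sequentially)
    ultimately show "(\<lambda>k. q k p) \<longlonglongrightarrow> loc_deriv c d (F (fst p)) (snd p) v"
      using p(1) by (simp add: tendsto_cong)
  qed
qed

lemma loc_deriv_continuous:
  assumes F: "C1_local_diffeo M F" and c: "c \<in> atlas M" and d: "d \<in> atlas M"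
  shows "continuous_on (chart_dom c \<inter> F -` chart_dom d) (\<lambda>x. loc_deriv c d F x v)"
proof -
  let ?Q = "chart_dom c \<inter> F -` chart_dom d"
  have "isCont F x" for x using C1_local_diffeo_mdiff(1)[OF F] by (simp add: mdiff_def)
  then have contF: "continuous_on UNIV F" by (simp add: continuous_at_imp_continuous_on)
  have "open (F -` chart_dom d)" using contF chart_dom_open[OF d] by (rule open_vimage[rotated])
  then have Q: "open ?Q" using chart_dom_open[OF c] by blast
  have "continuous (at x) (\<lambda>x. loc_deriv c d F x v)" if x: "x \<in> ?Q" for x
  proof -
    from F have "\<exists>U G. open U \<and> x \<in> U \<and> open (F ` U) \<and> C1_map_on M U F \<and> C1_map_on M (F ` U) G \<and> (\<forall>y\<in>U. G (F y) = y)"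
      unfolding C1_local_diffeo_def by (rule spec)
    then obtain U where U: "open U" "x \<in> U" "C1_map_on M U F" by metis
    let ?W = "U \<inter> chart_dom c \<inter> F -` chart_dom d"
    have W: "open ?W" "x \<in> ?W" using U Q x by (auto simp: Int_assoc)
    have "Ck_on 1 (coord c ` ?W) (coord d \<circ> F \<circ> coord_inv c)" using U(3) c d by (simp add: C1_map_on_def)
    then have "continuous_on (coord c ` ?W) (\<lambda>y. frechet_derivative (coord d \<circ> F \<circ> coord_inv c) (at y) v)" by simp
    then have "continuous_on ?W (\<lambda>x. loc_deriv c d F x v)" unfolding loc_deriv_def
      by (rule continuous_on_compose2[OF _ continuous_on_subset[OF coord_continuous[OF c]]]) auto
    thus ?thesis using W by (simp add: continuous_on_eq_continuous_at)
  qed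
  thus ?thesis by (simp add: continuous_at_imp_continuous_on)
qed

end

lemma continuous_on_locally:
  assumes "\<And>x. x \<in> X \<Longrightarrow> \<exists>W. open W \<and> x \<in> W \<and> continuous_on (X \<inter> W) g"
  shows "continuous_on X g"
  unfolding continuous_on_def
proof
  fix x assume x: "x \<in> X"
  then obtain W where W: "open W" "x \<in> W" "continuous_on (X \<inter> W) g" using assms by blast
  have "at x within X = at x within (X \<inter> W)" by (rule at_within_nhd[OF W(2,1)]) auto
  thus "(g \<longlongrightarrow> g x) (at x within X)" using W x by (simp add: continuous_on_def)
qed

section \<open>Ambient derivatives through Gram matrices in charts\<close>

context embedded begin

definition chart_emb :: "('a, 'e) chart \<Rightarrow> 'a \<Rightarrow> 'e \<Rightarrow> 'n" where "chart_emb c x v = \<iota> x (from_chart M c x v)"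

definition chart_retr :: "('a, 'e) chart \<Rightarrow> 'a \<Rightarrow> 'n \<Rightarrow> 'e" where "chart_retr c x z = inv (from_chart M c x) (retr x z)"

text \<open>The Gram matrix of the metric in the chart \<open>c\<close>. Inverting it expresses the
  projection onto the fibre through \<open>chart_emb\<close>, whose continuity is known.\<close>

definition gram :: "('a, 'e) chart \<Rightarrow> 'a \<Rightarrow> 'e \<Rightarrow> 'e" where
  "gram c x v = (\<Sum>b\<in>Basis. (chart_emb c x v \<bullet> chart_emb c x b) *\<^sub>R b)"

lemma chart_emb_continuous: "c \<in> atlas M \<Longrightarrow> continuous_on ((X \<inter> chart_dom c) \<times> UNIV) (\<lambda>(x, v). chart_emb c x v)"
  using embedding unfolding isometric_embedding_def chart_emb_def by blast

lemma chart_emb_continuous1: assumes "c \<in> atlas M" shows "continuous_on (X \<inter> chart_dom c) (\<lambda>x. chart_emb c x v)"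
proof -
  have "continuous_on (X \<inter> chart_dom c) (\<lambda>x. (x, v))" by (intro continuous_intros)
  from continuous_on_compose2[OF chart_emb_continuous[OF assms] this] show ?thesis by auto
qed

context
  fixes c x assumes c: "c \<in> atlas M" "x \<in> chart_dom c" "x \<in> X"
begin

lemma chart_emb_linear: "linear (chart_emb c x)"
  using linear_compose[OF from_chart_linear[OF c(1,2)] emb_linear[OF c(3)]] by (simp add: chart_emb_def comp_def fun_eq_iff[symmetric])
    (simp add: chart_emb_def[abs_def])

lemma chart_emb_eq_0: "chart_emb c x v = 0 \<longleftrightarrow> v = 0"
  using emb_eq_0[OF c(3)] from_chart_bij[OF c(1,2)] from_chart_linear[OF c(1,2)]
  by (metis bij_is_inj chart_emb_def linear_injective_0 linear_0)

lemma chart_emb_in_fibre: "chart_emb c x v \<in> fibre x" by (simp add: chart_emb_def)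

lemma from_chart_retr: "from_chart M c x (chart_retr c x z) = retr x z"
  using from_chart_bij[OF c(1,2)] by (simp add: chart_retr_def bij_is_surj surj_f_inv_f)

lemma chart_emb_retr: "chart_emb c x (chart_retr c x z) = orth_proj (fibre x) z"
  by (simp add: chart_emb_def from_chart_retr emb_retr[OF c(3)])

lemma chart_retr_linear: "linear (chart_retr c x)"
proof -
  have "linear (inv (from_chart M c x) \<circ> retr x)"
    using inj_linear_imp_inv_linear[OF from_chart_linear[OF c(1,2)]] from_chart_bij[OF c(1,2)]
    by (intro linear_compose retr_linear c) (auto simp: bij_is_inj)
  moreover have "inv (from_chart M c x) \<circ> retr x = chart_retr c x" by (auto simp: chart_retr_def)
  ultimately show ?thesis by simp
qed

lemma gram_inner: "gram c x v \<bullet> w = chart_emb c x v \<bullet> chart_emb c x w"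
proof -
  have "gram c x v \<bullet> w = (\<Sum>b\<in>Basis. (chart_emb c x v \<bullet> chart_emb c x b) * (w \<bullet> b))"
    by (simp add: gram_def inner_sum_left inner_commute[of w])
  also have "\<dots> = chart_emb c x v \<bullet> (\<Sum>b\<in>Basis. (w \<bullet> b) *\<^sub>R chart_emb c x b)"
    by (simp add: inner_sum_right mult.commute)
  finally show ?thesis by (simp add: linear_basis_sum[OF chart_emb_linear, of w])
qed

lemma gram_linear: "linear (gram c x)"
  unfolding gram_def
  by (rule linearI) (simp_all add: linear_add[OF chart_emb_linear] linear_cmul[OF chart_emb_linear] inner_add_left scaleR_add_left sum.distrib scaleR_sum_right)

lemma gram_bij: "bij (gram c x)"
proof -
  have "v = 0" if "gram c x v = 0" for v
    using gram_inner[of v v] that chart_emb_eq_0 by simp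
  then have "inj (gram c x)" using linear_injective_0[OF gram_linear] by blast
  thus ?thesis using linear_injective_imp_surjective[OF gram_linear] by (simp add: bij_def)
qed

lemma gram_inv_linear: "linear (inv (gram c x))"
  using inj_linear_imp_inv_linear[OF gram_linear] gram_bij bij_is_inj by blast

text \<open>The normal equations of least squares: the coordinates of the orthogonal projection
  solve the Gram system. The right side is visibly continuous in the base point, the left side is
  not.\<close>

lemma chart_retr_eq: "chart_retr c x z = inv (gram c x) (\<Sum>b\<in>Basis. (z \<bullet> chart_emb c x b) *\<^sub>R b)"
proof -
  have "z \<bullet> chart_emb c x b = orth_proj (fibre x) z \<bullet> chart_emb c x b" for b
    using orth_proj(2)[OF fibre_subspace[OF c(3)] chart_emb_in_fibre, of z b] by (simp add: inner_diff_left)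
  then have "gram c x (chart_retr c x z) = (\<Sum>b\<in>Basis. (z \<bullet> chart_emb c x b) *\<^sub>R b)"
    by (simp add: gram_def chart_emb_retr)
  thus ?thesis using gram_bij by (metis bij_inv_eq_iff)
qed

end

lemma gram_continuous: "c \<in> atlas M \<Longrightarrow> continuous_on (X \<inter> chart_dom c) (\<lambda>x. gram c x v)"
  unfolding gram_def by (intro continuous_intros chart_emb_continuous1)

lemma gram_inv_continuous:
  assumes "c \<in> atlas M" shows "continuous_on (X \<inter> chart_dom c) (\<lambda>x. inv (gram c x) w)"
  by (rule continuous_on_inv_linear) (use assms gram_linear gram_bij gram_continuous in auto)

lemma chart_retr_continuous:
  assumes c: "c \<in> atlas M" shows "continuous_on (X \<inter> chart_dom c) (\<lambda>x. chart_retr c x z)"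
proof -
  have "continuous_on (X \<inter> chart_dom c) (\<lambda>x. inv (gram c x) (\<Sum>b\<in>Basis. (z \<bullet> chart_emb c x b) *\<^sub>R b))"
    by (rule continuous_on_linear_apply[where K="\<lambda>x. inv (gram c x)"])
      (use c gram_inv_linear gram_inv_continuous in \<open>auto intro!: continuous_intros chart_emb_continuous1\<close>)
  thus ?thesis by (rule continuous_on_eq) (use chart_retr_eq[OF c] in auto)
qed

lemma loc_deriv_bij:
  assumes F: "regular F x" and c: "c \<in> atlas M" "x \<in> chart_dom c" and d: "d \<in> atlas M" "F x \<in> chart_dom d"
  shows "bij (loc_deriv c d F x)"
proof -
  note l = loc_deriv[OF regularD(1)[OF F] c d]
  have "v = 0" if "loc_deriv c d F x v = 0" for v
  proof -
    have "tderiv M F x (from_chart M c x v) = 0" using l(3)[of v] that linear_0[OF from_chart_linear[OF d]] by simp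
    then have "from_chart M c x v = 0" using regularD(2,3)[OF F] by (metis bij_is_inj linear_injective_0)
    thus "v = 0" using from_chart_bij[OF c] from_chart_linear[OF c] by (metis bij_is_inj linear_injective_0)
  qed
  then have "inj (loc_deriv c d F x)" using linear_injective_0[OF l(2)] by blast
  thus ?thesis using linear_injective_imp_surjective[OF l(2)] by (simp add: bij_def)
qed

lemma amb_deriv_loc:
  assumes F: "regular F x" and c: "c \<in> atlas M" "x \<in> chart_dom c" and d: "d \<in> atlas M" "F x \<in> chart_dom d"
    and x: "x \<in> X" "F x \<in> X"
  shows "amb_deriv F x z = chart_emb d (F x) (loc_deriv c d F x (chart_retr c x z))"
  using loc_deriv(3)[OF regularD(1)[OF F] c d, of "chart_retr c x z"]
  by (simp add: amb_deriv_apply[OF F x] chart_emb_def from_chart_retr[OF c x(1)])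

lemma amb_inv_loc:
  assumes F: "regular F x" and c: "c \<in> atlas M" "x \<in> chart_dom c" and d: "d \<in> atlas M" "F x \<in> chart_dom d"
    and x: "x \<in> X" "F x \<in> X"
  shows "amb_inv F x z = chart_emb c x (inv (loc_deriv c d F x) (chart_retr d (F x) z))"
proof -
  let ?w = "inv (loc_deriv c d F x) (chart_retr d (F x) z)"
  have "loc_deriv c d F x ?w = chart_retr d (F x) z"
    using loc_deriv_bij[OF F c d] by (simp add: bij_is_surj surj_f_inv_f)
  then have "tderiv M F x (from_chart M c x ?w) = retr (F x) z"
    using loc_deriv(3)[OF regularD(1)[OF F] c d, of ?w] by (simp add: from_chart_retr[OF d x(2)])
  then have "inv (tderiv M F x) (retr (F x) z) = from_chart M c x ?w"
    using regularD(2)[OF F] by (metis bij_inv_eq_iff)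
  thus ?thesis by (simp add: amb_inv_apply[OF F x] chart_emb_def)
qed

lemma cot_deriv_sum:
  assumes F: "regular F x" and x: "x \<in> X" "F x \<in> X"
  shows "cot_deriv F x u = (\<Sum>b\<in>Basis. (u \<bullet> amb_inv F x b) *\<^sub>R b)"
  by (subst euclidean_representation[symmetric]) (simp add: cot_deriv_inner[OF F x])

definition diffeo_on_X :: "('a \<Rightarrow> 'a) \<Rightarrow> bool" where
  "diffeo_on_X F \<longleftrightarrow> C1_local_diffeo M F \<and> F ` X \<subseteq> X"

lemma diffeo_on_XD:
  assumes "diffeo_on_X F"
  shows "C1_local_diffeo M F" "regular F x" "x \<in> X \<Longrightarrow> F x \<in> X" "continuous_on UNIV F"
proof -
  show r: "regular F x" and "C1_local_diffeo M F" and "x \<in> X \<Longrightarrow> F x \<in> X" for x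
    using assms C1_local_diffeo_regular by (auto simp: diffeo_on_X_def)
  show "continuous_on UNIV F" using regularD(1)[OF r] by (auto simp: mdiff_def intro!: continuous_at_imp_continuous_on)
qed

text \<open>The preferred chart, and with it the tangent coordinates, may jump with the point, but
  \<open>\<iota>\<close> absorbs the jump. In fixed charts around \<open>x\<close> and
  \<open>F x\<close> the ambient maps are products of continuous factors.\<close>

lemma amb_deriv_continuous:
  assumes F: "diffeo_on_X F" shows "continuous_on X (amb_deriv F)" "continuous_on X (cot_deriv F)"
proof -
  have *: "\<exists>W. open W \<and> x \<in> W \<and> continuous_on (X \<inter> W) (\<lambda>x. amb_deriv F x z) \<and> continuous_on (X \<inter> W) (\<lambda>x. amb_inv F x z)"
    if x: "x \<in> X" for x z
  proof (intro exI conjI)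
    \<comment> \<open>Both charts are frozen at the point \<open>x\<close> under consideration;
      nearby points \<open>y\<close> use the same pair instead of their own.\<close>
    let ?c = "chart_at M x" and ?d = "chart_at M (F x)"
    let ?W = "chart_dom ?c \<inter> F -` chart_dom ?d"
    have "open (F -` chart_dom ?d)" by (rule open_vimage[OF chart_dom_open[OF chart_at(1)] diffeo_on_XD(4)[OF F]])
    thus "open ?W" using chart_dom_open[OF chart_at(1)] by blast
    show "x \<in> ?W" using chart_at(2) by simp
    note a = chart_at(1)[of x] chart_at(1)[of "F x"]
    have W: "y \<in> chart_dom ?c" "F y \<in> chart_dom ?d" "y \<in> X" "F y \<in> X" "regular F y" if "y \<in> X \<inter> ?W" for y
      using that diffeo_on_XD[OF F] by auto
    have cF: "continuous_on (X \<inter> ?W) F" using continuous_on_subset[OF diffeo_on_XD(4)[OF F]] by blast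
    have Jd: "continuous_on (X \<inter> ?W) (\<lambda>y. chart_emb ?d (F y) v)" for v
      by (rule continuous_on_compose2[OF chart_emb_continuous1[OF a(2)] cF]) (use W(2,4) in blast)
    have Jc: "continuous_on (X \<inter> ?W) (\<lambda>y. chart_emb ?c y v)" for v
      by (rule continuous_on_subset[OF chart_emb_continuous1[OF a(1)]]) auto
    have Rd: "continuous_on (X \<inter> ?W) (\<lambda>y. chart_retr ?d (F y) v)" for v
      by (rule continuous_on_compose2[OF chart_retr_continuous[OF a(2)] cF]) (use W(2,4) in blast)
    have Rc: "continuous_on (X \<inter> ?W) (\<lambda>y. chart_retr ?c y v)" for v
      by (rule continuous_on_subset[OF chart_retr_continuous[OF a(1)]]) auto
    have D: "continuous_on (X \<inter> ?W) (\<lambda>y. loc_deriv ?c ?d F y v)" for v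
      by (rule continuous_on_subset[OF loc_deriv_continuous[OF diffeo_on_XD(1)[OF F] a]]) auto
    have lin: "linear (loc_deriv ?c ?d F y)" "bij (loc_deriv ?c ?d F y)" "linear (inv (loc_deriv ?c ?d F y))" if "y \<in> X \<inter> ?W" for y
    proof -
      note w = W[OF that]
      show l: "linear (loc_deriv ?c ?d F y)" by (rule loc_deriv(2)[OF regularD(1)[OF w(5)] a(1) w(1) a(2) w(2)])
      show b: "bij (loc_deriv ?c ?d F y)" by (rule loc_deriv_bij[OF w(5) a(1) w(1) a(2) w(2)])
      show "linear (inv (loc_deriv ?c ?d F y))" using inj_linear_imp_inv_linear[OF l] b bij_is_inj by blast
    qed
    have Di: "continuous_on (X \<inter> ?W) (\<lambda>y. inv (loc_deriv ?c ?d F y) v)" for v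
      by (rule continuous_on_inv_linear) (use lin D in auto)
    have le: "linear (chart_emb ?c y)" "linear (chart_emb ?d (F y))" if "y \<in> X \<inter> ?W" for y
      using W[OF that] by (auto intro: chart_emb_linear a)
    have "continuous_on (X \<inter> ?W) (\<lambda>y. loc_deriv ?c ?d F y (chart_retr ?c y z))"
      by (rule continuous_on_linear_apply[OF lin(1) D Rc])
    note continuous_on_linear_apply[OF le(2) Jd this]
    thus "continuous_on (X \<inter> ?W) (\<lambda>y. amb_deriv F y z)"
    proof (rule continuous_on_eq)
      fix y assume "y \<in> X \<inter> ?W"
      note w = W[OF this]
      show "chart_emb ?d (F y) (loc_deriv ?c ?d F y (chart_retr ?c y z)) = amb_deriv F y z"
        by (rule amb_deriv_loc[symmetric, OF w(5) a(1) w(1) a(2) w(2-4)])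
    qed
    have "continuous_on (X \<inter> ?W) (\<lambda>y. inv (loc_deriv ?c ?d F y) (chart_retr ?d (F y) z))"
      by (rule continuous_on_linear_apply[OF lin(3) Di Rd])
    note continuous_on_linear_apply[OF le(1) Jc this]
    thus "continuous_on (X \<inter> ?W) (\<lambda>y. amb_inv F y z)"
    proof (rule continuous_on_eq)
      fix y assume "y \<in> X \<inter> ?W"
      note w = W[OF this]
      show "chart_emb ?c y (inv (loc_deriv ?c ?d F y) (chart_retr ?d (F y) z)) = amb_inv F y z"
        by (rule amb_inv_loc[symmetric, OF w(5) a(1) w(1) a(2) w(2-4)])
    qed
  qed
  show "continuous_on X (amb_deriv F)"
    by (rule continuous_on_blinfun_componentwise, rule continuous_on_locally) (use * in blast)
  have inv: "continuous_on X (\<lambda>x. amb_inv F x z)" for z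
    by (rule continuous_on_locally) (use * in blast)
  show "continuous_on X (cot_deriv F)"
  proof (rule continuous_on_blinfun_componentwise)
    fix u :: 'n
    have "continuous_on X (\<lambda>x. \<Sum>b\<in>Basis. (u \<bullet> amb_inv F x b) *\<^sub>R b)" by (intro continuous_intros inv)
    thus "continuous_on X (\<lambda>x. cot_deriv F x u)"
      using cot_deriv_sum diffeo_on_XD[OF F] by (simp cong: continuous_on_cong)
  qed
qed

section \<open>Measurable families of diffeomorphisms as cocycles\<close>

definition random_diffeo :: "'t measure \<Rightarrow> ('t \<Rightarrow> 'a \<Rightarrow> 'a) \<Rightarrow> bool" where
  "random_diffeo T F \<longleftrightarrow> (\<lambda>(t, x). F t x) \<in> borel_measurable (T \<Otimes>\<^sub>M borel) \<and> (\<forall>t\<in>space T. diffeo_on_X (F t))"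

lemma random_diffeo_random_map: assumes "random_diffeo T F" shows "random_map T X F"
  unfolding random_map_def
proof (rule measurable_restrict_space2)
  show "(\<lambda>(t, x). F t x) \<in> space (T \<Otimes>\<^sub>M restrict_space borel X) \<rightarrow> X"
    using assms diffeo_on_XD(3) by (auto simp: random_diffeo_def space_pair_measure space_restrict_space)
  have "(\<lambda>p. (fst p, snd p)) \<in> measurable (T \<Otimes>\<^sub>M restrict_space borel X) (T \<Otimes>\<^sub>M borel)"
    by (intro measurable_Pair measurable_fst measurable_compose[OF measurable_snd measurable_restrict_space1[OF measurable_ident_sets]]) auto
  moreover have "(\<lambda>(t, x). F t x) \<in> borel_measurable (T \<Otimes>\<^sub>M borel)" using assms by (simp add: random_diffeo_def)
  ultimately have "(\<lambda>p. (\<lambda>(t, x). F t x) (fst p, snd p)) \<in> borel_measurable (T \<Otimes>\<^sub>M restrict_space borel X)"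
    by (rule measurable_compose)
  then show "(\<lambda>(t, x). F t x) \<in> borel_measurable (T \<Otimes>\<^sub>M restrict_space borel X)" by simp
qed

text \<open>Countably many pairs of charts for point and image cover everything; on each piece all
  chart factors are measurable, and the pieces are glued.\<close>

lemma amb_deriv_measurable:
  assumes F: "random_diffeo T F"
  shows "(\<lambda>p. amb_deriv (F (fst p)) (snd p) z) \<in> borel_measurable (T \<Otimes>\<^sub>M restrict_space borel X)"
    "(\<lambda>p. cot_deriv (F (fst p)) (snd p) z) \<in> borel_measurable (T \<Otimes>\<^sub>M restrict_space borel X)"
proof -
  let ?N = "T \<Otimes>\<^sub>M restrict_space borel X"
  obtain C :: "nat \<Rightarrow> ('a, 'e) chart" where C: "\<And>n. C n \<in> atlas M" "(\<Union>n. chart_dom (C n)) = UNIV" using countable_chart_cover by metis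
  have fd: "diffeo_on_X (F t)" if "t \<in> space T" for t using F that by (simp add: random_diffeo_def)
  have FX: "(\<lambda>p. F (fst p) (snd p)) \<in> measurable ?N (restrict_space borel X)"
    using random_diffeo_random_map[OF F] by (simp add: random_map_def case_prod_beta')
  then have Fb: "(\<lambda>p. F (fst p) (snd p)) \<in> borel_measurable ?N" by (simp add: measurable_restrict_space2_iff)
  have sb: "snd \<in> borel_measurable ?N"
    by (rule measurable_compose[OF measurable_snd measurable_restrict_space1[OF measurable_ident_sets]]) auto
  define R where "R i j = {p. snd p \<in> chart_dom (C i) \<and> F (fst p) (snd p) \<in> chart_dom (C j)}" for i j
  have RM: "R i j \<inter> space ?N \<in> sets ?N" for i j
  proof -
    have "snd -` chart_dom (C i) \<inter> space ?N \<in> sets ?N" "(\<lambda>p. F (fst p) (snd p)) -` chart_dom (C j) \<inter> space ?N \<in> sets ?N"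
      using chart_dom_open[OF C(1)] by (auto intro: measurable_sets[OF sb] measurable_sets[OF Fb])
    moreover have "R i j \<inter> space ?N = (snd -` chart_dom (C i) \<inter> space ?N) \<inter> ((\<lambda>p. F (fst p) (snd p)) -` chart_dom (C j) \<inter> space ?N)"
      unfolding R_def by blast
    ultimately show ?thesis by (simp only: sets.Int)
  qed
  have cover: "space ?N \<subseteq> (\<Union>(i, j). R i j)"
  proof
    fix p assume "p \<in> space ?N"
    have "snd p \<in> (\<Union>n. chart_dom (C n))" "F (fst p) (snd p) \<in> (\<Union>n. chart_dom (C n))" unfolding C(2) by auto
    thus "p \<in> (\<Union>(i, j). R i j)" by (auto simp: R_def)
  qed
  have main: "(\<lambda>p. amb_deriv (F (fst p)) (snd p) z) \<in> borel_measurable (restrict_space ?N (R i j)) \<and>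
     (\<lambda>p. amb_inv (F (fst p)) (snd p) z) \<in> borel_measurable (restrict_space ?N (R i j))" for i j z
  proof -
    let ?c = "C i" and ?d = "C j" and ?K = "restrict_space ?N (R i j)"
    note a = C(1)[of i] C(1)[of j]
    have W: "snd p \<in> chart_dom ?c" "F (fst p) (snd p) \<in> chart_dom ?d" "snd p \<in> X" "F (fst p) (snd p) \<in> X" "regular (F (fst p)) (snd p)"
      if "p \<in> space ?K" for p
      using that fd[of "fst p"] diffeo_on_XD[of "F (fst p)"] by (auto simp: R_def space_restrict_space space_pair_measure)
    have x: "snd \<in> measurable ?K (restrict_space borel (X \<inter> chart_dom ?c))"
      using W by (intro measurable_restrict_space2 measurable_restrict_space1[OF sb]) auto
    have y: "(\<lambda>p. F (fst p) (snd p)) \<in> measurable ?K (restrict_space borel (X \<inter> chart_dom ?d))"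
      using W by (intro measurable_restrict_space2 measurable_restrict_space1[OF Fb]) auto
    note cr = borel_measurable_continuous_on_restrict
    have Jd: "(\<lambda>p. chart_emb ?d (F (fst p) (snd p)) v) \<in> borel_measurable ?K" for v
      by (rule measurable_compose[OF y cr[OF chart_emb_continuous1[OF a(2)]]])
    have Jc: "(\<lambda>p. chart_emb ?c (snd p) v) \<in> borel_measurable ?K" for v
      by (rule measurable_compose[OF x cr[OF chart_emb_continuous1[OF a(1)]]])
    have Rd: "(\<lambda>p. chart_retr ?d (F (fst p) (snd p)) v) \<in> borel_measurable ?K" for v
      by (rule measurable_compose[OF y cr[OF chart_retr_continuous[OF a(2)]]])
    have Rc: "(\<lambda>p. chart_retr ?c (snd p) v) \<in> borel_measurable ?K" for v
      by (rule measurable_compose[OF x cr[OF chart_retr_continuous[OF a(1)]]])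
    have md: "mdiff (F t) x" if "t \<in> space T" for t x using regularD(1)[OF diffeo_on_XD(2)[OF fd[OF that]]] .
    have D: "(\<lambda>p. loc_deriv ?c ?d (F (fst p)) (snd p) v) \<in> borel_measurable ?K" for v
    proof -
      have "(\<lambda>p. p) \<in> measurable ?K (restrict_space (T \<Otimes>\<^sub>M borel) (R i j))"
      proof (rule measurable_restrict_space2)
        show "(\<lambda>p. p) \<in> space ?K \<rightarrow> R i j" by (auto simp: space_restrict_space)
        have "(\<lambda>p. (fst p, snd p)) \<in> measurable ?N (T \<Otimes>\<^sub>M borel)" by (intro measurable_Pair measurable_fst sb)
        thus "(\<lambda>p. p) \<in> measurable ?K (T \<Otimes>\<^sub>M borel)" by (intro measurable_restrict_space1) simp
      qed
      from measurable_compose[OF this, of "\<lambda>p. loc_deriv ?c ?d (F (fst p)) (snd p) v" borel]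
      show ?thesis using loc_deriv_measurable[where F=F and T=T and v=v, OF _ md a] F unfolding R_def random_diffeo_def by blast
    qed
    have lin: "linear (loc_deriv ?c ?d (F (fst p)) (snd p))" "bij (loc_deriv ?c ?d (F (fst p)) (snd p))"
       "linear (inv (loc_deriv ?c ?d (F (fst p)) (snd p)))" if "p \<in> space ?K" for p
    proof -
      note w = W[OF that]
      show l: "linear (loc_deriv ?c ?d (F (fst p)) (snd p))" by (rule loc_deriv(2)[OF regularD(1)[OF w(5)] a(1) w(1) a(2) w(2)])
      show b: "bij (loc_deriv ?c ?d (F (fst p)) (snd p))" by (rule loc_deriv_bij[OF w(5) a(1) w(1) a(2) w(2)])
      show "linear (inv (loc_deriv ?c ?d (F (fst p)) (snd p)))" using inj_linear_imp_inv_linear[OF l] b bij_is_inj by blast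
    qed
    have Di: "(\<lambda>p. inv (loc_deriv ?c ?d (F (fst p)) (snd p)) v) \<in> borel_measurable ?K" for v
      by (rule borel_measurable_inv_linear) (use lin D in auto)
    have le: "linear (chart_emb ?c (snd p))" "linear (chart_emb ?d (F (fst p) (snd p)))" if "p \<in> space ?K" for p
      using W[OF that] by (auto intro: chart_emb_linear a)
    note m1 = borel_measurable_linear_apply[OF le(2) Jd borel_measurable_linear_apply[OF lin(1) D Rc]]
    note m2 = borel_measurable_linear_apply[OF le(1) Jc borel_measurable_linear_apply[OF lin(3) Di Rd]]
    have e: "chart_emb ?d (F (fst p) (snd p)) (loc_deriv ?c ?d (F (fst p)) (snd p) (chart_retr ?c (snd p) z)) = amb_deriv (F (fst p)) (snd p) z"
      "chart_emb ?c (snd p) (inv (loc_deriv ?c ?d (F (fst p)) (snd p)) (chart_retr ?d (F (fst p) (snd p)) z)) = amb_inv (F (fst p)) (snd p) z"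
      if "p \<in> space ?K" for p
    proof -
      note w = W[OF that]
      show "chart_emb ?d (F (fst p) (snd p)) (loc_deriv ?c ?d (F (fst p)) (snd p) (chart_retr ?c (snd p) z)) = amb_deriv (F (fst p)) (snd p) z"
        by (rule amb_deriv_loc[symmetric, OF w(5) a(1) w(1) a(2) w(2-4)])
      show "chart_emb ?c (snd p) (inv (loc_deriv ?c ?d (F (fst p)) (snd p)) (chart_retr ?d (F (fst p) (snd p)) z)) = amb_inv (F (fst p)) (snd p) z"
        by (rule amb_inv_loc[symmetric, OF w(5) a(1) w(1) a(2) w(2-4)])
    qed
    show ?thesis
      by (intro conjI iffD1[OF measurable_cong[OF e(1)] m1] iffD1[OF measurable_cong[OF e(2)] m2])
  qed
  have pw: "g \<in> borel_measurable ?N" if g: "\<And>i j. g \<in> borel_measurable (restrict_space ?N (R i j))" for g :: "'b \<times> 'a \<Rightarrow> 'n"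
  proof (rule measurable_piecewise_restrict[where C="range (\<lambda>(i, j). R i j)"])
    show "space ?N \<subseteq> \<Union>(range (\<lambda>(i, j). R i j))" using cover by auto
  qed (use g RM in auto)
  show "(\<lambda>p. amb_deriv (F (fst p)) (snd p) z) \<in> borel_measurable ?N" by (rule pw) (use main in blast)
  have inv: "(\<lambda>p. amb_inv (F (fst p)) (snd p) z) \<in> borel_measurable ?N" for z by (rule pw) (use main in blast)
  have "(\<lambda>p. \<Sum>b\<in>Basis. (z \<bullet> amb_inv (F (fst p)) (snd p) b) *\<^sub>R b) \<in> borel_measurable ?N"
    by (intro borel_measurable_sum borel_measurable_scaleR borel_measurable_inner inv) auto
  moreover have "cot_deriv (F (fst p)) (snd p) z = (\<Sum>b\<in>Basis. (z \<bullet> amb_inv (F (fst p)) (snd p) b) *\<^sub>R b)" if "p \<in> space ?N" for p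
    using that fd[of "fst p"] diffeo_on_XD[of "F (fst p)"] by (intro cot_deriv_sum) (auto simp: space_pair_measure space_restrict_space)
  ultimately show "(\<lambda>p. cot_deriv (F (fst p)) (snd p) z) \<in> borel_measurable ?N" by (simp cong: measurable_cong)
qed

lemma random_diffeo_cocycle:
  assumes F: "random_diffeo T F" and G: "integrable T G"
    and b: "\<And>t x. t \<in> space T \<Longrightarrow> x \<in> X \<Longrightarrow> norm (amb_deriv (F t) x) \<le> exp (G t)"
       "\<And>t x. t \<in> space T \<Longrightarrow> x \<in> X \<Longrightarrow> norm (cot_deriv (F t) x) \<le> exp (G t)"
  shows "cocycle T X fibre F (\<lambda>t. cot_deriv (F t)) G"
  unfolding cocycle_def
proof (intro conjI allI ballI impI)
  show "random_map T X F" by (rule random_diffeo_random_map[OF F])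
  show "(\<lambda>(t, x). cot_deriv (F t) x u) \<in> borel_measurable (T \<Otimes>\<^sub>M restrict_space borel X)" for u
    using amb_deriv_measurable(2)[OF F] by (simp add: case_prod_beta')
  fix t x assume t: "t \<in> space T" and x: "x \<in> X"
  have d: "diffeo_on_X (F t)" using F t by (simp add: random_diffeo_def)
  note r = diffeo_on_XD(2)[OF d] and Fx = diffeo_on_XD(3)[OF d x]
  show "norm (cot_deriv (F t) x) \<le> exp (G t)" by (rule b(2)[OF t x])
  fix u assume u: "u \<in> fibre x"
  show "cot_deriv (F t) x u \<in> fibre (F t x)" by (rule cot_deriv_in_fibre[OF r x Fx])
  have "norm u \<le> norm (amb_deriv (F t) x) * norm (cot_deriv (F t) x u)" by (rule cot_deriv_lower[OF r x Fx u])
  also have "\<dots> \<le> exp (G t) * norm (cot_deriv (F t) x u)" by (intro mult_right_mono b(1)[OF t x]) simp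
  finally show "exp (- G t) * norm u \<le> norm (cot_deriv (F t) x u)" by (simp add: exp_minus field_simps)
qed (rule G)

lemma projection_continuous: "continuous_on (X \<times> UNIV) (\<lambda>(x, u). orth_proj (fibre x) u)"
proof (rule continuous_on_locally)
  fix p :: "'a \<times> 'n" assume "p \<in> X \<times> UNIV"
  let ?c = "chart_at M (fst p)"
  let ?W = "chart_dom ?c \<times> (UNIV :: 'n set)"
  note a = chart_at(1)[of "fst p"]
  have f: "continuous_on (X \<times> UNIV \<inter> ?W) fst" "fst ` (X \<times> UNIV \<inter> ?W) \<subseteq> X \<inter> chart_dom ?c" by (auto intro: continuous_intros)
  have Je: "continuous_on (X \<times> UNIV \<inter> ?W) (\<lambda>p. chart_emb ?c (fst p) v)" for v
    by (rule continuous_on_compose2[OF chart_emb_continuous1[OF a] f])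
  have Re: "continuous_on (X \<times> UNIV \<inter> ?W) (\<lambda>p. chart_retr ?c (fst p) v)" for v
    by (rule continuous_on_compose2[OF chart_retr_continuous[OF a] f])
  have "continuous_on (X \<times> UNIV \<inter> ?W) (\<lambda>p. chart_retr ?c (fst p) (snd p))"
    by (rule continuous_on_linear_apply[where K="\<lambda>p. chart_retr ?c (fst p)", OF _ Re continuous_on_snd[OF continuous_on_id]])
      (auto intro!: chart_retr_linear[OF a])
  note continuous_on_linear_apply[where K="\<lambda>p. chart_emb ?c (fst p)", OF _ Je this]
  moreover have "linear (chart_emb ?c (fst p))" if "p \<in> X \<times> UNIV \<inter> ?W" for p
    using that by (auto intro!: chart_emb_linear[OF a])
  ultimately have "continuous_on (X \<times> UNIV \<inter> ?W) (\<lambda>p. chart_emb ?c (fst p) (chart_retr ?c (fst p) (snd p)))"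
    by blast
  then have "continuous_on (X \<times> UNIV \<inter> ?W) (\<lambda>(x, u). orth_proj (fibre x) u)"
    by (rule continuous_on_eq) (auto simp: chart_emb_retr[OF a])
  thus "\<exists>W. open W \<and> p \<in> W \<and> continuous_on (X \<times> UNIV \<inter> W) (\<lambda>(x, u). orth_proj (fibre x) u)"
    using chart_dom_open[OF a] chart_at(2)[of "fst p"] by (intro exI[of _ ?W]) (auto simp: open_Times mem_Times_iff)
qed

text \<open>A vector lies in the fibre exactly when the projection fixes it, which is a closed
  condition inside the compact product of \<open>X\<close> with the unit sphere.\<close>

lemma sphere_compact: "compact SX"
proof -
  have eq: "SX = {p \<in> X \<times> sphere 0 1. (\<lambda>(x, u). orth_proj (fibre x) u) p - snd p = 0}"
  proof (rule set_eqI, clarify)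
    fix x u
    have "u \<in> fibre x \<longleftrightarrow> orth_proj (fibre x) u = u" if "x \<in> X"
      using orth_proj(1)[OF fibre_subspace[OF that]] orth_proj_in[OF fibre_subspace[OF that]] by metis
    thus "(x, u) \<in> SX \<longleftrightarrow> (x, u) \<in> {p \<in> X \<times> sphere 0 1. (\<lambda>(x, u). orth_proj (fibre x) u) p - snd p = 0}"
      by (auto simp: unit_sphere_bundle_def)
  qed
  have K: "compact (X \<times> sphere (0::'n) 1)" by (intro compact_Times compact_X compact_sphere)
  have "continuous_on (X \<times> sphere 0 1) (\<lambda>p. (\<lambda>(x, u). orth_proj (fibre x) u) p - snd p)"
    by (intro continuous_intros continuous_on_subset[OF projection_continuous]) auto
  from continuous_closedin_preimage_constant[OF this, of 0]
  have "closedin (top_of_set (X \<times> sphere 0 1)) SX" by (simp only: eq)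
  thus ?thesis using K closedin_compact by blast
qed

text \<open>Take one coordinate vector \<open>b\<close> in the first chart of the countable cover
  that contains the point, and normalise its image. The section is continuous where that index is
  constant, and these pieces are Borel.\<close>

lemma measurable_section_exists:
  "\<exists>s \<in> measurable (restrict_space borel X) (restrict_space borel SX). \<forall>x\<in>X. fst (s x) = x"
proof -
  obtain C :: "nat \<Rightarrow> ('a, 'e) chart" where C: "\<And>n. C n \<in> atlas M" "(\<Union>n. chart_dom (C n)) = UNIV" using countable_chart_cover by metis
  obtain b :: 'e where b: "b \<in> Basis" using nonempty_Basis by blast
  define n where "n x = (LEAST n. x \<in> chart_dom (C n))" for x
  have n: "x \<in> chart_dom (C (n x))" for x
  proof -
    have "\<exists>n. x \<in> chart_dom (C n)" using C(2) by blast
    thus ?thesis unfolding n_def by (rule LeastI_ex)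
  qed
  define s where "s x = (x, chart_emb (C (n x)) x b /\<^sub>R norm (chart_emb (C (n x)) x b))" for x
  have nz: "chart_emb (C (n x)) x b \<noteq> 0" if "x \<in> X" for x
    using chart_emb_eq_0[OF C(1) n that] b nonzero_Basis by auto
  define R where "R k = {x \<in> X. n x = k}" for k
  have R_eq: "R k = X \<inter> (chart_dom (C k) - (\<Union>j<k. chart_dom (C j)))" for k
  proof (rule set_eqI)
    fix x
    have "n x = k \<longleftrightarrow> x \<in> chart_dom (C k) \<and> (\<forall>j<k. x \<notin> chart_dom (C j))"
      using n[of x] not_less_Least[of _ "\<lambda>n. x \<in> chart_dom (C n)"] unfolding n_def by (metis linorder_neqE_nat)
    thus "x \<in> R k \<longleftrightarrow> x \<in> X \<inter> (chart_dom (C k) - (\<Union>j<k. chart_dom (C j)))" by (auto simp: R_def)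
  qed
  have RM: "R k \<inter> space (restrict_space borel X) \<in> sets (restrict_space borel X)" for k
  proof -
    have "chart_dom (C j) \<in> sets borel" for j using chart_dom_open[OF C(1)] by simp
    then have "chart_dom (C k) - (\<Union>j<k. chart_dom (C j)) \<in> sets borel" by (intro sets.Diff sets.finite_UN) auto
    thus ?thesis by (auto simp: R_eq space_restrict_space sets_restrict_space)
  qed
  have "s \<in> borel_measurable (restrict_space borel X)"
  proof (rule measurable_piecewise_restrict[where C="range R"])
    fix Q assume "Q \<in> range R"
    then obtain k where Q: "Q = R k" by auto
    show "Q \<inter> space (restrict_space borel X) \<in> sets (restrict_space borel X)" using RM Q by simp
    have sub: "R k \<subseteq> X \<inter> chart_dom (C k)" using n by (auto simp: R_def)
    have "continuous_on (R k) (\<lambda>x. (x, chart_emb (C k) x b /\<^sub>R norm (chart_emb (C k) x b)))"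
      by (intro continuous_intros continuous_on_subset[OF chart_emb_continuous1[OF C(1)] sub])
        (use nz in \<open>auto simp: R_def\<close>)
    then have "continuous_on (R k) s" by (rule continuous_on_eq) (auto simp: s_def R_def)
    from borel_measurable_continuous_on_restrict[OF this]
    show "s \<in> borel_measurable (restrict_space (restrict_space borel X) Q)"
      using sub by (simp add: Q sets_restrict_restrict_space Int_absorb1 cong: measurable_cong_sets)
  qed (auto simp: R_def space_restrict_space)
  moreover have "s x \<in> SX" if "x \<in> X" for x
    using nz[OF that] that subspace_scale[OF fibre_subspace[OF that]] by (auto simp: s_def unit_sphere_bundle_def chart_emb_def)
  ultimately have "s \<in> measurable (restrict_space borel X) (restrict_space borel SX)"
    by (intro measurable_restrict_space2) (auto simp: space_restrict_space)
  thus ?thesis by (intro bexI[of _ s]) (auto simp: s_def)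
qed

sublocale sphere_bundle X fibre
  by unfold_locales (use compact_X sphere_compact fibre_subspace measurable_section_exists in auto)

end

section \<open>The Riemannian distance and the topology\<close>

context riemannian begin

lemma metric_bilinear: "bilinear (metric M x)" and metric_pos: "v \<noteq> 0 \<Longrightarrow> 0 < metric M x v v"
  using riemannian by (auto simp: riemannian_manifold_def)

text \<open>The squared length attains a positive minimum on \<open>K\<close> times the Euclidean
  unit sphere; homogeneity of degree two extends the bound to all vectors.\<close>

lemma metric_lower_bound:
  assumes c: "c \<in> atlas M" and K: "compact K" "K \<subseteq> coord c ` chart_dom c"
  obtains \<kappa> where "\<kappa> > 0" "\<And>y v. y \<in> K \<Longrightarrow> \<kappa> * norm v \<le> tnorm M (coord_inv c y) (from_chart M c (coord_inv c y) v)"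
proof (cases "K = {}")
  case True
  thus thesis using that[of 1] by simp
next
  case False
  define g where "g y v = metric M (coord_inv c y) (from_chart M c (coord_inv c y) v) (from_chart M c (coord_inv c y) v)" for y v
  have dom: "coord_inv c y \<in> chart_dom c" if "y \<in> K" for y using that K(2) coord_inv_coord[OF c] by auto
  have sm: "smooth_on (coord c ` chart_dom c) (\<lambda>y. metric M (coord_inv c y) (from_chart M c (coord_inv c y) v) (from_chart M c (coord_inv c y) w))" for v w
    using riemannian c by (auto simp: riemannian_manifold_def)
  have "Ck_on 0 (coord c ` chart_dom c) (\<lambda>y. metric M (coord_inv c y) (from_chart M c (coord_inv c y) v) (from_chart M c (coord_inv c y) w))" for v w
    using sm[of v w] unfolding smooth_on_def by (rule spec)
  then have ij: "continuous_on K (\<lambda>y. metric M (coord_inv c y) (from_chart M c (coord_inv c y) v) (from_chart M c (coord_inv c y) w))" for v w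
    by (intro continuous_on_subset[OF _ K(2)]) simp
  \<comment> \<open>The manifold structure provides regularity for fixed pairs of vectors only;
    expanding in the basis gives continuity jointly in the point and the vector.\<close>
  have exp: "g y v = (\<Sum>i\<in>Basis. \<Sum>j\<in>Basis. (v \<bullet> i) * (v \<bullet> j) * metric M (coord_inv c y) (from_chart M c (coord_inv c y) i) (from_chart M c (coord_inv c y) j))"
    if "y \<in> K" for y v
  proof -
    let ?x = "coord_inv c y"
    note lin = from_chart_linear[OF c dom[OF that]]
    have l1: "linear (\<lambda>a. metric M ?x a b)" and l2: "linear (metric M ?x b)" for b
      using metric_bilinear[of ?x] by (auto simp: bilinear_def)
    have "g y v = metric M ?x (\<Sum>i\<in>Basis. (v \<bullet> i) *\<^sub>R from_chart M c ?x i) (\<Sum>j\<in>Basis. (v \<bullet> j) *\<^sub>R from_chart M c ?x j)"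
      unfolding g_def by (subst (1 2) linear_basis_sum[OF lin, of v]) (rule refl)
    also have "\<dots> = (\<Sum>i\<in>Basis. (v \<bullet> i) * (\<Sum>j\<in>Basis. (v \<bullet> j) * metric M ?x (from_chart M c ?x i) (from_chart M c ?x j)))"
      by (subst linear_sum[OF l1], subst linear_cmul[OF l1], subst linear_sum[OF l2], subst linear_cmul[OF l2]) simp
    finally show ?thesis by (simp add: sum_distrib_left mult.assoc)
  qed
  have "continuous_on (K \<times> sphere 0 1) (\<lambda>p. \<Sum>i\<in>Basis. \<Sum>j\<in>Basis. (snd p \<bullet> i) * (snd p \<bullet> j) *
      metric M (coord_inv c (fst p)) (from_chart M c (coord_inv c (fst p)) i) (from_chart M c (coord_inv c (fst p)) j))"
    by (intro continuous_intros continuous_on_compose2[OF ij continuous_on_fst[OF continuous_on_id]]) auto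
  then have gc: "continuous_on (K \<times> sphere 0 1) (\<lambda>p. g (fst p) (snd p))"
    by (rule continuous_on_eq) (auto simp: exp)
  have ne: "K \<times> sphere (0::'e) 1 \<noteq> {}" using False by (simp add: sphere_eq_empty)
  obtain p where p: "p \<in> K \<times> sphere 0 1" "\<And>q. q \<in> K \<times> sphere 0 1 \<Longrightarrow> g (fst p) (snd p) \<le> g (fst q) (snd q)"
    using continuous_attains_inf[OF compact_Times[OF K(1) compact_sphere] ne gc] by blast
  let ?m = "g (fst p) (snd p)"
  have nz: "from_chart M c (coord_inv c (fst p)) (snd p) \<noteq> 0"
  proof -
    have p1: "fst p \<in> K" "norm (snd p) = 1" using p(1) by auto
    have "inj (from_chart M c (coord_inv c (fst p)))" using from_chart_bij[OF c dom[OF p1(1)]] by (rule bij_is_inj)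
    then show ?thesis
      using linear_injective_0[OF from_chart_linear[OF c dom[OF p1(1)]]] p1(2) by auto
  qed
  then have m: "0 < ?m" unfolding g_def by (rule metric_pos)
  show thesis
  proof (rule that[of "sqrt ?m"])
    show "0 < sqrt ?m" using m by simp
    fix y v assume y: "y \<in> K"
    show "sqrt ?m * norm v \<le> tnorm M (coord_inv c y) (from_chart M c (coord_inv c y) v)"
    proof (cases "v = 0")
      case True thus ?thesis
        using linear_0[OF from_chart_linear[OF c dom[OF y]]] metric_bilinear[of "coord_inv c y"] by (simp add: tnorm_def bilinear_lzero)
    next
      case False
      have "g y v = (norm v)\<^sup>2 * g y (v /\<^sub>R norm v)"
        using False by (simp add: exp[OF y] sum_distrib_left power2_eq_square field_simps)
      moreover have "?m \<le> g y (v /\<^sub>R norm v)" using p(2)[of "(y, v /\<^sub>R norm v)"] y False by simp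
      ultimately have "(norm v)\<^sup>2 * ?m \<le> g y v" by (simp add: mult_left_mono)
      then have "sqrt ((norm v)\<^sup>2 * ?m) \<le> sqrt (g y v)" by simp
      thus ?thesis by (simp add: real_sqrt_mult tnorm_def g_def mult.commute)
    qed
  qed
qed

text \<open>The fundamental theorem of calculus passes over finitely many exceptional times because
  the curve is continuous there. If the speed is not integrable, the right side is infinite.\<close>

lemma C1_curve_length_bound:
  fixes \<beta> :: "real \<Rightarrow> 'e"
  assumes s: "0 \<le> s" and c: "continuous_on {0..s} \<beta>" and S: "finite S" and C1: "\<beta> C1_differentiable_on ({0<..<s} - S)"
  shows "ennreal (norm (\<beta> s - \<beta> 0)) \<le> (\<integral>\<^sup>+t. ennreal (norm (vector_derivative \<beta> (at t))) * indicator ({0<..<s} - S) t \<partial>lborel)"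
proof -
  let ?A = "{0<..<s} - S"
  let ?D = "\<lambda>t. vector_derivative \<beta> (at t)"
  have d: "(\<beta> has_vector_derivative ?D t) (at t)" if "t \<in> ?A" for t
    using C1 that unfolding C1_differentiable_on_eq by (simp add: vector_derivative_works)
  have contD: "continuous_on ?A ?D" using C1 unfolding C1_differentiable_on_eq by simp
  have "open ?A" using finite_imp_closed[OF S] by (intro open_Diff) auto
  then have m: "(\<lambda>t. indicator ?A t *\<^sub>R ?D t) \<in> borel_measurable borel"
    by (intro borel_measurable_continuous_on_indicator contD) auto
  have nn: "(\<integral>\<^sup>+t. ennreal (norm (?D t)) * indicator ?A t \<partial>lborel) = (\<integral>\<^sup>+t. ennreal (norm (indicator ?A t *\<^sub>R ?D t)) \<partial>lborel)"
    by (intro nn_integral_cong) (auto split: split_indicator)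
  show ?thesis
  proof (cases "(\<integral>\<^sup>+t. ennreal (norm (indicator ?A t *\<^sub>R ?D t)) \<partial>lborel) = \<infinity>")
    case True thus ?thesis unfolding nn by simp
  next
    case False
    then have int: "integrable lborel (\<lambda>t. indicator ?A t *\<^sub>R ?D t)"
      using m by (intro integrableI_bounded) (auto simp: top.not_eq_extremum)
    have "(?D has_integral (\<beta> s - \<beta> 0)) {0..s}"
      by (rule fundamental_theorem_of_calculus_interior_strong[OF S s]) (use d c in auto)
    moreover have "(?D has_integral (\<beta> s - \<beta> 0)) {0..s} \<longleftrightarrow> (?D has_integral (\<beta> s - \<beta> 0)) ?A"
    proof (rule has_integral_spike_set_eq)
      have "negligible (insert 0 (insert s S))" using S by (intro negligible_finite) simp
      then show "negligible {x \<in> {0..s} - ?A. ?D x \<noteq> 0}" by (rule negligible_subset) auto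
      have "{x \<in> ?A - {0..s}. ?D x \<noteq> 0} = {}" by auto
      then show "negligible {x \<in> ?A - {0..s}. ?D x \<noteq> 0}" by (metis negligible_empty)
    qed
    ultimately have "(?D has_integral (\<beta> s - \<beta> 0)) ?A" by simp
    then have "((\<lambda>t. if t \<in> ?A then ?D t else 0) has_integral (\<beta> s - \<beta> 0)) UNIV"
      by (simp only: has_integral_restrict_UNIV)
    moreover have "(\<lambda>t. if t \<in> ?A then ?D t else 0) = (\<lambda>t. indicator ?A t *\<^sub>R ?D t)" by (auto split: split_indicator)
    ultimately have "\<beta> s - \<beta> 0 = integral\<^sup>L lborel (\<lambda>t. indicator ?A t *\<^sub>R ?D t)"
      using has_integral_unique[OF _ has_integral_integral_lborel[OF int]] by simp
    thus ?thesis unfolding nn using integral_norm_bound_ennreal[OF int] by simp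
  qed
qed

lemma velocity_in_chart:
  assumes c: "c \<in> atlas M" "\<gamma> t \<in> chart_dom c" and \<gamma>: "open W" "t \<in> W" "\<And>s. s \<in> W \<Longrightarrow> \<gamma> s \<in> chart_dom c"
    and d: "((coord c \<circ> \<gamma>) has_vector_derivative v) (at t)"
  shows "velocity M \<gamma> t = from_chart M c (\<gamma> t) v"
proof -
  let ?ca = "chart_at M (\<gamma> t)"
  have "((coord ?ca \<circ> coord_inv c) has_derivative from_chart M c (\<gamma> t)) (at ((coord c \<circ> \<gamma>) t))"
    using from_chart_mderiv[OF c] by (simp add: mderiv_def)
  from vector_derivative_diff_chain_within[of "coord c \<circ> \<gamma>" v t UNIV "coord ?ca \<circ> coord_inv c" "from_chart M c (\<gamma> t)"] d this
  have "(((coord ?ca \<circ> coord_inv c) \<circ> (coord c \<circ> \<gamma>)) has_vector_derivative from_chart M c (\<gamma> t) v) (at t)"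
    by (auto intro: has_derivative_at_withinI)
  then have "((coord ?ca \<circ> \<gamma>) has_vector_derivative from_chart M c (\<gamma> t) v) (at t)"
    by (rule has_vector_derivative_transform_within_open[OF _ \<gamma>(1,2)]) (use \<gamma>(3) coord_inv_coord[OF c(1)] in auto)
  thus ?thesis unfolding velocity_def by (rule vector_derivative_at)
qed

text \<open>A curve from near \<open>p\<close> that ends outside \<open>U\<close> has to cross an
  annulus in the coordinates around \<open>p\<close>, where the Riemannian norm dominates a multiple
  of the Euclidean one. So a small \<open>rdist\<close> keeps the end point in
  \<open>U\<close>.\<close>

lemma rdist_lower_bound:
  assumes U: "open U" "p \<in> U"
  obtains W \<delta> where "open W" "p \<in> W" "\<delta> > 0" "\<And>x y. x \<in> W \<Longrightarrow> rdist M x y < ennreal \<delta> \<Longrightarrow> y \<in> U"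
proof -
  let ?c = "chart_at M p"
  note c = chart_at(1)[of p] chart_at(2)[of p]
  let ?a = "coord ?c p"
  have opn: "open (coord ?c ` (U \<inter> chart_dom ?c))" by (rule coord_image_open[OF c(1) U(1)])
  then obtain e where e: "e > 0" "cball ?a e \<subseteq> coord ?c ` (U \<inter> chart_dom ?c)"
    using open_contains_cball[of "coord ?c ` (U \<inter> chart_dom ?c)"] c U by blast
  \<comment> \<open>Three radii are used: the curve starts within \<open>r\<close>, has to pass
    \<open>3/2 * r\<close>, and until then stays in the ball of radius \<open>2 * r\<close>, on
    which the chart and \<open>\<kappa>\<close> are under control. The difference
    \<open>r / 2\<close> enters the bound.\<close>
  define r where "r = e / 2"
  have r: "r > 0" "cball ?a (2 * r) \<subseteq> coord ?c ` (U \<inter> chart_dom ?c)" using e by (auto simp: r_def)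
  have sub: "cball ?a (2 * r) \<subseteq> coord ?c ` chart_dom ?c" using r(2) by auto
  obtain \<kappa> where \<kappa>: "\<kappa> > 0" "\<And>y v. y \<in> cball ?a (2 * r) \<Longrightarrow> \<kappa> * norm v \<le> tnorm M (coord_inv ?c y) (from_chart M ?c (coord_inv ?c y) v)"
    using metric_lower_bound[OF c(1) compact_cball sub] by metis
  define O' where "O' = chart_dom ?c \<inter> coord ?c -` ball ?a (2 * r)"
  define W where "W = chart_dom ?c \<inter> coord ?c -` ball ?a r"
  have opens: "open O'" "open W" unfolding O'_def W_def
    by (rule continuous_open_preimage[OF coord_continuous[OF c(1)] chart_dom_open[OF c(1)] open_ball])+
  have OU: "O' \<subseteq> U"
  proof
    fix x assume x: "x \<in> O'"
    then have "coord ?c x \<in> cball ?a (2 * r)" by (auto simp: O'_def)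
    then obtain y where y: "y \<in> U" "y \<in> chart_dom ?c" "coord ?c x = coord ?c y" using r(2) by blast
    then have "x = y" using x coord_inv_coord[OF c(1)] by (metis IntD1 O'_def)
    thus "x \<in> U" using y by simp
  qed
  have key: "ennreal (\<kappa> * (r / 2)) \<le> curve_length M \<gamma>"
    if \<gamma>: "piecewise_C1_curve M \<gamma>" "\<gamma> 0 \<in> W" "\<gamma> 1 \<notin> U" for \<gamma>
  proof -
    obtain S where S: "continuous_on {0..1} \<gamma>" "finite S" "(coord ?c \<circ> \<gamma>) C1_differentiable_on (({0<..<1} - S) \<inter> \<gamma> -` chart_dom ?c)"
      using \<gamma>(1) c(1) unfolding piecewise_C1_curve_def by blast
    define Q where "Q = {0..1} \<inter> \<gamma> -` (- O')"
    have "closed Q" unfolding Q_def by (rule continuous_closed_preimage[OF S(1)]) (use opens in auto)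
    then have Qc: "compact Q" using bounded_subset[OF bounded_closed_interval[of 0 "1::real"], of Q] by (auto simp: Q_def compact_eq_bounded_closed)
    have "1 \<in> Q" using \<gamma>(3) OU by (auto simp: Q_def)
    \<comment> \<open>The first exit time from \<open>O'\<close>; before it the curve can be read in
      the chart.\<close>
    then obtain T where T: "T \<in> Q" "\<And>t. t \<in> Q \<Longrightarrow> T \<le> t" using compact_attains_inf[OF Qc] by blast
    have W_O: "W \<subseteq> O'" using r(1) by (auto simp: W_def O'_def)
    have T01: "0 < T" "T \<le> 1" using T(1) \<gamma>(2) W_O by (auto simp: Q_def less_le)
    have in_O: "\<gamma> t \<in> O'" if "0 \<le> t" "t < T" for t
      using T(2)[of t] that T01 by (force simp: Q_def)
    \<comment> \<open>Otherwise the curve stays, before \<open>T\<close>, in the preimage of the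
      smaller closed ball. That set is compact, hence closed in the manifold, so it also contains
      the exit point, which would then still lie in \<open>O'\<close>.\<close>
    have "\<exists>s. 0 \<le> s \<and> s < T \<and> 3 / 2 * r < dist ?a (coord ?c (\<gamma> s))"
    proof (rule ccontr)
      assume "\<not> ?thesis"
      then have le: "dist ?a (coord ?c (\<gamma> s)) \<le> 3 / 2 * r" if "0 \<le> s" "s < T" for s using that by force
      let ?K = "coord_inv ?c ` cball ?a (3 / 2 * r)"
      have s2: "cball ?a (3 / 2 * r) \<subseteq> cball ?a (2 * r)" using r(1) by auto
      have "compact ?K"
        by (rule compact_continuous_image[OF continuous_on_subset[OF coord_inv_continuous[OF c(1)]] compact_cball]) (use sub s2 in auto)
      then have Kcl: "closed ?K" by (rule compact_imp_closed)
      have K: "\<gamma> s \<in> ?K" if "0 \<le> s" "s < T" for s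
        using le[OF that] in_O[OF that] coord_inv_coord[OF c(1), of "\<gamma> s"] by (intro image_eqI[of _ _ "coord ?c (\<gamma> s)"]) (auto simp: O'_def)
      have "(\<lambda>n. T - T / real (Suc n)) \<longlonglongrightarrow> T - 0" by (intro tendsto_diff tendsto_const LIMSEQ_Suc[OF lim_const_over_n])
      moreover have Tn: "T - T / real (Suc n) \<in> {0..1}" "0 \<le> T - T / real (Suc n)" "T - T / real (Suc n) < T" for n
      proof -
        have "0 < T / real (Suc n)" "T / real (Suc n) \<le> T" using T01 by (auto simp: divide_le_eq mult_ge1_I)
        thus "T - T / real (Suc n) \<in> {0..1}" "0 \<le> T - T / real (Suc n)" "T - T / real (Suc n) < T"
          using T01 unfolding atLeastAtMost_iff by linarith+
      qed
      moreover have "T \<in> {0..1}" using T01 by simp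
      ultimately have "(\<lambda>n. \<gamma> (T - T / real (Suc n))) \<longlonglongrightarrow> \<gamma> T"
        using S(1)[unfolded continuous_on_sequentially comp_def, rule_format, of T "\<lambda>n. T - T / real (Suc n)"] by simp
      then have "\<gamma> T \<in> ?K"
        by (rule closed_sequentially[OF Kcl, rotated]) (rule K[OF Tn(2,3)])
      then obtain y where y: "y \<in> cball ?a (3 / 2 * r)" "\<gamma> T = coord_inv ?c y" by blast
      then obtain w where w: "w \<in> chart_dom ?c" "y = coord ?c w" using sub s2 by blast
      then have "\<gamma> T = w" using y coord_inv_coord[OF c(1)] by simp
      then have "\<gamma> T \<in> O'" using w y r(1) by (auto simp: O'_def)
      thus False using T(1) by (simp add: Q_def)
    qed
    then obtain s where s: "0 \<le> s" "s < T" "3 / 2 * r < dist ?a (coord ?c (\<gamma> s))" by blast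
    let ?\<beta> = "coord ?c \<circ> \<gamma>"
    let ?A = "{0<..<s} - S"
    have O_dom: "\<gamma> t \<in> chart_dom ?c" "coord ?c (\<gamma> t) \<in> cball ?a (2 * r)" if "0 \<le> t" "t < T" for t
      using in_O[OF that] by (auto simp: O'_def)
    have bc: "continuous_on {0..s} ?\<beta>"
      using s T01 O_dom by (intro continuous_on_compose continuous_on_subset[OF S(1)] continuous_on_subset[OF coord_continuous[OF c(1)]]) auto
    have C1: "?\<beta> C1_differentiable_on ?A"
      by (rule C1_differentiable_on_subset[OF S(3)]) (use s T01 O_dom in auto)
    have "r / 2 \<le> norm (?\<beta> s - ?\<beta> 0)"
    proof -
      have "dist ?a (coord ?c (\<gamma> 0)) < r" using \<gamma>(2) by (auto simp: W_def)
      thus ?thesis using s(3) dist_triangle[of ?a "coord ?c (\<gamma> s)" "coord ?c (\<gamma> 0)"] by (simp add: dist_norm norm_minus_commute)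
    qed
    then have "ennreal (\<kappa> * (r / 2)) \<le> ennreal (\<kappa> * norm (?\<beta> s - ?\<beta> 0))" using \<kappa>(1) by (intro ennreal_leI mult_left_mono) auto
    also have "\<dots> = ennreal \<kappa> * ennreal (norm (?\<beta> s - ?\<beta> 0))" using \<kappa>(1) by (simp add: ennreal_mult)
    also have "\<dots> \<le> ennreal \<kappa> * (\<integral>\<^sup>+t. ennreal (norm (vector_derivative ?\<beta> (at t))) * indicator ?A t \<partial>lborel)"
      by (intro mult_left_mono C1_curve_length_bound[OF s(1) bc S(2) C1]) simp
    also have "\<dots> = (\<integral>\<^sup>+t. ennreal \<kappa> * (ennreal (norm (vector_derivative ?\<beta> (at t))) * indicator ?A t) \<partial>lborel)"
    proof (rule nn_integral_cmult[symmetric])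
      have "open ?A" using finite_imp_closed[OF S(2)] by (intro open_Diff) auto
      then have "(\<lambda>t. indicator ?A t *\<^sub>R vector_derivative ?\<beta> (at t)) \<in> borel_measurable borel"
        using C1 unfolding C1_differentiable_on_eq by (intro borel_measurable_continuous_on_indicator) auto
      then have "(\<lambda>t. ennreal (norm (indicator ?A t *\<^sub>R vector_derivative ?\<beta> (at t)))) \<in> borel_measurable lborel"
        by (intro measurable_compose[OF _ measurable_ennreal] measurable_compose[OF _ borel_measurable_norm]) simp
      moreover have "(\<lambda>t. ennreal (norm (indicator ?A t *\<^sub>R vector_derivative ?\<beta> (at t)))) = (\<lambda>t. ennreal (norm (vector_derivative ?\<beta> (at t))) * indicator ?A t)"
        by (auto split: split_indicator)
      ultimately show "(\<lambda>t. ennreal (norm (vector_derivative ?\<beta> (at t))) * indicator ?A t) \<in> borel_measurable lborel"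
        by (simp only:)
    qed
    also have "\<dots> \<le> curve_length M \<gamma>"
      unfolding curve_length_def
    proof (rule nn_integral_mono)
      fix t
      show "ennreal \<kappa> * (ennreal (norm (vector_derivative ?\<beta> (at t))) * indicator ?A t) \<le> ennreal (tnorm M (\<gamma> t) (velocity M \<gamma> t)) * indicator {0..1} t"
      proof (cases "t \<in> ?A")
        case True
        then have t: "0 < t" "t < s" "t < T" "0 \<le> t" "t \<in> {0..1}" using s T01 by auto
        have d: "(?\<beta> has_vector_derivative vector_derivative ?\<beta> (at t)) (at t)"
          using C1 True unfolding C1_differentiable_on_eq by (simp add: vector_derivative_works)
        have v: "velocity M \<gamma> t = from_chart M ?c (\<gamma> t) (vector_derivative ?\<beta> (at t))"
          by (rule velocity_in_chart[OF c(1) O_dom(1)[OF t(4,3)] open_greaterThanLessThan[of 0 T] _ _ d]) (use t O_dom in auto)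
        have "\<kappa> * norm (vector_derivative ?\<beta> (at t)) \<le> tnorm M (\<gamma> t) (velocity M \<gamma> t)"
          using \<kappa>(2)[OF O_dom(2)[OF t(4,3)], of "vector_derivative ?\<beta> (at t)"] coord_inv_coord[OF c(1) O_dom(1)[OF t(4,3)]]
          unfolding v by simp
        then show ?thesis using True t(5) \<kappa>(1) by (simp add: ennreal_mult[symmetric] ennreal_leI)
      qed simp
    qed
    finally show ?thesis .
  qed
  show thesis
  proof (rule that[of W "\<kappa> * (r / 2)"])
    show "open W" by (rule opens)
    show "p \<in> W" using c r(1) by (simp add: W_def)
    show "0 < \<kappa> * (r / 2)" using \<kappa>(1) r(1) by simp
    fix x y assume x: "x \<in> W" and d: "rdist M x y < ennreal (\<kappa> * (r / 2))"
    show "y \<in> U"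
    proof (rule ccontr)
      assume "y \<notin> U"
      have "ennreal (\<kappa> * (r / 2)) \<le> rdist M x y" unfolding rdist_def
        by (rule INF_greatest) (use key x \<open>y \<notin> U\<close> in auto)
      thus False using d by simp
    qed
  qed
qed

text \<open>Near each point of \<open>X\<close>, \<open>rdist_lower_bound\<close> traps the second
  argument in a neighbourhood where \<rho> is small; a finite subcover makes the threshold
  uniform.\<close>

lemma rdist_uniform:
  fixes \<rho> :: "'a \<times> 'a \<Rightarrow> real"
  assumes X: "compact X" and \<rho>: "continuous_on (X \<times> X) \<rho>" "\<And>x. x \<in> X \<Longrightarrow> \<rho> (x, x) = 0" and e: "e > 0"
  obtains \<delta> where "\<delta> > 0" "\<And>x y. x \<in> X \<Longrightarrow> y \<in> X \<Longrightarrow> rdist M x y < ennreal \<delta> \<Longrightarrow> \<bar>\<rho> (x, y)\<bar> < e"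
proof -
  have "\<exists>W \<delta>. open W \<and> p \<in> W \<and> \<delta> > 0 \<and> (\<forall>x y. x \<in> W \<longrightarrow> x \<in> X \<longrightarrow> y \<in> X \<longrightarrow> rdist M x y < ennreal \<delta> \<longrightarrow> \<bar>\<rho> (x, y)\<bar> < e)" if p: "p \<in> X" for p
  proof -
    obtain Q where Q: "open Q" "(p, p) \<in> Q" "\<And>z. z \<in> Q \<Longrightarrow> z \<in> X \<times> X \<Longrightarrow> \<rho> z \<in> {-e<..<e}"
    proof -
      have "\<rho> (p, p) \<in> {-e<..<e}" using \<rho>(2)[OF p] e by simp
      with \<rho>(1) p show thesis using that unfolding continuous_on_topological
        by (metis SigmaI open_greaterThanLessThan)
    qed
    obtain A B where AB: "open A" "open B" "p \<in> A" "p \<in> B" "A \<times> B \<subseteq> Q"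
      using open_prod_elim[OF Q(1,2)] by (metis mem_Sigma_iff)
    obtain W \<delta> where W: "open W" "p \<in> W" "\<delta> > 0" "\<And>x y. x \<in> W \<Longrightarrow> rdist M x y < ennreal \<delta> \<Longrightarrow> y \<in> B"
      using rdist_lower_bound[OF AB(2,4)] by metis
    have "\<bar>\<rho> (x, y)\<bar> < e" if "x \<in> W \<inter> A" "x \<in> X" "y \<in> X" "rdist M x y < ennreal \<delta>" for x y
    proof -
      have "y \<in> B" using W(4) that by blast
      then have "\<rho> (x, y) \<in> {-e<..<e}" using AB(5) that by (intro Q(3)) auto
      thus ?thesis by auto
    qed
    thus ?thesis using W AB by (intro exI[of _ "W \<inter> A"] exI[of _ \<delta>]) auto
  qed
  then obtain W \<delta> where W: "\<And>p. p \<in> X \<Longrightarrow> open (W p)" "\<And>p. p \<in> X \<Longrightarrow> p \<in> W p" "\<And>p. p \<in> X \<Longrightarrow> \<delta> p > (0::real)"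
    "\<And>p x y. p \<in> X \<Longrightarrow> x \<in> W p \<Longrightarrow> x \<in> X \<Longrightarrow> y \<in> X \<Longrightarrow> rdist M x y < ennreal (\<delta> p) \<Longrightarrow> \<bar>\<rho> (x, y)\<bar> < e" by metis
  have "X \<subseteq> (\<Union>p\<in>X. W p)" using W(2) by blast
  then obtain D where D: "D \<subseteq> X" "finite D" "X \<subseteq> (\<Union>p\<in>D. W p)" using compactE_image[OF X, of X W] W(1) by metis
  define d where "d = Min (insert 1 (\<delta> ` D))"
  have d: "d > 0" "\<And>p. p \<in> D \<Longrightarrow> d \<le> \<delta> p" using D W(3) by (auto simp: d_def)
  show thesis
  proof (rule that[OF d(1)])
    fix x y assume *: "x \<in> X" "y \<in> X" "rdist M x y < ennreal d"
    then obtain p where p: "p \<in> D" "x \<in> W p" using D(3) by blast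
    have "rdist M x y < ennreal (\<delta> p)" using *(3) d(2)[OF p(1)] by (meson ennreal_leI less_le_trans)
    thus "\<bar>\<rho> (x, y)\<bar> < e" using W(4) p D(1) * by blast
  qed
qed

end

section \<open>Almost-everywhere representatives\<close>

text \<open>The noise is a letter followed by independent noise; an event that reads only the first
  letter is constant along the second factor.\<close>

lemma AE_noise_zeroD:
  assumes T: "prob_space T" and Q: "AE \<omega> in noise T. Q (\<omega> 0)"
  shows "AE t in T. Q t"
proof -
  interpret T: prob_space T by fact
  interpret product_prob_space "\<lambda>_. T" "UNIV :: nat set" by unfold_locales
  interpret sequence_space T ..
  interpret N: prob_space "noise T" by (rule prob_space_noise[OF T])
  interpret pair_sigma_finite T "noise T" ..
  have "AE p in T \<Otimes>\<^sub>M noise T. Q ((case p of (s, \<omega>) \<Rightarrow> case_nat s \<omega>) 0)"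
  proof (rule AE_distrD[where M'="noise T" and f="\<lambda>(s, \<omega>). case_nat s \<omega>" and P="\<lambda>\<omega>. Q (\<omega> 0)"])
    show "(\<lambda>(s, \<omega>). case_nat s \<omega>) \<in> measurable (T \<Otimes>\<^sub>M noise T) (noise T)" by measurable
    show "AE \<omega> in distr (T \<Otimes>\<^sub>M noise T) (noise T) (\<lambda>(s, \<omega>). case_nat s \<omega>). Q (\<omega> 0)"
      using Q by (simp only: PiM_iter)
  qed
  then have "AE s in T. AE \<omega> in noise T. Q s" using AE_pair by fastforce
  then show ?thesis by eventually_elim simp
qed

text \<open>Integrands built from a random map coincide with measurable ones almost surely only, so
  they become measurable in the completion; the value is then computed with the measurable version
  on the original space.\<close>

lemma AE_equal_completion_integral:
  fixes g h :: "'w \<Rightarrow> real"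
  assumes h: "h \<in> borel_measurable M" and eq: "AE x in M. g x = h x"
  shows "integral\<^sup>L (completion M) g = integral\<^sup>L M h"
proof -
  have eq': "AE x in completion M. g x = h x" using eq by (rule AE_completion)
  have hm: "h \<in> borel_measurable (completion M)" using h by (rule measurable_completion)
  have gm: "g \<in> borel_measurable (completion M)"
  proof (rule measurableI)
    fix A :: "real set" assume A: "A \<in> sets borel"
    show "g -` A \<inter> space (completion M) \<in> sets (completion M)"
    proof (rule completion.in_sets_AE[where A="h -` A \<inter> space (completion M)"])
      show "AE x in completion M. x \<in> h -` A \<inter> space (completion M) \<longleftrightarrow> x \<in> g -` A \<inter> space (completion M)"
        using eq' by eventually_elim simp
      show "h -` A \<inter> space (completion M) \<in> sets (completion M)" by (rule measurable_sets[OF hm A])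
    qed auto
  qed simp
  have "integral\<^sup>L (completion M) g = integral\<^sup>L (completion M) h" by (rule integral_cong_AE[OF gm hm eq'])
  also have "\<dots> = integral\<^sup>L M h" by (rule integral_completion[OF h])
  finally show ?thesis .
qed

lemma distr_random_map_emeasure:
  assumes T: "prob_space T" and \<Phi>: "random_map T S \<Phi>" and \<nu>: "prob_space \<nu>" "sets \<nu> = sets (restrict_space borel S)"
    and B: "B \<in> sets \<nu>"
  shows "emeasure (distr (T \<Otimes>\<^sub>M \<nu>) (restrict_space borel S) (\<lambda>(t, z). \<Phi> t z)) B = (\<integral>\<^sup>+t. emeasure \<nu> (\<Phi> t -` B \<inter> space \<nu>) \<partial>T)"
    and "(\<lambda>t. emeasure \<nu> (\<Phi> t -` B \<inter> space \<nu>)) \<in> borel_measurable T"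
proof -
  interpret \<nu>: prob_space \<nu> by fact
  have m: "(\<lambda>(t, z). \<Phi> t z) \<in> measurable (T \<Otimes>\<^sub>M \<nu>) (restrict_space borel S)"
    using \<Phi> \<nu>(2) unfolding random_map_def by (simp cong: measurable_cong_sets sets_pair_measure_cong)
  let ?A = "(\<lambda>(t, z). \<Phi> t z) -` B \<inter> space (T \<Otimes>\<^sub>M \<nu>)"
  have A: "?A \<in> sets (T \<Otimes>\<^sub>M \<nu>)" using B \<nu>(2) by (intro measurable_sets[OF m]) simp
  have sec: "Pair t -` ?A = \<Phi> t -` B \<inter> space \<nu>" if "t \<in> space T" for t using that by (auto simp: space_pair_measure)
  have "emeasure (distr (T \<Otimes>\<^sub>M \<nu>) (restrict_space borel S) (\<lambda>(t, z). \<Phi> t z)) B = emeasure (T \<Otimes>\<^sub>M \<nu>) ?A"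
    using B \<nu>(2) by (intro emeasure_distr[OF m]) simp
  also have "\<dots> = (\<integral>\<^sup>+t. emeasure \<nu> (Pair t -` ?A) \<partial>T)" by (rule \<nu>.emeasure_pair_measure_alt[OF A])
  also have "\<dots> = (\<integral>\<^sup>+t. emeasure \<nu> (\<Phi> t -` B \<inter> space \<nu>) \<partial>T)" using sec by (intro nn_integral_cong) simp
  finally show "emeasure (distr (T \<Otimes>\<^sub>M \<nu>) (restrict_space borel S) (\<lambda>(t, z). \<Phi> t z)) B = (\<integral>\<^sup>+t. emeasure \<nu> (\<Phi> t -` B \<inter> space \<nu>) \<partial>T)" .
  have "(\<lambda>t. emeasure \<nu> (Pair t -` ?A)) \<in> borel_measurable T" by (rule \<nu>.measurable_emeasure_Pair[OF A])
  then show "(\<lambda>t. emeasure \<nu> (\<Phi> t -` B \<inter> space \<nu>)) \<in> borel_measurable T" using sec by (simp cong: measurable_cong)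
qed

lemma nn_integral_noise_zero:
  assumes T: "prob_space T" and h: "h \<in> borel_measurable T" and eq: "AE \<omega> in noise T. g \<omega> = h (\<omega> 0)"
  shows "(\<integral>\<^sup>+\<omega>. g \<omega> \<partial>noise T) = (\<integral>\<^sup>+t. h t \<partial>T)"
proof -
  have "(\<integral>\<^sup>+\<omega>. g \<omega> \<partial>noise T) = (\<integral>\<^sup>+\<omega>. h (\<omega> 0) \<partial>noise T)" by (rule nn_integral_cong_AE[OF eq])
  also have "\<dots> = (\<integral>\<^sup>+t. h t \<partial>distr (noise T) T (\<lambda>\<omega>. \<omega> 0))" using h by (intro nn_integral_distr[symmetric]) auto
  finally show ?thesis by (simp only: distr_noise_component[OF T])
qed

text \<open>Almost surely \<open>f \<omega>\<close> acts on \<open>S\<close> as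
  \<open>\<Phi> (\<omega> 0)\<close>, and \<open>\<omega> 0\<close> has law \<open>T\<close>; both
  conditions thus compare the same numbers on every measurable set.\<close>

lemma stationary_iff_invariant:
  assumes T: "prob_space T" and \<Phi>: "random_map T S \<Phi>" and \<nu>: "prob_space \<nu>" "sets \<nu> = sets (restrict_space borel S)"
    and f: "AE \<omega> in noise T. \<forall>x\<in>S. f \<omega> x = \<Phi> (\<omega> 0) x"
  shows "stationary (noise T) f \<nu> \<longleftrightarrow> invariant_measure T S \<Phi> \<nu>"
proof -
  have sp: "space \<nu> = S" using sets_eq_imp_space_eq[OF \<nu>(2)] by (simp add: space_restrict_space)
  have "(\<integral>\<^sup>+\<omega>. emeasure (distr \<nu> \<nu> (f \<omega>)) B \<partial>noise T) = emeasure (distr (T \<Otimes>\<^sub>M \<nu>) (restrict_space borel S) (\<lambda>(t, z). \<Phi> t z)) B"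
    if B: "B \<in> sets \<nu>" for B
    unfolding distr_random_map_emeasure(1)[OF T \<Phi> \<nu> B]
  proof (rule nn_integral_noise_zero[OF T distr_random_map_emeasure(2)[OF T \<Phi> \<nu> B]])
    show "AE \<omega> in noise T. emeasure (distr \<nu> \<nu> (f \<omega>)) B = emeasure \<nu> (\<Phi> (\<omega> 0) -` B \<inter> space \<nu>)"
      using f AE_space
    proof eventually_elim
      case (elim \<omega>)
      have m: "\<Phi> (\<omega> 0) \<in> measurable \<nu> \<nu>"
      proof -
        have "(\<lambda>z. \<Phi> (\<omega> 0) z) \<in> measurable \<nu> (restrict_space borel S)"
          using noise_component[OF elim(2)] by (intro random_map_measurable[OF \<Phi>]) (auto simp: \<nu>(2) cong: measurable_cong_sets)
        thus ?thesis by (simp add: \<nu>(2) cong: measurable_cong_sets)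
      qed
      have "distr \<nu> \<nu> (f \<omega>) = distr \<nu> \<nu> (\<Phi> (\<omega> 0))" using elim(1) by (intro distr_cong) (auto simp: sp)
      then show ?case using emeasure_distr[OF m B] by simp
    qed
  qed
  note eq = this
  show ?thesis
  proof
    assume "stationary (noise T) f \<nu>"
    then have "distr (T \<Otimes>\<^sub>M \<nu>) (restrict_space borel S) (\<lambda>(t, z). \<Phi> t z) = \<nu>"
      using eq \<nu>(2) by (intro measure_eqI) (auto simp: stationary_def)
    thus "invariant_measure T S \<Phi> \<nu>" using \<nu> by (simp add: invariant_measure_def)
  next
    assume "invariant_measure T S \<Phi> \<nu>"
    thus "stationary (noise T) f \<nu>" using eq by (simp add: stationary_def invariant_measure_def)
  qed
qed

section \<open>The projectivised cotangent bundle\<close>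

context embedded begin

lemma cov_compose_from_chart:
  assumes c: "c \<in> atlas M" "x \<in> chart_dom c" and x: "x \<in> X"
  shows "(cov x u o\<^sub>L Blinfun (from_chart M c x)) v = u \<bullet> chart_emb c x v"
proof -
  have "bounded_linear (from_chart M c x)" using from_chart_linear[OF c] by (simp add: linear_conv_bounded_linear)
  thus ?thesis by (simp add: bounded_linear_Blinfun_apply cov_apply[OF x] chart_emb_def)
qed

lemma compose_from_chart_inj:
  assumes c: "c \<in> atlas M" "x \<in> chart_dom c"
    and eq: "\<xi> o\<^sub>L Blinfun (from_chart M c x) = \<zeta> o\<^sub>L Blinfun (from_chart M c x)"
  shows "\<xi> = \<zeta>"
proof (rule blinfun_eqI)
  fix w
  have bl: "bounded_linear (from_chart M c x)" using from_chart_linear[OF c] by (simp add: linear_conv_bounded_linear)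
  obtain v where v: "w = from_chart M c x v" using from_chart_bij[OF c] by (metis bij_pointE)
  from arg_cong[OF eq, of "\<lambda>A. blinfun_apply A v"] show "\<xi> w = \<zeta> w" by (simp add: v bounded_linear_Blinfun_apply[OF bl])
qed

text \<open>Inverse of the trivialisation of the cotangent bundle over \<open>c\<close>: the inverse
  Gram matrix raises the index of the coordinates \<eta>, and \<open>chart_emb\<close> places the
  result in the fibre.\<close>

definition chart_covector :: "('a, 'e) chart \<Rightarrow> 'a \<Rightarrow> ('e \<Rightarrow>\<^sub>L real) \<Rightarrow> 'n" where
  "chart_covector c x \<eta> = chart_emb c x (inv (gram c x) (\<Sum>b\<in>Basis. \<eta> b *\<^sub>R b))"

lemma chart_covector:
  assumes c: "c \<in> atlas M" "x \<in> chart_dom c" "x \<in> X"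
  shows "chart_covector c x \<eta> \<in> fibre x" "cov x (chart_covector c x \<eta>) o\<^sub>L Blinfun (from_chart M c x) = \<eta>"
proof -
  show "chart_covector c x \<eta> \<in> fibre x" by (simp add: chart_covector_def chart_emb_in_fibre[OF c])
  show "cov x (chart_covector c x \<eta>) o\<^sub>L Blinfun (from_chart M c x) = \<eta>"
  proof (rule blinfun_eqI)
    fix v
    let ?a = "inv (gram c x) (\<Sum>b\<in>Basis. \<eta> b *\<^sub>R b)"
    have "(cov x (chart_covector c x \<eta>) o\<^sub>L Blinfun (from_chart M c x)) v = gram c x ?a \<bullet> v"
      by (simp only: cov_compose_from_chart[OF c(1,2,3)] chart_covector_def gram_inner[OF c])
    also have "gram c x ?a = (\<Sum>b\<in>Basis. \<eta> b *\<^sub>R b)" using gram_bij[OF c] by (simp add: bij_is_surj surj_f_inv_f)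
    also have "\<dots> \<bullet> v = (\<Sum>b\<in>Basis. (v \<bullet> b) *\<^sub>R \<eta> b)" by (simp add: inner_sum_left inner_commute[of v] mult.commute)
    also have "\<dots> = \<eta> v"
      using linear_basis_sum[of "blinfun_apply \<eta>" v] by (simp add: blinfun.bounded_linear_right linear_conv_bounded_linear)
    finally show "(cov x (chart_covector c x \<eta>) o\<^sub>L Blinfun (from_chart M c x)) v = \<eta> v" .
  qed
qed

lemma chart_covector_continuous:
  assumes c: "c \<in> atlas M"
  shows "continuous_on ((X \<inter> chart_dom c) \<times> UNIV) (\<lambda>p. chart_covector c (fst p) (snd p))"
proof -
  let ?W = "(X \<inter> chart_dom c) \<times> (UNIV :: ('e \<Rightarrow>\<^sub>L real) set)"
  have f: "continuous_on ?W fst" "fst ` ?W \<subseteq> X \<inter> chart_dom c" by (auto intro: continuous_intros)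
  have Je: "continuous_on ?W (\<lambda>p. chart_emb c (fst p) v)" for v
    by (rule continuous_on_compose2[OF chart_emb_continuous1[OF c] f])
  have Ge: "continuous_on ?W (\<lambda>p. inv (gram c (fst p)) v)" for v
    by (rule continuous_on_compose2[OF gram_inv_continuous[OF c] f])
  have "continuous_on ?W (\<lambda>p. blinfun_apply (snd p) b)" for b
    by (rule bounded_linear.continuous_on[OF blinfun.bounded_linear_left continuous_on_snd[OF continuous_on_id]])
  then have s: "continuous_on ?W (\<lambda>p. \<Sum>b\<in>Basis. blinfun_apply (snd p) b *\<^sub>R b)" by (intro continuous_on_sum continuous_on_scaleR continuous_on_const)
  have "continuous_on ?W (\<lambda>p. inv (gram c (fst p)) (\<Sum>b\<in>Basis. blinfun_apply (snd p) b *\<^sub>R b))"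
    by (rule continuous_on_linear_apply[OF _ Ge s]) (auto intro: gram_inv_linear[OF c])
  note continuous_on_linear_apply[where K="\<lambda>p. chart_emb c (fst p)", OF _ Je this]
  moreover have "linear (chart_emb c (fst p))" if "p \<in> ?W" for p using that by (auto intro: chart_emb_linear[OF c])
  ultimately show ?thesis unfolding chart_covector_def by blast
qed

text \<open>Identifies the quotient topology coming from nonzero covectors with the one coming from
  the unit sphere bundle, by continuous maps in both directions that respect lines. All topological
  questions about lines can then be settled on spheres.\<close>

lemma proj_cotangent_open_iff:
  "proj_cotangent_open M X U \<longleftrightarrow> U \<subseteq> proj_cotangent X \<and> openin (top_of_set SX) (SX \<inter> cot_line -` U)"
proof
  assume U: "proj_cotangent_open M X U"
  have "\<exists>W. openin (top_of_set SX) W \<and> p \<in> W \<and> W \<subseteq> SX \<inter> cot_line -` U" if p: "p \<in> SX \<inter> cot_line -` U" for p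
  proof -
    let ?c = "chart_at M (fst p)"
    note c = chart_at(1)[of "fst p"]
    let ?Q = "{(x, \<xi> o\<^sub>L Blinfun (from_chart M ?c x)) | x \<xi>. x \<in> chart_dom ?c \<and> \<xi> \<noteq> 0 \<and> (x, span {\<xi>}) \<in> U}"
    have Q: "openin (top_of_set ((X \<inter> chart_dom ?c) \<times> (- {0}))) ?Q" using U c by (simp add: proj_cotangent_open_def)
    let ?Y = "SX \<inter> (chart_dom ?c \<times> UNIV)"
    define g where "g q = (fst q, cov (fst q) (snd q) o\<^sub>L Blinfun (from_chart M ?c (fst q)))" for q
    have inX: "fst q \<in> chart_dom ?c" "fst q \<in> X" "snd q \<in> fibre (fst q)" "norm (snd q) = 1" if "q \<in> ?Y" for q
      using that by (auto simp: unit_sphere_bundle_def)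
    have nz: "cov (fst q) (snd q) \<noteq> 0" if "q \<in> ?Y" for q
      using cov_eq_0[OF inX(2,3)[OF that]] inX(4)[OF that] by auto
    have cont: "continuous_on ?Y g"
    proof -
      have f: "continuous_on ?Y fst" "fst ` ?Y \<subseteq> X \<inter> chart_dom ?c" using inX by (auto intro: continuous_intros)
      have "continuous_on ?Y (\<lambda>q. cov (fst q) (snd q) o\<^sub>L Blinfun (from_chart M ?c (fst q)))"
      proof (rule continuous_on_blinfun_componentwise)
        fix v :: 'e
        have "continuous_on ?Y (\<lambda>q. snd q \<bullet> chart_emb ?c (fst q) v)"
          by (intro continuous_intros continuous_on_compose2[OF chart_emb_continuous1[OF c] f])
        then show "continuous_on ?Y (\<lambda>q. (cov (fst q) (snd q) o\<^sub>L Blinfun (from_chart M ?c (fst q))) v)"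
          by (rule continuous_on_eq) (metis cov_compose_from_chart[OF c] inX(1,2))
      qed
      with f(1) show ?thesis unfolding g_def by (rule continuous_on_Pair)
    qed
    have gY: "g ` ?Y \<subseteq> (X \<inter> chart_dom ?c) \<times> (- {0})"
    proof
      fix z assume "z \<in> g ` ?Y"
      then obtain q where q: "q \<in> ?Y" "z = g q" by auto
      have "cov (fst q) (snd q) o\<^sub>L Blinfun (from_chart M ?c (fst q)) \<noteq> 0 o\<^sub>L Blinfun (from_chart M ?c (fst q))"
        using compose_from_chart_inj[OF c inX(1)[OF q(1)]] nz[OF q(1)] by blast
      then show "z \<in> (X \<inter> chart_dom ?c) \<times> (- {0})"
        using inX[OF q(1)] by (simp add: q(2) g_def bounded_bilinear.zero_left[OF bounded_bilinear_blinfun_compose])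
    qed
    have "openin (top_of_set ?Y) (?Y \<inter> g -` ?Q)" using continuous_openin_preimage[OF cont _ Q] gY by blast
    moreover have "openin (top_of_set SX) ?Y"
      using chart_dom_open[OF c] by (intro openin_open_Int open_Times) auto
    ultimately have oQ: "openin (top_of_set SX) (?Y \<inter> g -` ?Q)" by (rule openin_trans)
    have iff: "q \<in> g -` ?Q \<longleftrightarrow> cot_line q \<in> U" if q: "q \<in> ?Y" for q
    proof
      assume "q \<in> g -` ?Q"
      then obtain \<xi> where \<xi>: "\<xi> \<noteq> 0" "(fst q, span {\<xi>}) \<in> U"
        "cov (fst q) (snd q) o\<^sub>L Blinfun (from_chart M ?c (fst q)) = \<xi> o\<^sub>L Blinfun (from_chart M ?c (fst q))"
        by (auto simp: g_def)
      from compose_from_chart_inj[OF c inX(1)[OF q] \<xi>(3)] \<xi>(2) show "cot_line q \<in> U" by (simp add: cot_line_def case_prod_beta')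
    next
      assume "cot_line q \<in> U"
      then show "q \<in> g -` ?Q" using nz[OF q] inX[OF q] by (auto simp: g_def cot_line_def case_prod_beta')
    qed
    have "?Y \<inter> g -` ?Q = ?Y \<inter> cot_line -` U" using iff by blast
    with oQ have "openin (top_of_set SX) (?Y \<inter> cot_line -` U)" by (simp only:)
    then show ?thesis using p chart_at(2)[of "fst p"]
      by (intro exI[of _ "?Y \<inter> cot_line -` U"]) (auto simp: mem_Times_iff)
  qed
  then have "openin (top_of_set SX) (SX \<inter> cot_line -` U)" by (subst openin_subopen) blast
  with U show "U \<subseteq> proj_cotangent X \<and> openin (top_of_set SX) (SX \<inter> cot_line -` U)" by (simp add: proj_cotangent_open_def)
next
  assume U: "U \<subseteq> proj_cotangent X \<and> openin (top_of_set SX) (SX \<inter> cot_line -` U)"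
  show "proj_cotangent_open M X U" unfolding proj_cotangent_open_def
  proof (intro conjI ballI)
    fix c assume c: "c \<in> atlas M"
    let ?W = "(X \<inter> chart_dom c) \<times> (- {0 :: 'e \<Rightarrow>\<^sub>L real})"
    let ?Q = "{(x, \<xi> o\<^sub>L Blinfun (from_chart M c x)) | x \<xi>. x \<in> chart_dom c \<and> \<xi> \<noteq> 0 \<and> (x, span {\<xi>}) \<in> U}"
    let ?w = "\<lambda>p. chart_covector c (fst p) (snd p)"
    \<comment> \<open>The opposite direction: coordinates are turned into a fibre vector and
      normalised, which leaves the line unchanged.\<close>
    define h where "h p = (fst p, ?w p /\<^sub>R norm (?w p))" for p
    have in': "fst p \<in> chart_dom c" "fst p \<in> X" "snd p \<noteq> 0" if "p \<in> ?W" for p using that by auto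
    note cw = chart_covector[OF c in'(1,2)]
    have cnz: "cov (fst p) (?w p) \<noteq> 0" if "p \<in> ?W" for p
      using cw(2)[OF that that, of "snd p"] in'(3)[OF that] by (auto simp: bounded_bilinear.zero_left[OF bounded_bilinear_blinfun_compose])
    have nz: "?w p \<noteq> 0" if "p \<in> ?W" for p
      using cnz[OF that] cov_eq_0[OF in'(2)[OF that] cw(1)[OF that that, of "snd p"]] by simp
    have wc: "continuous_on ?W ?w" by (rule continuous_on_subset[OF chart_covector_continuous[OF c]]) auto
    have hc: "continuous_on ?W h" unfolding h_def using nz by (intro continuous_intros wc) auto
    have hS: "h ` ?W \<subseteq> SX"
      using nz in' cw(1) subspace_scale[OF fibre_subspace] by (auto simp: h_def unit_sphere_bundle_def)
    have "openin (top_of_set ?W) (?W \<inter> h -` (SX \<inter> cot_line -` U))"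
      using continuous_openin_preimage[OF hc _ conjunct2[OF U]] hS by blast
    moreover have "?W \<inter> h -` (SX \<inter> cot_line -` U) = ?Q"
    proof (rule set_eqI)
      fix p :: "'a \<times> ('e \<Rightarrow>\<^sub>L real)"
      have line: "cot_line (h p) = (fst p, span {cov (fst p) (?w p)})" if "p \<in> ?W" for p
        using nz[OF that] by (simp add: h_def cot_line_def cov_scale[OF in'(2)[OF that]] span_scale)
      show "p \<in> ?W \<inter> h -` (SX \<inter> cot_line -` U) \<longleftrightarrow> p \<in> ?Q"
      proof
        assume p: "p \<in> ?W \<inter> h -` (SX \<inter> cot_line -` U)"
        then have "(fst p, span {cov (fst p) (?w p)}) \<in> U" using line[of p] by (metis IntD1 IntD2 vimageE)
        then show "p \<in> ?Q" using p cw(2)[of p "snd p"] cnz[of p]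
          by (intro CollectI exI[of _ "fst p"] exI[of _ "cov (fst p) (?w p)"]) auto
      next
        assume "p \<in> ?Q"
        then obtain x \<xi> where p: "p = (x, \<xi> o\<^sub>L Blinfun (from_chart M c x))" "x \<in> chart_dom c" "\<xi> \<noteq> 0" "(x, span {\<xi>}) \<in> U" by blast
        have x: "x \<in> X" using p(4) U by (auto simp: proj_cotangent_def)
        have "\<xi> o\<^sub>L Blinfun (from_chart M c x) \<noteq> 0 o\<^sub>L Blinfun (from_chart M c x)"
          using compose_from_chart_inj[OF c p(2)] p(3) by blast
        then have W: "p \<in> ?W" using x p by (simp add: bounded_bilinear.zero_left[OF bounded_bilinear_blinfun_compose])
        have "cov x (?w p) = \<xi>"
          by (rule compose_from_chart_inj[OF c p(2)]) (use chart_covector(2)[OF c p(2) x, of "snd p"] in \<open>simp add: p(1)\<close>)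
        then have "cot_line (h p) \<in> U" using line[OF W] p by simp
        then show "p \<in> ?W \<inter> h -` (SX \<inter> cot_line -` U)" using W hS by auto
      qed
    qed
    ultimately show "openin (top_of_set ?W) ?Q" by simp
  qed (use U in blast)
qed

lemma space_proj_cotangent_borel [simp]: "space (proj_cotangent_borel M X) = proj_cotangent X"
  unfolding proj_cotangent_borel_def by (rule space_measure_of) (auto simp: proj_cotangent_open_def)

lemma proj_cotangent_open_sets: "proj_cotangent_open M X U \<Longrightarrow> U \<in> sets (proj_cotangent_borel M X)"
  unfolding proj_cotangent_borel_def by (subst sets_measure_of) (auto simp: proj_cotangent_open_def)

lemma measurable_into_proj_cotangent:
  assumes "f \<in> space N \<rightarrow> proj_cotangent X" "\<And>U. proj_cotangent_open M X U \<Longrightarrow> f -` U \<inter> space N \<in> sets N"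
  shows "f \<in> measurable N (proj_cotangent_borel M X)"
  unfolding proj_cotangent_borel_def
  by (rule measurable_measure_of) (use assms in \<open>auto simp: proj_cotangent_open_def\<close>)

lemma cot_line_measurable: "cot_line \<in> measurable (restrict_space borel SX) (proj_cotangent_borel M X)"
proof (rule measurable_into_proj_cotangent)
  show "cot_line \<in> space (restrict_space borel SX) \<rightarrow> proj_cotangent X"
    using cot_line_image by (auto simp: space_restrict_space)
  fix U :: "('a \<times> ('e \<Rightarrow>\<^sub>L real) set) set" assume "proj_cotangent_open M X U"
  then obtain W where "open W" "SX \<inter> cot_line -` U = SX \<inter> W" by (auto simp: proj_cotangent_open_iff openin_open)
  then show "cot_line -` U \<inter> space (restrict_space borel SX) \<in> sets (restrict_space borel SX)"
    by (auto simp: space_restrict_space sets_restrict_space Int_commute intro!: image_eqI[of _ _ W])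
qed

text \<open>Preimages of open sets lift to open subsets of the sphere bundle, hence are open among
  the lines.\<close>

lemma measurable_from_lift:
  assumes "continuous_on SX (\<lambda>z. g (cot_line z))"
  shows "g \<in> borel_measurable (proj_cotangent_borel M X)"
proof (rule borel_measurableI)
  fix W :: "'b set" assume "open W"
  have "openin (top_of_set SX) (SX \<inter> (\<lambda>z. g (cot_line z)) -` W)" by (rule continuous_openin_preimage_gen[OF assms \<open>open W\<close>])
  moreover have "SX \<inter> (\<lambda>z. g (cot_line z)) -` W = SX \<inter> cot_line -` (g -` W \<inter> proj_cotangent X)"
    using cot_line_image by auto
  ultimately have "proj_cotangent_open M X (g -` W \<inter> proj_cotangent X)" by (simp add: proj_cotangent_open_iff)
  thus "g -` W \<inter> space (proj_cotangent_borel M X) \<in> sets (proj_cotangent_borel M X)" using proj_cotangent_open_sets by simp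
qed

lemma fst_proj_measurable: "fst \<in> measurable (proj_cotangent_borel M X) (restrict_space borel X)"
proof (rule measurable_restrict_space2)
  show "fst \<in> space (proj_cotangent_borel M X) \<rightarrow> X" by (auto simp: proj_cotangent_def)
  have "(\<lambda>z. fst (cot_line z)) = fst" by (auto simp: cot_line_def)
  then have "continuous_on SX (\<lambda>z. fst (cot_line z))" by (simp only: continuous_on_fst[OF continuous_on_id])
  then show "fst \<in> borel_measurable (proj_cotangent_borel M X)" by (rule measurable_from_lift)
qed

lemma projective_action_single_continuous:
  assumes F: "diffeo_on_X F"
  shows "continuous_on SX (projective_action (\<lambda>_. F) (\<lambda>_. cot_deriv F) t)"
proof -
  have nz: "0 < norm (cot_deriv F x u)" if "(x, u) \<in> SX" for x u
  proof -
    have xu: "x \<in> X" "u \<in> fibre x" "norm u = 1" using that by (auto simp: unit_sphere_bundle_def)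
    from cot_deriv_lower[OF diffeo_on_XD(2)[OF F] xu(1) diffeo_on_XD(3)[OF F xu(1)] xu(2)] xu(3) show ?thesis by auto
  qed
  have "continuously_convergent SX (\<lambda>k. projective_action (\<lambda>_. F) (\<lambda>_. cot_deriv F) t) (projective_action (\<lambda>_. F) (\<lambda>_. cot_deriv F) t)"
    by (rule continuously_convergent_projective_action(1)[OF continuously_convergent_const continuously_convergent_const])
      (use amb_deriv_continuous(2)[OF F] continuous_on_subset[OF diffeo_on_XD(4)[OF F]] nz in auto)
  thus ?thesis by (simp add: continuously_convergent_const_iff)
qed

lemma proj_cot_map_lift:
  assumes F: "diffeo_on_X F" and z: "z \<in> SX"
  shows "proj_cot_map M F (cot_line z) = cot_line (projective_action (\<lambda>_. F) (\<lambda>_. cot_deriv F) t z)"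
    "projective_action (\<lambda>_. F) (\<lambda>_. cot_deriv F) t z \<in> SX"
proof -
  obtain x u where xu: "z = (x, u)" "x \<in> X" "u \<in> fibre x" "norm u = 1" using z by (auto simp: unit_sphere_bundle_def)
  note r = diffeo_on_XD(2)[OF F, of x] diffeo_on_XD(3)[OF F xu(2)]
  show "proj_cot_map M F (cot_line z) = cot_line (projective_action (\<lambda>_. F) (\<lambda>_. cot_deriv F) t z)"
    using proj_cot_map_line[OF r(1) _ r(2), of u] z by (simp add: projective_action_def xu(1))
  have "norm u \<le> norm (amb_deriv F x) * norm (cot_deriv F x u)" by (rule cot_deriv_lower[OF r(1) xu(2) r(2) xu(3)])
  then have "cot_deriv F x u \<noteq> 0" using xu(4) by auto
  then show "projective_action (\<lambda>_. F) (\<lambda>_. cot_deriv F) t z \<in> SX"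
    using r subspace_scale[OF fibre_subspace cot_deriv_in_fibre[OF r(1) xu(2) r(2)]]
    by (simp add: projective_action_def xu(1) unit_sphere_bundle_def)
qed

lemma proj_cot_map_measurable:
  assumes F: "diffeo_on_X F"
  shows "proj_cot_map M F \<in> measurable (proj_cotangent_borel M X) (proj_cotangent_borel M X)"
proof (rule measurable_into_proj_cotangent)
  let ?\<Phi> = "projective_action (\<lambda>_. F) (\<lambda>_. cot_deriv F) ()"
  have into: "proj_cot_map M F p \<in> proj_cotangent X" if p: "p \<in> proj_cotangent X" for p
  proof -
    have "p \<in> cot_line ` SX" using p cot_line_image by simp
    then obtain z where "z \<in> SX" "p = cot_line z" by blast
    thus ?thesis using proj_cot_map_lift[OF F, of z "()"] cot_line_image by auto
  qed
  then show "proj_cot_map M F \<in> space (proj_cotangent_borel M X) \<rightarrow> proj_cotangent X" by auto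
  fix U :: "('a \<times> ('e \<Rightarrow>\<^sub>L real) set) set" assume "proj_cotangent_open M X U"
  then have "openin (top_of_set SX) (SX \<inter> cot_line -` U)" by (simp add: proj_cotangent_open_iff)
  then have "openin (top_of_set SX) (SX \<inter> ?\<Phi> -` (SX \<inter> cot_line -` U))"
  proof (rule continuous_openin_preimage[where T=SX, OF projective_action_single_continuous[OF F, of "()"], rotated])
    show "?\<Phi> \<in> SX \<rightarrow> SX" using proj_cot_map_lift(2)[OF F] by (intro Pi_I)
  qed
  moreover have "SX \<inter> ?\<Phi> -` (SX \<inter> cot_line -` U) = SX \<inter> cot_line -` (proj_cot_map M F -` U \<inter> proj_cotangent X)"
  proof (rule set_eqI)
    fix z
    show "z \<in> SX \<inter> ?\<Phi> -` (SX \<inter> cot_line -` U) \<longleftrightarrow> z \<in> SX \<inter> cot_line -` (proj_cot_map M F -` U \<inter> proj_cotangent X)"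
    proof (cases "z \<in> SX")
      case True
      then have "cot_line z \<in> proj_cotangent X" using cot_line_image by blast
      with True proj_cot_map_lift[OF F True, of "()"] show ?thesis by simp
    qed simp
  qed
  ultimately have "proj_cotangent_open M X (proj_cot_map M F -` U \<inter> proj_cotangent X)" by (simp add: proj_cotangent_open_iff)
  thus "proj_cot_map M F -` U \<inter> space (proj_cotangent_borel M X) \<in> sets (proj_cotangent_borel M X)"
    using proj_cotangent_open_sets by simp
qed

text \<open>A random map depends on the first coordinate of the noise only almost surely; \<open>represents\<close> fixes a
  version for which this, and the regularity, holds everywhere.\<close>

definition represents :: "'t measure \<Rightarrow> ('t \<Rightarrow> 'a \<Rightarrow> 'a) \<Rightarrow> ((nat \<Rightarrow> 't) \<Rightarrow> 'a \<Rightarrow> 'a) \<Rightarrow> bool" where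
  "represents T F f \<longleftrightarrow> random_diffeo T F \<and> (AE \<omega> in noise T. \<forall>n. f (\<lambda>k. \<omega> (n + k)) = F (\<omega> n))"

lemma representsD:
  assumes "represents T F f"
  shows "random_diffeo T F" "AE \<omega> in noise T. f \<omega> = F (\<omega> 0)"
proof -
  show "random_diffeo T F" using assms by (simp add: represents_def)
  have "AE \<omega> in noise T. \<forall>n. f (\<lambda>k. \<omega> (n + k)) = F (\<omega> n)" using assms by (simp add: represents_def)
  then show "AE \<omega> in noise T. f \<omega> = F (\<omega> 0)" by eventually_elim (drule spec[of _ 0], simp)
qed

text \<open>The identity serves as the default map on null sets of letters.\<close>

lemma diffeo_on_X_id: "diffeo_on_X id"
proof -
  have "C1_map_on M UNIV id"
  proof -
    have "Ck_on 1 (coord c ` (chart_dom c \<inter> chart_dom d)) (coord d \<circ> coord_inv c)" if "c \<in> atlas M" "d \<in> atlas M" for c d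
      using transition_smooth[OF that] unfolding smooth_on_def by blast
    thus ?thesis by (simp add: C1_map_on_def continuous_on_id id_def comp_def)
  qed
  then have "C1_local_diffeo M id" unfolding C1_local_diffeo_def
    by (intro allI exI[of _ UNIV] exI[of _ id]) simp
  thus ?thesis by (simp add: diffeo_on_X_def)
qed

text \<open>Lets a version be reset off any full-measure set of letters, so that estimates valid
  there become valid for every letter, as \<open>cocycle\<close> demands.\<close>

lemma represents_modify:
  assumes T: "prob_space T" and F: "represents T F f" and A: "A \<in> sets T" "AE t in T. t \<in> A"
  shows "represents T (\<lambda>t. if t \<in> A then F t else id) f"
proof -
  have m: "(\<lambda>(t, x). F t x) \<in> borel_measurable (T \<Otimes>\<^sub>M borel)" using F by (simp add: represents_def random_diffeo_def)
  have "(\<lambda>p. if fst p \<in> A then (\<lambda>(t, x). F t x) p else snd p) \<in> borel_measurable (T \<Otimes>\<^sub>M borel)"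
    using measurable_sets[OF measurable_fst A(1), of borel]
    by (intro measurable_If m measurable_snd) (simp add: vimage_def Int_def conj_commute)
  then have "random_diffeo T (\<lambda>t. if t \<in> A then F t else id)"
    using F diffeo_on_X_id by (auto simp: represents_def random_diffeo_def case_prod_beta' if_distrib[of "\<lambda>f. f _"] cong: if_cong)
  moreover have "AE \<omega> in noise T. \<forall>n. \<omega> n \<in> A" by (rule AE_noise_component[OF T A(2)])
  ultimately show ?thesis using F by (auto simp: represents_def)
qed

lemma represents_exists:
  assumes T: "prob_space T" and f: "f \<in> Diff1_loc M T X"
  obtains F where "represents T F f"
proof -
  interpret T: prob_space T by fact
  have f': "C1_random_map M T f" and fd: "AE \<omega> in noise T. C1_local_diffeo M (f \<omega>)" "AE \<omega> in noise T. f \<omega> ` X \<subseteq> X"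
    using f unfolding Diff1_loc_def C1_random_map_def by blast+
  have fm: "(\<lambda>(\<omega>, x). f \<omega> x) \<in> borel_measurable (noise T \<Otimes>\<^sub>M borel)"
    using f' unfolding C1_random_map_def by (rule conjunct1)
  have f0: "f \<omega> = f \<omega>'" if "\<omega> \<in> space (noise T)" "\<omega>' \<in> space (noise T)" "\<omega> 0 = \<omega>' 0" for \<omega> \<omega>'
    using f' that unfolding C1_random_map_def by blast
  \<comment> \<open>The map belonging to a letter \<open>t\<close> is read off at the constant
    sequence, since \<open>f\<close> depends on the first coordinate only.\<close>
  have cs: "(\<lambda>_. t) \<in> space (noise T)" if "t \<in> space T" for t using that by (simp add: space_PiM PiE_iff)
  have ff: "f \<omega> = f (\<lambda>_. \<omega> 0)" if "\<omega> \<in> space (noise T)" for \<omega>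
    using f0[OF that cs[OF noise_component[OF that]]] by simp
  have "AE \<omega> in noise T. diffeo_on_X (f (\<lambda>_. \<omega> 0))"
    using fd AE_space
  proof eventually_elim
    case (elim \<omega>)
    show ?case using elim(1,2) unfolding ff[OF elim(3)] by (simp add: diffeo_on_X_def)
  qed
  then have "AE t in T. diffeo_on_X (f (\<lambda>_. t))" by (rule AE_noise_zeroD[OF T])
  then obtain N where N: "N \<in> null_sets T" "{t \<in> space T. \<not> diffeo_on_X (f (\<lambda>_. t))} \<subseteq> N"
    by (auto simp: eventually_ae_filter)
  define F where "F t = (if t \<in> space T - N then f (\<lambda>_. t) else id)" for t
  have d: "diffeo_on_X (F t)" if "t \<in> space T" for t using that N diffeo_on_X_id by (auto simp: F_def)
  have "(\<lambda>p. (\<lambda>(\<omega>, x). f \<omega> x) ((\<lambda>_. fst p), snd p)) \<in> borel_measurable (T \<Otimes>\<^sub>M borel)"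
  proof (intro measurable_compose[OF measurable_Pair fm] measurable_snd)
    show "(\<lambda>p. (\<lambda>_. fst p)) \<in> measurable (T \<Otimes>\<^sub>M borel) (noise T)"
      by (rule measurable_PiM_single') (auto simp: space_PiM space_pair_measure)
  qed
  then have "(\<lambda>p. if fst p \<in> space T - N then f (\<lambda>_. fst p) (snd p) else snd p) \<in> borel_measurable (T \<Otimes>\<^sub>M borel)"
    using N(1) by (intro measurable_If measurable_snd) auto
  then have r: "random_diffeo T F" unfolding random_diffeo_def
    using d by (auto simp: F_def case_prod_beta' if_distrib[of "\<lambda>f. f _"] cong: if_cong)
  have "AE t in T. t \<in> space T - N" using AE_not_in[OF N(1)] AE_space by eventually_elim simp
  then have "AE \<omega> in noise T. \<forall>n. \<omega> n \<in> space T - N" by (rule AE_noise_component[OF T])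
  then have "AE \<omega> in noise T. \<forall>n. f (\<lambda>k. \<omega> (n + k)) = F (\<omega> n)"
    using AE_space
  proof eventually_elim
    case (elim \<omega>)
    show ?case
    proof
      fix n
      have "f (\<lambda>k. \<omega> (n + k)) = f (\<lambda>_. \<omega> n)" using ff[OF shift_in_space[OF elim(2), of n]] by simp
      thus "f (\<lambda>k. \<omega> (n + k)) = F (\<omega> n)" using elim(1) by (simp add: F_def)
    qed
  qed
  with r show thesis using that by (simp add: represents_def)
qed

section \<open>Stationary measures and exponents in terms of representatives\<close>

lemma stat_measures_iff:
  assumes T: "prob_space T" and F: "represents T F f"
  shows "\<mu> \<in> stat_measures T X f \<longleftrightarrow> invariant_measure T X F \<mu>"
proof -
  have "AE \<omega> in noise T. \<forall>x\<in>X. f \<omega> x = F (\<omega> 0) x" using representsD(2)[OF F] by eventually_elim simp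
  from stationary_iff_invariant[OF T random_diffeo_random_map[OF representsD(1)[OF F]] _ _ this]
  show ?thesis unfolding stat_measures_def by (auto simp: invariant_measure_def)
qed

lemma lyap_min_at_eq:
  assumes T: "prob_space T" and F: "represents T F f" and coc: "cocycle T X fibre F (\<lambda>t. cot_deriv (F t)) G"
    and \<mu>: "invariant_measure T X F \<mu>"
  shows "lyap_min_at M T \<mu> f = - growth_rate T F (\<lambda>t. cot_deriv (F t)) \<mu>"
proof -
  let ?C = "\<lambda>t. cot_deriv (F t)"
  have sp: "space \<mu> = X" using \<mu> sets_eq_imp_space_eq[of \<mu> "restrict_space borel X"] by (simp add: space_restrict_space invariant_measure_def)
  have rd: "diffeo_on_X (F t)" if "t \<in> space T" for t using representsD(1)[OF F] that by (simp add: random_diffeo_def)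
  have it: "rand_iter f n \<omega> = iter F n \<omega>" if "\<forall>n. f (\<lambda>k. \<omega> (n + k)) = F (\<omega> n)" for n \<omega>
    using that by (induction n) auto
  have reg: "regular (iter F n \<omega>) x" if \<omega>: "\<omega> \<in> space (noise T)" for n \<omega> x
  proof (induction n)
    case 0 then show ?case using regular_id[of x] by (simp add: id_def)
  next
    case (Suc n)
    have "iter F (Suc n) \<omega> = F (\<omega> n) \<circ> iter F n \<omega>" by auto
    then show ?case using regular_compose[OF Suc diffeo_on_XD(2)[OF rd[OF noise_component[OF \<omega>]]]] by metis
  qed
  have inX: "iter F n \<omega> x \<in> X" if "\<omega> \<in> space (noise T)" "x \<in> X" for n \<omega> x
    by (rule iter_in[OF random_diffeo_random_map[OF representsD(1)[OF F]] that])
  \<comment> \<open>The comparison starts at time 1: for the identity, \<open>cot_deriv\<close> is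
    the projection onto the fibre, whereas \<open>iter_lin\<close> begins with the identity of the
    ambient space. One factor later both agree, because \<open>cot_deriv\<close> sees only the fibre
    component.\<close>
  have cd: "cot_deriv (iter F (Suc n) \<omega>) x = iter_lin F ?C (Suc n) \<omega> x" if \<omega>: "\<omega> \<in> space (noise T)" and x: "x \<in> X" for n \<omega> x
  proof (induction n)
    case 0
    have "iter F (Suc 0) \<omega> = F (\<omega> 0)" by auto
    then show ?case by (auto intro: blinfun_eqI)
  next
    case (Suc n)
    have "iter F (Suc (Suc n)) \<omega> = F (\<omega> (Suc n)) \<circ> iter F (Suc n) \<omega>" by auto
    moreover have "cot_deriv (F (\<omega> (Suc n)) \<circ> iter F (Suc n) \<omega>) x = cot_deriv (F (\<omega> (Suc n))) (iter F (Suc n) \<omega> x) o\<^sub>L cot_deriv (iter F (Suc n) \<omega>) x"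
      by (rule cot_deriv_compose[OF reg[OF \<omega>] diffeo_on_XD(2)[OF rd[OF noise_component[OF \<omega>]]] x inX[OF \<omega> x]])
        (rule diffeo_on_XD(3)[OF rd[OF noise_component[OF \<omega>]] inX[OF \<omega> x]])
    ultimately show ?case unfolding Suc iter_lin.simps(2)[of F ?C "Suc n"] by (simp only:)
  qed
  have key: "(LINT x|\<mu>. LINT \<omega>|completion (noise T). ln (conorm M x (rand_iter f (Suc n) \<omega> x) (tderiv M (rand_iter f (Suc n) \<omega>) x)))
     = - log_growth T F ?C \<mu> (Suc n)" for n
  proof -
    have "(LINT \<omega>|completion (noise T). ln (conorm M x (rand_iter f (Suc n) \<omega> x) (tderiv M (rand_iter f (Suc n) \<omega>) x)))
       = - (LINT \<omega>|noise T. ln (norm (iter_lin F ?C (Suc n) \<omega> x)))" if x: "x \<in> X" for x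
    proof -
      have "AE \<omega> in noise T. ln (conorm M x (rand_iter f (Suc n) \<omega> x) (tderiv M (rand_iter f (Suc n) \<omega>) x)) = - ln (norm (iter_lin F ?C (Suc n) \<omega> x))"
        using conjunct2[OF F[unfolded represents_def]] AE_space
      proof eventually_elim
        case (elim \<omega>)
        have "conorm M x (iter F (Suc n) \<omega> x) (tderiv M (iter F (Suc n) \<omega>) x) = inverse (norm (iter_lin F ?C (Suc n) \<omega> x))"
          unfolding conorm_deriv[OF reg[OF elim(2)] x inX[OF elim(2) x]] cd[OF elim(2) x] ..
        then show ?case unfolding it[OF elim(1)] using norm_iter_lin_pos[OF T coc elim(2) x, of "Suc n"] by (simp only: ln_inverse)
      qed
      then have "(LINT \<omega>|completion (noise T). ln (conorm M x (rand_iter f (Suc n) \<omega> x) (tderiv M (rand_iter f (Suc n) \<omega>) x)))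
         = (LINT \<omega>|noise T. - ln (norm (iter_lin F ?C (Suc n) \<omega> x)))"
        by (intro AE_equal_completion_integral borel_measurable_uminus borel_measurable_integrable[OF log_norm_integrable[OF T coc x]])
      thus ?thesis by simp
    qed
    then have "(LINT x|\<mu>. LINT \<omega>|completion (noise T). ln (conorm M x (rand_iter f (Suc n) \<omega> x) (tderiv M (rand_iter f (Suc n) \<omega>) x)))
      = (LINT x|\<mu>. - (LINT \<omega>|noise T. ln (norm (iter_lin F ?C (Suc n) \<omega> x))))"
      by (intro Bochner_Integration.integral_cong) (auto simp: sp)
    thus ?thesis by (simp add: log_growth_def)
  qed
  have "(\<lambda>n. 1 / real n * (LINT x|\<mu>. LINT \<omega>|completion (noise T). ln (conorm M x (rand_iter f n \<omega> x) (tderiv M (rand_iter f n \<omega>) x))))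
    = (\<lambda>n. - (log_growth T F ?C \<mu> n / n))"
  proof
    fix n show "1 / real n * (LINT x|\<mu>. LINT \<omega>|completion (noise T). ln (conorm M x (rand_iter f n \<omega> x) (tderiv M (rand_iter f n \<omega>) x)))
      = - (log_growth T F ?C \<mu> n / n)"
    \<comment> \<open>At \<open>n = 0\<close> both sides are 0 by the convention on division, so the
      sequences agree everywhere.\<close>
    proof (cases n)
      case (Suc m) then show ?thesis using key[of m] by simp
    qed simp
  qed
  moreover have "lim (\<lambda>n. - (log_growth T F ?C \<mu> n / n)) = - growth_rate T F ?C \<mu>"
    by (intro limI tendsto_minus growth_rate(1)[OF T coc \<mu>])
  ultimately show ?thesis unfolding lyap_min_at_def by simp
qed

lemma cot_phi_lift:
  assumes T: "prob_space T" and F: "represents T F f" and coc: "cocycle T X fibre F (\<lambda>t. cot_deriv (F t)) G" and z: "z \<in> SX"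
  shows "cot_phi M T f (cot_line z) = mean_log_stretch T (\<lambda>t. cot_deriv (F t)) z"
proof -
  obtain x u where xu: "z = (x, u)" "x \<in> X" using z by (auto simp: unit_sphere_bundle_def)
  note xu' = z[unfolded xu(1)]
  let ?\<xi> = "SOME \<xi>. \<xi> \<in> span {cov x u} \<and> cotnorm M x \<xi> = 1"
  have \<xi>: "?\<xi> \<in> span {cov x u}" "cotnorm M x ?\<xi> = 1" using unit_covector_choice[OF xu'] by auto
  have m: "(\<lambda>t. ln (norm (cot_deriv (F t) x u))) \<in> borel_measurable T"
    using measurable_section_left[OF T coc log_stretch_measurable[OF T coc] z] by (simp add: xu(1))
  have "AE \<omega> in noise T. ln (cotnorm M (f \<omega> x) (cot_push M (f \<omega>) x ?\<xi>)) = ln (norm (cot_deriv (F (\<omega> 0)) x u))"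
    using representsD(2)[OF F] AE_space
  proof eventually_elim
    case (elim \<omega>)
    have d: "diffeo_on_X (F (\<omega> 0))" using representsD(1)[OF F] noise_component[OF elim(2)] by (simp add: random_diffeo_def)
    show ?case unfolding elim(1) cot_push_unit[OF diffeo_on_XD(2)[OF d] xu' diffeo_on_XD(3)[OF d xu(2)] \<xi>] ..
  qed
  then have "(LINT \<omega>|completion (noise T). ln (cotnorm M (f \<omega> x) (cot_push M (f \<omega>) x ?\<xi>))) = (LINT \<omega>|noise T. ln (norm (cot_deriv (F (\<omega> 0)) x u)))"
    by (intro AE_equal_completion_integral measurable_compose[OF _ m]) auto
  also have "\<dots> = (LINT t|T. ln (norm (cot_deriv (F t) x u)))" by (rule integral_noise_component[OF T m])
  finally show ?thesis by (simp add: cot_phi_def cot_line_def xu(1) mean_log_stretch_def)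
qed

text \<open>Weak limits are constructed on spheres while coquasi-irreducibility speaks of lines;
  pushing \<open>N\<close> forward by \<open>cot_line\<close> keeps stationarity, the base measure
  and the integral.\<close>

lemma cot_stationary_measure:
  assumes T: "prob_space T" and F: "represents T F f" and coc: "cocycle T X fibre F (\<lambda>t. cot_deriv (F t)) G"
    and N: "invariant_measure T SX (projective_action F (\<lambda>t. cot_deriv (F t))) N"
    and \<mu>: "\<mu> = distr N (restrict_space borel X) fst"
  defines "\<nu> \<equiv> distr N (proj_cotangent_borel M X) cot_line"
  shows "\<nu> \<in> cot_stat_measures M T X \<mu> f" "(LINT z|\<nu>. cot_phi M T f z) = integral\<^sup>L N (mean_log_stretch T (\<lambda>t. cot_deriv (F t)))"
proof -
  let ?C = "\<lambda>t. cot_deriv (F t)"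
  let ?\<Phi> = "projective_action F ?C"
  have N': "prob_space N" "sets N = sets (restrict_space borel SX)" using N by (auto simp: invariant_measure_def)
  interpret N: prob_space N by fact
  have sp: "space N = SX" using sets_eq_imp_space_eq[OF N'(2)] by (simp add: space_restrict_space)
  have lm: "cot_line \<in> measurable N (proj_cotangent_borel M X)" using cot_line_measurable N'(2) by (simp cong: measurable_cong_sets)
  have rm: "random_map T SX ?\<Phi>" by (rule projective_action_random_map[OF T coc])
  have pm: "prob_space \<nu>" unfolding \<nu>_def by (rule N.prob_space_distr[OF lm])
  have rd: "diffeo_on_X (F t)" if "t \<in> space T" for t using representsD(1)[OF F] that by (simp add: random_diffeo_def)
  have "stationary (noise T) (\<lambda>\<omega>. proj_cot_map M (f \<omega>)) \<nu>"
    unfolding stationary_def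
  proof
    fix B assume B: "B \<in> sets \<nu>"
    define B' where "B' = cot_line -` B \<inter> space N"
    have B': "B' \<in> sets N" unfolding B'_def using B by (intro measurable_sets[OF lm]) (simp add: \<nu>_def)
    have "emeasure \<nu> B = emeasure N B'" unfolding \<nu>_def B'_def using B by (intro emeasure_distr[OF lm]) (simp add: \<nu>_def)
    also have "\<dots> = emeasure (distr (T \<Otimes>\<^sub>M N) (restrict_space borel SX) (\<lambda>(t, z). ?\<Phi> t z)) B'" using N by (simp add: invariant_measure_def)
    also have "\<dots> = (\<integral>\<^sup>+t. emeasure N (?\<Phi> t -` B' \<inter> space N) \<partial>T)" by (rule distr_random_map_emeasure(1)[OF T rm N' B'])
    also have "\<dots> = (\<integral>\<^sup>+\<omega>. emeasure (distr \<nu> \<nu> (proj_cot_map M (f \<omega>))) B \<partial>noise T)"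
    proof (rule nn_integral_noise_zero[symmetric, OF T distr_random_map_emeasure(2)[OF T rm N' B']])
      show "AE \<omega> in noise T. emeasure (distr \<nu> \<nu> (proj_cot_map M (f \<omega>))) B = emeasure N (?\<Phi> (\<omega> 0) -` B' \<inter> space N)"
        using representsD(2)[OF F] AE_space
      proof eventually_elim
        case (elim \<omega>)
        note d = rd[OF noise_component[OF elim(2), of 0]]
        have pcm: "proj_cot_map M (F (\<omega> 0)) \<in> measurable \<nu> \<nu>"
          using proj_cot_map_measurable[OF d] by (simp add: \<nu>_def cong: measurable_cong_sets)
        have "emeasure (distr \<nu> \<nu> (proj_cot_map M (F (\<omega> 0)))) B = emeasure \<nu> (proj_cot_map M (F (\<omega> 0)) -` B \<inter> space \<nu>)"
          by (rule emeasure_distr[OF pcm B])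
        also have "\<dots> = emeasure N (cot_line -` (proj_cot_map M (F (\<omega> 0)) -` B \<inter> space \<nu>) \<inter> space N)"
          unfolding \<nu>_def using measurable_sets[OF pcm B] by (intro emeasure_distr[OF lm]) (simp add: \<nu>_def)
        also have "cot_line -` (proj_cot_map M (F (\<omega> 0)) -` B \<inter> space \<nu>) \<inter> space N = ?\<Phi> (\<omega> 0) -` B' \<inter> space N"
        proof -
          have "projective_action F ?C (\<omega> 0) = projective_action (\<lambda>_. F (\<omega> 0)) (\<lambda>_. cot_deriv (F (\<omega> 0))) ()"
            by (simp add: projective_action_def)
          then have l: "proj_cot_map M (F (\<omega> 0)) (cot_line z) = cot_line (?\<Phi> (\<omega> 0) z)" "?\<Phi> (\<omega> 0) z \<in> SX" if "z \<in> SX" for z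
            using proj_cot_map_lift[OF d that, of "()"] by simp_all
          show ?thesis
          proof (rule set_eqI)
            fix z
            show "z \<in> cot_line -` (proj_cot_map M (F (\<omega> 0)) -` B \<inter> space \<nu>) \<inter> space N \<longleftrightarrow> z \<in> ?\<Phi> (\<omega> 0) -` B' \<inter> space N"
            proof (cases "z \<in> SX")
              case True
              then have "cot_line z \<in> proj_cotangent X" using cot_line_image by blast
              with True l[OF True] show ?thesis by (simp add: B'_def sp \<nu>_def)
            qed (simp add: sp)
          qed
        qed
        finally show ?case unfolding elim(1) .
      qed
    qed
    finally show "emeasure \<nu> B = (\<integral>\<^sup>+\<omega>. emeasure (distr \<nu> \<nu> (proj_cot_map M (f \<omega>))) B \<partial>noise T)" .
  qed
  moreover have "distr \<nu> \<mu> fst = \<mu>"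
  proof -
    have fm: "fst \<in> measurable (proj_cotangent_borel M X) \<mu>" using fst_proj_measurable by (simp add: \<mu> cong: measurable_cong_sets)
    have "distr \<nu> \<mu> fst = distr N \<mu> (fst \<circ> cot_line)" unfolding \<nu>_def by (rule distr_distr[OF fm lm])
    also have "fst \<circ> cot_line = fst" by (auto simp: cot_line_def)
    also have "distr N \<mu> fst = distr N (restrict_space borel X) fst" by (rule distr_cong) (simp_all add: \<mu>)
    finally show ?thesis by (simp add: \<mu>)
  qed
  ultimately show "\<nu> \<in> cot_stat_measures M T X \<mu> f" using pm by (simp add: cot_stat_measures_def \<nu>_def)
  \<comment> \<open>Change of variables requires \<open>cot_phi\<close> to be measurable on the
    space of lines, and this is obtained from continuity of its lift.\<close>
  have cont: "continuous_on SX (\<lambda>z. cot_phi M T f (cot_line z))"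
  proof -
    have cc: "AE t in T. continuously_convergent SX (\<lambda>k z. ln (norm (?C t (fst z) (snd z)))) (\<lambda>z. ln (norm (?C t (fst z) (snd z))))"
    proof (rule AE_I2)
      fix t assume t: "t \<in> space T"
      have nz: "0 < norm (?C t x u)" if "(x, u) \<in> SX" for x u
        using that by (intro stretch_pos[OF T coc t]) (auto simp: unit_sphere_bundle_def)
      show "continuously_convergent SX (\<lambda>k z. ln (norm (?C t (fst z) (snd z)))) (\<lambda>z. ln (norm (?C t (fst z) (snd z))))"
        by (rule continuously_convergent_projective_action(2)[where F=F and F'="\<lambda>_. F" and C="?C" and C'="\<lambda>_. ?C", OF continuously_convergent_const continuously_convergent_const])
          (rule continuous_on_subset[OF diffeo_on_XD(4)[OF rd[OF t]] subset_UNIV] amb_deriv_continuous(2)[OF rd[OF t]] nz, assumption?)+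
    qed
    have "continuously_convergent SX (\<lambda>k. mean_log_stretch T ?C) (mean_log_stretch T ?C)"
      unfolding mean_log_stretch_def case_prod_beta'
    proof (rule continuously_convergent_integral[OF cc])
      show "(\<lambda>t. ln (norm (?C t (fst z) (snd z)))) \<in> borel_measurable T" if "z \<in> SX" for z
        using measurable_section_left[OF T coc log_stretch_measurable[OF T coc] that] .
      then show "(\<lambda>t. ln (norm (?C t (fst z) (snd z)))) \<in> borel_measurable T" if "z \<in> SX" for z using that .
      show "AE t in T. \<bar>ln (norm (?C t (fst z) (snd z)))\<bar> \<le> G t" if "z \<in> SX" for z
        using log_stretch_bound[OF T coc, of _ "fst z" "snd z"] that by (intro AE_I2) auto
    qed (rule integrable_bound[OF T coc])
    then have "continuous_on SX (mean_log_stretch T ?C)" by (simp add: continuously_convergent_const_iff)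
    then show ?thesis by (rule continuous_on_eq) (simp add: cot_phi_lift[OF T F coc])
  qed
  have "(LINT z|\<nu>. cot_phi M T f z) = (LINT z|N. cot_phi M T f (cot_line z))"
    unfolding \<nu>_def by (rule integral_distr[OF lm measurable_from_lift[OF cont]])
  also have "\<dots> = integral\<^sup>L N (mean_log_stretch T ?C)"
    by (rule Bochner_Integration.integral_cong[OF refl]) (simp add: sp cot_phi_lift[OF T F coc])
  finally show "(LINT z|\<nu>. cot_phi M T f z) = integral\<^sup>L N (mean_log_stretch T ?C)" .
qed

end

section \<open>Consequences of a small average distance\<close>

text \<open>One point from each basic set meeting \<open>X\<close>. Suprema over \<open>X\<close> of
  continuous functions become countable suprema, hence measurable in a parameter.\<close>

lemma countable_dense_subset:
  fixes X :: "'a::second_countable_topology set"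
  obtains D where "countable D" "D \<subseteq> X"
    "\<And>h :: 'a \<Rightarrow> real. continuous_on X h \<Longrightarrow> (\<And>x. x \<in> X \<Longrightarrow> 0 \<le> h x) \<Longrightarrow> (SUP x\<in>X. ennreal (h x)) = (SUP x\<in>D. ennreal (h x))"
proof -
  obtain \<B> :: "'a set set" where B: "countable \<B>" "topological_basis \<B>" using ex_countable_basis by auto
  define D where "D = (\<lambda>B. SOME x. x \<in> B \<inter> X) ` {B \<in> \<B>. B \<inter> X \<noteq> {}}"
  have pick: "(SOME x. x \<in> B \<inter> X) \<in> B \<inter> X" if "B \<inter> X \<noteq> {}" for B
    by (rule someI_ex) (use that in blast)
  have "countable D" "D \<subseteq> X" using B(1) pick by (auto simp: D_def)
  moreover have "(SUP x\<in>X. ennreal (h x)) = (SUP x\<in>D. ennreal (h x))"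
    if h: "continuous_on X h" "\<And>x. x \<in> X \<Longrightarrow> 0 \<le> h x" for h :: "'a \<Rightarrow> real"
  proof (rule antisym)
    show "(SUP x\<in>D. ennreal (h x)) \<le> (SUP x\<in>X. ennreal (h x))" using \<open>D \<subseteq> X\<close> by (intro SUP_subset_mono) auto
    show "(SUP x\<in>X. ennreal (h x)) \<le> (SUP x\<in>D. ennreal (h x))"
    proof (rule SUP_least, rule ccontr)
      fix x assume x: "x \<in> X" and "\<not> ennreal (h x) \<le> (SUP x\<in>D. ennreal (h x))"
      then have lt: "(SUP x\<in>D. ennreal (h x)) < ennreal (h x)" by simp
      then obtain c where c: "(SUP x\<in>D. ennreal (h x)) = ennreal c" "0 \<le> c"
        by (metis ennreal_cases ennreal_less_top not_less_iff_gr_or_eq order.strict_trans)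
      have "c < h x" using lt c by (simp add: ennreal_less_iff)
      then obtain U where U: "open U" "x \<in> U" "\<And>y. y \<in> X \<Longrightarrow> y \<in> U \<Longrightarrow> h y \<in> {c<..}"
        using h(1) x unfolding continuous_on_topological by (metis greaterThan_iff open_greaterThan)
      obtain b where b: "b \<in> \<B>" "x \<in> b" "b \<subseteq> U" using topological_basisE[OF B(2) U(1,2)] by metis
      let ?d = "SOME x. x \<in> b \<inter> X"
      have ne: "b \<inter> X \<noteq> {}" using b x by auto
      have d: "?d \<in> D" "?d \<in> X" "?d \<in> U" using pick[OF ne] b ne by (auto simp: D_def)
      have "ennreal (h ?d) \<le> ennreal c" unfolding c(1)[symmetric] by (rule SUP_upper[OF d(1)])
      then have "h ?d \<le> c" using c(2) by (simp add: ennreal_le_iff)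
      thus False using U(3)[OF d(2,3)] by simp
    qed
  qed
  ultimately show thesis using that by blast
qed

text \<open>If \<open>y\<close> failed to converge, a subsequence staying away from \<open>p\<close>
  would accumulate at some \<open>q\<close>; continuity gives \<open>\<rho> (p, q) = 0\<close>, so
  \<open>q = p\<close> after all.\<close>

lemma tendsto_of_diagonal_zero:
  fixes X :: "'a::{first_countable_topology,t2_space} set" and \<rho> :: "'a \<times> 'a \<Rightarrow> real"
  assumes X: "compact X" and \<rho>: "continuous_on (X \<times> X) \<rho>" "\<And>x y. x \<in> X \<Longrightarrow> y \<in> X \<Longrightarrow> \<rho> (x, y) = 0 \<Longrightarrow> x = y"
    and a: "\<And>j. a j \<in> X" "p \<in> X" "a \<longlonglongrightarrow> p" and y: "\<And>j. y j \<in> X" and lim: "(\<lambda>j. \<rho> (a j, y j)) \<longlonglongrightarrow> 0"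
  shows "y \<longlonglongrightarrow> p"
proof (rule ccontr)
  assume "\<not> y \<longlonglongrightarrow> p"
  then obtain U where U: "open U" "p \<in> U" "\<not> (\<forall>\<^sub>F j in sequentially. y j \<in> U)" unfolding tendsto_def by blast
  then have "infinite {j. y j \<notin> U}" unfolding infinite_nat_iff_unbounded_le eventually_sequentially by auto
  then obtain s :: "nat \<Rightarrow> nat" where s: "strict_mono s" "\<And>j. y (s j) \<notin> U" using infinite_enumerate by blast
  obtain q s' where q: "q \<in> X" "strict_mono (s' :: nat \<Rightarrow> nat)" "((\<lambda>j. y (s j)) \<circ> s') \<longlonglongrightarrow> q"
    using compact_imp_seq_compact[OF X] y unfolding seq_compact_def by metis
  let ?t = "\<lambda>j. s (s' j)"
  have t: "strict_mono ?t" using strict_mono_o[OF s(1) q(2)] by (simp add: comp_def)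
  have yq: "(\<lambda>j. y (?t j)) \<longlonglongrightarrow> q" using q(3) by (simp add: comp_def)
  have "(\<lambda>j. (a (?t j), y (?t j))) \<longlonglongrightarrow> (p, q)"
    using LIMSEQ_subseq_LIMSEQ[OF a(3) t] yq by (intro tendsto_Pair) (simp_all add: comp_def)
  then have "(\<lambda>j. \<rho> (a (?t j), y (?t j))) \<longlonglongrightarrow> \<rho> (p, q)"
    by (rule continuous_on_tendsto_compose[OF \<rho>(1)]) (use a(1,2) y q(1) in simp_all)
  moreover have "(\<lambda>j. \<rho> (a (?t j), y (?t j))) \<longlonglongrightarrow> 0" using LIMSEQ_subseq_LIMSEQ[OF lim t] by (simp add: comp_def)
  ultimately have "\<rho> (p, q) = 0" by (rule LIMSEQ_unique)
  then have "p = q" by (rule \<rho>(2)[OF a(2) q(1)])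
  then have "\<forall>\<^sub>F j in sequentially. y (?t j) \<in> U" using topological_tendstoD[OF yq U(1)] U(2) by simp
  then show False using s(2) by simp
qed

text \<open>A continuous function with zero set the diagonal plays the part of a metric on
  \<open>X\<close>; neither symmetry nor a triangle inequality is asked of it.\<close>

lemma diagonal_function_exists:
  fixes X :: "'a::{second_countable_topology,t2_space} set"
  assumes X: "compact X"
  obtains \<rho> :: "'a \<times> 'a \<Rightarrow> real" where "continuous_on (X \<times> X) \<rho>" "\<And>x y. x \<in> X \<Longrightarrow> y \<in> X \<Longrightarrow> 0 \<le> \<rho> (x, y)"
    "\<And>x y. x \<in> X \<Longrightarrow> y \<in> X \<Longrightarrow> \<rho> (x, y) = 0 \<longleftrightarrow> x = y"
proof -
  have cl: "closed {p :: 'a \<times> 'a. fst p = snd p}" by (intro closed_Collect_eq continuous_intros)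
  show thesis
  proof (rule compact_zero_set_function[OF compact_Times[OF X X] cl])
    fix \<rho> :: "'a \<times> 'a \<Rightarrow> real"
    assume \<rho>: "continuous_on (X \<times> X) \<rho>" "\<And>p. p \<in> X \<times> X \<Longrightarrow> 0 \<le> \<rho> p \<and> \<rho> p \<le> 1"
      "\<And>p. p \<in> X \<times> X \<Longrightarrow> \<rho> p = 0 \<longleftrightarrow> p \<in> {p. fst p = snd p}"
    show thesis by (rule that[OF \<rho>(1)]) (simp_all add: \<rho>(2,3))
  qed
qed

lemma log_plus_measurable [measurable]: "log_plus \<in> borel_measurable borel"
  unfolding log_plus_def by measurable

section \<open>Integrable bounds and exceptional letters extracted from the distance\<close>

context embedded begin

lemma represents_diffeo: "represents T F f \<Longrightarrow> t \<in> space T \<Longrightarrow> diffeo_on_X (F t)"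
  by (auto simp: represents_def random_diffeo_def)

lemma ambient_section_measurable:
  assumes F: "random_diffeo T F" and x: "x \<in> X"
  shows "(\<lambda>t. amb_deriv (F t) x u) \<in> borel_measurable T" "(\<lambda>t. cot_deriv (F t) x u) \<in> borel_measurable T"
proof -
  have m: "(\<lambda>t. (t, x)) \<in> measurable T (T \<Otimes>\<^sub>M restrict_space borel X)"
    using x by (intro measurable_Pair measurable_ident_sets measurable_const) (auto simp: space_restrict_space)
  show "(\<lambda>t. amb_deriv (F t) x u) \<in> borel_measurable T" "(\<lambda>t. cot_deriv (F t) x u) \<in> borel_measurable T"
    using measurable_compose[OF m amb_deriv_measurable(1)[OF F]] measurable_compose[OF m amb_deriv_measurable(2)[OF F]] by simp_all
qed

lemma deriv_sup_eq:
  assumes F: "diffeo_on_X F"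
  shows "deriv_sup M X F = (SUP x\<in>X. ennreal (norm (amb_deriv F x)))" "deriv_inv_sup M X F = (SUP x\<in>X. ennreal (norm (cot_deriv F x)))"
  unfolding deriv_sup_def deriv_inv_sup_def
  using opnorm_deriv[OF diffeo_on_XD(2)[OF F] _ diffeo_on_XD(3)[OF F]] opnorm_inv[OF diffeo_on_XD(2)[OF F] _ diffeo_on_XD(3)[OF F]]
  by (auto intro!: SUP_cong)

lemma norm_le_exp_log_plus:
  assumes "ennreal n \<le> s" "s < \<infinity>" "log_plus s \<le> ennreal g" "0 \<le> g"
  shows "n \<le> exp g"
proof (cases "n \<le> 0")
  case True thus ?thesis by (rule order_trans) simp
next
  case False
  obtain a where a: "s = ennreal a" "0 \<le> a" using assms(2) by (cases s) auto
  have n: "n \<le> a" "0 < n" using assms(1) False a by (auto simp: ennreal_le_iff)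
  have "ennreal (max 0 (ln a)) \<le> ennreal g" using assms(3) a by (simp add: log_plus_def)
  then have "ln a \<le> g" using assms(4) by (simp add: ennreal_le_iff)
  then have "a \<le> exp g" using n by (metis exp_ln exp_le_cancel_iff less_le_trans)
  thus ?thesis using n by simp
qed

text \<open>The sum of both \<open>log_plus\<close> terms of the integrability condition dominates
  each of them. As a countable supremum it is measurable, so one real function \<open>g\<close>
  bounds the derivative and its inverse.\<close>

lemma represents_bound:
  assumes T: "prob_space T" and F: "represents T F f" and f: "f \<in> Diff1_loc M T X"
  obtains g where "integrable T g" "\<And>t. 0 \<le> g t"
    "\<And>t x. t \<in> space T \<Longrightarrow> x \<in> X \<Longrightarrow> norm (amb_deriv (F t) x) \<le> exp (g t)"
    "\<And>t x. t \<in> space T \<Longrightarrow> x \<in> X \<Longrightarrow> norm (cot_deriv (F t) x) \<le> exp (g t)"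
proof -
  note rF = representsD(1)[OF F] and d = represents_diffeo[OF F]
  obtain D where D: "countable D" "D \<subseteq> X"
    "\<And>h :: 'a \<Rightarrow> real. continuous_on X h \<Longrightarrow> (\<And>x. x \<in> X \<Longrightarrow> 0 \<le> h x) \<Longrightarrow> (SUP x\<in>X. ennreal (h x)) = (SUP x\<in>D. ennreal (h x))"
    using countable_dense_subset[of X] by metis
  let ?A = "\<lambda>t. deriv_sup M X (F t)" and ?B = "\<lambda>t. deriv_inv_sup M X (F t)"
  have A_eq: "?A t = (SUP x\<in>D. ennreal (norm (amb_deriv (F t) x)))" "?B t = (SUP x\<in>D. ennreal (norm (cot_deriv (F t) x)))"
    if "t \<in> space T" for t
    unfolding deriv_sup_eq[OF d[OF that]] using amb_deriv_continuous[OF d[OF that]]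
    by (auto intro!: D(3) continuous_on_norm)
  have m0: "(\<lambda>t. SUP x\<in>D. ennreal (norm (amb_deriv (F t) x))) \<in> borel_measurable T" "(\<lambda>t. SUP x\<in>D. ennreal (norm (cot_deriv (F t) x))) \<in> borel_measurable T"
    using D ambient_section_measurable[OF rF]
    by (auto intro!: borel_measurable_SUP measurable_compose[OF _ measurable_ennreal] borel_measurable_norm_blinfun)
  have m[measurable]: "?A \<in> borel_measurable T" "?B \<in> borel_measurable T"
    using m0 A_eq by (simp_all cong: measurable_cong)
  \<comment> \<open>Finite for every letter: the version is C1 everywhere and \<open>X\<close> is
    compact. Hence \<open>enn2real\<close> loses nothing.\<close>
  have fin: "?A t < \<infinity>" "?B t < \<infinity>" if "t \<in> space T" for t
  proof -
    have bd: "(SUP x\<in>X. ennreal (norm (h x))) < \<infinity>" if h: "continuous_on X h" for h :: "'a \<Rightarrow> 'n \<Rightarrow>\<^sub>L 'n"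
    proof -
      obtain b where "\<And>x. x \<in> X \<Longrightarrow> norm (h x) \<le> b"
        using compact_continuous_image[OF h compact_X] compact_imp_bounded bounded_iff by (metis imageI)
      then have "(SUP x\<in>X. ennreal (norm (h x))) \<le> ennreal b" by (intro SUP_least ennreal_leI)
      thus ?thesis unfolding infinity_ennreal_def by (rule le_less_trans) simp
    qed
    show "?A t < \<infinity>" "?B t < \<infinity>"
      unfolding deriv_sup_eq[OF d[OF that]] using bd amb_deriv_continuous[OF d[OF that]] by blast+
  qed
  let ?h = "\<lambda>t. log_plus (?A t) + log_plus (?B t)"
  have hm: "?h \<in> borel_measurable T" by measurable
  have "AE \<omega> in noise T. log_plus (deriv_sup M X (f \<omega>)) + log_plus (deriv_inv_sup M X (f \<omega>)) = ?h (\<omega> 0)"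
    using representsD(2)[OF F] by eventually_elim simp
  from nn_integral_noise_zero[OF T hm this] have int: "(\<integral>\<^sup>+t. ?h t \<partial>T) < \<infinity>" using f by (simp add: Diff1_loc_def)
  have lp_fin: "log_plus s < \<infinity>" if "s < \<infinity>" for s using that by (simp add: log_plus_def)
  have hfin: "ennreal (enn2real (?h t)) = ?h t" if "t \<in> space T" for t
    using lp_fin[OF fin(1)[OF that]] lp_fin[OF fin(2)[OF that]] by (intro ennreal_enn2real) (simp add: ennreal_add_less_top)
  show thesis
  proof (rule that[of "\<lambda>t. enn2real (?h t)"])
    have "(\<integral>\<^sup>+t. ennreal (enn2real (?h t)) \<partial>T) = (\<integral>\<^sup>+t. ?h t \<partial>T)" by (rule nn_integral_cong) (rule hfin)
    then show "integrable T (\<lambda>t. enn2real (?h t))" using int by (intro integrableI_nonneg) auto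
    fix t x assume t: "t \<in> space T" and x: "x \<in> X"
    show "norm (amb_deriv (F t) x) \<le> exp (enn2real (?h t))"
    proof (rule norm_le_exp_log_plus[OF _ fin(1)[OF t]])
      show "ennreal (norm (amb_deriv (F t) x)) \<le> ?A t" unfolding deriv_sup_eq[OF d[OF t]] by (rule SUP_upper[OF x])
    qed (simp_all only: hfin[OF t] enn2real_nonneg, simp)
    show "norm (cot_deriv (F t) x) \<le> exp (enn2real (?h t))"
    proof (rule norm_le_exp_log_plus[OF _ fin(2)[OF t]])
      show "ennreal (norm (cot_deriv (F t) x)) \<le> ?B t" unfolding deriv_sup_eq[OF d[OF t]] by (rule SUP_upper[OF x])
    qed (simp_all only: hfin[OF t] enn2real_nonneg, simp)
  qed simp
qed

text \<open>The integral in \<open>dist_C1\<close> is a lower integral when the integrand is not measurable, so it can only be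
  used through a measurable minorant; here it is obtained by taking suprema over a countable dense set.\<close>

lemma represents_dist_deriv:
  assumes T: "prob_space T" and F: "represents T F f" and F': "represents T F' f'"
  obtains H where "H \<in> borel_measurable T" "(\<integral>\<^sup>+t. H t \<partial>T) \<le> dist_C1 M T X \<iota> f f'"
    "\<And>t x. t \<in> space T \<Longrightarrow> x \<in> X \<Longrightarrow> ennreal (norm (amb_deriv (F t) x - amb_deriv (F' t) x)) \<le> H t"
    "\<And>t x. t \<in> space T \<Longrightarrow> x \<in> X \<Longrightarrow> ennreal (norm (cot_deriv (F t) x - cot_deriv (F' t) x)) \<le> H t"
proof -
  note d = represents_diffeo[OF F] and d' = represents_diffeo[OF F']
  obtain D where D: "countable D" "D \<subseteq> X"
    "\<And>h :: 'a \<Rightarrow> real. continuous_on X h \<Longrightarrow> (\<And>x. x \<in> X \<Longrightarrow> 0 \<le> h x) \<Longrightarrow> (SUP x\<in>X. ennreal (h x)) = (SUP x\<in>D. ennreal (h x))"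
    using countable_dense_subset[of X] by metis
  let ?a = "\<lambda>t x. norm (amb_deriv (F t) x - amb_deriv (F' t) x)" and ?b = "\<lambda>t x. norm (cot_deriv (F t) x - cot_deriv (F' t) x)"
  define H where "H t = (SUP x\<in>D. ennreal (?a t x)) + (SUP x\<in>D. ennreal (?b t x))" for t
  have m0: "(\<lambda>t. SUP x\<in>D. ennreal (?a t x)) \<in> borel_measurable T" "(\<lambda>t. SUP x\<in>D. ennreal (?b t x)) \<in> borel_measurable T"
    using D ambient_section_measurable[OF representsD(1)[OF F]] ambient_section_measurable[OF representsD(1)[OF F']]
    by (auto intro!: borel_measurable_SUP measurable_compose[OF _ measurable_ennreal] borel_measurable_norm_blinfun simp: minus_blinfun.rep_eq)
  have Hm: "H \<in> borel_measurable T" unfolding H_def using m0 by measurable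
  have sup: "(SUP x\<in>X. ennreal (?a t x)) = (SUP x\<in>D. ennreal (?a t x))" "(SUP x\<in>X. ennreal (?b t x)) = (SUP x\<in>D. ennreal (?b t x))"
    if "t \<in> space T" for t
    using amb_deriv_continuous[OF d[OF that]] amb_deriv_continuous[OF d'[OF that]] by (auto intro!: D(3) continuous_on_norm continuous_on_diff)
  have H_eq: "H t = dist_deriv M X \<iota> (F t) (F' t) + dist_deriv_inv M X \<iota> (F t) (F' t)" if t: "t \<in> space T" for t
  proof -
    note r = diffeo_on_XD(2)[OF d[OF t]] diffeo_on_XD(2)[OF d'[OF t]] and x = diffeo_on_XD(3)[OF d[OF t]] diffeo_on_XD(3)[OF d'[OF t]]
    have "dist_deriv M X \<iota> (F t) (F' t) = (SUP x\<in>X. ennreal (?a t x))" unfolding dist_deriv_def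
      by (rule SUP_cong[OF refl]) (simp only: dist_amb_deriv[OF r _ x])
    moreover have "dist_deriv_inv M X \<iota> (F t) (F' t) = (SUP x\<in>X. ennreal (?b t x))" unfolding dist_deriv_inv_def
      by (rule SUP_cong[OF refl]) (simp only: dist_cot_deriv[OF r _ x])
    ultimately show ?thesis by (simp add: H_def sup[OF t])
  qed
  show thesis
  proof (rule that[OF Hm])
    have "(\<integral>\<^sup>+t. H t \<partial>T) = (\<integral>\<^sup>+\<omega>. H (\<omega> 0) \<partial>noise T)" by (rule nn_integral_noise_zero[symmetric, OF T Hm]) simp
    \<comment> \<open>Dropping the nonnegative term \<open>dist_C0\<close> from the integrand leaves
      exactly \<open>H\<close>.\<close>
    also have "\<dots> \<le> dist_C1 M T X \<iota> f f'" unfolding dist_C1_def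
    proof (rule nn_integral_mono_AE)
      show "AE \<omega> in noise T. H (\<omega> 0) \<le> dist_C0 M X (f \<omega>) (f' \<omega>) + dist_deriv M X \<iota> (f \<omega>) (f' \<omega>) + dist_deriv_inv M X \<iota> (f \<omega>) (f' \<omega>)"
        using representsD(2)[OF F] representsD(2)[OF F'] AE_space
      proof eventually_elim
        case (elim \<omega>)
        show ?case unfolding elim(1,2) H_eq[OF noise_component[OF elim(3)]] by (simp add: add.assoc add_increasing)
      qed
    qed
    finally show "(\<integral>\<^sup>+t. H t \<partial>T) \<le> dist_C1 M T X \<iota> f f'" .
    fix t x assume t: "t \<in> space T" and x: "x \<in> X"
    have "ennreal (?a t x) \<le> (SUP x\<in>D. ennreal (?a t x))" "ennreal (?b t x) \<le> (SUP x\<in>D. ennreal (?b t x))"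
      unfolding sup[OF t, symmetric] using x by (auto intro: SUP_upper)
    then show "ennreal (?a t x) \<le> H t" "ennreal (?b t x) \<le> H t"
      unfolding H_def by (simp_all add: add_increasing add_increasing2)
  qed
qed

text \<open>No measurability of the Riemannian distance is available, which is why it is replaced by a continuous
  function \<open>\<rho>\<close> vanishing on the diagonal.\<close>

lemma represents_dist_C0:
  fixes \<rho> :: "'a \<times> 'a \<Rightarrow> real"
  assumes T: "prob_space T" and F: "represents T F f" and F': "represents T F' f'"
    and \<rho>: "continuous_on (X \<times> X) \<rho>" "\<And>x y. x \<in> X \<Longrightarrow> y \<in> X \<Longrightarrow> 0 \<le> \<rho> (x, y)"
    and \<delta>: "\<delta> > 0" "\<And>x y. x \<in> X \<Longrightarrow> y \<in> X \<Longrightarrow> rdist M x y < ennreal \<delta> \<Longrightarrow> \<bar>\<rho> (x, y)\<bar> < e" and e: "0 < e"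
  obtains B where "B \<in> sets T" "ennreal \<delta> * emeasure T B \<le> dist_C1 M T X \<iota> f f'"
    "\<And>t x. t \<in> space T - B \<Longrightarrow> x \<in> X \<Longrightarrow> \<rho> (F t x, F' t x) \<le> e"
proof -
  note d = represents_diffeo[OF F] and d' = represents_diffeo[OF F']
  obtain D where D: "countable D" "D \<subseteq> X"
    "\<And>h :: 'a \<Rightarrow> real. continuous_on X h \<Longrightarrow> (\<And>x. x \<in> X \<Longrightarrow> 0 \<le> h x) \<Longrightarrow> (SUP x\<in>X. ennreal (h x)) = (SUP x\<in>D. ennreal (h x))"
    using countable_dense_subset[of X] by metis
  let ?r = "\<lambda>t x. \<rho> (F t x, F' t x)"
  define E where "E t = (SUP x\<in>D. ennreal (?r t x))" for t
  have sec: "(\<lambda>t. ?r t x) \<in> borel_measurable T" if x: "x \<in> X" for x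
  proof -
    have Fx: "(\<lambda>t. K t x) \<in> measurable T (restrict_space borel X)" if "random_diffeo T K" for K
      using x by (intro random_map_measurable[OF random_diffeo_random_map[OF that]] measurable_ident_sets) (auto simp: space_restrict_space)
    have "(\<lambda>t. (F t x, F' t x)) \<in> measurable T (restrict_space borel (X \<times> X))"
    proof (rule measurable_restrict_space2)
      show "(\<lambda>t. (F t x, F' t x)) \<in> space T \<rightarrow> X \<times> X" using diffeo_on_XD(3)[OF d x] diffeo_on_XD(3)[OF d' x] by auto
      show "(\<lambda>t. (F t x, F' t x)) \<in> borel_measurable T"
        using Fx[OF representsD(1)[OF F]] Fx[OF representsD(1)[OF F']] by (intro borel_measurable_Pair) (auto simp: measurable_restrict_space2_iff)
    qed
    from measurable_compose[OF this borel_measurable_continuous_on_restrict[OF \<rho>(1)]] show ?thesis .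
  qed
  have Em: "E \<in> borel_measurable T" unfolding E_def
    using D sec by (intro borel_measurable_SUP measurable_compose[OF _ measurable_ennreal]) auto
  have E_sup: "(SUP x\<in>X. ennreal (?r t x)) = E t" if t: "t \<in> space T" for t unfolding E_def
  proof (rule D(3))
    have "continuous_on X (\<lambda>x. (F t x, F' t x))"
      using continuous_on_subset[OF diffeo_on_XD(4)[OF d[OF t]]] continuous_on_subset[OF diffeo_on_XD(4)[OF d'[OF t]]]
      by (intro continuous_on_Pair) auto
    then show "continuous_on X (?r t)"
      by (rule continuous_on_compose2[OF \<rho>(1)]) (use diffeo_on_XD(3)[OF d[OF t]] diffeo_on_XD(3)[OF d'[OF t]] in auto)
    show "0 \<le> ?r t x" if "x \<in> X" for x by (rule \<rho>(2)[OF diffeo_on_XD(3)[OF d[OF t] that] diffeo_on_XD(3)[OF d'[OF t] that]])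
  qed
  \<comment> \<open>The bad letters, described by the measurable \<open>E\<close>. On
    \<open>B\<close> some point has \<rho> above \<open>e\<close>, so its two images are at
    \<open>rdist\<close> at least \<delta>; integrating gives a Markov inequality.\<close>
  define B where "B = {t \<in> space T. ennreal e < E t}"
  have B: "B \<in> sets T" unfolding B_def using Em by measurable
  show thesis
  proof (rule that[OF B])
    have "ennreal \<delta> * emeasure T B = (\<integral>\<^sup>+t. ennreal \<delta> * indicator B t \<partial>T)" using B by (simp add: nn_integral_cmult_indicator)
    also have "\<dots> = (\<integral>\<^sup>+\<omega>. ennreal \<delta> * indicator B (\<omega> 0) \<partial>noise T)"
      using B by (intro nn_integral_noise_zero[symmetric, OF T]) auto
    also have "\<dots> \<le> dist_C1 M T X \<iota> f f'" unfolding dist_C1_def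
    proof (rule nn_integral_mono_AE)
      show "AE \<omega> in noise T. ennreal \<delta> * indicator B (\<omega> 0) \<le> dist_C0 M X (f \<omega>) (f' \<omega>) + dist_deriv M X \<iota> (f \<omega>) (f' \<omega>) + dist_deriv_inv M X \<iota> (f \<omega>) (f' \<omega>)"
        using representsD(2)[OF F] representsD(2)[OF F'] AE_space
      proof eventually_elim
        case (elim \<omega>)
        have t: "\<omega> 0 \<in> space T" by (rule noise_component[OF elim(3)])
        have "ennreal \<delta> * indicator B (\<omega> 0) \<le> dist_C0 M X (F (\<omega> 0)) (F' (\<omega> 0))"
        proof (cases "\<omega> 0 \<in> B")
          case True
          then have "ennreal e < (SUP x\<in>X. ennreal (?r (\<omega> 0) x))" using E_sup[OF t] by (simp add: B_def)
          then obtain x where x: "x \<in> X" "ennreal e < ennreal (?r (\<omega> 0) x)" by (auto simp: less_SUP_iff)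
          then have "e < ?r (\<omega> 0) x" using e by (simp add: ennreal_less_iff)
          then have "\<not> rdist M (F (\<omega> 0) x) (F' (\<omega> 0) x) < ennreal \<delta>"
            using \<delta>(2)[OF diffeo_on_XD(3)[OF d[OF t] x(1)] diffeo_on_XD(3)[OF d'[OF t] x(1)]] by force
          then have "ennreal \<delta> \<le> rdist M (F (\<omega> 0) x) (F' (\<omega> 0) x)" by simp
          also have "\<dots> \<le> dist_C0 M X (F (\<omega> 0)) (F' (\<omega> 0))" unfolding dist_C0_def by (rule SUP_upper[OF x(1)])
          finally show ?thesis using True by simp
        qed simp
        then show ?case unfolding elim(1,2) by (simp add: add.assoc add_increasing2)
      qed
    qed
    finally show "ennreal \<delta> * emeasure T B \<le> dist_C1 M T X \<iota> f f'" .
    fix t x assume t: "t \<in> space T - B" and x: "x \<in> X"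
    have "ennreal (?r t x) \<le> (SUP x\<in>X. ennreal (?r t x))" by (rule SUP_upper[OF x])
    also have "\<dots> \<le> ennreal e" using t E_sup[of t] by (auto simp: B_def not_less)
    finally show "?r t x \<le> e" using e by (simp add: ennreal_le_iff)
  qed
qed

text \<open>For the identity both ambient maps are the projection onto the fibre or its adjoint;
  with norm at most 1 they obey the common bound on the letters reset to the identity.\<close>

lemma derivatives_id:
  assumes x: "x \<in> X" shows "norm (amb_deriv id x) \<le> 1" "norm (cot_deriv id x) \<le> 1"
proof -
  have bnd: "norm (\<iota> x (retr x z)) \<le> 1 * norm z" for z
    using orth_proj_norm[OF fibre_subspace[OF x], of z] by (simp add: emb_retr[OF x])
  show "norm (amb_deriv id x) \<le> 1"
    by (rule norm_blinfun_bound) (use bnd amb_deriv_apply[OF regular_id x] x mdiff_id(2)[of x] in auto)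
  have "norm (amb_inv id x) \<le> 1"
    by (rule norm_blinfun_bound) (use bnd amb_inv_apply[OF regular_id x] x mdiff_id(2)[of x] in auto)
  thus "norm (cot_deriv id x) \<le> 1" using norm_cot_deriv[OF regular_id x] x by simp
qed

end

section \<open>Continuity of the smallest exponent\<close>

context embedded begin

text \<open>What one subsequence achieves. Convergence of the exponents is conditional because the
  limit measure \<eta> is not known in advance, so its coquasi-irreducibility can only be tested
  afterwards.\<close>

definition stat_limit :: "'t measure \<Rightarrow> ((nat \<Rightarrow> 't) \<Rightarrow> 'a \<Rightarrow> 'a) \<Rightarrow> (nat \<Rightarrow> (nat \<Rightarrow> 't) \<Rightarrow> 'a \<Rightarrow> 'a) \<Rightarrow> (nat \<Rightarrow> 'a measure) \<Rightarrow>
    (nat \<Rightarrow> nat) \<Rightarrow> 'a measure \<Rightarrow> bool" where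
  "stat_limit T f g \<mu> r \<eta> \<longleftrightarrow> strict_mono r \<and> \<eta> \<in> stat_measures T X f \<and>
        (\<forall>h::'a\<Rightarrow>real. continuous_on X h \<longrightarrow> (\<lambda>k. integral\<^sup>L (\<mu> (r k)) h) \<longlonglongrightarrow> integral\<^sup>L \<eta> h) \<and>
        (coquasi_irreducible M T X \<eta> f \<longrightarrow> (\<lambda>k. lyap_min_at M T (\<mu> (r k)) (g (r k))) \<longlonglongrightarrow> lyap_min_at M T \<eta> f)"

text \<open>The rate \<open>d\<close> precedes the maps and measures in the quantifiers: it is
  computed from the comparison of \<open>rdist\<close> with \<rho> alone, so a sequence of
  counterexamples can be chosen to meet it.\<close>

lemma lyap_min_at_subseq:
  assumes T: "prob_space T"
  shows "\<exists>d :: nat \<Rightarrow> real. (\<forall>k. d k > 0) \<and> (\<forall>f g \<mu>. f \<in> Diff1_loc M T X \<longrightarrow> (\<forall>k. g k \<in> Diff1_loc M T X) \<longrightarrow>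
    (\<forall>k. dist_C1 M T X \<iota> f (g k) < ennreal (d k)) \<longrightarrow> (\<forall>k. \<mu> k \<in> stat_measures T X (g k)) \<longrightarrow>
    (\<exists>r \<eta>. stat_limit T f g \<mu> r \<eta>))"
proof -
  interpret T: prob_space T by fact
  obtain \<rho> :: "'a \<times> 'a \<Rightarrow> real" where \<rho>: "continuous_on (X \<times> X) \<rho>" "\<And>x y. x \<in> X \<Longrightarrow> y \<in> X \<Longrightarrow> 0 \<le> \<rho> (x, y)"
    "\<And>x y. x \<in> X \<Longrightarrow> y \<in> X \<Longrightarrow> \<rho> (x, y) = 0 \<longleftrightarrow> x = y"
    using diagonal_function_exists[OF compact_X] by metis
  have "\<exists>\<delta>>0. \<forall>x y. x \<in> X \<longrightarrow> y \<in> X \<longrightarrow> rdist M x y < ennreal \<delta> \<longrightarrow> \<bar>\<rho> (x, y)\<bar> < (1/2)^k" for k :: nat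
    using rdist_uniform[OF compact_X \<rho>(1), of "(1/2)^k"] \<rho>(3) by (metis zero_less_divide_1_iff zero_less_numeral zero_less_power)
  then obtain \<delta> :: "nat \<Rightarrow> real" where \<delta>: "\<And>k. \<delta> k > 0"
    "\<And>k x y. x \<in> X \<Longrightarrow> y \<in> X \<Longrightarrow> rdist M x y < ennreal (\<delta> k) \<Longrightarrow> \<bar>\<rho> (x, y)\<bar> < (1/2)^k" by metis
  \<comment> \<open>The factor \<open>(1/2)^k\<close> makes the derivative errors summable in mean;
    the factor \<open>\<delta> k\<close> compensates the one in the Markov bound, so that the bad
    sets have measure at most \<open>(1/2)^k\<close>.\<close>
  define d where "d k = (1/2)^k * min 1 (\<delta> k)" for k
  have d: "d k > 0" "d k \<le> (1/2)^k" "d k \<le> (1/2)^k * \<delta> k" for k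
    using \<delta>(1)[of k] by (auto simp: d_def mult_left_le)
  show ?thesis
  proof (intro exI[of _ d] conjI allI impI d(1))
    fix f g \<mu>
    assume f: "f \<in> Diff1_loc M T X" and "\<forall>k. g k \<in> Diff1_loc M T X" "\<forall>k. dist_C1 M T X \<iota> f (g k) < ennreal (d k)"
      "\<forall>k. \<mu> k \<in> stat_measures T X (g k)"
    then have g: "\<And>k. g k \<in> Diff1_loc M T X" and dist: "\<And>k. dist_C1 M T X \<iota> f (g k) < ennreal (d k)"
      and \<mu>: "\<And>k. \<mu> k \<in> stat_measures T X (g k)" by blast+
    obtain F where F: "represents T F f" using represents_exists[OF T f] .
    have "\<exists>F'. represents T F' (g k)" for k using represents_exists[OF T g] by metis
    then obtain F' where F': "\<And>k. represents T (F' k) (g k)" by metis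
    obtain b where b: "integrable T b" "\<And>t. 0 \<le> b t"
      "\<And>t x. t \<in> space T \<Longrightarrow> x \<in> X \<Longrightarrow> norm (amb_deriv (F t) x) \<le> exp (b t)"
      "\<And>t x. t \<in> space T \<Longrightarrow> x \<in> X \<Longrightarrow> norm (cot_deriv (F t) x) \<le> exp (b t)"
      using represents_bound[OF T F f] by metis
    have "\<exists>H. H \<in> borel_measurable T \<and> (\<integral>\<^sup>+t. H t \<partial>T) \<le> dist_C1 M T X \<iota> f (g k) \<and>
       (\<forall>t x. t \<in> space T \<longrightarrow> x \<in> X \<longrightarrow> ennreal (norm (amb_deriv (F t) x - amb_deriv (F' k t) x)) \<le> H t \<and>
         ennreal (norm (cot_deriv (F t) x - cot_deriv (F' k t) x)) \<le> H t)" for k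
      using represents_dist_deriv[OF T F F'] by metis
    then obtain H where H: "\<And>k. H k \<in> borel_measurable T" "\<And>k. (\<integral>\<^sup>+t. H k t \<partial>T) \<le> dist_C1 M T X \<iota> f (g k)"
      "\<And>k t x. t \<in> space T \<Longrightarrow> x \<in> X \<Longrightarrow> ennreal (norm (amb_deriv (F t) x - amb_deriv (F' k t) x)) \<le> H k t"
      "\<And>k t x. t \<in> space T \<Longrightarrow> x \<in> X \<Longrightarrow> ennreal (norm (cot_deriv (F t) x - cot_deriv (F' k t) x)) \<le> H k t" by metis
    have "\<exists>B. B \<in> sets T \<and> ennreal (\<delta> k) * emeasure T B \<le> dist_C1 M T X \<iota> f (g k) \<and>
       (\<forall>t x. t \<in> space T - B \<longrightarrow> x \<in> X \<longrightarrow> \<rho> (F t x, F' k t x) \<le> (1/2)^k)" for k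
    proof (rule represents_dist_C0[OF T F F'[of k] \<rho>(1,2) \<delta>(1)[of k] \<delta>(2)[of _ _ k]])
      fix B assume "B \<in> sets T" "ennreal (\<delta> k) * emeasure T B \<le> dist_C1 M T X \<iota> f (g k)"
        "\<And>t x. t \<in> space T - B \<Longrightarrow> x \<in> X \<Longrightarrow> \<rho> (F t x, F' k t x) \<le> (1/2)^k"
      then show ?thesis by blast
    qed simp_all
    then obtain B where B: "\<And>k. B k \<in> sets T" "\<And>k. ennreal (\<delta> k) * emeasure T (B k) \<le> dist_C1 M T X \<iota> f (g k)"
       "\<And>k t x. t \<in> space T - B k \<Longrightarrow> x \<in> X \<Longrightarrow> \<rho> (F t x, F' k t x) \<le> (1/2)^k" by metis
    have half: "summable (\<lambda>k. (1/2::real)^k)" by (rule summable_geometric) simp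
    have "measure T (B k) \<le> (1/2)^k" for k
    proof -
      have "ennreal (\<delta> k * measure T (B k)) \<le> ennreal (d k)"
        using order_trans[OF B(2) less_imp_le[OF dist]] \<delta>(1)[of k] by (simp add: T.emeasure_eq_measure ennreal_mult)
      then have "\<delta> k * measure T (B k) \<le> (1/2)^k * \<delta> k" using d[of k] by (simp add: ennreal_le_iff)
      thus ?thesis using \<delta>(1)[of k] by (simp add: mult.commute)
    qed
    then have "summable (\<lambda>k. measure T (B k))" by (intro summable_comparison_test'[OF half]) auto
    \<comment> \<open>Borel-Cantelli: almost every letter is bad for finitely many \<open>k\<close>
      only.\<close>
    then have evB: "AE t in T. \<forall>\<^sub>F k in sequentially. t \<in> space T - B k"
      by (intro borel_cantelli_AE1 B(1)) (auto simp: T.emeasure_eq_measure)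
    \<comment> \<open>The total derivative error. Being integrable it is finite almost surely, which
      yields two facts at once: the single errors tend to zero, and all of them are dominated by one
      integrable function.\<close>
    define \<Sigma> where "\<Sigma> t = (\<Sum>k. H k t)" for t
    have \<Sigma>m[measurable]: "\<Sigma> \<in> borel_measurable T" unfolding \<Sigma>_def using H(1) by measurable
    have \<Sigma>int: "(\<integral>\<^sup>+t. \<Sigma> t \<partial>T) < \<infinity>"
    proof -
      have "(\<integral>\<^sup>+t. \<Sigma> t \<partial>T) = (\<Sum>k. \<integral>\<^sup>+t. H k t \<partial>T)" unfolding \<Sigma>_def by (rule nn_integral_suminf[OF H(1)])
      also have "\<dots> \<le> (\<Sum>k. ennreal ((1/2)^k))"
      proof (intro suminf_le allI)
        fix k show "(\<integral>\<^sup>+t. H k t \<partial>T) \<le> ennreal ((1/2)^k)"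
          using H(2)[of k] dist[of k] ennreal_leI[OF d(2)[of k]] by (meson less_imp_le order_trans)
      qed auto
      also have "\<dots> < \<infinity>" using half by (simp add: suminf_ennreal2)
      finally show ?thesis .
    qed
    define A where "A = {t \<in> space T. \<Sigma> t \<noteq> \<infinity>}"
    have A: "A \<in> sets T" unfolding A_def by measurable
    have AE_A: "AE t in T. t \<in> A"
      using nn_integral_PInf_AE[OF \<Sigma>m] \<Sigma>int AE_space by (auto simp: A_def elim!: eventually_elim2)
    define \<sigma> where "\<sigma> t = enn2real (\<Sigma> t)" for t
    have \<sigma>A: "ennreal (\<sigma> t) = \<Sigma> t" if "t \<in> A" for t using that by (simp add: \<sigma>_def A_def ennreal_enn2real less_top)
    have \<sigma>int: "integrable T \<sigma>"
    proof (rule integrableI_nonneg)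
      have "(\<integral>\<^sup>+t. ennreal (\<sigma> t) \<partial>T) = (\<integral>\<^sup>+t. \<Sigma> t \<partial>T)"
        using AE_A by (intro nn_integral_cong_AE) (auto simp: \<sigma>A elim!: eventually_mono)
      thus "(\<integral>\<^sup>+t. ennreal (\<sigma> t) \<partial>T) < \<infinity>" using \<Sigma>int by simp
      show "\<sigma> \<in> borel_measurable T" unfolding \<sigma>_def by measurable
    qed (auto simp: \<sigma>_def)
    have \<sigma>0: "0 \<le> \<sigma> t" for t by (simp add: \<sigma>_def)
    have H_le: "H k t \<le> ennreal (\<sigma> t)" if "t \<in> A" for k t
      unfolding \<sigma>A[OF that] \<Sigma>_def using sum_le_suminf[of "\<lambda>k. H k t" "{k}"] by simp
    define h where "h k t = enn2real (H k t)" for k t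
    have hH: "ennreal (h k t) = H k t" "h k t \<le> \<sigma> t" if t: "t \<in> A" for k t
    proof -
      have "H k t < \<infinity>" unfolding infinity_ennreal_def by (rule le_less_trans[OF H_le[OF t]]) simp
      then show e: "ennreal (h k t) = H k t" by (simp add: h_def ennreal_enn2real)
      show "h k t \<le> \<sigma> t" using H_le[OF t, of k] \<sigma>0[of t] unfolding e[symmetric] by (simp add: ennreal_le_iff)
    qed
    have h_le: "norm (amb_deriv (F t) x - amb_deriv (F' k t) x) \<le> h k t" "norm (cot_deriv (F t) x - cot_deriv (F' k t) x) \<le> h k t"
      if t: "t \<in> A" and x: "x \<in> X" for k t x
    proof -
      have tT: "t \<in> space T" using t by (simp add: A_def)
      have "0 \<le> h k t" by (simp add: h_def)
      then show "norm (amb_deriv (F t) x - amb_deriv (F' k t) x) \<le> h k t" "norm (cot_deriv (F t) x - cot_deriv (F' k t) x) \<le> h k t"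
        using H(3,4)[OF tT x, of k] unfolding hH(1)[OF t, symmetric] by (simp_all add: ennreal_le_iff)
    qed
    have h_lim: "(\<lambda>k. h k t) \<longlonglongrightarrow> 0" if t: "t \<in> A" for t
    proof -
      have "(\<Sum>k. ennreal (h k t)) \<noteq> \<infinity>" using t by (simp add: hH(1)[OF t] A_def \<Sigma>_def)
      then have "summable (\<lambda>k. h k t)" by (intro summable_suminf_not_top) (auto simp: h_def)
      thus ?thesis by (rule summable_LIMSEQ_zero)
    qed
    \<comment> \<open>Off \<open>A\<close> all maps are reset to the identity, so that the bound by
      \<open>?G\<close> holds for every letter and every \<open>k\<close>.\<close>
    let ?F = "\<lambda>t. if t \<in> A then F t else id" and ?F' = "\<lambda>k t. if t \<in> A then F' k t else id"
    let ?G = "\<lambda>t. b t + \<sigma> t"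
    have rF: "represents T ?F f" by (rule represents_modify[OF T F A AE_A])
    have rF': "represents T (?F' k) (g k)" for k by (rule represents_modify[OF T F' A AE_A])
    have Gint: "integrable T ?G" by (rule Bochner_Integration.integrable_add[OF b(1) \<sigma>int])
    have le1: "exp (b t) \<le> exp (?G t)" "1 \<le> exp (?G t)" for t using b(2)[of t] \<sigma>0[of t] by simp_all
    \<comment> \<open>As \<open>b\<close> is nonnegative, the additive error can be made
      multiplicative: \<open>exp b + h\<close> is at most \<open>exp b * (1 + h)\<close>, and
      \<open>1 + h\<close> is at most \<open>exp \<sigma>\<close>. This is the origin of the
      exponent \<open>b + \<sigma>\<close>.\<close>
    have le2: "exp (b t) + h k t \<le> exp (?G t)" if t: "t \<in> A" for k t
    proof -
      have "exp (b t) + h k t \<le> exp (b t) + exp (b t) * h k t"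
        using mult_right_mono[of 1 "exp (b t)" "h k t"] b(2)[of t] by (simp add: h_def)
      also have "\<dots> = exp (b t) * (1 + h k t)" by (simp add: algebra_simps)
      also have "\<dots> \<le> exp (b t) * exp (\<sigma> t)"
        using exp_ge_add_one_self[of "\<sigma> t"] hH(2)[OF t, of k] by (intro mult_left_mono exp_ge_zero) linarith
      finally show ?thesis by (simp add: exp_add)
    qed
    have coc: "cocycle T X fibre ?F (\<lambda>t. cot_deriv (?F t)) ?G"
    proof (rule random_diffeo_cocycle[OF representsD(1)[OF rF] Gint])
      fix t x assume t: "t \<in> space T" and x: "x \<in> X"
      show "norm (amb_deriv (?F t) x) \<le> exp (?G t)" "norm (cot_deriv (?F t) x) \<le> exp (?G t)"
        using order_trans[OF b(3)[OF t x] le1(1)] order_trans[OF b(4)[OF t x] le1(1)]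
          order_trans[OF derivatives_id(1)[OF x] le1(2)] order_trans[OF derivatives_id(2)[OF x] le1(2)]
        by (simp_all only: split: if_split) simp_all
    qed
    have coc': "cocycle T X fibre (?F' k) (\<lambda>t. cot_deriv (?F' k t)) ?G" for k
    proof (rule random_diffeo_cocycle[OF representsD(1)[OF rF'] Gint])
      fix t x assume t: "t \<in> space T" and x: "x \<in> X"
      show "norm (amb_deriv (?F' k t) x) \<le> exp (?G t)"
      proof (cases "t \<in> A")
        case True
        have "norm (amb_deriv (F' k t) x) \<le> norm (amb_deriv (F t) x) + norm (amb_deriv (F t) x - amb_deriv (F' k t) x)"
          by (metis norm_minus_commute norm_triangle_sub)
        also have "\<dots> \<le> exp (b t) + h k t" by (intro add_mono b(3)[OF t x] h_le(1)[OF True x])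
        also have "\<dots> \<le> exp (?G t)" by (rule le2[OF True])
        finally show ?thesis using True by simp
      qed (use order_trans[OF derivatives_id(1)[OF x] le1(2)[of t]] in simp)
      show "norm (cot_deriv (?F' k t) x) \<le> exp (?G t)"
      proof (cases "t \<in> A")
        case True
        have "norm (cot_deriv (F' k t) x) \<le> norm (cot_deriv (F t) x) + norm (cot_deriv (F t) x - cot_deriv (F' k t) x)"
          by (metis norm_minus_commute norm_triangle_sub)
        also have "\<dots> \<le> exp (b t) + h k t" by (intro add_mono b(4)[OF t x] h_le(2)[OF True x])
        also have "\<dots> \<le> exp (?G t)" by (rule le2[OF True])
        finally show ?thesis using True by simp
      qed (use order_trans[OF derivatives_id(2)[OF x] le1(2)[of t]] in simp)
    qed
    have contF: "continuous_on X (?F t)" "continuous_on X (cot_deriv (?F t))" if "t \<in> space T" for t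
      using continuous_on_subset[OF diffeo_on_XD(4)[OF represents_diffeo[OF rF that]] subset_UNIV]
        amb_deriv_continuous(2)[OF represents_diffeo[OF rF that]] by auto
    have ccC: "continuously_convergent X (\<lambda>k. cot_deriv (?F' k t)) (cot_deriv (?F t))" if t: "t \<in> A" for t
      unfolding continuously_convergent_def
    proof (intro allI impI)
      fix r :: "nat \<Rightarrow> nat" and z z0 assume *: "strict_mono r" "\<forall>j. z j \<in> X" "z0 \<in> X" "z \<longlonglongrightarrow> z0"
      have tT: "t \<in> space T" using t by (simp add: A_def)
      have 1: "(\<lambda>j. cot_deriv (F t) (z j)) \<longlonglongrightarrow> cot_deriv (F t) z0"
        using contF(2)[OF tT, unfolded continuous_on_sequentially comp_def] * t by simp
      have "(\<lambda>j. cot_deriv (F t) (z j) - cot_deriv (F' (r j) t) (z j)) \<longlonglongrightarrow> 0"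
      proof (rule Lim_null_comparison)
        show "(\<lambda>j. h (r j) t) \<longlonglongrightarrow> 0" using LIMSEQ_subseq_LIMSEQ[OF h_lim[OF t] *(1)] by (simp add: comp_def)
      qed (use h_le(2)[OF t] * in auto)
      from tendsto_diff[OF 1 this] show "(\<lambda>j. cot_deriv (?F' (r j) t) (z j)) \<longlonglongrightarrow> cot_deriv (?F t) z0" using t by simp
    qed
    have ccF: "continuously_convergent X (\<lambda>k. ?F' k t) (?F t)"
      if t: "t \<in> A" and ev: "\<forall>\<^sub>F k in sequentially. t \<in> space T - B k" for t
      unfolding continuously_convergent_def
    proof (intro allI impI)
      fix r :: "nat \<Rightarrow> nat" and z z0 assume *: "strict_mono r" "\<forall>j. z j \<in> X" "z0 \<in> X" "z \<longlonglongrightarrow> z0"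
      have tT: "t \<in> space T" using t by (simp add: A_def)
      have inX: "F t x \<in> X" "F' k t x \<in> X" if "x \<in> X" for k x
        using diffeo_on_XD(3)[OF represents_diffeo[OF F tT] that] diffeo_on_XD(3)[OF represents_diffeo[OF F' tT] that] .
      have "(\<lambda>j. F' (r j) t (z j)) \<longlonglongrightarrow> F t z0"
      proof (rule tendsto_of_diagonal_zero[OF compact_X \<rho>(1)])
        show "(\<lambda>j. F t (z j)) \<longlonglongrightarrow> F t z0"
          using contF(1)[OF tT, unfolded continuous_on_sequentially comp_def] * t by simp
        have "\<forall>\<^sub>F j in sequentially. t \<in> space T - B (r j)"
          using ev filterlim_subseq[OF *(1)] by (rule eventually_compose_filterlim)
        then have "\<forall>\<^sub>F j in sequentially. norm (\<rho> (F t (z j), F' (r j) t (z j))) \<le> (1/2)^r j"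
          by eventually_elim (use B(3) \<rho>(2) inX * in \<open>auto simp: abs_of_nonneg\<close>)
        moreover have "(\<lambda>j. (1/2::real)^r j) \<longlonglongrightarrow> 0"
          using LIMSEQ_subseq_LIMSEQ[OF summable_LIMSEQ_zero[OF half] *(1)] by (simp add: comp_def)
        ultimately show "(\<lambda>j. \<rho> (F t (z j), F' (r j) t (z j))) \<longlonglongrightarrow> 0" by (rule Lim_null_comparison)
      qed (use \<rho>(3) inX * in auto)
      then show "(\<lambda>j. ?F' (r j) t (z j)) \<longlonglongrightarrow> ?F t z0" using t by simp
    qed
    have inv: "invariant_measure T X (?F' k) (\<mu> k)" for k using \<mu>[of k] stat_measures_iff[OF T rF'] by simp
    obtain r N where r: "strict_mono r" and N: "invariant_measure T SX (projective_action ?F (\<lambda>t. cot_deriv (?F t))) N"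
      and inv\<eta>: "invariant_measure T X ?F (distr N (restrict_space borel X) fst)"
      and w: "\<And>h::'a\<Rightarrow>real. continuous_on X h \<Longrightarrow> (\<lambda>k. integral\<^sup>L (\<mu> (r k)) h) \<longlonglongrightarrow> integral\<^sup>L (distr N (restrict_space borel X) fst) h"
      and gr: "integral\<^sup>L N (mean_log_stretch T (\<lambda>t. cot_deriv (?F t))) = growth_rate T ?F (\<lambda>t. cot_deriv (?F t)) (distr N (restrict_space borel X) fst) \<Longrightarrow>
        (\<lambda>k. growth_rate T (?F' (r k)) (\<lambda>t. cot_deriv (?F' (r k) t)) (\<mu> (r k))) \<longlonglongrightarrow> growth_rate T ?F (\<lambda>t. cot_deriv (?F t)) (distr N (restrict_space borel X) fst)"
    proof (rule growth_rate_subseq[OF T coc coc' _ _ _ _ inv])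
      show "AE t in T. continuously_convergent X (\<lambda>k. ?F' k t) (?F t)"
        using AE_A evB by eventually_elim (rule ccF)
      show "AE t in T. continuously_convergent X (\<lambda>k. cot_deriv (?F' k t)) (cot_deriv (?F t))"
        using AE_A by eventually_elim (rule ccC)
      show "AE t in T. continuous_on X (?F t)" "AE t in T. continuous_on X (cot_deriv (?F t))"
        using contF by (auto intro: AE_I2)
    qed blast
    let ?\<eta> = "distr N (restrict_space borel X) fst"
    have \<eta>: "?\<eta> \<in> stat_measures T X f" using inv\<eta> stat_measures_iff[OF T rF] by simp
    have "(\<lambda>k. lyap_min_at M T (\<mu> (r k)) (g (r k))) \<longlonglongrightarrow> lyap_min_at M T ?\<eta> f" if ci: "coquasi_irreducible M T X ?\<eta> f"
    proof -
      \<comment> \<open>The image of \<open>N\<close> among the lines is one of the stationary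
        measures over \<open>?\<eta>\<close>, so coquasi-irreducibility evaluates the stretch
        integral and discharges the premise of \<open>gr\<close>.\<close>
      note cs = cot_stationary_measure[OF T rF coc N refl]
      have "integral\<^sup>L N (mean_log_stretch T (\<lambda>t. cot_deriv (?F t))) = - lyap_min_at M T ?\<eta> f"
        using ci cs unfolding coquasi_irreducible_def by metis
      then have "integral\<^sup>L N (mean_log_stretch T (\<lambda>t. cot_deriv (?F t))) = growth_rate T ?F (\<lambda>t. cot_deriv (?F t)) ?\<eta>"
        using lyap_min_at_eq[OF T rF coc inv\<eta>] by simp
      from tendsto_minus[OF gr[OF this]] show ?thesis
        by (simp only: lyap_min_at_eq[OF T rF' coc' inv] lyap_min_at_eq[OF T rF coc inv\<eta>])
    qed
    with r \<eta> w show "\<exists>r \<eta>. stat_limit T f g \<mu> r \<eta>" unfolding stat_limit_def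
      by blast
  qed
qed

text \<open>The infimum in \<open>lyap_min\<close> is taken in the reals, where it has its usual
  properties only for nonempty families bounded below.\<close>

lemma stat_measures_nonempty:
  assumes T: "prob_space T" and f: "f \<in> Diff1_loc M T X" and X: "X \<noteq> {}"
  shows "stat_measures T X f \<noteq> {}" "bdd_below ((\<lambda>\<eta>. lyap_min_at M T \<eta> f) ` stat_measures T X f)"
proof -
  obtain F where F: "represents T F f" using represents_exists[OF T f] .
  note d = represents_diffeo[OF F]
  have "AE t in T. continuous_on X (F t)"
    using continuous_on_subset[OF diffeo_on_XD(4)[OF d] subset_UNIV] by (intro AE_I2)
  then obtain N where "invariant_measure T X F N"
    using invariant_measure_exists[OF T compact_X X random_diffeo_random_map[OF representsD(1)[OF F]]] by blast
  thus "stat_measures T X f \<noteq> {}" using stat_measures_iff[OF T F] by blast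
  obtain b where b: "integrable T b" "\<And>t. 0 \<le> b t"
    "\<And>t x. t \<in> space T \<Longrightarrow> x \<in> X \<Longrightarrow> norm (amb_deriv (F t) x) \<le> exp (b t)"
    "\<And>t x. t \<in> space T \<Longrightarrow> x \<in> X \<Longrightarrow> norm (cot_deriv (F t) x) \<le> exp (b t)"
    using represents_bound[OF T F f] by metis
  have coc: "cocycle T X fibre F (\<lambda>t. cot_deriv (F t)) b"
    by (rule random_diffeo_cocycle[OF representsD(1)[OF F] b(1,3,4)])
  show "bdd_below ((\<lambda>\<eta>. lyap_min_at M T \<eta> f) ` stat_measures T X f)"
  proof (rule bdd_belowI2[where m="- (LINT t|T. b t)"])
    fix \<eta> assume "\<eta> \<in> stat_measures T X f"
    then have inv: "invariant_measure T X F \<eta>" using stat_measures_iff[OF T F] by simp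
    show "- (LINT t|T. b t) \<le> lyap_min_at M T \<eta> f"
      using growth_rate_lower[OF T coc inv] lyap_min_at_eq[OF T F coc inv] by linarith
  qed
qed

text \<open>All maps preserve the same \<mu>, so the subsequence lemma is applied to a constant
  sequence of measures and the limit measure has to be \<mu> itself.\<close>

theorem lyap_min_at_continuous:
  assumes T: "prob_space T" and f: "f \<in> Diff1_loc_preserving M T X \<mu>" and ci: "coquasi_irreducible M T X \<mu> f"
  shows "continuous_at_wrt (dist_C1 M T X \<iota>) (Diff1_loc_preserving M T X \<mu>) (lyap_min_at M T \<mu>) f"
proof (rule ccontr)
  assume "\<not> ?thesis"
  then obtain e where e: "e > 0" "\<And>\<delta>. \<delta> > 0 \<Longrightarrow> \<exists>g\<in>Diff1_loc_preserving M T X \<mu>. dist_C1 M T X \<iota> f g < ennreal \<delta> \<and> \<not> \<bar>lyap_min_at M T \<mu> g - lyap_min_at M T \<mu> f\<bar> < e"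
    unfolding continuous_at_wrt_def by blast
  obtain d :: "nat \<Rightarrow> real" where d: "\<forall>k. d k > 0"
    "\<forall>f g \<mu>. f \<in> Diff1_loc M T X \<longrightarrow> (\<forall>k. g k \<in> Diff1_loc M T X) \<longrightarrow>
      (\<forall>k. dist_C1 M T X \<iota> f (g k) < ennreal (d k)) \<longrightarrow> (\<forall>k. \<mu> k \<in> stat_measures T X (g k)) \<longrightarrow> (\<exists>r \<eta>. stat_limit T f g \<mu> r \<eta>)"
    using lyap_min_at_subseq[OF T] by (elim exE conjE)
  obtain g where g: "\<And>k. g k \<in> Diff1_loc_preserving M T X \<mu>" "\<And>k. dist_C1 M T X \<iota> f (g k) < ennreal (d k)"
    "\<And>k. \<not> \<bar>lyap_min_at M T \<mu> (g k) - lyap_min_at M T \<mu> f\<bar> < e"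
    using e(2)[OF d(1)[rule_format]] by metis
  obtain r \<eta> where r: "strict_mono (r :: nat \<Rightarrow> nat)" "\<eta> \<in> stat_measures T X f"
    "\<And>h::'a\<Rightarrow>real. continuous_on X h \<Longrightarrow> (\<lambda>k. integral\<^sup>L \<mu> h) \<longlonglongrightarrow> integral\<^sup>L \<eta> h"
    "coquasi_irreducible M T X \<eta> f \<Longrightarrow> (\<lambda>k. lyap_min_at M T \<mu> (g (r k))) \<longlonglongrightarrow> lyap_min_at M T \<eta> f"
    using d(2)[rule_format, of f g "\<lambda>_. \<mu>"] f g(1,2) unfolding Diff1_loc_preserving_def stat_limit_def by blast
  \<comment> \<open>The integrals against \<mu> form constant sequences, so weak convergence says
    that both measures integrate continuous functions alike.\<close>
  have "\<mu> = \<eta>"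
  proof (rule compact_borel_measure_eqI[OF compact_X])
    show "integral\<^sup>L \<mu> h = integral\<^sup>L \<eta> h" if "continuous_on X h" for h :: "'a \<Rightarrow> real"
      using LIMSEQ_unique[OF tendsto_const r(3)[OF that]] .
  qed (use f r(2) in \<open>auto simp: Diff1_loc_preserving_def stat_measures_def\<close>)
  then have "(\<lambda>k. lyap_min_at M T \<mu> (g (r k))) \<longlonglongrightarrow> lyap_min_at M T \<mu> f" using r(4) ci by simp
  then have "\<forall>\<^sub>F k in sequentially. \<bar>lyap_min_at M T \<mu> (g (r k)) - lyap_min_at M T \<mu> f\<bar> < e"
    using e(1) by (auto dest!: tendstoD simp: dist_real_def)
  then show False using g(3) by simp
qed

text \<open>The limit measure cannot be prescribed here, but maximality makes every stationary
  measure of \<open>f\<close> coquasi-irreducible with the same exponent, so whichever limit occurs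
  the exponents tend to \<open>lyap_min M T X f\<close>.\<close>

theorem lyap_min_continuous:
  assumes T: "prob_space T" and f: "f \<in> Diff1_loc M T X" and ci: "maximal_coquasi_irreducible M T X f"
  shows "continuous_at_wrt (dist_C1 M T X \<iota>) (Diff1_loc M T X) (lyap_min M T X) f"
proof (cases "X = {}")
  case True
  have "stat_measures T X g = {}" for g
  proof -
    have False if "\<mu> \<in> stat_measures T X g" for \<mu>
    proof -
      have "prob_space \<mu>" "sets \<mu> = sets (restrict_space borel X)" using that by (auto simp: stat_measures_def)
      then show False using prob_space.not_empty sets_eq_imp_space_eq[of \<mu> "restrict_space borel X"] True by (fastforce simp: space_restrict_space)
    qed
    thus ?thesis by blast
  qed
  \<comment> \<open>An infimum over the empty family is the same unspecified real for every
    \<open>g\<close>, so the map is constant.\<close>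
  then have eq: "lyap_min M T X g = lyap_min M T X f" for g by (simp add: lyap_min_def)
  show ?thesis unfolding continuous_at_wrt_def by (subst eq) (auto intro!: exI[of _ 1])
next
  case X: False
  show ?thesis
  proof (rule ccontr)
    assume "\<not> ?thesis"
    then obtain e where e: "e > 0" "\<And>\<delta>. \<delta> > 0 \<Longrightarrow> \<exists>g\<in>Diff1_loc M T X. dist_C1 M T X \<iota> f g < ennreal \<delta> \<and> \<not> \<bar>lyap_min M T X g - lyap_min M T X f\<bar> < e"
      unfolding continuous_at_wrt_def by blast
    obtain d :: "nat \<Rightarrow> real" where d: "\<forall>k. d k > 0"
      "\<forall>f g \<mu>. f \<in> Diff1_loc M T X \<longrightarrow> (\<forall>k. g k \<in> Diff1_loc M T X) \<longrightarrow>
        (\<forall>k. dist_C1 M T X \<iota> f (g k) < ennreal (d k)) \<longrightarrow> (\<forall>k. \<mu> k \<in> stat_measures T X (g k)) \<longrightarrow> (\<exists>r \<eta>. stat_limit T f g \<mu> r \<eta>)"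
      using lyap_min_at_subseq[OF T] by (elim exE conjE)
    obtain g where g: "\<And>k. g k \<in> Diff1_loc M T X" "\<And>k. dist_C1 M T X \<iota> f (g k) < ennreal (d k)"
      "\<And>k. \<not> \<bar>lyap_min M T X (g k) - lyap_min M T X f\<bar> < e"
      using e(2)[OF d(1)[rule_format]] by metis
    \<comment> \<open>Almost minimisers are enough: the slack \<open>1 / Suc k\<close> disappears in
      the limit, and the infimum is squeezed between their exponents and these minus the
      slack.\<close>
    have "\<exists>\<mu>\<in>stat_measures T X (g k). lyap_min_at M T \<mu> (g k) < lyap_min M T X (g k) + 1 / real (Suc k)" for k
      using cINF_less_iff[OF stat_measures_nonempty[OF T g(1) X], of k "lyap_min M T X (g k) + 1 / real (Suc k)"]
      unfolding lyap_min_def by simp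
    then obtain \<mu> where \<mu>: "\<And>k. \<mu> k \<in> stat_measures T X (g k)" "\<And>k. lyap_min_at M T (\<mu> k) (g k) < lyap_min M T X (g k) + 1 / real (Suc k)"
      by metis
    have \<mu>_le: "lyap_min M T X (g k) \<le> lyap_min_at M T (\<mu> k) (g k)" for k
      unfolding lyap_min_def by (rule cINF_lower[OF stat_measures_nonempty(2)[OF T g(1) X] \<mu>(1)])
    obtain r \<eta> where r: "strict_mono (r :: nat \<Rightarrow> nat)" "\<eta> \<in> stat_measures T X f"
      "coquasi_irreducible M T X \<eta> f \<Longrightarrow> (\<lambda>k. lyap_min_at M T (\<mu> (r k)) (g (r k))) \<longlonglongrightarrow> lyap_min_at M T \<eta> f"
      using d(2)[rule_format, of f g \<mu>] f g(1,2) \<mu>(1) unfolding stat_limit_def by blast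
    have lim: "(\<lambda>k. lyap_min_at M T (\<mu> (r k)) (g (r k))) \<longlonglongrightarrow> lyap_min M T X f"
      using r(2,3) ci unfolding maximal_coquasi_irreducible_def by metis
    have "(\<lambda>k. 1 / real (Suc k)) \<longlonglongrightarrow> 0" using LIMSEQ_Suc[OF lim_const_over_n[of 1]] by simp
    then have "(\<lambda>k. 1 / real (Suc (r k))) \<longlonglongrightarrow> 0" using LIMSEQ_subseq_LIMSEQ[OF _ r(1), of "\<lambda>k. 1 / real (Suc k)"] by (simp add: comp_def)
    from tendsto_diff[OF lim this]
    have low: "(\<lambda>k. lyap_min_at M T (\<mu> (r k)) (g (r k)) - 1 / real (Suc (r k))) \<longlonglongrightarrow> lyap_min M T X f" by simp
    have "(\<lambda>k. lyap_min M T X (g (r k))) \<longlonglongrightarrow> lyap_min M T X f"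
    proof (rule tendsto_sandwich[OF _ _ low lim])
      show "\<forall>\<^sub>F k in sequentially. lyap_min_at M T (\<mu> (r k)) (g (r k)) - 1 / real (Suc (r k)) \<le> lyap_min M T X (g (r k))"
        using \<mu>(2) by (intro always_eventually allI) (simp add: less_eq_real_def algebra_simps)
      show "\<forall>\<^sub>F k in sequentially. lyap_min M T X (g (r k)) \<le> lyap_min_at M T (\<mu> (r k)) (g (r k))"
        using \<mu>_le by simp
    qed
    then have "\<forall>\<^sub>F k in sequentially. \<bar>lyap_min M T X (g (r k)) - lyap_min M T X f\<bar> < e"
      using e(1) by (auto dest!: tendstoD simp: dist_real_def)
    then show False using g(3) by simp
  qed
qed

end

theorem theorem3:
  fixes M :: "('a::{second_countable_topology, t2_space}, 'e::euclidean_space) manifold"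
    and T :: "'t measure"
    and X :: "'a set"
    and \<iota> :: "'a \<Rightarrow> 'e \<Rightarrow> real ^ 'N"
  assumes "riemannian_manifold M"
    and "prob_space T"
    and "compact X"
    and "isometric_embedding M X \<iota>"
  shows
    "(\<forall>\<mu>. \<forall>f \<in> Diff1_loc_preserving M T X \<mu>. coquasi_irreducible M T X \<mu> f \<longrightarrow>
        continuous_at_wrt (dist_C1 M T X \<iota>) (Diff1_loc_preserving M T X \<mu>) (lyap_min_at M T \<mu>) f) \<and>
     (\<forall>f \<in> Diff1_loc M T X. maximal_coquasi_irreducible M T X f \<longrightarrow>
        continuous_at_wrt (dist_C1 M T X \<iota>) (Diff1_loc M T X) (lyap_min M T X) f)"
proof -
  interpret embedded M X \<iota> using assms by unfold_locales
  show ?thesis using lyap_min_at_continuous[OF assms(2)] lyap_min_continuous[OF assms(2)] by blast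
qed

end
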